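(* There exists a $\textsc{Q-DT-FOIL}$ formula $\phi$ such that, if $\textsc{Comp}(\phi)$ can be solved in $\mathrm{FP}^{\mathrm{NP}}$, then the polynomial hierarchy collapses to its second level $\Sigma_2^p$.
   Context: Partial instances of dimension $n$ are tuples in $\{0,1,\bot\}^n$; $\mathbf{e}_\bot=\{i\mid\mathbf{e}[i]=\bot\}$. A decision tree of dimension $n$ is a rooted binary tree with internal nodes labeled by features in $\{1,\dots,n\}$, edges labeled $0/1$, leaves labeled $\mathsf{true}/\mathsf{false}$, no feature repeated on a root-to-leaf path. For a node $u$ with root-to-$u$ path $u_1\cdots u_k$, $\mathbf{e}_u[j]$ is the label of the edge leaving the node $u_i$ ($i<k$) labeled $j$, and $\bot$ if none. Formulas are interpreted for $\mathcal{T}$ over domain $\{0,1,\bot\}^n$: $\subseteq$ is subsumption ($\mathbf{e}_1\subseteq\mathbf{e}_2$ iff $\mathbf{e}_1[i]=\mathbf{e}_2[i]$ whenever $\mathbf{e}_1[i]\neq\bot$); $\mathbf{e}\preceq\mathbf{e}'$ iff $|\mathbf{e}_\bot|\ge|\mathbf{e}'_\bot|$; $\textsc{Node}(\mathbf{e})$ iff $\mathbf{e}=\mathbf{e}_u$ for some node $u$; $\textsc{PosLeaf}(\mathbf{e})$ iff $\mathbf{e}=\mathbf{e}_u$ for a $\mathsf{true}$ leaf $u$. $\textsc{DT-FOIL}$: all first-order formulas over $\{\subseteq,\preceq\}$, closed under Boolean combinations and guarded quantifications $\exists x(\textsc{Node}(x)\wedge\phi)$, $\forall x(\textsc{Node}(x)\to\phi)$,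 $\exists x(\textsc{PosLeaf}(x)\wedge\phi)$, $\forall x(\textsc{PosLeaf}(x)\to\phi)$. $\textsc{Q-DT-FOIL}$: $\textsc{DT-FOIL}$ formulas, Boolean combinations of $\textsc{Q-DT-FOIL}$ formulas, and $\exists x_1\cdots\exists x_\ell\,\phi$, $\forall x_1\cdots\forall x_\ell\,\phi$ for $\phi$ in $\textsc{DT-FOIL}$ (unguarded). For a fixed formula $\phi(x_1,\dots,x_m)$, $\textsc{Comp}(\phi)$ is the problem of computing, given a decision tree $\mathcal{T}$ of dimension $n$, partial instances $\mathbf{e}_1,\dots,\mathbf{e}_m$ of dimension $n$ with $\mathcal{T}\models\phi(\mathbf{e}_1,\dots,\mathbf{e}_m)$, or answering no if none exist. *)

theory Defs
  imports Main "HOL-Computational_Algebra.Polynomial"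
begin

section \<open>Partial instances and decision trees\<close>

text \<open>A partial instance of dimension \<open>n\<close> is a partial map with domain inside \<open>{1..n}\<close>;
  \<open>None\<close> plays the role of bottom.\<close>

type_synonym pinst = "nat \<Rightarrow> bool option"

definition pinsts :: "nat \<Rightarrow> pinst set" where
  "pinsts n = {e. dom e \<subseteq> {1..n}}"

definition bots :: "nat \<Rightarrow> pinst \<Rightarrow> nat set" where
  "bots n e = {i \<in> {1..n}. e i = None}"

definition subsumed :: "nat \<Rightarrow> pinst \<Rightarrow> pinst \<Rightarrow> bool" where
  "subsumed n e1 e2 \<longleftrightarrow> (\<forall>i\<in>{1..n}. e1 i \<noteq> None \<longrightarrow> e1 i = e2 i)"

definition level_le :: "nat \<Rightarrow> pinst \<Rightarrow> pinst \<Rightarrow> bool" where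
  "level_le n e1 e2 \<longleftrightarrow> card (bots n e1) \<ge> card (bots n e2)"

text \<open>In \<open>Branch i l r\<close> the edge to \<open>l\<close> is labeled 0 and the edge to \<open>r\<close> is labeled 1.\<close>

datatype dtree = Leaf bool | Branch nat dtree dtree

fun features :: "dtree \<Rightarrow> nat set" where
  "features (Leaf b) = {}"
| "features (Branch i l r) = insert i (features l \<union> features r)"

fun decision_tree :: "nat \<Rightarrow> dtree \<Rightarrow> bool" where
  "decision_tree n (Leaf b) \<longleftrightarrow> True"
| "decision_tree n (Branch i l r) \<longleftrightarrow>
     i \<in> {1..n} \<and> i \<notin> features l \<union> features r \<and> decision_tree n l \<and> decision_tree n r"

text \<open>A node is given by the list of edge labels on the path from the root to it.\<close>

fun subtree_at :: "dtree \<Rightarrow> bool list \<Rightarrow> dtree option" where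
  "subtree_at t [] = Some t"
| "subtree_at (Leaf c) (b # u) = None"
| "subtree_at (Branch i l r) (b # u) = subtree_at (if b then r else l) u"

fun node_inst :: "dtree \<Rightarrow> bool list \<Rightarrow> pinst" where
  "node_inst t [] = Map.empty"
| "node_inst (Leaf c) (b # u) = Map.empty"
| "node_inst (Branch i l r) (b # u) = (node_inst (if b then r else l) u)(i \<mapsto> b)"

definition is_node :: "dtree \<Rightarrow> pinst \<Rightarrow> bool" where
  "is_node T e \<longleftrightarrow> (\<exists>u. subtree_at T u \<noteq> None \<and> e = node_inst T u)"

definition is_posleaf :: "dtree \<Rightarrow> pinst \<Rightarrow> bool" where
  "is_posleaf T e \<longleftrightarrow> (\<exists>u. subtree_at T u = Some (Leaf True) \<and> e = node_inst T u)"

section \<open>The logics\<close>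

datatype fm =
    Subs nat nat
  | LevelLe nat nat
  | Equal nat nat
  | NodeAt nat
  | PosLeafAt nat
  | Neg fm
  | Conj fm fm
  | Disj fm fm
  | Impl fm fm
  | Ex nat fm
  | All nat fm

fun fv :: "fm \<Rightarrow> nat set" where
  "fv (Subs x y) = {x, y}"
| "fv (LevelLe x y) = {x, y}"
| "fv (Equal x y) = {x, y}"
| "fv (NodeAt x) = {x}"
| "fv (PosLeafAt x) = {x}"
| "fv (Neg \<phi>) = fv \<phi>"
| "fv (Conj \<phi> \<psi>) = fv \<phi> \<union> fv \<psi>"
| "fv (Disj \<phi> \<psi>) = fv \<phi> \<union> fv \<psi>"
| "fv (Impl \<phi> \<psi>) = fv \<phi> \<union> fv \<psi>"
| "fv (Ex x \<phi>) = fv \<phi> - {x}"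
| "fv (All x \<phi>) = fv \<phi> - {x}"

fun sat :: "nat \<Rightarrow> dtree \<Rightarrow> (nat \<Rightarrow> pinst) \<Rightarrow> fm \<Rightarrow> bool" where
  "sat n T v (Subs x y) \<longleftrightarrow> subsumed n (v x) (v y)"
| "sat n T v (LevelLe x y) \<longleftrightarrow> level_le n (v x) (v y)"
| "sat n T v (Equal x y) \<longleftrightarrow> v x = v y"
| "sat n T v (NodeAt x) \<longleftrightarrow> is_node T (v x)"
| "sat n T v (PosLeafAt x) \<longleftrightarrow> is_posleaf T (v x)"
| "sat n T v (Neg \<phi>) \<longleftrightarrow> \<not> sat n T v \<phi>"
| "sat n T v (Conj \<phi> \<psi>) \<longleftrightarrow> sat n T v \<phi> \<and> sat n T v \<psi>"
| "sat n T v (Disj \<phi> \<psi>) \<longleftrightarrow> sat n T v \<phi> \<or> sat n T v \<psi>"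
| "sat n T v (Impl \<phi> \<psi>) \<longleftrightarrow> (sat n T v \<phi> \<longrightarrow> sat n T v \<psi>)"
| "sat n T v (Ex x \<phi>) \<longleftrightarrow> (\<exists>e\<in>pinsts n. sat n T (v(x := e)) \<phi>)"
| "sat n T v (All x \<phi>) \<longleftrightarrow> (\<forall>e\<in>pinsts n. sat n T (v(x := e)) \<phi>)"

text \<open>First-order formulas over subsumption and level comparison only; their quantifiers are
  unguarded.\<close>

fun fo_base :: "fm \<Rightarrow> bool" where
  "fo_base (Subs x y) \<longleftrightarrow> True"
| "fo_base (LevelLe x y) \<longleftrightarrow> True"
| "fo_base (Equal x y) \<longleftrightarrow> True"
| "fo_base (NodeAt x) \<longleftrightarrow> False"
| "fo_base (PosLeafAt x) \<longleftrightarrow> False"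
| "fo_base (Neg \<phi>) \<longleftrightarrow> fo_base \<phi>"
| "fo_base (Conj \<phi> \<psi>) \<longleftrightarrow> fo_base \<phi> \<and> fo_base \<psi>"
| "fo_base (Disj \<phi> \<psi>) \<longleftrightarrow> fo_base \<phi> \<and> fo_base \<psi>"
| "fo_base (Impl \<phi> \<psi>) \<longleftrightarrow> fo_base \<phi> \<and> fo_base \<psi>"
| "fo_base (Ex x \<phi>) \<longleftrightarrow> fo_base \<phi>"
| "fo_base (All x \<phi>) \<longleftrightarrow> fo_base \<phi>"

inductive dt_foil :: "fm \<Rightarrow> bool" where
  base: "fo_base \<phi> \<Longrightarrow> dt_foil \<phi>"
| neg: "dt_foil \<phi> \<Longrightarrow> dt_foil (Neg \<phi>)"
| conj: "dt_foil \<phi> \<Longrightarrow> dt_foil \<psi> \<Longrightarrow> dt_foil (Conj \<phi> \<psi>)"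
| disj: "dt_foil \<phi> \<Longrightarrow> dt_foil \<psi> \<Longrightarrow> dt_foil (Disj \<phi> \<psi>)"
| impl: "dt_foil \<phi> \<Longrightarrow> dt_foil \<psi> \<Longrightarrow> dt_foil (Impl \<phi> \<psi>)"
| ex_node: "dt_foil \<phi> \<Longrightarrow> dt_foil (Ex x (Conj (NodeAt x) \<phi>))"
| all_node: "dt_foil \<phi> \<Longrightarrow> dt_foil (All x (Impl (NodeAt x) \<phi>))"
| ex_posleaf: "dt_foil \<phi> \<Longrightarrow> dt_foil (Ex x (Conj (PosLeafAt x) \<phi>))"
| all_posleaf: "dt_foil \<phi> \<Longrightarrow> dt_foil (All x (Impl (PosLeafAt x) \<phi>))"

inductive q_dt_foil :: "fm \<Rightarrow> bool" where
  dt: "dt_foil \<phi> \<Longrightarrow> q_dt_foil \<phi>"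
| neg: "q_dt_foil \<phi> \<Longrightarrow> q_dt_foil (Neg \<phi>)"
| conj: "q_dt_foil \<phi> \<Longrightarrow> q_dt_foil \<psi> \<Longrightarrow> q_dt_foil (Conj \<phi> \<psi>)"
| disj: "q_dt_foil \<phi> \<Longrightarrow> q_dt_foil \<psi> \<Longrightarrow> q_dt_foil (Disj \<phi> \<psi>)"
| impl: "q_dt_foil \<phi> \<Longrightarrow> q_dt_foil \<psi> \<Longrightarrow> q_dt_foil (Impl \<phi> \<psi>)"
| ex_block: "dt_foil \<phi> \<Longrightarrow> q_dt_foil (foldr Ex xs \<phi>)"
| all_block: "dt_foil \<phi> \<Longrightarrow> q_dt_foil (foldr All xs \<phi>)"

section \<open>Deterministic multitape oracle Turing machines\<close>

text \<open>Tapes are two-way infinite. Symbol 0 is the blank; symbols 1 and 2 are the bits. Tape 0 holds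
  the input, tape 1 the output and tape 2 the oracle queries; all further tapes are work tapes
  (tapes 0 to 2 may be read and written as well).\<close>

datatype move = GoLeft | Stay | GoRight

record otm =
  n_tapes :: nat
  n_syms :: nat
  n_states :: nat
  q_start :: nat
  q_halt :: nat
  q_query :: nat
  q_yes :: nat
  q_no :: nat
  trans :: "nat \<Rightarrow> nat list \<Rightarrow> nat \<times> (nat \<times> move) list"

definition wf_otm :: "otm \<Rightarrow> bool" where
  "wf_otm M \<longleftrightarrow>
     3 \<le> n_tapes M \<and> 3 \<le> n_syms M \<and>
     {q_start M, q_halt M, q_query M, q_yes M, q_no M} \<subseteq> {..<n_states M} \<and>
     (\<forall>q < n_states M. \<forall>ss. length ss = n_tapes M \<and> set ss \<subseteq> {..<n_syms M} \<longrightarrow>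
        fst (trans M q ss) < n_states M \<and>
        length (snd (trans M q ss)) = n_tapes M \<and>
        fst ` set (snd (trans M q ss)) \<subseteq> {..<n_syms M})"

type_synonym tape = "int \<times> (int \<Rightarrow> nat)"
type_synonym config = "nat \<times> tape list"

definition bit_sym :: "bool \<Rightarrow> nat" where
  "bit_sym b = (if b then 2 else 1)"

definition tape_of :: "bool list \<Rightarrow> tape" where
  "tape_of w = (0, \<lambda>i. if 0 \<le> i \<and> i < int (length w) then bit_sym (w ! nat i) else 0)"

text \<open>A tape carries the word that starts at cell 0 and is ended by the first blank.\<close>

definition carries :: "tape \<Rightarrow> bool list \<Rightarrow> bool" where
  "carries t w \<longleftrightarrow>
     (\<forall>i < length w. snd t (int i) = bit_sym (w ! i)) \<and> snd t (int (length w)) = 0"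

fun offset :: "move \<Rightarrow> int" where
  "offset GoLeft = -1"
| "offset Stay = 0"
| "offset GoRight = 1"

fun act :: "nat \<times> move \<Rightarrow> tape \<Rightarrow> tape" where
  "act (s, d) (h, c) = (h + offset d, c(h := s))"

fun read_sym :: "tape \<Rightarrow> nat" where
  "read_sym (h, c) = c h"

fun step :: "otm \<Rightarrow> bool list set \<Rightarrow> config \<Rightarrow> config" where
  "step M A (q, ts) =
     (if q = q_halt M then (q, ts)
      else if q = q_query M then (if \<exists>w\<in>A. carries (ts ! 2) w then q_yes M else q_no M, ts)
      else let (q', as) = trans M q (map read_sym ts) in (q', map2 act as ts))"

definition init_config :: "otm \<Rightarrow> bool list \<Rightarrow> config" where
  "init_config M x = (q_start M, tape_of x # replicate (n_tapes M - 1) (tape_of []))"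

text \<open>Halting configurations are fixed points of \<open>step\<close>, so this says that \<open>M\<close> with oracle \<open>A\<close>
  halts within \<open>t \<bar>x\<bar>\<close> steps with output \<open>f x\<close>.\<close>

definition computes_in_time ::
  "otm \<Rightarrow> bool list set \<Rightarrow> (bool list \<Rightarrow> bool list) \<Rightarrow> (nat \<Rightarrow> nat) \<Rightarrow> bool" where
  "computes_in_time M A f t \<longleftrightarrow>
     (\<forall>x. \<exists>ts. (step M A ^^ t (length x)) (init_config M x) = (q_halt M, ts) \<and>
               carries (ts ! 1) (f x))"

section \<open>Complexity classes\<close>

definition FP_oracle :: "bool list set \<Rightarrow> (bool list \<Rightarrow> bool list) set" where
  "FP_oracle A = {f. \<exists>M (p :: nat poly). wf_otm M \<and> computes_in_time M A f (poly p)}"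

text \<open>With the empty oracle every query is answered negatively, so an oracle machine is just an
  ordinary Turing machine.\<close>

definition class_P :: "bool list set set" where
  "class_P = {L. (\<lambda>x. [x \<in> L]) \<in> FP_oracle {}}"

text \<open>Injective pairing: the bits of the first word are doubled and 01 is the separator.\<close>

definition pair_word :: "bool list \<Rightarrow> bool list \<Rightarrow> bool list" where
  "pair_word x u = concat (map (\<lambda>b. [b, b]) x) @ [False, True] @ u"

definition poly_ex :: "bool list set set \<Rightarrow> bool list set set" where
  "poly_ex C = {L. \<exists>R\<in>C. \<exists>p :: nat poly. \<forall>x.
      x \<in> L \<longleftrightarrow> (\<exists>u. length u \<le> poly p (length x) \<and> pair_word x u \<in> R)}"

definition class_NP :: "bool list set set" where
  "class_NP = poly_ex class_P"

text \<open>\<open>uminus ` C\<close> is the class of complements of languages in \<open>C\<close>.\<close>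

fun Sigma_p :: "nat \<Rightarrow> bool list set set" where
  "Sigma_p 0 = class_P"
| "Sigma_p (Suc k) = poly_ex (uminus ` Sigma_p k)"

definition PH :: "bool list set set" where
  "PH = (\<Union>k. Sigma_p k)"

definition FP_NP :: "(bool list \<Rightarrow> bool list) set" where
  "FP_NP = (\<Union>A\<in>class_NP. FP_oracle A)"

section \<open>The problem of computing satisfying tuples\<close>

text \<open>The dimension is written in unary, so that partial instances of dimension \<open>n\<close> have size
  polynomial in the input; features, being at most \<open>n\<close>, may then be written in unary too.\<close>

fun enc_tree :: "dtree \<Rightarrow> bool list" where
  "enc_tree (Leaf b) = [False, b]"
| "enc_tree (Branch i l r) = True # replicate i True @ False # enc_tree l @ enc_tree r"

definition enc_input :: "nat \<Rightarrow> dtree \<Rightarrow> bool list" where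
  "enc_input n T = replicate n True @ False # enc_tree T"

fun enc_entry :: "bool option \<Rightarrow> bool list" where
  "enc_entry None = [False, False]"
| "enc_entry (Some b) = [True, b]"

definition enc_pinst :: "nat \<Rightarrow> pinst \<Rightarrow> bool list" where
  "enc_pinst n e = concat (map (\<lambda>i. enc_entry (e i)) [1..<n+1])"

text \<open>\<open>None\<close> is the answer no.\<close>

fun enc_answer :: "nat \<Rightarrow> pinst list option \<Rightarrow> bool list" where
  "enc_answer n None = [False]"
| "enc_answer n (Some es) = True # concat (map (enc_pinst n) es)"

text \<open>For a formula with free variables \<open>0, \<dots>, m - 1\<close>, the tuple \<open>es\<close> assigns \<open>es ! i\<close> to
  variable \<open>i\<close>; the values of \<open>(!) es\<close> beyond \<open>m - 1\<close> are irrelevant.\<close>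

definition answers :: "fm \<Rightarrow> nat \<Rightarrow> nat \<Rightarrow> dtree \<Rightarrow> pinst list set" where
  "answers \<phi> m n T = {es. length es = m \<and> set es \<subseteq> pinsts n \<and> sat n T ((!) es) \<phi>}"

definition solves_Comp :: "fm \<Rightarrow> nat \<Rightarrow> (bool list \<Rightarrow> bool list) \<Rightarrow> bool" where
  "solves_Comp \<phi> m f \<longleftrightarrow> (\<forall>n T. decision_tree n T \<longrightarrow>
     (if answers \<phi> m n T = {} then f (enc_input n T) = enc_answer n None
      else \<exists>es \<in> answers \<phi> m n T. f (enc_input n T) = enc_answer n (Some es)))"

end

theory Submission
  imports Defs "HOL-Library.Countable"
begin

text \<open>If the hierarchy does not collapse to \<open>Sigma_p 2\<close>, there is a language \<open>L\<close> in \<open>Sigma_p 3\<close> but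
  not in \<open>Sigma_p 2\<close>, say \<open>x \<in> L\<close> iff \<open>pair_word x u \<notin> K\<close> for some short \<open>u\<close>, where \<open>w \<in> K\<close> iff there is
  a short \<open>u\<close> such that all short \<open>v\<close> satisfy a polynomial-time relation \<open>R\<close>. The formula depends on a
  machine for \<open>R\<close>. A tree in the shape of a comb stores a word \<open>w\<close> in the labels of the leaves next to
  its spine, and a partial instance codes a set of positions of that word. The two free variables
  describe \<open>u\<close>, and the formula says that every family of sets closed under the Horn clauses of the
  tableau of the machine on \<open>w\<close>, \<open>u\<close> and an arbitrary \<open>v\<close> contains an accepting row; the clauses being
  Horn, it suffices to look at the facts of the true run. So the formula has an answer for the
  tree of \<open>w\<close> iff \<open>w \<in> K\<close>.

  If a machine with an NP oracle decided whether there is an answer, \<open>L\<close> would be in \<open>Sigma_p 2\<close>: guess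
  \<open>u\<close> and the oracle answers along the run of the machine, with certificates for the positive ones, and
  let the universal word select either a step whose positive certificate is checked or whose negative
  answer is challenged by a certificate, or the output of the run.\<close>

text \<open>A \<open>q_dt_foil\<close> formula offers one block of unguarded quantifiers over a
  \<open>dt_foil\<close> body, and the search for the free variables contributes one existential
  block. This is exactly the prefix of \<open>Sigma_p 2\<close> and leaves no quantifier for
  guessing a computation. Hence the tableau is not asserted to exist: its facts join the universally
  quantified sets, and the run is what every closed family must contain. That is sound because no
  clause has a negated fact as a premise. Guarded quantifiers see only nodes, so every bound has to
  be readable from the tree: the leading zeros of the stored word give the time bound, trailing
  zeros make room for the rows, and addition of positions, defined through subsumption and levels,
  is the only arithmetic.

  No complete problem is involved: the formula is made for one language that witnesses the failure
  of the collapse, and if the hierarchy collapses anyway, any formula will do. The final guess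
  succeeds because a deterministic machine with an NP oracle decides \<open>K\<close> and its
  complement alike, so the quantifier over \<open>u\<close> and the guess of the oracle answers
  merge into one.\<close>

definition polyfun :: "(nat \<Rightarrow> nat) \<Rightarrow> bool" where
  "polyfun F \<longleftrightarrow> (\<exists>p. F = poly p)"

lemma polyfun_poly: "polyfun (poly p)"
  by (auto simp: polyfun_def)

lemma polyfun_const: "polyfun (\<lambda>_. c)"
  unfolding polyfun_def by (rule exI[of _ "[:c:]"]) auto

lemma polyfun_id: "polyfun (\<lambda>n. n)"
  unfolding polyfun_def by (rule exI[of _ "[:0, 1:]"]) auto

lemma polyfun_add: "polyfun F \<Longrightarrow> polyfun G \<Longrightarrow> polyfun (\<lambda>n. F n + G n)"
  proof (unfold polyfun_def, elim exE)
  fix p q assume "F = poly p" "G = poly q"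
  then show "\<exists>r. (\<lambda>n. F n + G n) = poly r" by (intro exI[of _ "p + q"]) auto
qed

lemma polyfun_mult: "polyfun F \<Longrightarrow> polyfun G \<Longrightarrow> polyfun (\<lambda>n. F n * G n)"
  proof (unfold polyfun_def, elim exE)
  fix p q assume "F = poly p" "G = poly q"
  then show "\<exists>r. (\<lambda>n. F n * G n) = poly r" by (intro exI[of _ "p * q"]) auto
qed

lemma polyfun_compose: "polyfun F \<Longrightarrow> polyfun G \<Longrightarrow> polyfun (\<lambda>n. F (G n))"
  proof (unfold polyfun_def, elim exE)
  fix p q assume "F = poly p" "G = poly q"
  then show "\<exists>r. (\<lambda>n. F (G n)) = poly r"
    by (intro exI[of _ "pcompose p q"]) (auto simp: poly_pcompose)
qed

lemma polyfun_Suc: "polyfun F \<Longrightarrow> polyfun (\<lambda>n. Suc (F n))"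
  using polyfun_add[OF _ polyfun_const[of 1]] by simp

lemmas polyfun_intros =
  polyfun_const polyfun_id polyfun_add polyfun_mult polyfun_Suc

text \<open>Natural coefficients make every polynomial monotone, so that bounds in the length of a
  subword become bounds in the length of the input.\<close>

lemma poly_nat_mono: "m \<le> n \<Longrightarrow> poly (p :: nat poly) m \<le> poly p n"
  by (induction p) (auto intro!: add_mono mult_mono)

section \<open>Structured programs over tapes\<close>

type_synonym store = "nat \<Rightarrow> tape"

definition reads :: "store \<Rightarrow> nat \<Rightarrow> nat" where
  "reads s = (\<lambda>i. read_sym (s i))"

definition stay :: "(nat \<Rightarrow> nat) \<Rightarrow> nat \<Rightarrow> nat \<times> move" where
  "stay r = (\<lambda>i. (r i, Stay))"

definition apply_act :: "(nat \<Rightarrow> nat \<times> move) \<Rightarrow> store \<Rightarrow> store" where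
  "apply_act F s = (\<lambda>i. act (F i) (s i))"

lemma act_stay: "act (read_sym x, Stay) x = x"
  by (cases x) auto

lemma apply_act_stay [simp]: "apply_act (stay (reads s)) s = s"
  by (simp add: apply_act_def stay_def reads_def act_stay)

lemma apply_act_upd [simp]:
  "apply_act (F(i := a)) s = (apply_act F s)(i := act a (s i))"
  by (auto simp: apply_act_def)

text \<open>Tests and actions see only the symbols under the heads. A residual program therefore
  serves as the control state of a machine.\<close>

datatype cmd =
    Skip
  | Act "(nat \<Rightarrow> nat) \<Rightarrow> nat \<Rightarrow> nat \<times> move"
  | Seq cmd cmd (infixr ";;" 60)
  | Cond "(nat \<Rightarrow> nat) \<Rightarrow> bool" cmd cmd
  | While "(nat \<Rightarrow> nat) \<Rightarrow> bool" cmd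

text \<open>One call is one machine step. A test, and the removal of a finished first part of a
  sequence, each cost a step in which the tapes stay; these are the constants added in the rules for
  \<open>run\<close>.\<close>

fun nxt :: "cmd \<Rightarrow> (nat \<Rightarrow> nat) \<Rightarrow> cmd \<times> (nat \<Rightarrow> nat \<times> move)" where
  "nxt Skip r = (Skip, stay r)"
| "nxt (Act f) r = (Skip, f r)"
| "nxt (c ;; d) r =
     (if c = Skip then (d, stay r) else (fst (nxt c r) ;; d, snd (nxt c r)))"
| "nxt (Cond p c d) r = (if p r then c else d, stay r)"
| "nxt (While p c) r = (if p r then c ;; While p c else Skip, stay r)"

fun nstep :: "cmd \<times> store \<Rightarrow> cmd \<times> store" where
  "nstep (c, s) = (fst (nxt c (reads s)), apply_act (snd (nxt c (reads s))) s)"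

text \<open>As \<open>Skip\<close> is a fixed point of \<open>nstep\<close>, the number
  \<open>t\<close> is an upper bound on the running time and not its exact value.\<close>

definition run :: "cmd \<Rightarrow> store \<Rightarrow> nat \<Rightarrow> store \<Rightarrow> bool" where
  "run c s t s' \<longleftrightarrow> (nstep ^^ t) (c, s) = (Skip, s')"

lemma nstep_Skip [simp]: "(nstep ^^ t) (Skip, s) = (Skip, s)"
  by (induction t) auto

lemma run_mono: "run c s t s' \<Longrightarrow> t \<le> t' \<Longrightarrow> run c s t' s'"
proof -
  assume a: "run c s t s'" "t \<le> t'"
  then obtain k where "t' = k + t" using le_iff_add add.commute by metis
  with a show ?thesis by (simp add: run_def funpow_add)
qed

lemma run_first: "nstep (c, s) = (c', s1) \<Longrightarrow> run c' s1 t s' \<Longrightarrow> run c s (Suc t) s'"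
  by (simp add: run_def funpow_Suc_right del: nstep.simps funpow.simps)

lemma run_Skip: "run Skip s t s"
  by (simp add: run_def)

lemma run_Act: "s' = apply_act (f (reads s)) s \<Longrightarrow> run (Act f) s 1 s'"
  by (simp add: run_def)

text \<open>A program that ends early idles on its own, but inside a sequence it hands over to
  \<open>d\<close> at once. Hence only some \<open>t' \<le> t\<close> can be claimed.\<close>

lemma nstep_Seq:
  "(nstep ^^ t) (c, s) = (Skip, s') \<Longrightarrow> \<exists>t'\<le>t. (nstep ^^ t') (c ;; d, s) = (Skip ;; d, s')"
proof (induction t arbitrary: c s)
  case 0
  then show ?case by auto
next
  case (Suc t)
  show ?case
  proof (cases "c = Skip")
    case True
    then show ?thesis using Suc.prems by (intro exI[of _ 0]) (auto simp: nstep_Skip[of "Suc t", simplified])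
  next
    case False
    obtain c1 s1 where n: "nstep (c, s) = (c1, s1)" by (cases "nstep (c, s)") auto
    from Suc.prems n have "(nstep ^^ t) (c1, s1) = (Skip, s')"
      by (simp add: funpow_Suc_right del: nstep.simps funpow.simps)
    from Suc.IH[OF this] obtain t' where t': "t' \<le> t" "(nstep ^^ t') (c1 ;; d, s1) = (Skip ;; d, s')"
      by auto
    have "nstep (c ;; d, s) = (c1 ;; d, s1)" using False n by auto
    then have "(nstep ^^ Suc t') (c ;; d, s) = (Skip ;; d, s')"
      using t' by (simp add: funpow_Suc_right del: nstep.simps funpow.simps)
    then show ?thesis using t' by (intro exI[of _ "Suc t'"]) auto
  qed
qed

lemma run_Seq:
  assumes "run c s t1 s1" "run d s1 t2 s2"
  shows "run (c ;; d) s (t1 + t2 + 1) s2"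
proof -
  from nstep_Seq assms(1) obtain t' where t': "t' \<le> t1" "(nstep ^^ t') (c ;; d, s) = (Skip ;; d, s1)"
    unfolding run_def by blast
  have "(nstep ^^ (t2 + (Suc t'))) (c ;; d, s) = (nstep ^^ t2) (nstep ((nstep ^^ t') (c ;; d, s)))"
    by (simp only: funpow_add funpow.simps(2) o_apply)
  also have "\<dots> = (Skip, s2)" using assms(2) by (simp only: t' run_def) (simp add: apply_act_def stay_def reads_def act_stay)
  finally have "run (c ;; d) s (t2 + Suc t') s2" by (simp add: run_def)
  then show ?thesis by (rule run_mono) (use t' in auto)
qed

lemma run_Cond:
  assumes "p (reads s) \<Longrightarrow> run c s t s'" "\<not> p (reads s) \<Longrightarrow> run d s t s'"
  shows "run (Cond p c d) s (t + 1) s'"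
  using assms by (cases "p (reads s)") (auto intro!: run_first[OF nstep.simps])

lemma run_While_False: "\<not> p (reads s) \<Longrightarrow> run (While p c) s 1 s"
  by (simp add: run_def)

lemma run_While_True:
  assumes "p (reads s)" "run c s t1 s1" "run (While p c) s1 t2 s2"
  shows "run (While p c) s (t1 + t2 + 2) s2"
proof -
  have "run (c ;; While p c) s (t1 + t2 + 1) s2"
    using assms run_Seq by auto
  then have "run (While p c) s (Suc (t1 + t2 + 1)) s2"
    using assms(1) by (intro run_first[OF nstep.simps]) auto
  then show ?thesis by simp
qed

lemma run_While_inv:
  assumes "\<And>i s. i < n \<Longrightarrow> I i s \<Longrightarrow> p (reads s) \<and> (\<exists>s'. run c s t s' \<and> I (Suc i) s')"
    and "\<And>s. I n s \<Longrightarrow> \<not> p (reads s)" and "I 0 s"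
  shows "\<exists>s'. run (While p c) s (n * (t + 2) + 1) s' \<and> I n s'"
proof -
  have "\<forall>s. I (n - m) s \<longrightarrow> (\<exists>s'. run (While p c) s (m * (t + 2) + 1) s' \<and> I n s')" if "m \<le> n" for m
    using that
  proof (induction m)
    case 0
    then show ?case using run_While_False assms(2) by fastforce
  next
    case (Suc m)
    show ?case
    proof (intro allI impI)
      fix s assume "I (n - Suc m) s"
      with assms(1)[of "n - Suc m" s] Suc.prems obtain s1
        where s1: "p (reads s)" "run c s t s1" "I (Suc (n - Suc m)) s1" by auto
      have e: "Suc (n - Suc m) = n - m" using Suc.prems by auto
      from Suc s1 e obtain s2 where s2: "run (While p c) s1 (m * (t + 2) + 1) s2" "I n s2" by auto
      from run_While_True[OF s1(1,2) s2(1)]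
      have "run (While p c) s (Suc m * (t + 2) + 1) s2" by (rule run_mono) simp
      with s2 show "\<exists>s'. run (While p c) s (Suc m * (t + 2) + 1) s' \<and> I n s'" by blast
    qed
  qed
  from this[of n] assms(3) show ?thesis by auto
qed

text \<open>For loops whose states have a closed form \<open>S i\<close>, which covers most loops on
  word registers and counters.\<close>

lemma run_While_iter:
  assumes "\<And>i. i < n \<Longrightarrow> p (reads (S i)) \<and> run c (S i) t (S (Suc i))"
    and "\<not> p (reads (S n))" and "s = S 0" and "s' = S n"
  shows "run (While p c) s (n * (t + 2) + 1) s'"
proof -
  have "\<exists>s'. run (While p c) s (n * (t + 2) + 1) s' \<and> s' = S n"
    by (rule run_While_inv[where I = "\<lambda>i s. s = S i"]) (use assms in auto)
  then show ?thesis using assms(4) by blast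
qed

subsection \<open>Compilation to Turing machines\<close>

text \<open>A store has infinitely many tapes, a machine only \<open>K\<close>; tests and actions of
  a program to be compiled may depend on the first \<open>K\<close> symbols only.\<close>

definition loc :: "nat \<Rightarrow> ((nat \<Rightarrow> nat) \<Rightarrow> 'a) \<Rightarrow> bool" where
  "loc K h \<longleftrightarrow> (\<forall>r r'. (\<forall>i<K. r i = r' i) \<longrightarrow> h r = h r')"

definition wf_act :: "nat \<Rightarrow> nat \<Rightarrow> ((nat \<Rightarrow> nat) \<Rightarrow> nat \<Rightarrow> nat \<times> move) \<Rightarrow> bool" where
  "wf_act K g f \<longleftrightarrow> (\<forall>i<K. loc K (\<lambda>r. f r i)) \<and>
     (\<forall>r i. (\<forall>i<K. r i < g) \<longrightarrow> i < K \<longrightarrow> fst (f r i) < g)"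

fun wf_cmd :: "nat \<Rightarrow> nat \<Rightarrow> cmd \<Rightarrow> bool" where
  "wf_cmd K g Skip \<longleftrightarrow> True"
| "wf_cmd K g (Act f) \<longleftrightarrow> wf_act K g f"
| "wf_cmd K g (c ;; d) \<longleftrightarrow> wf_cmd K g c \<and> wf_cmd K g d"
| "wf_cmd K g (Cond p c d) \<longleftrightarrow> loc K p \<and> wf_cmd K g c \<and> wf_cmd K g d"
| "wf_cmd K g (While p c) \<longleftrightarrow> loc K p \<and> wf_cmd K g c"

lemma locI: "(\<And>r r'. (\<And>i. i < K \<Longrightarrow> r i = r' i) \<Longrightarrow> h r = h r') \<Longrightarrow> loc K h"
  unfolding loc_def by blast

lemma locD: "loc K h \<Longrightarrow> (\<And>i. i < K \<Longrightarrow> r i = r' i) \<Longrightarrow> h r = h r'"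
  unfolding loc_def by blast

lemma wf_act_stay: "wf_act K g stay"
  unfolding wf_act_def by (intro conjI allI impI locI) (simp_all add: stay_def)

lemma wf_act_upd:
  assumes "wf_act K g f" "loc K h" "\<And>r. (\<And>i. i < K \<Longrightarrow> r i < g) \<Longrightarrow> fst (h r) < g"
  shows "wf_act K g (\<lambda>r. (f r)(i := h r))"
  unfolding wf_act_def
proof (intro conjI allI impI)
  fix j assume "j < K"
  then show "loc K (\<lambda>r. ((f r)(i := h r)) j)"
    using assms(1,2) by (cases "j = i") (auto simp: wf_act_def)
next
  fix r j assume "\<forall>i<K. r i < g" "j < K"
  then show "fst (((f r)(i := h r)) j) < g"
    using assms(1,3) by (cases "j = i") (auto simp: wf_act_def)
qed

text \<open>A finite set of programs that contains \<open>c\<close> and is closed under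
  \<open>nxt\<close>. It is an overapproximation by syntax, so finiteness and closure follow by
  structural induction; its members become the machine states.\<close>

fun reach :: "cmd \<Rightarrow> cmd set" where
  "reach Skip = {Skip}"
| "reach (Act f) = {Act f, Skip}"
| "reach (c ;; d) = (\<lambda>c'. c' ;; d) ` reach c \<union> reach d"
| "reach (Cond p c d) = {Cond p c d} \<union> reach c \<union> reach d"
| "reach (While p c) = {While p c, Skip} \<union> (\<lambda>c'. c' ;; While p c) ` reach c"

lemma finite_reach: "finite (reach c)"
  by (induction c) auto

lemma reach_self: "c \<in> reach c"
  by (induction c) auto

lemma reach_Skip: "Skip \<in> reach c"
  by (induction c) auto

lemma reach_nxt: "d \<in> reach c \<Longrightarrow> fst (nxt d r) \<in> reach c"
proof (induction c arbitrary: d)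
  case (While p c)
  then show ?case using reach_self reach_Skip by (auto split: if_splits)
next
  case (Seq c1 c2)
  then show ?case using reach_self reach_Skip by (auto split: if_splits)
next
  case (Cond p c1 c2)
  then show ?case using reach_self[of c1] reach_self[of c2] by auto
qed auto

lemma reach_wf: "wf_cmd K g c \<Longrightarrow> d \<in> reach c \<Longrightarrow> wf_cmd K g d"
proof (induction c arbitrary: d)
  case (Seq c1 c2)
  from Seq.prems consider c' where "c' \<in> reach c1" "d = c' ;; c2" | "d \<in> reach c2" by auto
  then show ?case
  proof cases
    case 1
    then show ?thesis using Seq.IH(1)[of c'] Seq.prems(1) by simp
  next
    case 2
    then show ?thesis using Seq.IH(2)[of d] Seq.prems(1) by simp
  qed
next
  case (Cond p c1 c2)
  from Cond.prems(2) consider "d = Cond p c1 c2" | "d \<in> reach c1" | "d \<in> reach c2" by auto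
  then show ?case
    using Cond.IH(1)[of d] Cond.IH(2)[of d] Cond.prems(1) by cases simp_all
next
  case (While p c)
  from While.prems(2) consider "d = While p c" | "d = Skip"
    | c' where "c' \<in> reach c" "d = c' ;; While p c" by auto
  then show ?case
  proof cases
    case 3
    then show ?thesis using While.IH[of c'] While.prems(1) by simp
  qed (use While.prems(1) in simp_all)
next
  case (Act f)
  then have "d = Act f \<or> d = Skip" by simp
  then show ?case using Act.prems(1) by (elim disjE) simp_all
qed simp

lemma wf_nxt_local: "wf_cmd K g c \<Longrightarrow> (\<And>i. i < K \<Longrightarrow> r i = r' i) \<Longrightarrow>
   fst (nxt c r) = fst (nxt c r') \<and> (\<forall>i<K. snd (nxt c r) i = snd (nxt c r') i)"
proof (induction c)
  case (Act f)
  have "f r i = f r' i" if "i < K" for i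
  proof (rule locD[of K "\<lambda>r. f r i"])
    show "loc K (\<lambda>r. f r i)" using Act that by (simp add: wf_act_def)
  qed (rule Act)
  then show ?case by simp
next
  case (Cond p c1 c2)
  have "p r = p r'" by (rule locD[of K p]) (use Cond.prems in \<open>simp, blast\<close>)
  moreover have "\<forall>i<K. stay r i = stay r' i" by (simp add: stay_def Cond.prems)
  ultimately show ?case by simp
next
  case (While p c)
  have "p r = p r'" by (rule locD[of K p]) (use While.prems in \<open>simp, blast\<close>)
  moreover have "\<forall>i<K. stay r i = stay r' i" by (simp add: stay_def While.prems)
  ultimately show ?case by simp
qed (simp_all add: stay_def)

lemma wf_nxt_bound: "wf_cmd K g c \<Longrightarrow> (\<And>i. i < K \<Longrightarrow> r i < g) \<Longrightarrow> i < K \<Longrightarrow>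
   fst (snd (nxt c r) i) < g"
  by (induction c) (auto simp: stay_def wf_act_def)

text \<open>States are numbered residual programs. The additional state \<open>n\<close> serves as
  query state and as both answer states and is never entered, so the run is the same under every
  oracle \<open>A\<close>.\<close>

theorem compile:
  assumes "wf_cmd K g c" "3 \<le> K" "3 \<le> g"
  shows "\<exists>M. wf_otm M \<and> n_tapes M = K \<and> n_syms M = g \<and>
    (\<forall>s t s' A. run c s t s' \<longrightarrow>
      (step M A ^^ t) (q_start M, map s [0..<K]) = (q_halt M, map s' [0..<K]))"
proof -
  define n where "n = card (reach c)"
  obtain h where h: "bij_betw h (reach c) {0..<n}"
    using ex_bij_betw_finite_nat[OF finite_reach] unfolding n_def by blast
  then have inj: "inj_on h (reach c)" and rng: "\<And>d. d \<in> reach c \<Longrightarrow> h d < n"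
    by (auto simp: bij_betw_def)
  define k where "k = the_inv_into (reach c) h"
  have k: "k (h d) = d" if "d \<in> reach c" for d
    using that inj by (simp add: k_def the_inv_into_f_f)
  have kr: "k q \<in> reach c" if "q < n" for q
    using that h unfolding k_def
    by (metis atLeastLessThan_iff bij_betw_def le0 order_refl the_inv_into_into)
  define rr where "rr = (\<lambda>ss :: nat list. \<lambda>i. if i < K then ss ! i else 0)"
  define M where "M = \<lparr>n_tapes = K, n_syms = g, n_states = Suc n, q_start = h c, q_halt = h Skip,
     q_query = n, q_yes = n, q_no = n,
     trans = (\<lambda>q ss. if q < n then (h (fst (nxt (k q) (rr ss))), map (snd (nxt (k q) (rr ss))) [0..<K])
                 else (n, map (\<lambda>i. (0, Stay)) [0..<K]))\<rparr>"
  have wf: "wf_otm M"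
    unfolding wf_otm_def
  proof (intro conjI allI impI)
    show "{q_start M, q_halt M, q_query M, q_yes M, q_no M} \<subseteq> {..<n_states M}"
      using rng[OF reach_self] rng[OF reach_Skip] by (auto simp: M_def)
  next
    fix q ss assume q: "q < n_states M" and ss: "length ss = n_tapes M \<and> set ss \<subseteq> {..<n_syms M}"
    have "fst (trans M q ss) < n_states M"
      using rng[OF reach_nxt[OF kr]] by (auto simp: M_def intro: less_SucI)
    moreover have "fst ` set (snd (trans M q ss)) \<subseteq> {..<n_syms M}"
    proof (cases "q < n")
      case True
      have "wf_cmd K g (k q)" using assms(1) kr[OF True] reach_wf by blast
      moreover have "\<And>i. i < K \<Longrightarrow> rr ss i < g" using ss by (auto simp: rr_def M_def dest!: nth_mem)
      ultimately show ?thesis using True wf_nxt_bound by (auto simp: M_def)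
    qed (use assms in \<open>auto simp: M_def\<close>)
    ultimately show "fst (trans M q ss) < n_states M"
      "length (snd (trans M q ss)) = n_tapes M"
      "fst ` set (snd (trans M q ss)) \<subseteq> {..<n_syms M}" by (auto simp: M_def)
  qed (use assms in \<open>auto simp: M_def\<close>)
  have st: "step M A (h d, map s [0..<K]) = (h (fst (nstep (d, s))), map (snd (nstep (d, s))) [0..<K])"
    if d: "d \<in> reach c" for d s A
  proof (cases "d = Skip")
    case True
    then show ?thesis by (simp add: M_def)
  next
    case False
    have hd: "h d \<noteq> h Skip" using False inj d reach_Skip by (meson inj_on_def)
    have hn: "h d < n" using rng d .
    have rs: "rr (map read_sym (map s [0..<K])) i = reads s i" if "i < K" for i
      using that by (simp add: rr_def reads_def)
    have wd: "wf_cmd K g d" using assms(1) d reach_wf by blast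
    note nl = wf_nxt_local[OF wd rs]
    have "map2 act (map (snd (nxt d (rr (map read_sym (map s [0..<K]))))) [0..<K]) (map s [0..<K])
        = map (apply_act (snd (nxt d (reads s))) s) [0..<K]"
      using nl by (auto simp: list_eq_iff_nth_eq apply_act_def)
    then show ?thesis using hd hn nl k[OF d] by (auto simp: M_def Let_def)
  qed
  have "(step M A ^^ t) (h d, map s [0..<K]) =
      (h (fst ((nstep ^^ t) (d, s))), map (snd ((nstep ^^ t) (d, s))) [0..<K])
      \<and> fst ((nstep ^^ t) (d, s)) \<in> reach c" if "d \<in> reach c" for d s t A
  proof (induction t)
    case 0
    then show ?case using that by simp
  next
    case (Suc t)
    obtain e s' where e: "(nstep ^^ t) (d, s) = (e, s')" by (cases "(nstep ^^ t) (d, s)") auto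
    then show ?case using Suc st[of e A s'] reach_nxt by auto
  qed
  from this[OF reach_self] have "(step M A ^^ t) (q_start M, map s [0..<K]) = (q_halt M, map s' [0..<K])"
    if "run c s t s'" for s t s' A
    using that by (simp add: run_def M_def)
  moreover have "n_tapes M = K" "n_syms M = g" by (auto simp: M_def)
  ultimately show ?thesis using wf by blast
qed

section \<open>Word registers\<close>

definition cells :: "nat list \<Rightarrow> int \<Rightarrow> nat" where
  "cells w = (\<lambda>i. if 0 \<le> i \<and> i < int (length w) then w ! nat i else 0)"

definition wt :: "nat \<Rightarrow> nat list \<Rightarrow> tape" where
  "wt i w = (int i, cells w)"

abbreviation fin :: "nat list \<Rightarrow> tape" where
  "fin w \<equiv> wt (length w) w"

text \<open>A unary counter of capacity \<open>T\<close> with value \<open>m\<close>; the blank cell 0 marks its bottom, so the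
  blank tape is the counter with value and capacity 0.\<close>

definition ctr :: "nat \<Rightarrow> nat \<Rightarrow> tape" where
  "ctr m T = (int m, \<lambda>i. if 1 \<le> i \<and> i \<le> int T then 1 else 0)"

definition shift :: "move \<Rightarrow> tape \<Rightarrow> tape" where
  "shift d x = (fst x + offset d, snd x)"

abbreviation blank :: tape where
  "blank \<equiv> (0, \<lambda>_. 0)"

lemma read_pair: "read_sym x = snd x (fst x)"
  by (cases x) auto

lemma act_read: "act (read_sym x, d) x = shift d x"
  by (cases x) (auto simp: shift_def)

lemma act_reads [simp]: "act (reads s a, d) (s a) = shift d (s a)"
  by (simp add: reads_def act_read)

lemma read_wt [simp]: "read_sym (wt i w) = (if i < length w then w ! i else 0)"
  by (simp add: wt_def cells_def)

lemma read_ctr [simp]: "read_sym (ctr m T) = (if 1 \<le> m \<and> m \<le> T then 1 else 0)"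
  by (simp add: ctr_def)

lemma shift_wt [simp]: "shift GoRight (wt i w) = wt (Suc i) w" "shift GoLeft (wt (Suc i) w) = wt i w"
  by (auto simp: wt_def shift_def)

lemma shift_ctr [simp]: "shift GoRight (ctr m T) = ctr (Suc m) T" "shift GoLeft (ctr (Suc m) T) = ctr m T"
  by (auto simp: ctr_def shift_def)

lemma shift_Stay [simp]: "shift Stay x = x"
  by (auto simp: shift_def)

lemma act_emit [simp]: "n = length w \<Longrightarrow> act (v, GoRight) (wt n w) = wt (Suc n) (w @ [v])"
  by (auto simp: wt_def cells_def fun_eq_iff nth_append nat_less_iff)

lemma blank_wt: "wt 0 [] = blank"
  by (auto simp: wt_def cells_def)

lemma blank_ctr: "ctr 0 0 = blank"
  by (auto simp: ctr_def)

lemma nth_nonzero [simp]: "0 \<notin> set (w :: nat list) \<Longrightarrow> i < length w \<Longrightarrow> 0 < w ! i"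
  using nth_mem[of i w] by (cases "w ! i = 0") auto

lemma cells_range: "0 \<notin> set w \<Longrightarrow> 0 < cells w i \<longleftrightarrow> 0 \<le> i \<and> i < int (length w)"
  by (auto simp: cells_def nat_less_iff)

lemma reads_at: "reads s a = read_sym (s a)"
  by (simp add: reads_def)

definition mv :: "nat \<Rightarrow> move \<Rightarrow> cmd" where
  "mv a d = Act (\<lambda>r. (stay r)(a := (r a, d)))"

definition wr :: "nat \<Rightarrow> nat \<Rightarrow> move \<Rightarrow> cmd" where
  "wr a v d = Act (\<lambda>r. (stay r)(a := (v, d)))"

definition emit_from :: "nat \<Rightarrow> nat \<Rightarrow> cmd" where
  "emit_from a b = Act (\<lambda>r. (stay r)(b := (r a, GoRight)))"

definition mv2 :: "nat \<Rightarrow> move \<Rightarrow> nat \<Rightarrow> move \<Rightarrow> cmd" where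
  "mv2 a d b e = Act (\<lambda>r. (stay r)(a := (r a, d), b := (r b, e)))"

lemma run_mv: "s' = s(a := shift d (s a)) \<Longrightarrow> run (mv a d) s 1 s'"
  unfolding mv_def by (rule run_Act) simp

lemma run_wr: "s' = s(a := act (v, d) (s a)) \<Longrightarrow> run (wr a v d) s 1 s'"
  unfolding wr_def by (rule run_Act) simp

lemma run_emit_from: "s' = s(b := act (read_sym (s a), GoRight) (s b)) \<Longrightarrow> run (emit_from a b) s 1 s'"
  unfolding emit_from_def by (rule run_Act) (simp add: reads_at)

lemma run_mv2: "a \<noteq> b \<Longrightarrow> s' = s(a := shift d (s a), b := shift e (s b)) \<Longrightarrow> run (mv2 a d b e) s 1 s'"
  unfolding mv2_def by (rule run_Act) simp

lemma loc_at: "a < K \<Longrightarrow> loc K (\<lambda>r. r a)"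
  by (simp add: loc_def)

lemma loc_comp: "loc K h \<Longrightarrow> loc K (\<lambda>r. f (h r))"
  unfolding loc_def by metis

lemma loc_comp2: "loc K h \<Longrightarrow> loc K h' \<Longrightarrow> loc K (\<lambda>r. f (h r) (h' r))"
  unfolding loc_def by metis

lemma loc_const: "loc K (\<lambda>_. c)"
  by (simp add: loc_def)

lemma wf_mv: "a < K \<Longrightarrow> wf_cmd K g (mv a d)"
  unfolding mv_def by (auto intro!: wf_act_upd wf_act_stay loc_comp2[of K _ _ Pair] loc_at loc_const)

lemma wf_wr: "a < K \<Longrightarrow> v < g \<Longrightarrow> wf_cmd K g (wr a v d)"
  unfolding wr_def by (auto intro!: wf_act_upd wf_act_stay loc_const)

lemma wf_emit_from: "a < K \<Longrightarrow> b < K \<Longrightarrow> wf_cmd K g (emit_from a b)"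
  unfolding emit_from_def
  by (auto intro!: wf_act_upd wf_act_stay loc_comp2[of K _ _ Pair] loc_at loc_const)

lemma wf_mv2: "a < K \<Longrightarrow> b < K \<Longrightarrow> wf_cmd K g (mv2 a d b e)"
  unfolding mv2_def
  by (auto intro!: wf_act_upd wf_act_stay loc_comp2[of K _ _ Pair] loc_at loc_const)

text \<open>The first move takes the head off the blank behind the word, where it usually stands;
  the loop then runs down to the blank cell -1.\<close>

definition rewind :: "nat \<Rightarrow> cmd" where
  "rewind a = mv a GoLeft ;; While (\<lambda>r. r a \<noteq> 0) (mv a GoLeft) ;; mv a GoRight"

lemma run_rewind:
  assumes "s a = wt i w" "i \<le> length w" "0 \<notin> set w" "length w \<le> n" "s' = s(a := wt 0 w)"
  shows "run (rewind a) s (3 * n + 6) s'"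
proof -
  define S where "S = (\<lambda>k. s(a := (int i - 1 - int k, cells w)))"
  have 1: "run (mv a GoLeft) s 1 (S 0)"
    by (rule run_mv) (simp add: S_def assms(1) wt_def shift_def)
  have 2: "run (While (\<lambda>r. r a \<noteq> 0) (mv a GoLeft)) (S 0) (i * (1 + 2) + 1) (S i)"
  proof (rule run_While_iter[where S = S])
    fix k assume "k < i"
    then have "reads (S k) a \<noteq> 0"
      using assms(2,3) by (auto simp: S_def reads_def cells_range)
    moreover have "run (mv a GoLeft) (S k) 1 (S (Suc k))"
      by (rule run_mv) (simp add: S_def shift_def)
    ultimately show "reads (S k) a \<noteq> 0 \<and> run (mv a GoLeft) (S k) 1 (S (Suc k))" ..
  qed (use assms in \<open>auto simp: S_def reads_def cells_def\<close>)
  have 3: "run (mv a GoRight) (S i) 1 s'"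
    by (rule run_mv) (simp add: S_def assms wt_def shift_def)
  show ?thesis unfolding rewind_def
    by (rule run_mono[OF run_Seq[OF 1 run_Seq[OF 2 3]]]) (use assms in simp)
qed

lemma wf_rewind: "a < K \<Longrightarrow> wf_cmd K g (rewind a)"
  by (auto simp: rewind_def wf_mv intro!: loc_at loc_comp[where f = "\<lambda>x. 0 < x"])

definition copy :: "nat \<Rightarrow> nat \<Rightarrow> cmd" where
  "copy a b = While (\<lambda>r. r a \<noteq> 0) (emit_from a b ;; mv a GoRight)"

lemma run_copy:
  assumes "s a = wt i w" "i \<le> length w" "0 \<notin> set w" "length w \<le> n" "s b = fin v" "a \<noteq> b"
    "s' = s(a := fin w, b := fin (v @ drop i w))"
  shows "run (copy a b) s (5 * n + 1) s'"
proof -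
  define S where "S = (\<lambda>k. s(a := wt (i + k) w, b := fin (v @ take k (drop i w))))"
  have "run (copy a b) s ((length w - i) * (3 + 2) + 1) s'"
    unfolding copy_def
  proof (rule run_While_iter[where S = S])
    fix k assume k: "k < length w - i"
    have "run (emit_from a b ;; mv a GoRight) (S k) (1 + 1 + 1) (S (Suc k))"
      by (rule run_Seq[OF run_emit_from[OF refl] run_mv])
        (use k assms(6) in \<open>auto simp: S_def take_Suc_conv_app_nth fun_upd_twist\<close>)
    then show "reads (S k) a \<noteq> 0 \<and> run (emit_from a b ;; mv a GoRight) (S k) 3 (S (Suc k))"
      using k assms by (simp add: S_def reads_def numeral_3_eq_3)
  qed (use assms in \<open>auto simp: S_def reads_def\<close>)
  then show ?thesis by (rule run_mono) (use assms in auto)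
qed

lemma wf_copy: "a < K \<Longrightarrow> b < K \<Longrightarrow> wf_cmd K g (copy a b)"
  by (auto simp: copy_def wf_mv wf_emit_from intro!: loc_at loc_comp[where f = "\<lambda>x. 0 < x"])

definition dbl :: "'a list \<Rightarrow> 'a list" where
  "dbl w = concat (map (\<lambda>b. [b, b]) w)"

lemma dbl_simps [simp]: "dbl [] = []" "dbl (b # w) = b # b # dbl w" "dbl (v @ w) = dbl v @ dbl w"
  by (auto simp: dbl_def)

lemma length_dbl [simp]: "length (dbl w) = 2 * length w"
  by (induction w) auto

lemma set_dbl [simp]: "set (dbl w) = set w"
  by (induction w) auto

lemma map_dbl: "map f (dbl w) = dbl (map f w)"
  by (induction w) auto

lemma pair_word_dbl: "pair_word x u = dbl x @ [False, True] @ u"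
  by (simp add: pair_word_def dbl_def)

definition dblcopy :: "nat \<Rightarrow> nat \<Rightarrow> cmd" where
  "dblcopy a b = While (\<lambda>r. r a \<noteq> 0) (emit_from a b ;; emit_from a b ;; mv a GoRight)"

lemma run_dblcopy:
  assumes "s a = wt 0 w" "0 \<notin> set w" "length w \<le> n" "s b = fin v" "a \<noteq> b"
    "s' = s(a := fin w, b := fin (v @ dbl w))"
  shows "run (dblcopy a b) s (7 * n + 1) s'"
proof -
  define S where "S = (\<lambda>k. s(a := wt k w, b := fin (v @ dbl (take k w))))"
  have "run (dblcopy a b) s (length w * (5 + 2) + 1) s'"
    unfolding dblcopy_def
  proof (rule run_While_iter[where S = S])
    fix k assume k: "k < length w"
    have "run (emit_from a b ;; emit_from a b ;; mv a GoRight) (S k) (1 + (1 + 1 + 1) + 1) (S (Suc k))"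
      by (rule run_Seq[OF run_emit_from[OF refl] run_Seq[OF run_emit_from[OF refl] run_mv]])
        (use k assms in \<open>auto simp: S_def take_Suc_conv_app_nth fun_upd_twist\<close>)
    then show "reads (S k) a \<noteq> 0 \<and>
        run (emit_from a b ;; emit_from a b ;; mv a GoRight) (S k) 5 (S (Suc k))"
      using k assms by (auto simp: S_def reads_def intro: run_mono)
  qed (use assms in \<open>auto simp: S_def reads_def\<close>)
  then show ?thesis by (rule run_mono) (use assms in auto)
qed

lemma wf_dblcopy: "a < K \<Longrightarrow> b < K \<Longrightarrow> wf_cmd K g (dblcopy a b)"
  by (auto simp: dblcopy_def wf_mv wf_emit_from intro!: loc_at loc_comp[where f = "\<lambda>x. 0 < x"])

definition takecopy :: "nat \<Rightarrow> nat \<Rightarrow> nat \<Rightarrow> cmd" where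
  "takecopy a b c = While (\<lambda>r. r a \<noteq> 0 \<and> r c \<noteq> 0) (emit_from a b ;; mv2 a GoRight c GoLeft)"

text \<open>Stated for arbitrary tapes: tapes 1 and 2 of the tableau machine are described by
  arbitrary sets of cells and may have gaps, and the machine takes as its word what stands before
  the first blank, cut at \<open>m\<close>.\<close>

definition prefix_word :: "tape \<Rightarrow> nat \<Rightarrow> nat list" where
  "prefix_word x m = takeWhile (\<lambda>v. v \<noteq> 0) (map (\<lambda>i. snd x (fst x + int i)) [0..<m])"

lemma prefix_word_length: "length (prefix_word x m) \<le> m"
  unfolding prefix_word_def using length_takeWhile_le[of _ "map (\<lambda>i. snd x (fst x + int i)) [0..<m]"]
  by simp

lemma prefix_word_cell: "k < length (prefix_word x m) \<Longrightarrow>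
   k < m \<and> snd x (fst x + int k) \<noteq> 0 \<and> prefix_word x m ! k = snd x (fst x + int k)"
proof -
  assume a: "k < length (prefix_word x m)"
  then have "k < m" using prefix_word_length[of x m] by simp
  moreover have "prefix_word x m ! k = snd x (fst x + int k)"
    using takeWhile_nth[OF a[unfolded prefix_word_def]] \<open>k < m\<close> by (simp add: prefix_word_def)
  moreover have "prefix_word x m ! k \<noteq> 0"
    using nth_mem[OF a] by (auto simp: prefix_word_def dest: set_takeWhileD)
  ultimately show ?thesis by simp
qed

lemma prefix_word_end: "length (prefix_word x m) < m \<Longrightarrow>
   snd x (fst x + int (length (prefix_word x m))) = 0"
  using nth_length_takeWhile[of _ "map (\<lambda>i. snd x (fst x + int i)) [0..<m]"]
  unfolding prefix_word_def by fastforce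

lemma prefix_word_wt: "0 \<notin> set w \<Longrightarrow> i \<le> length w \<Longrightarrow> prefix_word (wt i w) m = take m (drop i w)"
proof (rule nth_equalityI)
  assume w: "0 \<notin> set w" "i \<le> length w"
  let ?p = "prefix_word (wt i w) m"
  show l: "length ?p = length (take m (drop i w))"
  proof (rule antisym)
    show "length ?p \<le> length (take m (drop i w))"
    proof (rule ccontr)
      assume "\<not> ?thesis"
      then have "min (length w - i) m < length ?p"
        by (simp only: length_take length_drop not_le)
      from prefix_word_cell[OF this] prefix_word_length[of "wt i w" m] w show False
        by (auto simp: wt_def cells_def min_def split: if_splits)
    qed
    show "length (take m (drop i w)) \<le> length ?p"
    proof (rule ccontr)
      assume a: "\<not> ?thesis"
      then have "length ?p < m" "i + length ?p < length w" by auto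
      from prefix_word_end[OF this(1)] have "cells w (int i + int (length ?p)) = 0"
        by (simp add: wt_def)
      with cells_range[OF w(1), of "int i + int (length ?p)"] \<open>i + length ?p < length w\<close> show False
        by simp
    qed
  qed
  fix k assume "k < length ?p"
  with prefix_word_cell[OF this] l w show "?p ! k = take m (drop i w) ! k"
    by (auto simp: wt_def cells_def nat_add_distrib)
qed

lemma run_takecopy:
  assumes "s c = ctr m T" "m \<le> T" "s b = fin v" "a \<noteq> b" "a \<noteq> c" "b \<noteq> c" "m \<le> n"
    and u: "u = prefix_word (s a) m"
    and s': "s' = s(a := (fst (s a) + int (length u), snd (s a)), b := fin (v @ u), c := ctr (m - length u) T)"
  shows "run (takecopy a b c) s (5 * n + 1) s'"
proof -
  define S where "S = (\<lambda>k. s(a := (fst (s a) + int k, snd (s a)), b := fin (v @ take k u), c := ctr (m - k) T))"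
  have um: "length u \<le> m" using prefix_word_length u by auto
  have "run (takecopy a b c) s (length u * (3 + 2) + 1) s'"
    unfolding takecopy_def
  proof (rule run_While_iter[where S = S])
    fix k assume k: "k < length u"
    then have uk: "k < m" "snd (s a) (fst (s a) + int k) \<noteq> 0" "u ! k = snd (s a) (fst (s a) + int k)"
      using prefix_word_cell u by auto
    then obtain l where l: "m - k = Suc l" "m - Suc k = l" by (metis Suc_diff_Suc)
    have "run (emit_from a b ;; mv2 a GoRight c GoLeft) (S k) (1 + 1 + 1) (S (Suc k))"
      by (rule run_Seq[OF run_emit_from[OF refl] run_mv2])
        (use k uk l assms in \<open>auto simp: S_def take_Suc_conv_app_nth fun_upd_twist shift_def ctr_def add.assoc\<close>)
    then show "(reads (S k) a \<noteq> 0 \<and> reads (S k) c \<noteq> 0) \<and>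
        run (emit_from a b ;; mv2 a GoRight c GoLeft) (S k) 3 (S (Suc k))"
      using k uk assms l by (auto simp: S_def reads_def numeral_3_eq_3)
  next
    show "\<not> (reads (S (length u)) a \<noteq> 0 \<and> reads (S (length u)) c \<noteq> 0)"
      using assms prefix_word_end[of "s a" m] um by (cases "length u < m") (auto simp: S_def reads_def)
  qed (use assms in \<open>auto simp: S_def reads_def\<close>)
  then show ?thesis by (rule run_mono) (use assms um in auto)
qed

lemma wf_takecopy: "a < K \<Longrightarrow> b < K \<Longrightarrow> c < K \<Longrightarrow> wf_cmd K g (takecopy a b c)"
  by (auto simp: takecopy_def wf_mv2 wf_emit_from intro!: loc_at loc_comp2[where f = "\<lambda>x y. 0 < x \<and> 0 < y"])

subsection \<open>Counters and polynomials\<close>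

text \<open>Value and capacity change together here. A clock, in contrast, is only moved to the
  left: its value falls and its capacity stays, which later gives a bound on the distance travelled
  by a head.\<close>

definition push :: "nat \<Rightarrow> cmd" where
  "push a = mv a GoRight ;; wr a 1 Stay"

definition pop :: "nat \<Rightarrow> cmd" where
  "pop a = wr a 0 GoLeft"

lemma run_push: "s a = ctr m m \<Longrightarrow> s' = s(a := ctr (Suc m) (Suc m)) \<Longrightarrow> run (push a) s 3 s'"
  unfolding push_def
  by (rule run_mono[OF run_Seq[OF run_mv[OF refl] run_wr]]) (auto simp: ctr_def shift_def fun_eq_iff)

lemma run_pop: "s a = ctr (Suc m) (Suc m) \<Longrightarrow> s' = s(a := ctr m m) \<Longrightarrow> run (pop a) s 1 s'"
  unfolding pop_def by (rule run_wr) (auto simp: ctr_def fun_eq_iff)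

lemma wf_push: "a < K \<Longrightarrow> 1 < g \<Longrightarrow> wf_cmd K g (push a)"
  by (simp add: push_def wf_mv wf_wr)

lemma wf_pop: "a < K \<Longrightarrow> 1 < g \<Longrightarrow> wf_cmd K g (pop a)"
  by (simp add: pop_def wf_wr)

definition addw :: "nat \<Rightarrow> nat \<Rightarrow> cmd" where
  "addw a c = While (\<lambda>r. r a \<noteq> 0) (push c ;; mv a GoRight) ;; rewind a"

lemma run_addw:
  assumes "s a = wt 0 w" "0 \<notin> set w" "length w \<le> n" "s c = ctr m m" "a \<noteq> c"
    "s' = s(c := ctr (m + length w) (m + length w))"
  shows "run (addw a c) s (10 * n + 8) s'"
proof -
  define S where "S = (\<lambda>k. s(a := wt k w, c := ctr (m + k) (m + k)))"
  have 1: "run (While (\<lambda>r. r a \<noteq> 0) (push c ;; mv a GoRight)) s (length w * (5 + 2) + 1) (S (length w))"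
  proof (rule run_While_iter[where S = S])
    fix k assume k: "k < length w"
    have "run (push c ;; mv a GoRight) (S k) (3 + 1 + 1) (S (Suc k))"
      by (rule run_Seq[OF run_push[OF _ refl] run_mv]) (use assms in \<open>auto simp: S_def\<close>)
    then show "reads (S k) a \<noteq> 0 \<and> run (push c ;; mv a GoRight) (S k) 5 (S (Suc k))"
      using k assms by (simp add: S_def reads_def)
  qed (use assms in \<open>auto simp: S_def reads_def\<close>)
  have 2: "run (rewind a) (S (length w)) (3 * n + 6) s'"
    by (rule run_rewind[where i = "length w"]) (use assms in \<open>auto simp: S_def\<close>)
  show ?thesis unfolding addw_def by (rule run_mono[OF run_Seq[OF 1 2]]) (use assms in auto)
qed

lemma wf_addw: "a < K \<Longrightarrow> c < K \<Longrightarrow> 1 < g \<Longrightarrow> wf_cmd K g (addw a c)"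
  by (auto simp: addw_def wf_mv wf_push wf_rewind intro!: loc_at loc_comp[where f = "\<lambda>x. 0 < x"])

text \<open>Tape \<open>d\<close> accumulates one copy of the word length per mark of
  \<open>c\<close>, and is then emptied back into \<open>c\<close>, so it is blank again for the
  next round of Horner's rule.\<close>

definition mulw :: "nat \<Rightarrow> nat \<Rightarrow> nat \<Rightarrow> cmd" where
  "mulw a c d = While (\<lambda>r. r c \<noteq> 0) (pop c ;; addw a d) ;; While (\<lambda>r. r d \<noteq> 0) (pop d ;; push c)"

lemma run_mulw:
  assumes "s a = wt 0 w" "0 \<notin> set w" "length w \<le> n" "s c = ctr m m" "s d = ctr 0 0"
    "distinct [a, c, d]" "m \<le> N" "s' = s(c := ctr (m * length w) (m * length w))"
  shows "run (mulw a c d) s (N * (10 * n + 12) + N * n * 7 + 3) s'"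
proof -
  define S where "S = (\<lambda>k. s(c := ctr (m - k) (m - k), d := ctr (k * length w) (k * length w)))"
  have 1: "run (While (\<lambda>r. r c \<noteq> 0) (pop c ;; addw a d)) s (m * ((10 * n + 10) + 2) + 1) (S m)"
  proof (rule run_While_iter[where S = S])
    fix k assume k: "k < m"
    then obtain l where l: "m - k = Suc l" "m - Suc k = l" by (metis Suc_diff_Suc)
    have "run (pop c ;; addw a d) (S k) (1 + (10 * n + 8) + 1) (S (Suc k))"
      by (rule run_Seq[OF run_pop[where m = l, OF _ refl]
            run_addw[where w = w and m = "k * length w"]])
        (use assms l in \<open>auto simp: S_def add.commute\<close>)
    moreover have "reads (S k) c \<noteq> 0" using k assms by (simp add: S_def reads_def)
    ultimately show "reads (S k) c \<noteq> 0 \<and> run (pop c ;; addw a d) (S k) (10 * n + 10) (S (Suc k))"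
      by (simp add: add.commute)
  qed (use assms in \<open>auto simp: S_def reads_def\<close>)
  define M where "M = m * length w"
  define S' where "S' = (\<lambda>k. s(c := ctr k k, d := ctr (M - k) (M - k)))"
  have 2: "run (While (\<lambda>r. r d \<noteq> 0) (pop d ;; push c)) (S m) (M * (5 + 2) + 1) s'"
  proof (rule run_While_iter[where S = S'])
    fix k assume k: "k < M"
    then obtain l where l: "M - k = Suc l" "M - Suc k = l" by (metis Suc_diff_Suc)
    have "run (pop d ;; push c) (S' k) (1 + 3 + 1) (S' (Suc k))"
      by (rule run_Seq[OF run_pop[where m = l, OF _ refl] run_push[where m = k]])
        (use assms l in \<open>auto simp: S'_def\<close>)
    moreover have "reads (S' k) d \<noteq> 0" using k assms by (simp add: S'_def reads_def)
    ultimately show "reads (S' k) d \<noteq> 0 \<and> run (pop d ;; push c) (S' k) 5 (S' (Suc k))" by simp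
  qed (use assms in \<open>auto simp: S_def S'_def M_def reads_def\<close>)
  have "M \<le> N * n" unfolding M_def using assms by (intro mult_mono) auto
  moreover have "m * (10 * n + 12) \<le> N * (10 * n + 12)" using assms by (intro mult_mono) auto
  ultimately have "m * ((10 * n + 10) + 2) + 1 + (M * (5 + 2) + 1) + 1 \<le> N * (10 * n + 12) + N * n * 7 + 3"
    by (simp only: distrib_left distrib_right mult.assoc)
  then show ?thesis unfolding mulw_def by (rule run_mono[OF run_Seq[OF 1 2]])
qed

lemma wf_mulw: "a < K \<Longrightarrow> c < K \<Longrightarrow> d < K \<Longrightarrow> 1 < g \<Longrightarrow> wf_cmd K g (mulw a c d)"
  by (auto simp: mulw_def wf_pop wf_addw wf_push intro!: loc_at loc_comp[where f = "\<lambda>x. 0 < x"])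

fun pushes :: "nat \<Rightarrow> nat \<Rightarrow> cmd" where
  "pushes 0 c = Skip"
| "pushes (Suc k) c = push c ;; pushes k c"

lemma run_pushes: "s c = ctr m m \<Longrightarrow> s' = s(c := ctr (m + k) (m + k)) \<Longrightarrow> run (pushes k c) s (4 * k) s'"
proof (induction k arbitrary: s m)
  case 0
  then have "s' = s" by (simp add: fun_upd_idem)
  then show ?case by (simp add: run_Skip)
next
  case (Suc k)
  have "run (pushes (Suc k) c) s (3 + 4 * k + 1) s'"
    unfolding pushes.simps
    by (rule run_Seq[OF run_push[where m = m and s = s and a = c, OF Suc.prems(1) refl] Suc.IH[where m = "Suc m"]]) (auto simp: Suc.prems)
  then show ?case by (rule run_mono) simp
qed

lemma wf_pushes: "c < K \<Longrightarrow> 1 < g \<Longrightarrow> wf_cmd K g (pushes k c)"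
  by (induction k) (auto simp: wf_push)

text \<open>Horner's rule; \<open>coeffs\<close> lists the constant coefficient first, so the tail
  is evaluated before it is multiplied by the word length.\<close>

fun hornerc :: "nat list \<Rightarrow> nat \<Rightarrow> nat \<Rightarrow> nat \<Rightarrow> cmd" where
  "hornerc [] a c d = Skip"
| "hornerc (k # ks) a c d = hornerc ks a c d ;; mulw a c d ;; pushes k c"

definition polyc :: "nat poly \<Rightarrow> nat \<Rightarrow> nat \<Rightarrow> nat \<Rightarrow> cmd" where
  "polyc p = hornerc (coeffs p)"

lemma wf_polyc: "a < K \<Longrightarrow> c < K \<Longrightarrow> d < K \<Longrightarrow> 1 < g \<Longrightarrow> wf_cmd K g (polyc p a c d)"
proof -
  have "a < K \<Longrightarrow> c < K \<Longrightarrow> d < K \<Longrightarrow> 1 < g \<Longrightarrow> wf_cmd K g (hornerc ks a c d)" for ks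
    by (induction ks) (auto simp: wf_mulw wf_pushes)
  then show "a < K \<Longrightarrow> c < K \<Longrightarrow> d < K \<Longrightarrow> 1 < g \<Longrightarrow> wf_cmd K g (polyc p a c d)"
    by (simp add: polyc_def)
qed

lemma run_polyc:
  obtains F where "polyfun F" "\<And>s a c d w n. s a = wt 0 w \<Longrightarrow> 0 \<notin> set w \<Longrightarrow> length w \<le> n \<Longrightarrow>
     s c = blank \<Longrightarrow> s d = blank \<Longrightarrow> distinct [a, c, d] \<Longrightarrow>
     run (polyc p a c d) s (F n) (s(c := ctr (poly p (length w)) (poly p (length w))))"
proof -
  have "\<exists>F. polyfun F \<and> (\<forall>s a c d w n. s a = wt 0 w \<and> 0 \<notin> set w \<and> length w \<le> n \<and> s c = ctr 0 0 \<and>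
     s d = ctr 0 0 \<and> distinct [a, c, d] \<longrightarrow>
     run (hornerc ks a c d) s (F n) (s(c := ctr (poly (Poly ks) (length w)) (poly (Poly ks) (length w)))))" for ks
  proof (induction ks)
    case Nil
    show ?case
      by (rule exI[of _ "\<lambda>_. 0"]) (auto simp: polyfun_const run_Skip fun_upd_idem)
  next
    case (Cons k ks)
    then obtain F where F: "polyfun F" "\<And>s a c d w n. s a = wt 0 w \<and> 0 \<notin> set w \<and> length w \<le> n \<and>
      s c = ctr 0 0 \<and> s d = ctr 0 0 \<and> distinct [a, c, d] \<Longrightarrow>
      run (hornerc ks a c d) s (F n) (s(c := ctr (poly (Poly ks) (length w)) (poly (Poly ks) (length w))))"
      by blast
    define P where "P = poly (Poly ks)"
    define G where "G = (\<lambda>n. F n + ((P n * (10 * n + 12) + P n * n * 7 + 3) + 4 * k + 1) + 1)"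
    have "polyfun G" unfolding G_def P_def by (intro polyfun_intros F(1) polyfun_poly)
    moreover have "run (hornerc (k # ks) a c d) s (G n)
        (s(c := ctr (poly (Poly (k # ks)) (length w)) (poly (Poly (k # ks)) (length w))))"
      if h: "s a = wt 0 w \<and> 0 \<notin> set w \<and> length w \<le> n \<and> s c = ctr 0 0 \<and> s d = ctr 0 0 \<and>
        distinct [a, c, d]" for s a c d w n
      unfolding hornerc.simps G_def
      by (rule run_Seq[OF F(2)[OF h] run_Seq[OF
              run_mulw[where w = w and n = n and m = "P (length w)", OF _ _ _ _ _ _ _ refl]
              run_pushes[where m = "P (length w) * length w"]]])
        (use h poly_nat_mono[of "length w" n] in \<open>auto simp: P_def algebra_simps\<close>)
    ultimately show ?case by blast
  qed
  from this[of "coeffs p"] obtain F where F: "polyfun F"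
    "\<forall>s a c d w n. s a = wt 0 w \<and> 0 \<notin> set w \<and> length w \<le> n \<and> s c = ctr 0 0 \<and>
     s d = ctr 0 0 \<and> distinct [a, c, d] \<longrightarrow> run (hornerc (coeffs p) a c d) s (F n)
       (s(c := ctr (poly (Poly (coeffs p)) (length w)) (poly (Poly (coeffs p)) (length w))))"
    by (elim exE conjE)
  show thesis by (rule that[OF F(1)]) (use F(2) in \<open>simp add: polyc_def blank_ctr\<close>)
qed

subsection \<open>Decoding doubled words\<close>

text \<open>A left inverse of \<open>pair_word\<close> made total: any unequal pair of letters ends
  the doubled part, and a word without one leaves an empty rest. It is polymorphic because it is
  applied to bits and to tape symbols.\<close>

fun dec :: "'a list \<Rightarrow> 'a list \<times> 'a list" where
  "dec (a # b # r) = (if a = b then (a # fst (dec r), snd (dec r)) else ([], r))"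
| "dec [a] = ([], [])"
| "dec [] = ([], [])"

lemma dec_dbl: "a \<noteq> b \<Longrightarrow> dec (dbl x @ a # b # u) = (x, u)"
  by (induction x) auto

lemma dec_pair: "dec (pair_word x u) = (x, u)"
  by (simp add: pair_word_dbl dec_dbl)

lemma dec_map: "inj f \<Longrightarrow> dec (map f r) = (map f (fst (dec r)), map f (snd (dec r)))"
  by (induction r rule: dec.induct) (auto simp: inj_eq)

lemma dec_length: "2 * length (fst (dec r)) + length (snd (dec r)) \<le> length r"
  by (induction r rule: dec.induct) auto

text \<open>The rest is a suffix, so a machine need not copy it and just leaves its head
  there.\<close>

lemma dec_drop: "snd (dec r) = drop (length r - length (snd (dec r))) r"
proof (induction r rule: dec.induct)
  case (1 a b r)
  have "length (snd (dec r)) \<le> length r" using dec_length[of r] by simp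
  then have "Suc (Suc (length r)) - length (snd (dec r)) = Suc (Suc (length r - length (snd (dec r))))"
    by simp
  then show ?case using 1 by simp
qed simp_all

definition put_from :: "nat \<Rightarrow> nat \<Rightarrow> cmd" where
  "put_from a b = Act (\<lambda>r. (stay r)(b := (r a, Stay)))"

lemma run_put_from: "s' = s(b := act (read_sym (s a), Stay) (s b)) \<Longrightarrow> run (put_from a b) s 1 s'"
  unfolding put_from_def by (rule run_Act) (simp add: reads_at)

lemma wf_put_from: "a < K \<Longrightarrow> b < K \<Longrightarrow> wf_cmd K g (put_from a b)"
  unfolding put_from_def
  by (auto intro!: wf_act_upd wf_act_stay loc_comp2[of K _ _ Pair] loc_at loc_const)

text \<open>The first letter of a pair is written on \<open>b\<close> without a move, so that it can
  be compared with the second letter under the head of \<open>a\<close>; if they differ it is erased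
  again. The test for a blank covers words of odd length. The flag \<open>f\<close> ends the
  loop.\<close>

definition decstep :: "nat \<Rightarrow> nat \<Rightarrow> nat \<Rightarrow> cmd" where
  "decstep a b f = Cond (\<lambda>r. r a = 0) (wr f 1 Stay)
     (put_from a b ;; mv a GoRight ;; Cond (\<lambda>r. r a = r b) (mv2 a GoRight b GoRight)
        (wr b 0 Stay ;; Cond (\<lambda>r. r a = 0) Skip (mv a GoRight) ;; wr f 1 Stay))"

definition decc :: "nat \<Rightarrow> nat \<Rightarrow> nat \<Rightarrow> cmd" where
  "decc a b f = While (\<lambda>r. r f = 0) (decstep a b f) ;; wr f 0 Stay"

lemma wf_decc: "a < K \<Longrightarrow> b < K \<Longrightarrow> f < K \<Longrightarrow> 1 < g \<Longrightarrow> wf_cmd K g (decc a b f)"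
  unfolding decc_def decstep_def
  by (auto simp: wf_mv wf_mv2 wf_wr wf_put_from
      intro!: loc_at loc_comp[where f = "\<lambda>x. x = 0"] loc_comp2[where f = "(=)"])

abbreviation raised :: tape where
  "raised \<equiv> (0, (\<lambda>_. 0)(0 := 1))"

lemma act_Stay_fin:
  "n = length w \<Longrightarrow> act (v, Stay) (wt n w) = wt n (w @ [v])"
  "n = length w \<Longrightarrow> act (0, Stay) (wt n (w @ [v])) = wt n w"
  by (auto simp: wt_def cells_def fun_eq_iff nth_append nat_less_iff)

lemma run_decstep_end:
  assumes "s a = wt (length w) w" "s f = blank" "distinct [a, f]" "s' = s(f := raised)"
  shows "run (decstep a b f) s 2 s'"
proof -
  have "run (decstep a b f) s (1 + 1) s'" unfolding decstep_def
  proof (rule run_Cond)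
    show "run (wr f 1 Stay) s 1 s'" by (rule run_wr) (use assms in auto)
  qed (use assms in \<open>simp add: reads_def\<close>)
  then show ?thesis by (rule run_mono) simp
qed

lemma run_decstep_eq:
  assumes "s a = wt i w" "Suc i < length w" "0 \<notin> set w" "w ! i = w ! Suc i" "s b = fin v"
    "distinct [a, b, f]" "s' = s(a := wt (i + 2) w, b := fin (v @ [w ! i]))"
  shows "run (decstep a b f) s 8 s'"
proof -
  let ?s1 = "s(b := wt (length v) (v @ [w ! i]))"
  let ?s2 = "?s1(a := wt (Suc i) w)"
  have 1: "run (put_from a b) s 1 ?s1"
    by (rule run_put_from) (use assms in \<open>simp add: act_Stay_fin\<close>)
  have 2: "run (mv a GoRight) ?s1 1 ?s2"
    by (rule run_mv) (use assms in simp)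
  have 3: "run (mv2 a GoRight b GoRight) ?s2 1 s'"
    by (rule run_mv2) (use assms in \<open>auto simp: fun_upd_twist\<close>)
  have 4: "reads ?s2 a = reads ?s2 b" using assms by (simp add: reads_def)
  have 5: "reads s a \<noteq> 0" using assms by (simp add: reads_def)
  have "run (decstep a b f) s ((1 + (1 + (1 + 1) + 1) + 1) + 1) s'"
    unfolding decstep_def
    by (rule run_Cond[OF _ run_Seq[OF 1 run_Seq[OF 2 run_Cond[OF 3]]]]) (use 4 5 in auto)
  then show ?thesis by (rule run_mono) simp
qed

lemma run_decstep_neq:
  assumes "s a = wt i w" "i < length w" "0 \<notin> set w" "Suc i < length w \<Longrightarrow> w ! i \<noteq> w ! Suc i"
    "s b = fin v" "s f = blank" "distinct [a, b, f]"
    "s' = s(a := wt (min (i + 2) (length w)) w, f := raised)"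
  shows "run (decstep a b f) s 12 s'"
proof -
  let ?s1 = "s(b := wt (length v) (v @ [w ! i]))"
  let ?s2 = "?s1(a := wt (Suc i) w)"
  let ?s3 = "s(a := wt (Suc i) w)"
  let ?s4 = "s(a := wt (min (i + 2) (length w)) w)"
  have 1: "run (put_from a b) s 1 ?s1"
    by (rule run_put_from) (use assms in \<open>simp add: act_Stay_fin\<close>)
  have 2: "run (mv a GoRight) ?s1 1 ?s2"
    by (rule run_mv) (use assms in simp)
  have 3: "run (wr b 0 Stay) ?s2 1 ?s3"
    by (rule run_wr) (use assms in \<open>auto simp: act_Stay_fin fun_eq_iff\<close>)
  have 4: "run (Cond (\<lambda>r. r a = 0) Skip (mv a GoRight)) ?s3 (1 + 1) ?s4"
  proof (rule run_Cond)
    assume "reads ?s3 a = 0"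
    with assms have "Suc i = length w"
      by (cases "Suc i < length w") (auto simp: reads_def dest: nth_nonzero)
    then have "?s4 = ?s3" by simp
    then show "run Skip ?s3 1 ?s4" by (simp add: run_Skip)
  next
    assume "reads ?s3 a \<noteq> 0"
    then have "Suc i < length w" by (simp add: reads_def split: if_splits)
    then show "run (mv a GoRight) ?s3 1 ?s4" by (intro run_mv) (auto simp: min_def)
  qed
  have 5: "run (wr f 1 Stay) ?s4 1 s'"
    by (rule run_wr) (use assms in auto)
  have 6: "reads ?s2 a \<noteq> reads ?s2 b"
    using assms(2-4,7) nth_nonzero[of w i] by (cases "Suc i < length w") (auto simp: reads_def)
  have 7: "reads s a \<noteq> 0" using assms by (simp add: reads_def)
  have 8: "run (Cond (\<lambda>r. r a = r b) (mv2 a GoRight b GoRight)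
        (wr b 0 Stay ;; Cond (\<lambda>r. r a = 0) Skip (mv a GoRight) ;; wr f 1 Stay)) ?s2 (1 + ((1 + 1) + 1 + 1) + 1 + 1) s'"
    by (rule run_Cond) (use 6 run_Seq[OF 3 run_Seq[OF 4 5]] in simp_all)
  have "run (decstep a b f) s ((1 + (1 + (1 + ((1 + 1) + 1 + 1) + 1 + 1) + 1) + 1) + 1) s'"
    unfolding decstep_def
    by (rule run_Cond) (use 7 in blast, rule run_Seq[OF 1 run_Seq[OF 2 8]])
  then show ?thesis by (rule run_mono) simp
qed

text \<open>The time is bounded by the decoded word alone, since the rest is not read. For this
  reason the time of the matrix machine does not depend on the padding behind its input.\<close>

lemma run_decc:
  assumes "s a = wt i w" "i \<le> length w" "0 \<notin> set w" "length u \<le> n" "s b = fin v" "s f = blank"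
    "distinct [a, b, f]" "(u, r) = dec (drop i w)"
    "s' = s(a := wt (length w - length r) w, b := fin (v @ u))"
  shows "run (decc a b f) s (10 * n + 17) s'"
proof -
  have *: "run (While (\<lambda>r. r f = 0) (decstep a b f)) s (10 * length (fst (dec r)) + 15)
     (s(a := wt (length w - length (snd (dec r))) w, b := fin (v @ fst (dec r)), f := raised))"
    if "s a = wt i w" "i \<le> length w" "drop i w = r" "s b = fin v" "s f = blank" for r s i v
    using that
  proof (induction r arbitrary: s i v rule: dec.induct)
    case (1 x y r)
    have "length (drop i w) = length r + 2" using "1.prems"(3) by simp
    then have len: "Suc i < length w" "length w - length r = i + 2" by auto
    have "x # y # r = w ! i # w ! Suc i # drop (i + 2) w"
      using "1.prems"(3) len by (simp add: Cons_nth_drop_Suc)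
    then have xy: "x = w ! i" "y = w ! Suc i" "drop (i + 2) w = r" by auto
    show ?case
    proof (cases "x = y")
      case True
      let ?s1 = "s(a := wt (i + 2) w, b := fin (v @ [x]))"
      have a: "run (decstep a b f) s 8 ?s1"
        by (rule run_decstep_eq[of s a i w b v]) (use "1.prems" assms len xy True in auto)
      have b: "run (While (\<lambda>r. r f = 0) (decstep a b f)) ?s1 (10 * length (fst (dec r)) + 15)
        (?s1(a := wt (length w - length (snd (dec r))) w, b := fin ((v @ [x]) @ fst (dec r)), f := raised))"
        by (rule "1.IH"[OF True]) (use "1.prems" assms len xy(3) in auto)
      have "run (While (\<lambda>r. r f = 0) (decstep a b f)) s (8 + (10 * length (fst (dec r)) + 15) + 2)
        (?s1(a := wt (length w - length (snd (dec r))) w, b := fin ((v @ [x]) @ fst (dec r)), f := raised))"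
        by (rule run_While_True[OF _ a b]) (use "1.prems" in \<open>simp add: reads_def\<close>)
      moreover have "?s1(a := wt (length w - length (snd (dec r))) w, b := fin ((v @ [x]) @ fst (dec r)), f := raised)
        = s(a := wt (length w - length (snd (dec (x # y # r)))) w,
          b := fin (v @ fst (dec (x # y # r))), f := raised)"
        using True assms(7) by (simp add: fun_upd_twist)
      ultimately show ?thesis by (simp only:) (erule run_mono, simp add: True)
    next
      case False
      let ?s1 = "s(a := wt (min (i + 2) (length w)) w, f := raised)"
      have a: "run (decstep a b f) s 12 ?s1"
        by (rule run_decstep_neq[where v = v]) (use "1.prems" assms len xy(1,2) False in auto)
      have b: "run (While (\<lambda>r. r f = 0) (decstep a b f)) ?s1 1 ?s1"
        by (rule run_While_False) (simp add: reads_def)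
      have "run (While (\<lambda>r. r f = 0) (decstep a b f)) s (12 + 1 + 2) ?s1"
        by (rule run_While_True[OF _ a b]) (use "1.prems" in \<open>simp add: reads_def\<close>)
      moreover have "?s1 = s(a := wt (length w - length (snd (dec (x # y # r)))) w,
          b := fin (v @ fst (dec (x # y # r))), f := raised)"
        using False len "1.prems"(4) assms(7) by (auto simp: fun_eq_iff)
      ultimately show ?thesis by (simp only:) (erule run_mono, simp)
    qed
  next
    case (2 x)
    have "length (drop i w) = 1" using "2.prems"(3) by simp
    then have len: "Suc i = length w" by simp
    let ?s1 = "s(a := wt (min (i + 2) (length w)) w, f := raised)"
    have a: "run (decstep a b f) s 12 ?s1"
      by (rule run_decstep_neq[where v = v]) (use "2.prems" assms len in auto)
    have b: "run (While (\<lambda>r. r f = 0) (decstep a b f)) ?s1 1 ?s1"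
      by (rule run_While_False) (simp add: reads_def)
    have "run (While (\<lambda>r. r f = 0) (decstep a b f)) s (12 + 1 + 2) ?s1"
      by (rule run_While_True[OF _ a b]) (use "2.prems" in \<open>simp add: reads_def\<close>)
    moreover have "?s1 = s(a := wt (length w - length (snd (dec [x]))) w,
        b := fin (v @ fst (dec [x])), f := raised)"
      using len "2.prems"(4) assms(7) by (auto simp: fun_eq_iff)
    ultimately show ?case by (simp only:) (erule run_mono, simp)
  next
    case 3
    have len: "i = length w" using 3 by simp
    let ?s1 = "s(f := raised)"
    have a: "run (decstep a b f) s 2 ?s1"
      by (rule run_decstep_end) (use 3 assms len in auto)
    have b: "run (While (\<lambda>r. r f = 0) (decstep a b f)) ?s1 1 ?s1"
      by (rule run_While_False) (simp add: reads_def)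
    have "run (While (\<lambda>r. r f = 0) (decstep a b f)) s (2 + 1 + 2) ?s1"
      by (rule run_While_True[OF _ a b]) (use 3 in \<open>simp add: reads_def\<close>)
    moreover have "?s1 = s(a := wt (length w - length (snd (dec ([] :: nat list)))) w,
        b := fin (v @ fst (dec [])), f := raised)"
      using len 3(1,4) assms(7) by (auto simp: fun_eq_iff)
    ultimately show ?case by (simp only:) (erule run_mono, simp)
  qed
  have ur: "fst (dec (drop i w)) = u" "snd (dec (drop i w)) = r" by (simp_all flip: assms(8))
  show ?thesis unfolding decc_def
    by (rule run_mono[OF run_Seq[OF *[of s i "drop i w" v, OF assms(1,2) refl assms(5,6)] run_wr]])
      (use assms(4,6,7,9) ur in \<open>auto simp: fun_eq_iff\<close>)
qed

section \<open>Simulation of a Turing machine by a program\<close>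

lemma tape_of_wt: "tape_of x = wt 0 (map bit_sym x)"
  by (auto simp: tape_of_def wt_def cells_def fun_eq_iff)

lemma bit_sym_pos: "0 \<notin> set (map bit_sym x)"
  by (auto simp: bit_sym_def)

lemma tape_of_Nil: "tape_of [] = blank"
  by (auto simp: tape_of_def)

text \<open>Under the empty oracle, halting and queries are ordinary transitions. With them
  absorbed, one step always has the same shape, both for the simulation and for the tableau.\<close>

definition tr :: "otm \<Rightarrow> nat \<Rightarrow> nat list \<Rightarrow> nat \<times> (nat \<times> move) list" where
  "tr M q ss = (if q = q_halt M then (q, map (\<lambda>v. (v, Stay)) ss)
     else if q = q_query M then (q_no M, map (\<lambda>v. (v, Stay)) ss) else trans M q ss)"

lemma map2_act_stay: "map2 act (map (\<lambda>t. (read_sym t, Stay)) ts) ts = ts"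
  by (induction ts) (auto simp: act_stay)

lemma step_tr: "step M {} (q, ts) =
    (fst (tr M q (map read_sym ts)), map2 act (snd (tr M q (map read_sym ts))) ts)"
  by (auto simp: tr_def Let_def map2_act_stay comp_def split_beta)

lemma step_no_query: "q \<noteq> q_query M \<or> q = q_halt M \<Longrightarrow> step M A (q, ts) = step M {} (q, ts)"
  by auto

definition wf_conf :: "otm \<Rightarrow> config \<Rightarrow> bool" where
  "wf_conf M c \<longleftrightarrow> fst c < n_states M \<and> length (snd c) = n_tapes M \<and>
     (\<forall>t\<in>set (snd c). \<forall>i. snd t i < n_syms M)"

lemma tr_wf:
  assumes "wf_otm M" "q < n_states M" "length ss = n_tapes M" "set ss \<subseteq> {..<n_syms M}"
  shows "fst (tr M q ss) < n_states M" "length (snd (tr M q ss)) = n_tapes M"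
    "fst ` set (snd (tr M q ss)) \<subseteq> {..<n_syms M}"
  using assms unfolding wf_otm_def tr_def by (auto split: if_splits)

lemma act_snd: "snd (act x t) = (snd t)(fst t := fst x)"
  by (cases x; cases t) auto

lemma act_fst: "fst (act x t) = fst t + offset (snd x)"
  by (cases x; cases t) auto

lemma wf_conf_step:
  assumes "wf_otm M" "wf_conf M c"
  shows "wf_conf M (step M A c)"
proof -
  obtain q ts where c: "c = (q, ts)" by (cases c)
  have "set (map read_sym ts) \<subseteq> {..<n_syms M}" using assms(2) by (auto simp: wf_conf_def c read_pair)
  with assms c have t: "fst (tr M q (map read_sym ts)) < n_states M"
    "length (snd (tr M q (map read_sym ts))) = n_tapes M"
    "fst ` set (snd (tr M q (map read_sym ts))) \<subseteq> {..<n_syms M}"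
    using tr_wf[of M q "map read_sym ts"] by (auto simp: wf_conf_def)
  have l: "length ts = n_tapes M" using assms(2) c by (simp add: wf_conf_def)
  have b: "snd (map2 act (snd (tr M q (map read_sym ts))) ts ! j) i < n_syms M" if "j < n_tapes M" for i j
  proof -
    have "fst (snd (tr M q (map read_sym ts)) ! j) < n_syms M"
      using t(2,3) that nth_mem[of j "snd (tr M q (map read_sym ts))"] by (auto simp: image_subset_iff)
    moreover have "snd (ts ! j) i < n_syms M"
      using assms(2) c that l nth_mem[of j ts] by (auto simp: wf_conf_def)
    ultimately show ?thesis using that t(2) l by (simp add: act_snd)
  qed
  have 1: "wf_conf M (step M {} c)"
  proof -
    define X where "X = map2 act (snd (tr M q (map read_sym ts))) ts"
    have "length X = n_tapes M" using t(2) l by (simp add: X_def)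
    moreover have "\<forall>x\<in>set X. \<forall>i. snd x i < n_syms M"
      using b calculation unfolding X_def[symmetric] by (metis in_set_conv_nth)
    ultimately show ?thesis using t(1) unfolding c step_tr wf_conf_def X_def by simp
  qed
  show ?thesis
  proof (cases "q \<noteq> q_query M \<or> q = q_halt M")
    case True
    then show ?thesis using 1 step_no_query[OF True, of A ts] c by (simp only:)
  next
    case False
    then show ?thesis using assms unfolding c by (auto simp: wf_conf_def wf_otm_def)
  qed
qed

lemma wf_conf_steps: "wf_otm M \<Longrightarrow> wf_conf M c \<Longrightarrow> wf_conf M ((step M A ^^ t) c)"
  by (induction t) (auto intro: wf_conf_step simp del: step.simps)

lemma wf_conf_init: "wf_otm M \<Longrightarrow> wf_conf M (init_config M x)"
  by (auto simp: wf_conf_def init_config_def wf_otm_def tape_of_def bit_sym_def)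

text \<open>What \<open>t\<close> steps can do to a tape that started blank. It bounds the way of a
  head back to cell 0 and the length of a word written on the tape.\<close>

definition reach_tape :: "nat \<Rightarrow> tape \<Rightarrow> bool" where
  "reach_tape t x \<longleftrightarrow> \<bar>fst x\<bar> \<le> int t \<and> (\<forall>i. snd x i \<noteq> 0 \<longrightarrow> \<bar>i\<bar> < int t)"

lemma reach_tape_act:
  assumes "reach_tape t x"
  shows "reach_tape (Suc t) (act a x)"
  unfolding reach_tape_def
proof (intro conjI allI impI)
  have "\<bar>offset (snd a)\<bar> \<le> 1" by (cases "snd a") auto
  then show "\<bar>fst (act a x)\<bar> \<le> int (Suc t)" using assms
    unfolding reach_tape_def act_fst by linarith
  fix i assume "snd (act a x) i \<noteq> 0"
  then have "i = fst x \<or> snd x i \<noteq> 0" by (auto simp: act_snd split: if_splits)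
  then show "\<bar>i\<bar> < int (Suc t)"
  proof
    assume "snd x i \<noteq> 0"
    then have "\<bar>i\<bar> < int t" using assms by (simp add: reach_tape_def)
    then show ?thesis by simp
  qed (use assms in \<open>simp add: reach_tape_def\<close>)
qed

lemma reach_tape_mono: "reach_tape t x \<Longrightarrow> t \<le> t' \<Longrightarrow> reach_tape t' x"
  unfolding reach_tape_def by (meson of_nat_le_iff order_trans order_less_le_trans)

lemma reach_tape_step:
  assumes "wf_otm M" "wf_conf M (q, ts)" "j < n_tapes M" "reach_tape t (ts ! j)"
  shows "reach_tape (Suc t) (snd (step M A (q, ts)) ! j)"
proof (cases "q \<noteq> q_query M \<or> q = q_halt M")
  case True
  have "set (map read_sym ts) \<subseteq> {..<n_syms M}" using assms(2) by (auto simp: wf_conf_def read_pair)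
  then have "length (snd (tr M q (map read_sym ts))) = n_tapes M"
    using assms tr_wf(2)[of M q "map read_sym ts"] by (auto simp: wf_conf_def)
  then show ?thesis unfolding step_no_query[OF True] step_tr
    using assms by (auto simp: wf_conf_def intro!: reach_tape_act)
next
  case False
  then show ?thesis using assms(4) by (auto intro: reach_tape_mono)
qed

lemma reach_tape_init:
  assumes "wf_otm M" "0 < j" "j < n_tapes M"
  shows "reach_tape t (snd ((step M A ^^ t) (init_config M x)) ! j)"
proof (induction t)
  case 0
  show ?case using assms by (simp add: init_config_def nth_Cons' tape_of_Nil reach_tape_def)
next
  case (Suc t)
  show ?case
    using reach_tape_step[of M "fst ((step M A ^^ t) (init_config M x))"
        "snd ((step M A ^^ t) (init_config M x))" j t A] assms Suc
      wf_conf_steps[OF assms(1) wf_conf_init[OF assms(1)], where A = A and t = t and x1 = x]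
    by (simp del: step.simps)
qed

text \<open>A block of tapes starting at \<open>B\<close>: the state, the shadows of tapes 1 and 2 (a single mark
  at cell 0, under a head that follows the shadowed one), a clock, an auxiliary tape, and the tapes
  of the simulated machine.\<close>

definition shadow :: "int \<Rightarrow> tape" where
  "shadow h = (h, \<lambda>i. if i = 0 then 1 else 0)"

definition cell_tape :: "nat \<Rightarrow> tape" where
  "cell_tape q = (0, (\<lambda>_. 0)(0 := q))"

definition block :: "otm \<Rightarrow> nat \<Rightarrow> nat set" where
  "block M B = {B..<B + 5 + n_tapes M}"

definition emb :: "otm \<Rightarrow> nat \<Rightarrow> config \<Rightarrow> store \<Rightarrow> bool" where
  "emb M B c s \<longleftrightarrow> wf_conf M c \<and> s B = cell_tape (fst c) \<and>
     (\<forall>j<n_tapes M. s (B + 5 + j) = snd c ! j) \<and>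
     s (B + 1) = shadow (fst (snd c ! 1)) \<and> s (B + 2) = shadow (fst (snd c ! 2))"

text \<open>The simulated state is a symbol on tape \<open>B\<close>, so a simulated step is a
  single action. On symbols outside the ranges of \<open>M\<close> the action idles, which keeps it
  within the larger alphabet of the program.\<close>

definition sim_fun :: "otm \<Rightarrow> nat \<Rightarrow> (nat \<Rightarrow> nat) \<Rightarrow> nat \<Rightarrow> nat \<times> move" where
  "sim_fun M B r =
     (let t = tr M (r B) (map (\<lambda>j. r (B + 5 + j)) [0..<n_tapes M])
      in if r B < n_states M \<and> (\<forall>j<n_tapes M. r (B + 5 + j) < n_syms M)
         then (\<lambda>i. if i = B then (fst t, Stay)
             else if i = B + 1 then (r i, snd (snd t ! 1))
             else if i = B + 2 then (r i, snd (snd t ! 2))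
             else if B + 5 \<le> i \<and> i < B + 5 + n_tapes M then snd t ! (i - (B + 5))
             else (r i, Stay))
         else stay r)"

definition sim :: "otm \<Rightarrow> nat \<Rightarrow> cmd" where
  "sim M B = Act (sim_fun M B)"

lemma wf_sim:
  assumes "wf_otm M" "B + 5 + n_tapes M \<le> K" "n_syms M \<le> g" "n_states M \<le> g"
  shows "wf_cmd K g (sim M B)"
proof -
  have "sim_fun M B r i = sim_fun M B r' i" if "i < K" "\<And>i. i < K \<Longrightarrow> r i = r' i" for i r r'
  proof -
    have m: "map (\<lambda>j. r (B + 5 + j)) [0..<n_tapes M] = map (\<lambda>j. r' (B + 5 + j)) [0..<n_tapes M]"
      using that assms(2) by auto
    have e: "(\<forall>j<n_tapes M. r (B + 5 + j) < n_syms M) = (\<forall>j<n_tapes M. r' (B + 5 + j) < n_syms M)"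
      "r B = r' B" "r i = r' i" "r (Suc B) = r' (Suc B)" "r (Suc (Suc B)) = r' (Suc (Suc B))"
      using that assms(2) by auto
    show ?thesis
    proof (cases "r' B < n_states M \<and> (\<forall>j<n_tapes M. r' (B + 5 + j) < n_syms M)")
      case True
      show ?thesis unfolding sim_fun_def Let_def m e(1,2) if_P[OF True] by (simp add: e)
    next
      case False
      show ?thesis unfolding sim_fun_def Let_def m e(1,2) if_not_P[OF False] by (simp add: e stay_def)
    qed
  qed
  moreover have "fst (sim_fun M B r i) < g" if "i < K" "\<forall>i<K. r i < g" for i r
  proof (cases "r B < n_states M \<and> (\<forall>j<n_tapes M. r (B + 5 + j) < n_syms M)")
    case True
    let ?ss = "map (\<lambda>j. r (B + 5 + j)) [0..<n_tapes M]"
    have "set ?ss \<subseteq> {..<n_syms M}" using True by auto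
    then have "fst (tr M (r B) ?ss) < n_states M" "length (snd (tr M (r B) ?ss)) = n_tapes M"
      "fst ` set (snd (tr M (r B) ?ss)) \<subseteq> {..<n_syms M}"
      using tr_wf[of M "r B" ?ss] assms(1) True by simp_all
    note t = this
    then have X: "fst (snd (tr M (r B) ?ss) ! j) < n_syms M" if "j < n_tapes M" for j
      using that nth_mem[of j "snd (tr M (r B) ?ss)"] by (auto simp: image_subset_iff)
    have Y: "B + 5 \<le> i \<Longrightarrow> i < B + 5 + n_tapes M \<Longrightarrow> fst (snd (tr M (r B) ?ss) ! (i - (B + 5))) < g"
      by (rule order_less_le_trans[OF X]) (use assms in auto)
    have Z: "fst (tr M (r B) ?ss) < g"
      using t(1) assms(4) by simp
    show ?thesis using that Y Z
      unfolding sim_fun_def Let_def if_P[OF True] by simp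
  next
    case False
    show ?thesis using that unfolding sim_fun_def Let_def if_not_P[OF False] by (simp add: stay_def)
  qed
  ultimately show ?thesis unfolding sim_def wf_cmd.simps wf_act_def loc_def by blast
qed

lemma shift_pair: "shift d (h, X) = (h + offset d, X)"
  by (simp add: shift_def)

lemma shadow_shift: "shift d (shadow h) = shadow (h + offset d)"
  by (simp add: shift_def shadow_def)

lemma run_sim:
  assumes "wf_otm M" "emb M B c s" "fst c \<noteq> q_query M \<or> fst c = q_halt M \<or> A = {}"
  shows "\<exists>s'. run (sim M B) s 1 s' \<and> emb M B (step M A c) s' \<and>
    (\<forall>i. i \<notin> block M B \<or> i = B + 3 \<or> i = B + 4 \<longrightarrow> s' i = s i)"
proof -
  obtain q ts where c: "c = (q, ts)" by (cases c)
  have wc: "wf_conf M c" using assms(2) by (simp add: emb_def)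
  have k3: "3 \<le> n_tapes M" using assms(1) by (simp add: wf_otm_def)
  let ?ss = "map read_sym ts"
  have ss: "map (\<lambda>j. reads s (B + 5 + j)) [0..<n_tapes M] = ?ss"
    using assms(2) wc unfolding c emb_def wf_conf_def reads_def
    by (auto simp: list_eq_iff_nth_eq)
  have q: "reads s B = q" using assms(2) by (simp add: emb_def c reads_def cell_tape_def)
  have sy: "\<forall>j<n_tapes M. reads s (B + 5 + j) < n_syms M"
    using assms(2) wc unfolding c emb_def wf_conf_def reads_def by (auto simp: read_pair)
  have st: "step M A c = (fst (tr M q ?ss), map2 act (snd (tr M q ?ss)) ts)"
    using assms(3) step_no_query[of q M A ts] unfolding c by (metis fst_conv step_tr)
  have wf2: "wf_conf M (step M A c)" by (rule wf_conf_step[OF assms(1) wc])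
  have len: "length ts = n_tapes M" "length (snd (tr M q ?ss)) = n_tapes M"
    using wc c tr_wf(2)[of M q ?ss] assms(1) by (auto simp: wf_conf_def read_pair)
  define s' where "s' = apply_act (sim_fun M B (reads s)) s"
  have F: "sim_fun M B (reads s) = (\<lambda>i. if i = B then (fst (tr M q ?ss), Stay)
             else if i = B + 1 then (reads s i, snd (snd (tr M q ?ss) ! 1))
             else if i = B + 2 then (reads s i, snd (snd (tr M q ?ss) ! 2))
             else if B + 5 \<le> i \<and> i < B + 5 + n_tapes M then snd (tr M q ?ss) ! (i - (B + 5))
             else (reads s i, Stay))"
    unfolding sim_fun_def Let_def ss q using sy wc by (simp add: c wf_conf_def)
  have "emb M B (step M A c) s'"
    unfolding emb_def
  proof (intro conjI allI impI)
    show "s' B = cell_tape (fst (step M A c))"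
      using assms(2) unfolding s'_def apply_act_def F st by (auto simp: emb_def cell_tape_def)
    have sh: "s' (B + i) = shift (snd (snd (tr M q ?ss) ! i)) (s (B + i))" if "i = 1 \<or> i = 2" for i
      using that unfolding s'_def apply_act_def F by (auto simp del: add_2_eq_Suc')
    moreover have "s (B + 1) = shadow (fst (ts ! 1))" "s (B + 2) = shadow (fst (ts ! 2))"
      using assms(2) by (auto simp: emb_def c)
    ultimately show "s' (B + 1) = shadow (fst (snd (step M A c) ! 1))"
      "s' (B + 2) = shadow (fst (snd (step M A c) ! 2))"
      using k3 len sh[of 1] sh[of 2] unfolding st
      by (simp_all add: shadow_shift act_fst del: add_2_eq_Suc')
    fix j assume "j < n_tapes M"
    then show "s' (B + 5 + j) = snd (step M A c) ! j"
      using assms(2) len unfolding s'_def apply_act_def F st by (auto simp: emb_def c)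
  qed (rule wf2)
  moreover have "run (sim M B) s 1 s'" unfolding sim_def by (rule run_Act) (simp add: s'_def)
  moreover have "\<forall>i. i \<notin> block M B \<or> i = B + 3 \<or> i = B + 4 \<longrightarrow> s' i = s i"
    using k3 unfolding s'_def apply_act_def F by (auto simp: block_def)
  ultimately show ?thesis by blast
qed

definition boot :: "otm \<Rightarrow> nat \<Rightarrow> cmd" where
  "boot M B = wr B (q_start M) Stay ;; wr (B + 1) 1 Stay ;; wr (B + 2) 1 Stay"

lemma wf_boot: "wf_otm M \<Longrightarrow> B + 2 < K \<Longrightarrow> 1 < g \<Longrightarrow> n_states M \<le> g \<Longrightarrow> wf_cmd K g (boot M B)"
  by (auto simp: boot_def wf_otm_def intro!: wf_wr)

lemma run_boot:
  assumes "wf_otm M" "s (B + 5) = tape_of x"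
    "\<And>i. i \<in> block M B \<Longrightarrow> i \<noteq> B + 3 \<Longrightarrow> i \<noteq> B + 5 \<Longrightarrow> s i = blank"
  shows "\<exists>s'. run (boot M B) s 5 s' \<and> emb M B (init_config M x) s' \<and>
    (\<forall>i. i \<notin> {B, B + 1, B + 2} \<longrightarrow> s' i = s i)"
proof -
  have k3: "3 \<le> n_tapes M" using assms(1) by (simp add: wf_otm_def)
  have b: "s B = blank" "s (B + 1) = blank" "s (B + 2) = blank"
    using assms(3)[of B] assms(3)[of "B + 1"] assms(3)[of "B + 2"] by (auto simp: block_def)
  let ?s = "s(B := cell_tape (q_start M), B + 1 := shadow 0, B + 2 := shadow 0)"
  have "run (boot M B) s 5 ?s" unfolding boot_def
    by (rule run_mono[OF run_Seq[OF run_wr[OF refl] run_Seq[OF run_wr[OF refl] run_wr]]])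
      (use b in \<open>auto simp: fun_eq_iff cell_tape_def shadow_def\<close>)
  moreover have "?s (B + 5 + j) = snd (init_config M x) ! j" if "j < n_tapes M" for j
    using that assms(2) assms(3)[of "B + 5 + j"]
    by (cases j) (auto simp: init_config_def block_def tape_of_Nil)
  ultimately show ?thesis using wf_conf_init[OF assms(1)] k3
    by (intro exI[of _ ?s]) (auto simp: emb_def init_config_def nth_Cons' tape_of_Nil numeral_2_eq_2)
qed

text \<open>A head on a two-way infinite tape may be on either side of cell 0. Its distance is at
  most the capacity of the clock, so that many moves to the right reach a nonnegative cell, and from
  there a walk to the left meets the mark of the shadow.\<close>

definition home :: "nat \<Rightarrow> nat \<Rightarrow> cmd" where
  "home B j = mv (B + 3) GoRight ;;
     While (\<lambda>r. r (B + 3) \<noteq> 0) (mv (B + 3) GoRight ;; mv2 (B + 5 + j) GoRight (B + j) GoRight) ;;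
     While (\<lambda>r. r (B + j) = 0) (mv2 (B + 5 + j) GoLeft (B + j) GoLeft)"

lemma wf_home: "B + 5 + j < K \<Longrightarrow> wf_cmd K g (home B j)"
  by (auto simp: home_def wf_mv wf_mv2 intro!: loc_at loc_comp[where f = "\<lambda>x. 0 < x"]
      loc_comp[where f = "\<lambda>x. x = 0"])

lemma run_home:
  assumes "s (B + 3) = ctr 0 T" "s (B + j) = shadow h" "s (B + 5 + j) = (h, X)" "\<bar>h\<bar> \<le> int T"
    "j = 1 \<or> j = 2" "T \<le> n"
    "s' = s(B + 3 := ctr (Suc T) T, B + j := shadow 0, B + 5 + j := (0, X))"
  shows "run (home B j) s (11 * n + 6) s'"
proof -
  have d: "B + 3 \<noteq> B + j" "B + 3 \<noteq> B + 5 + j" "B + j \<noteq> B + 5 + j" using assms(5) by auto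
  define S where "S = (\<lambda>k. s(B + 3 := ctr (Suc k) T, B + j := shadow (h + int k), B + 5 + j := (h + int k, X)))"
  have 1: "run (mv (B + 3) GoRight) s 1 (S 0)"
    by (rule run_mv) (use assms d in \<open>auto simp: S_def fun_eq_iff\<close>)
  have 2: "run (While (\<lambda>r. r (B + 3) \<noteq> 0) (mv (B + 3) GoRight ;; mv2 (B + 5 + j) GoRight (B + j) GoRight))
     (S 0) (T * (3 + 2) + 1) (S T)"
  proof (rule run_While_iter[where S = S])
    fix k assume k: "k < T"
    have "run (mv (B + 3) GoRight ;; mv2 (B + 5 + j) GoRight (B + j) GoRight) (S k) (1 + 1 + 1) (S (Suc k))"
      by (rule run_Seq[OF run_mv[OF refl] run_mv2])
        (use d in \<open>auto simp: S_def fun_eq_iff shadow_shift shift_pair ac_simps\<close>)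
    moreover have "reads (S k) (B + 3) \<noteq> 0" using k d by (simp add: S_def reads_def)
    ultimately show "reads (S k) (B + 3) \<noteq> 0 \<and>
      run (mv (B + 3) GoRight ;; mv2 (B + 5 + j) GoRight (B + j) GoRight) (S k) 3 (S (Suc k))"
      by (simp add: numeral_3_eq_3)
  qed (use d in \<open>auto simp: S_def reads_def\<close>)
  define m where "m = nat (h + int T)"
  have m: "int m = h + int T" using assms(4) by (simp add: m_def)
  define S' where "S' = (\<lambda>k. s(B + 3 := ctr (Suc T) T, B + j := shadow (int m - int k), B + 5 + j := (int m - int k, X)))"
  have 3: "run (While (\<lambda>r. r (B + j) = 0) (mv2 (B + 5 + j) GoLeft (B + j) GoLeft)) (S T) (m * (1 + 2) + 1) s'"
  proof (rule run_While_iter[where S = S'])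
    fix k assume k: "k < m"
    have "run (mv2 (B + 5 + j) GoLeft (B + j) GoLeft) (S' k) 1 (S' (Suc k))"
      by (rule run_mv2) (use d in \<open>auto simp: S'_def fun_eq_iff shadow_shift shift_pair algebra_simps\<close>)
    moreover have "reads (S' k) (B + j) = 0" using k d by (simp add: S'_def reads_def shadow_def)
    ultimately show "reads (S' k) (B + j) = 0 \<and> run (mv2 (B + 5 + j) GoLeft (B + j) GoLeft) (S' k) 1 (S' (Suc k))"
      by simp
  qed (use d m assms(7) in \<open>auto simp: S_def S'_def reads_def shadow_def\<close>)
  have "m \<le> 2 * n" using m assms(4,6) by linarith
  then show ?thesis unfolding home_def
    by (intro run_mono[OF run_Seq[OF 1 run_Seq[OF 2 3]]]) (use assms(6) in simp)
qed

definition simloop :: "otm \<Rightarrow> nat \<Rightarrow> cmd" where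
  "simloop M B = While (\<lambda>r. r (B + 3) \<noteq> 0) (sim M B ;; mv (B + 3) GoLeft)"

lemma run_simloop:
  assumes "wf_otm M" "emb M B c s" "s (B + 3) = ctr T T" "T \<le> n"
  shows "\<exists>s'. run (simloop M B) s (5 * n + 1) s' \<and> emb M B ((step M {} ^^ T) c) s' \<and>
    s' (B + 3) = ctr 0 T \<and> (\<forall>i. i \<notin> block M B \<or> i = B + 4 \<longrightarrow> s' i = s i)"
proof -
  define I where "I = (\<lambda>k s'. emb M B ((step M {} ^^ k) c) s' \<and>
    s' (B + 3) = ctr (T - k) T \<and> (\<forall>i. i \<notin> block M B \<or> i = B + 4 \<longrightarrow> s' i = s i))"
  have "\<exists>s'. run (simloop M B) s (T * (3 + 2) + 1) s' \<and> I T s'"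
    unfolding simloop_def
  proof (rule run_While_inv[where I = I])
    fix k s1 assume k: "k < T" "I k s1"
    then obtain l where l: "T - k = Suc l" "T - Suc k = l" by (metis Suc_diff_Suc)
    from run_sim[OF assms(1), of B "(step M {} ^^ k) c" s1 "{}"] k
    obtain s2 where s2: "run (sim M B) s1 1 s2" "emb M B (step M {} ((step M {} ^^ k) c)) s2"
      "\<forall>i. i \<notin> block M B \<or> i = B + 3 \<or> i = B + 4 \<longrightarrow> s2 i = s1 i" unfolding I_def by blast
    let ?s3 = "s2(B + 3 := ctr l T)"
    have c3: "s2 (B + 3) = ctr (Suc l) T" using s2(3) k l by (simp add: I_def)
    have "run (sim M B ;; mv (B + 3) GoLeft) s1 (1 + 1 + 1) ?s3"
      by (rule run_Seq[OF s2(1) run_mv]) (simp add: c3)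
    moreover have "B + 3 \<in> block M B" by (simp add: block_def)
    then have "I (Suc k) ?s3"
      using s2 k l by (auto simp: I_def emb_def simp del: step.simps)
    moreover have "reads s1 (B + 3) \<noteq> 0" using k l by (simp add: I_def reads_def)
    ultimately show "reads s1 (B + 3) \<noteq> 0 \<and>
       (\<exists>s'. run (sim M B ;; mv (B + 3) GoLeft) s1 3 s' \<and> I (Suc k) s')"
      by (auto simp: numeral_3_eq_3)
  qed (use assms in \<open>auto simp: I_def reads_def\<close>)
  then obtain s' where "run (simloop M B) s (T * (3 + 2) + 1) s'" "I T s'" by blast
  moreover have "T * (3 + 2) + 1 \<le> 5 * n + 1" using assms(4) by simp
  ultimately show ?thesis unfolding I_def using run_mono by (metis diff_self_eq_0)
qed

definition decide :: "otm \<Rightarrow> nat poly \<Rightarrow> nat \<Rightarrow> cmd" where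
  "decide M p B = polyc p (B + 5) (B + 3) (B + 4) ;; boot M B ;; simloop M B ;; home B 1"

lemma wf_decide:
  assumes "wf_otm M" "B + 5 + n_tapes M \<le> K" "n_syms M \<le> g" "n_states M \<le> g"
  shows "wf_cmd K g (decide M p B)"
proof -
  have "3 \<le> n_tapes M" "3 \<le> n_syms M" using assms(1) by (auto simp: wf_otm_def)
  then show ?thesis unfolding decide_def simloop_def using assms
    by (auto intro!: wf_polyc wf_boot wf_sim wf_home wf_mv loc_at loc_comp[where f = "\<lambda>x. 0 < x"])
qed

text \<open>Halting configurations are fixed points, so running the full clock yields the final one.
  The verdict is the first output letter, which \<open>home\<close> brings under the head of tape
  \<open>B + 6\<close>, the simulated output tape.\<close>

lemma run_decide:
  assumes "wf_otm M" "computes_in_time M {} (\<lambda>x. [x \<in> L]) (poly p)"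
  obtains F where "polyfun F" "\<And>B s x n. s (B + 5) = wt 0 (map bit_sym x) \<Longrightarrow> length x \<le> n \<Longrightarrow>
     \<forall>i\<in>block M B. i \<noteq> B + 5 \<longrightarrow> s i = blank \<Longrightarrow>
     \<exists>s'. run (decide M p B) s (F n) s' \<and> read_sym (s' (B + 6)) = (if x \<in> L then 2 else 1) \<and>
        (\<forall>i. i \<notin> block M B \<longrightarrow> s' i = s i)"
proof -
  have k3: "3 \<le> n_tapes M" using assms(1) by (simp add: wf_otm_def)
  obtain F where F: "polyfun F" "\<And>s a c d w n. s a = wt 0 w \<Longrightarrow> 0 \<notin> set w \<Longrightarrow> length w \<le> n \<Longrightarrow>
     s c = blank \<Longrightarrow> s d = blank \<Longrightarrow> distinct [a, c, d] \<Longrightarrow>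
     run (polyc p a c d) s (F n) (s(c := ctr (poly p (length w)) (poly p (length w))))"
    by (rule run_polyc[where p = p]) (rule that)
  define G where "G = (\<lambda>n. F n + (5 + ((5 * poly p n + 1) + (11 * poly p n + 6) + 1) + 1) + 1)"
  have G: "polyfun G" unfolding G_def by (intro polyfun_intros polyfun_poly F(1))
  have "\<exists>s'. run (decide M p B) s (G n) s' \<and> read_sym (s' (B + 6)) = (if x \<in> L then 2 else 1) \<and>
        (\<forall>i. i \<notin> block M B \<longrightarrow> s' i = s i)"
    if h: "s (B + 5) = wt 0 (map bit_sym x)" "length x \<le> n" "\<forall>i\<in>block M B. i \<noteq> B + 5 \<longrightarrow> s i = blank"
    for B s x n
  proof -
    define T where "T = poly p (length x)"
    have T: "T \<le> poly p n" unfolding T_def by (rule poly_nat_mono[OF h(2)])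
    have inb: "B + i \<in> block M B" if "i \<le> 7" for i using that k3 by (auto simp: block_def)
    let ?s1 = "s(B + 3 := ctr T T)"
    have 1: "run (polyc p (B + 5) (B + 3) (B + 4)) s (F n) ?s1"
      using F(2)[of s "B + 5" "map bit_sym x" n "B + 3" "B + 4"] h bit_sym_pos[of x]
        inb[of 3] inb[of 4] by (simp add: T_def)
    have "\<exists>s'. run (boot M B) ?s1 5 s' \<and> emb M B (init_config M x) s' \<and>
       (\<forall>i. i \<notin> {B, B + 1, B + 2} \<longrightarrow> s' i = ?s1 i)"
      by (rule run_boot[OF assms(1)]) (use h in \<open>auto simp: tape_of_wt\<close>)
    then obtain s2 where s2: "run (boot M B) ?s1 5 s2" "emb M B (init_config M x) s2"
       "\<forall>i. i \<notin> {B, B + 1, B + 2} \<longrightarrow> s2 i = ?s1 i" by blast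
    then have "s2 (B + 3) = ctr T T" by simp
    from run_simloop[OF assms(1) s2(2) this T] obtain s3 where
      s3: "run (simloop M B) s2 (5 * poly p n + 1) s3" "emb M B ((step M {} ^^ T) (init_config M x)) s3"
      "s3 (B + 3) = ctr 0 T" "\<forall>i. i \<notin> block M B \<or> i = B + 4 \<longrightarrow> s3 i = s2 i" by blast
    obtain ts where ts: "(step M {} ^^ T) (init_config M x) = (q_halt M, ts)" "carries (ts ! 1) [x \<in> L]"
      using assms(2) unfolding computes_in_time_def T_def by blast
    have rt: "reach_tape T (ts ! 1)"
      using reach_tape_init[OF assms(1), of 1 T "{}" x] k3 ts by simp
    have "\<forall>j<n_tapes M. s3 (B + 5 + j) = ts ! j" using s3(2) unfolding ts(1) emb_def by simp
    from this[rule_format, of 1] k3 have "s3 (B + 5 + 1) = ts ! 1" by simp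
    then have t1: "s3 (B + 6) = ts ! 1" "s3 (B + 1) = shadow (fst (ts ! 1))"
      using s3(2) unfolding ts(1) by (simp_all add: emb_def add.commute)
    let ?s4 = "s3(B + 3 := ctr (Suc T) T, B + 1 := shadow 0, B + 5 + 1 := (0, snd (ts ! 1)))"
    have 4: "run (home B 1) s3 (11 * poly p n + 6) ?s4"
      by (rule run_home[OF s3(3) t1(2)]) (use t1 rt T in \<open>auto simp: reach_tape_def add.commute\<close>)
    have "run (decide M p B) s (G n) ?s4" unfolding decide_def G_def
      by (rule run_Seq[OF 1 run_Seq[OF s2(1) run_Seq[OF s3(1) 4]]])
    moreover have "snd (ts ! 1) 0 = bit_sym (x \<in> L)"
      using ts(2) by (auto simp: carries_def)
    then have "read_sym (?s4 (B + 6)) = (if x \<in> L then 2 else 1)"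
      by (simp add: bit_sym_def)
    moreover have "\<forall>i. i \<notin> block M B \<longrightarrow> ?s4 i = s i"
    proof (intro allI impI)
      fix i assume i: "i \<notin> block M B"
      then have "i \<noteq> B" "i \<noteq> B + 1" "i \<noteq> B + 2" "i \<noteq> B + 3" "i \<noteq> B + 6"
        using inb[of 0] inb[of 1] inb[of 2] inb[of 3] inb[of 6] by auto
      then show "?s4 i = s i" using s3(4) s2(3) i by simp
    qed
    ultimately show ?thesis by blast
  qed
  then show thesis by (rule that[OF G])
qed

section \<open>Words as decision trees\<close>

text \<open>Features increase along the spine, so the level of a leaf beside it tells the position
  of its letter. The leaf at the end of the spine carries no letter and is negative.\<close>

fun comb :: "nat \<Rightarrow> bool list \<Rightarrow> Defs.dtree" where
  "comb i [] = Leaf False"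
| "comb i (b # bs) = Branch i (Leaf b) (comb (Suc i) bs)"

lemma features_comb: "features (comb i bs) = {i..<i + length bs}"
proof (induction i bs rule: comb.induct)
  case (2 i b bs)
  have "{i..<i + length (b # bs)} = insert i {Suc i..<Suc i + length bs}" by auto
  then show ?case using 2 by simp
qed simp

lemma decision_tree_comb: "1 \<le> i \<Longrightarrow> i + length bs \<le> Suc n \<Longrightarrow> decision_tree n (comb i bs)"
  by (induction i bs rule: comb.induct) (auto simp: features_comb)

definition spine :: "nat \<Rightarrow> nat \<Rightarrow> pinst" where
  "spine i k = (\<lambda>j. if i \<le> j \<and> j < k then Some True else None)"

definition side :: "nat \<Rightarrow> nat \<Rightarrow> pinst" where
  "side i p = (\<lambda>j. if i \<le> j \<and> j < p then Some True else if j = p then Some False else None)"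

lemma is_node_Leaf: "is_node (Leaf b) e \<longleftrightarrow> e = Map.empty"
proof -
  have "subtree_at (Leaf b) u \<noteq> None \<longleftrightarrow> u = []" for u by (cases u) auto
  then show ?thesis by (auto simp: is_node_def)
qed

lemma is_node_Branch: "is_node (Branch i l r) e \<longleftrightarrow> e = Map.empty \<or>
    (\<exists>e'. is_node l e' \<and> e = e'(i \<mapsto> False)) \<or> (\<exists>e'. is_node r e' \<and> e = e'(i \<mapsto> True))"
proof
  assume "is_node (Branch i l r) e"
  then obtain u where u: "subtree_at (Branch i l r) u \<noteq> None" "e = node_inst (Branch i l r) u"
    by (auto simp: is_node_def)
  show "e = Map.empty \<or> (\<exists>e'. is_node l e' \<and> e = e'(i \<mapsto> False)) \<or> (\<exists>e'. is_node r e' \<and> e = e'(i \<mapsto> True))"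
  proof (cases u)
    case (Cons b v)
    show ?thesis
    proof (cases b)
      case True
      then have "is_node r (node_inst r v)" "e = (node_inst r v)(i \<mapsto> True)"
        using u Cons by (auto simp: is_node_def)
      then show ?thesis by blast
    next
      case False
      then have "is_node l (node_inst l v)" "e = (node_inst l v)(i \<mapsto> False)"
        using u Cons by (auto simp: is_node_def)
      then show ?thesis by blast
    qed
  qed (use u in auto)
next
  assume "e = Map.empty \<or> (\<exists>e'. is_node l e' \<and> e = e'(i \<mapsto> False)) \<or> (\<exists>e'. is_node r e' \<and> e = e'(i \<mapsto> True))"
  then show "is_node (Branch i l r) e"
  proof (elim disjE exE conjE)
    assume "e = Map.empty"
    then show ?thesis unfolding is_node_def by (intro exI[of _ "[]"]) auto
  next
    fix e' assume "is_node l e'" "e = e'(i \<mapsto> False)"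
    then obtain u where "subtree_at l u \<noteq> None" "e = (node_inst l u)(i \<mapsto> False)" by (auto simp: is_node_def)
    then show ?thesis unfolding is_node_def by (intro exI[of _ "False # u"]) auto
  next
    fix e' assume "is_node r e'" "e = e'(i \<mapsto> True)"
    then obtain u where "subtree_at r u \<noteq> None" "e = (node_inst r u)(i \<mapsto> True)" by (auto simp: is_node_def)
    then show ?thesis unfolding is_node_def by (intro exI[of _ "True # u"]) auto
  qed
qed

lemma is_posleaf_Leaf: "is_posleaf (Leaf b) e \<longleftrightarrow> b \<and> e = Map.empty"
proof -
  have "subtree_at (Leaf b) u = Some (Leaf True) \<longleftrightarrow> u = [] \<and> b" for u by (cases u) auto
  then show ?thesis by (auto simp: is_posleaf_def)
qed

lemma is_posleaf_Branch: "is_posleaf (Branch i l r) e \<longleftrightarrow>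
    (\<exists>e'. is_posleaf l e' \<and> e = e'(i \<mapsto> False)) \<or> (\<exists>e'. is_posleaf r e' \<and> e = e'(i \<mapsto> True))"
proof
  assume "is_posleaf (Branch i l r) e"
  then obtain u where u: "subtree_at (Branch i l r) u = Some (Leaf True)" "e = node_inst (Branch i l r) u"
    by (auto simp: is_posleaf_def)
  show "(\<exists>e'. is_posleaf l e' \<and> e = e'(i \<mapsto> False)) \<or> (\<exists>e'. is_posleaf r e' \<and> e = e'(i \<mapsto> True))"
  proof (cases u)
    case (Cons b v)
    show ?thesis
    proof (cases b)
      case True
      then have "is_posleaf r (node_inst r v)" "e = (node_inst r v)(i \<mapsto> True)"
        using u Cons by (auto simp: is_posleaf_def)
      then show ?thesis by blast
    next
      case False
      then have "is_posleaf l (node_inst l v)" "e = (node_inst l v)(i \<mapsto> False)"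
        using u Cons by (auto simp: is_posleaf_def)
      then show ?thesis by blast
    qed
  qed (use u in auto)
next
  assume "(\<exists>e'. is_posleaf l e' \<and> e = e'(i \<mapsto> False)) \<or> (\<exists>e'. is_posleaf r e' \<and> e = e'(i \<mapsto> True))"
  then show "is_posleaf (Branch i l r) e"
  proof (elim disjE exE conjE)
    fix e' assume "is_posleaf l e'" "e = e'(i \<mapsto> False)"
    then obtain u where "subtree_at l u = Some (Leaf True)" "e = (node_inst l u)(i \<mapsto> False)"
      by (auto simp: is_posleaf_def)
    then show ?thesis unfolding is_posleaf_def by (intro exI[of _ "False # u"]) auto
  next
    fix e' assume "is_posleaf r e'" "e = e'(i \<mapsto> True)"
    then obtain u where "subtree_at r u = Some (Leaf True)" "e = (node_inst r u)(i \<mapsto> True)"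
      by (auto simp: is_posleaf_def)
    then show ?thesis unfolding is_posleaf_def by (intro exI[of _ "True # u"]) auto
  qed
qed

lemma spine_Suc: "i < k \<Longrightarrow> (spine (Suc i) k)(i \<mapsto> True) = spine i k"
  by (auto simp: spine_def fun_eq_iff)

lemma side_Suc: "i < p \<Longrightarrow> (side (Suc i) p)(i \<mapsto> True) = side i p"
  by (auto simp: side_def fun_eq_iff)

lemma spine_self: "spine i i = Map.empty"
  by (auto simp: spine_def)

lemma side_self: "[i \<mapsto> False] = side i i"
  by (auto simp: side_def fun_eq_iff)

lemma is_node_comb: "is_node (comb i bs) e \<longleftrightarrow>
   (\<exists>k. i \<le> k \<and> k \<le> i + length bs \<and> e = spine i k) \<or> (\<exists>p. i \<le> p \<and> p < i + length bs \<and> e = side i p)"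
proof (induction i bs arbitrary: e rule: comb.induct)
  case (1 i)
  show ?case by (auto simp: is_node_Leaf spine_self intro!: exI[of _ i])
next
  case (2 i b bs)
  show ?case (is "?L \<longleftrightarrow> ?R")
  proof
    assume ?L
    then consider "e = Map.empty" | "e = [i \<mapsto> False]" | e' where "is_node (comb (Suc i) bs) e'" "e = e'(i \<mapsto> True)"
      by (auto simp: is_node_Branch is_node_Leaf)
    then show ?R
    proof cases
      case 1
      then have "e = spine i i" by (simp add: spine_self)
      then show ?thesis by auto
    next
      case 2
      then have "e = side i i" by (simp add: side_self)
      then show ?thesis by auto
    next
      case 3
      from 3(1) show ?thesis unfolding "2.IH"
      proof (elim disjE exE conjE)
        fix k assume k: "Suc i \<le> k" "k \<le> Suc i + length bs" "e' = spine (Suc i) k"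
        then have "e = spine i k" using 3 spine_Suc by simp
        then show ?thesis using k by (intro disjI1 exI[of _ k]) auto
      next
        fix p assume k: "Suc i \<le> p" "p < Suc i + length bs" "e' = side (Suc i) p"
        then have "e = side i p" using 3 side_Suc by simp
        then show ?thesis using k by (intro disjI2 exI[of _ p]) auto
      qed
    qed
  next
    assume ?R
    then have "e = spine i i \<or> e = side i i \<or>
       (\<exists>k. Suc i \<le> k \<and> k \<le> Suc i + length bs \<and> e = spine i k) \<or>
       (\<exists>p. Suc i \<le> p \<and> p < Suc i + length bs \<and> e = side i p)"
    proof (elim disjE exE conjE)
      fix k assume "i \<le> k" "k \<le> i + length (b # bs)" "e = spine i k"
      then show ?thesis by (cases "k = i") (auto intro: exI[of _ k])
    next
      fix p assume "i \<le> p" "p < i + length (b # bs)" "e = side i p"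
      then show ?thesis by (cases "p = i") (auto intro: exI[of _ p])
    qed
    then consider "e = spine i i" | "e = side i i"
      | k where "Suc i \<le> k" "k \<le> Suc i + length bs" "e = spine i k"
      | p where "Suc i \<le> p" "p < Suc i + length bs" "e = side i p" by blast
    then show ?L
    proof cases
      case 1
      then show ?thesis by (simp add: is_node_Branch spine_self)
    next
      case 2
      then have "e = [i \<mapsto> False]" by (simp only: side_self)
      then show ?thesis unfolding comb.simps is_node_Branch is_node_Leaf by blast
    next
      case 3
      then have "is_node (comb (Suc i) bs) (spine (Suc i) k)" by (auto simp: "2.IH")
      moreover have "e = (spine (Suc i) k)(i \<mapsto> True)" using 3 spine_Suc by simp
      ultimately show ?thesis unfolding comb.simps is_node_Branch by blast
    next
      case 4
      then have "is_node (comb (Suc i) bs) (side (Suc i) p)" by (auto simp: "2.IH")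
      moreover have "e = (side (Suc i) p)(i \<mapsto> True)" using 4 side_Suc by simp
      ultimately show ?thesis unfolding comb.simps is_node_Branch by blast
    qed
  qed
qed

lemma is_posleaf_comb: "is_posleaf (comb i bs) e \<longleftrightarrow>
   (\<exists>p. i \<le> p \<and> p < i + length bs \<and> bs ! (p - i) \<and> e = side i p)"
proof (induction i bs arbitrary: e rule: comb.induct)
  case (1 i)
  show ?case by (auto simp: is_posleaf_Leaf)
next
  case (2 i b bs)
  show ?case (is "?L \<longleftrightarrow> ?R")
  proof
    assume ?L
    then consider "b" "e = [i \<mapsto> False]" | e' where "is_posleaf (comb (Suc i) bs) e'" "e = e'(i \<mapsto> True)"
      by (auto simp: is_posleaf_Branch is_posleaf_Leaf)
    then show ?R
    proof cases
      case 1
      then have "e = side i i" by (simp add: side_self)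
      then show ?thesis using 1 by (intro exI[of _ i]) auto
    next
      case 2
      from 2(1) obtain p where k: "Suc i \<le> p" "p < Suc i + length bs" "bs ! (p - Suc i)" "e' = side (Suc i) p"
        unfolding "2.IH" by blast
      then have "e = side i p" "(b # bs) ! (p - i)" using 2 side_Suc by (auto simp: nth_Cons')
      then show ?thesis using k by (intro exI[of _ p]) auto
    qed
  next
    assume ?R
    then obtain p where p: "i \<le> p" "p < i + length (b # bs)" "(b # bs) ! (p - i)" "e = side i p" by blast
    show ?L
    proof (cases "p = i")
      case True
      then have "e = [i \<mapsto> False]" "b" using p by (simp_all only: side_self diff_self_eq_0 nth_Cons_0)
      then show ?thesis unfolding comb.simps is_posleaf_Branch is_posleaf_Leaf by blast
    next
      case False
      then have "is_posleaf (comb (Suc i) bs) (side (Suc i) p)" using p unfolding "2.IH" by (intro exI[of _ p]) (auto simp: nth_Cons')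
      moreover have "e = (side (Suc i) p)(i \<mapsto> True)" using False p side_Suc by simp
      ultimately show ?thesis unfolding comb.simps is_posleaf_Branch by blast
    qed
  qed
qed

text \<open>Position \<open>p\<close> of the word is represented by the leaf next to the spine at depth \<open>p\<close>. A
  partial instance \<open>e\<close> codes the set of positions whose leaf is inconsistent with \<open>e\<close>; in this way
  every set is coded and every partial instance codes some set.\<close>

definition pos :: "nat \<Rightarrow> pinst" where
  "pos p = side 1 p"

definition spn :: "nat \<Rightarrow> pinst" where
  "spn k = spine 1 (Suc k)"

definition wtree :: "bool list \<Rightarrow> Defs.dtree" where
  "wtree bs = comb 1 bs"

lemma pos_apply: "pos p j = (if 0 < j \<and> j < p then Some True else if j = p then Some False else None)"
  by (simp add: pos_def side_def Suc_le_eq)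

lemma spn_apply: "spn k j = (if 0 < j \<and> j \<le> k then Some True else None)"
  by (auto simp: spn_def spine_def Suc_le_eq)

lemma is_node_wtree: "is_node (wtree bs) e \<longleftrightarrow>
    (\<exists>k\<le>length bs. e = spn k) \<or> (\<exists>p. 0 < p \<and> p \<le> length bs \<and> e = pos p)"
proof -
  have "(\<exists>k. 1 \<le> k \<and> k \<le> 1 + length bs \<and> e = spine 1 k) \<longleftrightarrow> (\<exists>k\<le>length bs. e = spn k)"
  proof
    assume "\<exists>k. 1 \<le> k \<and> k \<le> 1 + length bs \<and> e = spine 1 k"
    then obtain k where "1 \<le> k" "k \<le> 1 + length bs" "e = spine 1 k" by blast
    then show "\<exists>k\<le>length bs. e = spn k" by (intro exI[of _ "k - 1"]) (auto simp: spn_def)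
  next
    assume "\<exists>k\<le>length bs. e = spn k"
    then obtain k where "k \<le> length bs" "e = spn k" by blast
    then show "\<exists>k. 1 \<le> k \<and> k \<le> 1 + length bs \<and> e = spine 1 k"
      by (intro exI[of _ "Suc k"]) (auto simp: spn_def)
  qed
  then show ?thesis unfolding wtree_def is_node_comb pos_def by (simp add: Suc_le_eq less_Suc_eq_le)
qed

lemma is_posleaf_wtree: "is_posleaf (wtree bs) e \<longleftrightarrow>
    (\<exists>p. 0 < p \<and> p \<le> length bs \<and> bs ! (p - 1) \<and> e = pos p)"
  unfolding wtree_def is_posleaf_comb pos_def by (simp add: Suc_le_eq less_Suc_eq_le)

lemma decision_tree_wtree: "decision_tree (length bs) (wtree bs)"
  unfolding wtree_def by (rule decision_tree_comb) auto

lemma dom_pos: "0 < p \<Longrightarrow> dom (pos p) = {0<..p}"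
  by (auto simp: pos_apply split: if_splits)

lemma dom_spn: "dom (spn k) = {0<..k}"
  by (auto simp: spn_apply split: if_splits)

lemma pos_pinst: "0 < p \<Longrightarrow> p \<le> n \<Longrightarrow> pos p \<in> pinsts n"
  by (auto simp: pinsts_def dom_pos)

lemma spn_pinst: "k \<le> n \<Longrightarrow> spn k \<in> pinsts n"
  by (auto simp: pinsts_def dom_spn)

lemma card_dom_pos [simp]: "0 < p \<Longrightarrow> card (dom (pos p)) = p"
  by (simp add: dom_pos)

lemma card_dom_spn [simp]: "card (dom (spn k)) = k"
  by (simp add: dom_spn)

lemma card_bots: "e \<in> pinsts n \<Longrightarrow> card (bots n e) = n - card (dom e) \<and> card (dom e) \<le> n"
proof -
  assume e: "e \<in> pinsts n"
  have "bots n e = {1..n} - dom e" by (auto simp: bots_def)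
  moreover have "card ({1..n} - dom e) = n - card (dom e)"
    using e card_Diff_subset[of "dom e" "{1..n}"] finite_subset[of "dom e" "{1..n}"] by (simp add: pinsts_def)
  moreover have "card (dom e) \<le> n" using e card_mono[of "{1..n}" "dom e"] by (simp add: pinsts_def)
  ultimately show ?thesis by simp
qed

lemma level_le_card: "e \<in> pinsts n \<Longrightarrow> e' \<in> pinsts n \<Longrightarrow>
   level_le n e e' \<longleftrightarrow> card (dom e) \<le> card (dom e')"
  using card_bots[of e n] card_bots[of e' n] by (auto simp: level_le_def)

lemma subsumed_map_le: "e \<in> pinsts n \<Longrightarrow> subsumed n e e' \<longleftrightarrow> e \<subseteq>\<^sub>m e'"
  by (auto simp: subsumed_def map_le_def pinsts_def)

lemma pos_inj: "0 < p \<Longrightarrow> 0 < q \<Longrightarrow> pos p = pos q \<longleftrightarrow> p = q"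
  by (metis card_dom_pos)

text \<open>Leaves are the nodes without a proper extension. The deepest side leaf and the end of
  the spine share the largest level \<open>n\<close>, so asking for a node of larger level removes
  both; this is why positions satisfy \<open>p < n\<close>.\<close>

lemma pos_iff:
  assumes "length bs = n"
  shows "is_node (wtree bs) e \<and> (\<forall>q. is_node (wtree bs) q \<longrightarrow> e \<subseteq>\<^sub>m q \<longrightarrow> q \<subseteq>\<^sub>m e) \<and>
      (\<exists>q. is_node (wtree bs) q \<and> card (dom e) < card (dom q)) \<longleftrightarrow> (\<exists>p. 0 < p \<and> p < n \<and> e = pos p)"
    (is "?L \<longleftrightarrow> ?R")
proof
  assume L: ?L
  have "card (dom q) \<le> n" if "is_node (wtree bs) q" for q
    using that assms by (auto simp: is_node_wtree)
  then have le: "card (dom e) < n" using L order_less_le_trans by blast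
  from L consider k where "k \<le> n" "e = spn k" | p where "0 < p" "p \<le> n" "e = pos p"
    unfolding is_node_wtree assms by blast
  then show ?R
  proof cases
    case 1
    then have "k < n" using le by simp
    then have "is_node (wtree bs) (spn (Suc k))"
      unfolding is_node_wtree assms by (intro disjI1 exI[of _ "Suc k"]) simp
    moreover have "e \<subseteq>\<^sub>m spn (Suc k)" using 1 by (auto simp: map_le_def spn_apply)
    ultimately have "spn (Suc k) \<subseteq>\<^sub>m e" using L by blast
    then have "spn (Suc k) (Suc k) = e (Suc k)" by (auto simp: map_le_def dom_spn)
    then show ?thesis using 1 by (simp add: spn_apply)
  next
    case 2
    then show ?thesis using le by auto
  qed
next
  assume ?R
  then obtain p where p: "0 < p" "p < n" "e = pos p" by blast
  have "q \<subseteq>\<^sub>m e" if "is_node (wtree bs) q" "e \<subseteq>\<^sub>m q" for q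
  proof -
    have "p \<in> dom (pos p)" using p by (simp add: dom_pos)
    then have "q p = pos p p" using that(2) p(3) unfolding map_le_def by metis
    then have "q p = Some False" by (simp add: pos_apply)
    moreover from that(1) have "(\<exists>k. q = spn k) \<or> (\<exists>r. q = pos r)" by (auto simp: is_node_wtree)
    ultimately have "q = pos p" by (auto simp: spn_apply pos_apply split: if_splits)
    then show ?thesis using p by simp
  qed
  moreover have "is_node (wtree bs) (spn n)" by (auto simp: is_node_wtree assms)
  then have "\<exists>q. is_node (wtree bs) q \<and> card (dom e) < card (dom q)"
    using p by (intro exI[of _ "spn n"]) auto
  ultimately show ?L using p by (auto simp: is_node_wtree assms)
qed

lemma is_node_pinst: "is_node (wtree bs) e \<Longrightarrow> length bs = n \<Longrightarrow> e \<in> pinsts n"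
  by (auto simp: is_node_wtree spn_pinst pos_pinst)

definition coded :: "nat \<Rightarrow> pinst \<Rightarrow> nat set" where
  "coded n e = {p. 0 < p \<and> p < n \<and> \<not> (\<exists>w\<in>pinsts n. subsumed n e w \<and> subsumed n (pos p) w)}"

text \<open>The leaf at \<open>p\<close> is the only one with \<open>False\<close> at feature
  \<open>p\<close>: deeper ones have \<open>True\<close> there and the others nothing. So a
  \<open>True\<close> at \<open>p\<close> conflicts with that leaf alone.\<close>

definition code :: "nat set \<Rightarrow> pinst" where
  "code X = (\<lambda>i. if i \<in> X then Some True else None)"

lemma code_pinst: "X \<subseteq> {1..<n} \<Longrightarrow> code X \<in> pinsts n"
  by (auto simp: code_def pinsts_def split: if_splits)

lemma coded_code:
  assumes "X \<subseteq> {1..<n}"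
  shows "coded n (code X) = X"
proof -
  define E where "E = (\<lambda>p. \<exists>w\<in>pinsts n. subsumed n (code X) w \<and> subsumed n (pos p) w)"
  have "E p \<longleftrightarrow> p \<notin> X" if p: "0 < p" "p < n" for p
  proof
    assume "E p"
    then obtain w where w: "subsumed n (code X) w" "subsumed n (pos p) w" unfolding E_def by blast
    have "p \<in> {1..n}" using p by simp
    with w have "pos p p \<noteq> None \<longrightarrow> w p = pos p p" "code X p \<noteq> None \<longrightarrow> w p = code X p"
      unfolding subsumed_def by metis+
    then show "p \<notin> X" by (auto simp: pos_apply code_def)
  next
    assume n: "p \<notin> X"
    \<comment> \<open>Where both are defined they agree: \<open>code X\<close> has only
      \<open>True\<close>, and the single \<open>False\<close> of \<open>pos p\<close> lies outside
      \<open>X\<close>.\<close>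
    let ?w = "pos p ++ code X"
    have "?w \<in> pinsts n" using code_pinst[OF assms] pos_pinst[of p n] p by (auto simp: pinsts_def)
    moreover have "subsumed n (code X) ?w" by (auto simp: subsumed_def code_def map_add_def)
    moreover have "subsumed n (pos p) ?w" using n by (auto simp: subsumed_def code_def map_add_def pos_apply)
    ultimately show "E p" unfolding E_def by blast
  qed
  moreover have "coded n (code X) = {p. 0 < p \<and> p < n \<and> \<not> E p}" by (simp add: coded_def E_def)
  ultimately show ?thesis using assms by auto
qed

section \<open>Formulas about words\<close>

text \<open>Allocation of variables: 0 and 1 are the free ones, 2 to 5 are local to the arithmetical
  formulas, 6 to 16 range over positions, and those from 20 on are the sets of facts.\<close>

definition memF :: "nat \<Rightarrow> nat \<Rightarrow> fm" where
  "memF y p = Neg (Ex 2 (Conj (Subs y 2) (Subs p 2)))"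

definition posF :: "nat \<Rightarrow> fm" where
  "posF p = Conj (All 2 (Impl (NodeAt 2) (Impl (Subs p 2) (Subs 2 p))))
     (Ex 2 (Conj (NodeAt 2) (Neg (LevelLe 2 p))))"

definition exP :: "nat \<Rightarrow> fm \<Rightarrow> fm" where
  "exP p \<phi> = Ex p (Conj (NodeAt p) (Conj (posF p) \<phi>))"

definition allP :: "nat \<Rightarrow> fm \<Rightarrow> fm" where
  "allP p \<phi> = All p (Impl (NodeAt p) (Impl (posF p) \<phi>))"

definition ltF :: "nat \<Rightarrow> nat \<Rightarrow> fm" where
  "ltF p q = Neg (LevelLe q p)"

definition eqF :: "nat \<Rightarrow> nat \<Rightarrow> fm" where
  "eqF p q = Conj (LevelLe p q) (LevelLe q p)"

text \<open>\<open>c\<close> is the least upper bound of two disjoint instances of the sizes of \<open>a\<close> and \<open>b\<close>.\<close>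

definition plusF :: "nat \<Rightarrow> nat \<Rightarrow> nat \<Rightarrow> fm" where
  "plusF a b c = Ex 2 (Ex 3 (Conj (Conj (Subs 2 c) (Subs 3 c))
     (Conj (All 4 (Impl (Conj (Subs 4 2) (Subs 4 3)) (All 5 (Subs 4 5))))
     (Conj (All 4 (Impl (Conj (Subs 2 4) (Subs 3 4)) (Subs c 4)))
     (Conj (eqF 2 a) (eqF 3 b))))))"

definition bitF :: "nat \<Rightarrow> fm" where
  "bitF p = Ex 2 (Conj (PosLeafAt 2) (Equal 2 p))"

definition andF :: "fm list \<Rightarrow> fm" where
  "andF fs = foldr Conj fs (Equal 0 0)"

lemma dt_andF: "(\<And>f. f \<in> set fs \<Longrightarrow> dt_foil f) \<Longrightarrow> dt_foil (andF fs)"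
  unfolding andF_def by (induction fs) (auto intro: dt_foil.intros)

lemma dt_memF: "dt_foil (memF y p)"
  by (rule dt_foil.base) (simp add: memF_def)

lemma dt_posF: "dt_foil (posF p)"
  unfolding posF_def by (intro dt_foil.intros) auto

lemma dt_exP: "dt_foil \<phi> \<Longrightarrow> dt_foil (exP p \<phi>)"
  unfolding exP_def by (intro dt_foil.ex_node dt_foil.conj dt_posF)

lemma dt_allP: "dt_foil \<phi> \<Longrightarrow> dt_foil (allP p \<phi>)"
  unfolding allP_def by (intro dt_foil.all_node dt_foil.impl dt_posF)

lemma dt_ltF: "dt_foil (ltF p q)"
  by (rule dt_foil.base) (simp add: ltF_def)

lemma dt_eqF: "dt_foil (eqF p q)"
  by (rule dt_foil.base) (simp add: eqF_def)

text \<open>The quantifiers of \<open>plusF\<close> run over all partial instances, not over nodes.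
  They are admissible in a \<open>dt_foil\<close> body because the formula mentions subsumption and
  levels only.\<close>

lemma dt_plusF: "dt_foil (plusF a b c)"
  by (rule dt_foil.base) (simp add: plusF_def eqF_def)

lemma dt_bitF: "dt_foil (bitF p)"
  unfolding bitF_def by (intro dt_foil.ex_posleaf dt_foil.base) simp

lemmas dt_intros = dt_andF dt_memF dt_exP dt_allP dt_ltF dt_eqF dt_plusF dt_bitF
  dt_foil.neg dt_foil.conj dt_foil.disj dt_foil.impl

lemma sat_andF [simp]: "sat n T v (andF fs) \<longleftrightarrow> (\<forall>f\<in>set fs. sat n T v f)"
  unfolding andF_def by (induction fs) auto

lemma sat_allP:
  assumes "length bs = n" "p \<noteq> 2"
  shows "sat n (wtree bs) v (allP p \<phi>) \<longleftrightarrow>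
    (\<forall>i. 0 < i \<and> i < n \<longrightarrow> sat n (wtree bs) (v(p := pos i)) \<phi>)"
proof -
  have "e \<in> pinsts n \<and> is_node (wtree bs) e \<and> sat n (wtree bs) (v(p := e)) (posF p) \<longleftrightarrow>
      (\<exists>i. 0 < i \<and> i < n \<and> e = pos i)" for e
  proof -
    have "e \<in> pinsts n \<and> is_node (wtree bs) e \<and> sat n (wtree bs) (v(p := e)) (posF p) \<longleftrightarrow>
      is_node (wtree bs) e \<and> (\<forall>q. is_node (wtree bs) q \<longrightarrow> e \<subseteq>\<^sub>m q \<longrightarrow> q \<subseteq>\<^sub>m e) \<and>
      (\<exists>q. is_node (wtree bs) q \<and> card (dom e) < card (dom q))"
      using assms is_node_pinst[of bs _ n]
      by (auto simp: posF_def subsumed_map_le level_le_card not_le)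
    then show ?thesis unfolding pos_iff[OF assms(1)] .
  qed
  then have *: "e \<in> pinsts n \<and> is_node (wtree bs) e \<and> sat n (wtree bs) (v(p := e)) (posF p) \<longleftrightarrow>
      (\<exists>i. 0 < i \<and> i < n \<and> e = pos i)" for e .
  have "sat n (wtree bs) v (allP p \<phi>) \<longleftrightarrow> (\<forall>e. e \<in> pinsts n \<and> is_node (wtree bs) e \<and>
      sat n (wtree bs) (v(p := e)) (posF p) \<longrightarrow> sat n (wtree bs) (v(p := e)) \<phi>)"
    unfolding allP_def by auto
  then show ?thesis unfolding * by blast
qed

lemma sat_exP:
  assumes "length bs = n" "p \<noteq> 2"
  shows "sat n (wtree bs) v (exP p \<phi>) \<longleftrightarrow>
    (\<exists>i. (0 < i \<and> i < n) \<and> sat n (wtree bs) (v(p := pos i)) \<phi>)"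
proof -
  have "sat n (wtree bs) v (exP p \<phi>) \<longleftrightarrow> \<not> sat n (wtree bs) v (allP p (Neg \<phi>))"
    by (auto simp: exP_def allP_def)
  then show ?thesis unfolding sat_allP[OF assms] by auto
qed

lemma sat_memF:
  "v p = pos i \<Longrightarrow> 0 < i \<Longrightarrow> i < n \<Longrightarrow> p \<noteq> 2 \<Longrightarrow> y \<noteq> 2 \<Longrightarrow> sat n T v (memF y p) \<longleftrightarrow> i \<in> coded n (v y)"
  by (auto simp: memF_def coded_def)

lemma sat_ltF:
  "v p = pos i \<Longrightarrow> v q = pos j \<Longrightarrow> 0 < i \<Longrightarrow> i < n \<Longrightarrow> 0 < j \<Longrightarrow> j < n \<Longrightarrow> sat n T v (ltF p q) \<longleftrightarrow> i < j"
  using pos_pinst[of i n] pos_pinst[of j n] by (simp add: ltF_def level_le_card not_le)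

lemma sat_bitF:
  "v p = pos i \<Longrightarrow> 0 < i \<Longrightarrow> i < n \<Longrightarrow> p \<noteq> 2 \<Longrightarrow> length bs = n \<Longrightarrow>
    sat n (wtree bs) v (bitF p) \<longleftrightarrow> bs ! (i - 1)"
  using pos_pinst[of i n] by (auto simp: bitF_def is_posleaf_wtree pos_inj)

text \<open>The domains of \<open>u\<close> and \<open>w\<close> partition that of \<open>c\<close>.
  Disjointness says that a common lower bound lies below everything, hence is empty; covering says
  that \<open>c\<close> lies below every common upper bound, in particular below
  \<open>u ++ w\<close>.\<close>

lemma plus_iff:
  assumes abc: "a \<in> pinsts n" "b \<in> pinsts n" "c \<in> pinsts n"
  shows "(\<exists>u\<in>pinsts n. \<exists>w\<in>pinsts n. (u \<subseteq>\<^sub>m c \<and> w \<subseteq>\<^sub>m c) \<and>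
     (\<forall>z\<in>pinsts n. z \<subseteq>\<^sub>m u \<and> z \<subseteq>\<^sub>m w \<longrightarrow> (\<forall>r\<in>pinsts n. z \<subseteq>\<^sub>m r)) \<and>
     (\<forall>z\<in>pinsts n. u \<subseteq>\<^sub>m z \<and> w \<subseteq>\<^sub>m z \<longrightarrow> c \<subseteq>\<^sub>m z) \<and>
     card (dom u) = card (dom a) \<and> card (dom w) = card (dom b)) \<longleftrightarrow>
    card (dom a) + card (dom b) = card (dom c)" (is "?L \<longleftrightarrow> ?R")
proof -
  have fin: "finite (dom e)" if "e \<in> pinsts n" for e
    using that finite_subset[of "dom e" "{1..n}"] by (simp add: pinsts_def)
  have 1: ?R if ?L
  proof -
    from that obtain u w where uw: "u \<in> pinsts n" "w \<in> pinsts n" "u \<subseteq>\<^sub>m c" "w \<subseteq>\<^sub>m c"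
      "\<And>z r. z \<in> pinsts n \<Longrightarrow> z \<subseteq>\<^sub>m u \<Longrightarrow> z \<subseteq>\<^sub>m w \<Longrightarrow> r \<in> pinsts n \<Longrightarrow> z \<subseteq>\<^sub>m r"
      "\<And>z. z \<in> pinsts n \<Longrightarrow> u \<subseteq>\<^sub>m z \<Longrightarrow> w \<subseteq>\<^sub>m z \<Longrightarrow> c \<subseteq>\<^sub>m z"
      "card (dom u) = card (dom a)" "card (dom w) = card (dom b)" by blast
    have "dom u \<inter> dom w = {}"
    proof (rule ccontr)
      assume "dom u \<inter> dom w \<noteq> {}"
      then obtain i where i: "i \<in> dom u" "i \<in> dom w" by blast
      let ?z = "c |` {i}"
      have "?z \<in> pinsts n" using abc(3) by (auto simp: pinsts_def)
      moreover have "?z \<subseteq>\<^sub>m u" "?z \<subseteq>\<^sub>m w"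
        using uw(3,4) i by (auto simp: map_le_def restrict_map_def split: if_splits)
      moreover have "Map.empty \<in> pinsts n" by (simp add: pinsts_def)
      ultimately have "?z \<subseteq>\<^sub>m Map.empty" using uw(5) by blast
      moreover have "i \<in> dom c" using i uw(3) by (metis map_le_def domIff)
      ultimately show False by (auto simp: map_le_def)
    qed
    moreover have "dom c = dom u \<union> dom w"
    proof
      show "dom u \<union> dom w \<subseteq> dom c" using uw(3,4) map_le_implies_dom_le by blast
      have "u ++ w \<in> pinsts n" using uw(1,2) by (auto simp: pinsts_def)
      moreover have "w \<subseteq>\<^sub>m u ++ w" by simp
      moreover have "u \<subseteq>\<^sub>m u ++ w"
        unfolding map_le_def
      proof
        fix i assume "i \<in> dom u"
        then have "i \<notin> dom w" using \<open>dom u \<inter> dom w = {}\<close> by blast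
        then show "u i = (u ++ w) i" by (simp add: map_add_dom_app_simps)
      qed
      ultimately have "c \<subseteq>\<^sub>m u ++ w" using uw(6) by blast
      then show "dom c \<subseteq> dom u \<union> dom w" using map_le_implies_dom_le[of c "u ++ w"] by auto
    qed
    ultimately show ?R using uw(7,8) fin[OF uw(1)] fin[OF uw(2)] by (simp add: card_Un_disjoint)
  qed
  have 2: ?L if ?R
  proof -
    from that obtain A where A: "A \<subseteq> dom c" "card A = card (dom a)"
      using obtain_subset_with_card_n[of "card (dom a)" "dom c"] by (metis le_add1)
    let ?u = "c |` A" and ?w = "c |` (- A)"
    have du: "dom ?u = A" "dom ?w = dom c - A" using A by auto
    have p: "?u \<in> pinsts n" "?w \<in> pinsts n" using abc(3) by (auto simp: pinsts_def)
    have le: "?u \<subseteq>\<^sub>m c" "?w \<subseteq>\<^sub>m c" by (auto simp: map_le_def)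
    have inf: "z \<subseteq>\<^sub>m r" if "z \<subseteq>\<^sub>m ?u \<and> z \<subseteq>\<^sub>m ?w" for z r
    proof -
      have "dom z \<subseteq> dom ?u" "dom z \<subseteq> dom ?w" using that map_le_implies_dom_le by blast+
      then have "dom z \<subseteq> A \<inter> (dom c - A)" unfolding du by blast
      then show ?thesis by (auto simp: map_le_def)
    qed
    have sup: "c \<subseteq>\<^sub>m z" if "?u \<subseteq>\<^sub>m z \<and> ?w \<subseteq>\<^sub>m z" for z
      unfolding map_le_def
    proof
      fix i assume "i \<in> dom c"
      then show "c i = z i" using that by (cases "i \<in> A") (force simp: map_le_def)+
    qed
    have cu: "card (dom ?u) = card (dom a)" using A du by simp
    have cw: "card (dom ?w) = card (dom b)"
      using that A du fin[OF abc(3)] card_Diff_subset[of A "dom c"] finite_subset[of A "dom c"] by simp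
    show ?L
    proof (rule bexI[OF _ p(1)], rule bexI[OF _ p(2)], intro conjI)
      show "\<forall>z\<in>pinsts n. z \<subseteq>\<^sub>m ?u \<and> z \<subseteq>\<^sub>m ?w \<longrightarrow> (\<forall>r\<in>pinsts n. z \<subseteq>\<^sub>m r)" by (intro ballI impI inf)
      show "\<forall>z\<in>pinsts n. ?u \<subseteq>\<^sub>m z \<and> ?w \<subseteq>\<^sub>m z \<longrightarrow> c \<subseteq>\<^sub>m z" by (intro ballI impI sup)
    qed (fact le cu cw)+
  qed
  from 1 2 show ?thesis by (rule iffI)
qed

lemma sat_plusF:
  assumes "v a = pos i" "v b = pos j" "v c = pos k" "0 < i" "i < n" "0 < j" "j < n" "0 < k" "k < n"
    "5 < a" "5 < b" "5 < c"
  shows "sat n T v (plusF a b c) \<longleftrightarrow> i + j = k"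
proof -
  have p: "pos i \<in> pinsts n" "pos j \<in> pinsts n" "pos k \<in> pinsts n" using assms pos_pinst by auto
  have n: "a \<noteq> 2" "a \<noteq> 3" "b \<noteq> 2" "b \<noteq> 3" "c \<noteq> 2" "c \<noteq> 3" "c \<noteq> 4" using assms by auto
  have le: "x \<le> y \<and> y \<le> x \<longleftrightarrow> x = y" for x y :: nat by auto
  show ?thesis using plus_iff[OF p]
    unfolding plusF_def eqF_def sat.simps
    using n assms(1-4,6,8) p by (simp add: subsumed_map_le level_le_card le cong: bex_cong_simp ball_cong_simp)
qed

lemma sat_cong: "(\<And>x. x \<in> fv \<phi> \<Longrightarrow> v x = v' x) \<Longrightarrow> sat n T v \<phi> = sat n T v' \<phi>"
proof (induction \<phi> arbitrary: v v')
  case (Ex x \<phi>)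
  have "sat n T (v(x := e)) \<phi> = sat n T (v'(x := e)) \<phi>" for e
    by (rule Ex.IH) (use Ex.prems in auto)
  then show ?case by simp
next
  case (All x \<phi>)
  have "sat n T (v(x := e)) \<phi> = sat n T (v'(x := e)) \<phi>" for e
    by (rule All.IH) (use All.prems in auto)
  then show ?case by simp
next
  case (Conj \<phi> \<psi>)
  have "sat n T v \<phi> = sat n T v' \<phi>" "sat n T v \<psi> = sat n T v' \<psi>"
    using Conj.prems by (intro Conj.IH; simp)+
  then show ?case by simp
next
  case (Disj \<phi> \<psi>)
  have "sat n T v \<phi> = sat n T v' \<phi>" "sat n T v \<psi> = sat n T v' \<psi>"
    using Disj.prems by (intro Disj.IH; simp)+
  then show ?case by simp
next
  case (Impl \<phi> \<psi>)
  have "sat n T v \<phi> = sat n T v' \<phi>" "sat n T v \<psi> = sat n T v' \<psi>"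
    using Impl.prems by (intro Impl.IH; simp)+
  then show ?case by simp
next
  case (Neg \<phi>)
  have "sat n T v \<phi> = sat n T v' \<phi>"
    using Neg.prems by (intro Neg.IH; simp)
  then show ?case by simp
qed auto

lemma sat_All_block: "sat n T v (foldr All xs \<phi>) \<longleftrightarrow>
   (\<forall>v'. (\<forall>x\<in>set xs. v' x \<in> pinsts n) \<and> (\<forall>x. x \<notin> set xs \<longrightarrow> v' x = v x) \<longrightarrow> sat n T v' \<phi>)"
proof (induction xs arbitrary: v)
  case Nil
  have "v' = v" if "\<forall>x. v' x = v x" for v' using that by auto
  then show ?case by auto
next
  case (Cons x xs)
  show ?case (is "?L \<longleftrightarrow> ?R")
  proof
    assume L: ?L
    show ?R
    proof (intro allI impI)
      fix v' assume v': "(\<forall>y\<in>set (x # xs). v' y \<in> pinsts n) \<and> (\<forall>y. y \<notin> set (x # xs) \<longrightarrow> v' y = v y)"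
      then have "sat n T (v(x := v' x)) (foldr All xs \<phi>)" using L by simp
      then show "sat n T v' \<phi>" unfolding Cons.IH using v' by auto
    qed
  next
    assume R: ?R
    have "sat n T (v(x := e)) (foldr All xs \<phi>)" if e: "e \<in> pinsts n" for e
      unfolding Cons.IH
    proof (intro allI impI)
      fix v' assume v': "(\<forall>y\<in>set xs. v' y \<in> pinsts n) \<and> (\<forall>y. y \<notin> set xs \<longrightarrow> v' y = (v(x := e)) y)"
      have "v' x \<in> pinsts n" using v' e by (cases "x \<in> set xs") auto
      moreover have "\<forall>y. y \<notin> set (x # xs) \<longrightarrow> v' y = v y" using v' by simp
      ultimately show "sat n T v' \<phi>" using R v' by auto
    qed
    then show ?L by simp
  qed
qed

lemma finite_fv: "finite (fv \<phi>)"
  by (induction \<phi>) auto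

lemma fv_All_block: "fv (foldr All xs \<phi>) = fv \<phi> - set xs"
  by (induction xs) auto

section \<open>The tableau formula\<close>

text \<open>Facts about a computation are coded by sets of positions. With a row width \<open>W\<close>, row \<open>t\<close> of the
  tableau starts at position \<open>\<tau> = (t + 1) * W\<close>. The facts \<open>FM\<close> (row start), \<open>FQ q\<close> (state),
  \<open>FR j s\<close> (symbol \<open>s\<close> is read on tape \<open>j\<close>) and \<open>FA j s d\<close> (action on tape \<open>j\<close>) are placed at \<open>\<tau>\<close>;
  \<open>FH j\<close> (head) and \<open>FC j s\<close> (content) are placed at \<open>\<tau> + c\<close> with \<open>0 < c < W\<close>. The sets \<open>FVB\<close> and
  \<open>FVP\<close> hold the bits of the universally quantified word and the cells that it occupies.\<close>

instance move :: countable
  by countable_datatype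

datatype fact = FM | FVB | FVP | FQ nat | FR nat nat | FA nat nat move | FH nat | FC nat nat

instance fact :: countable
  by countable_datatype

definition fvar :: "fact \<Rightarrow> nat" where
  "fvar f = 20 + to_nat f"

lemma fvar_inj: "fvar f = fvar f' \<longleftrightarrow> f = f'"
  by (simp add: fvar_def)

lemma fvar_neq [simp]: "fvar f \<noteq> numeral w \<longleftrightarrow> 20 + to_nat f \<noteq> numeral w"
  "fvar f \<noteq> 0" "fvar f \<noteq> Suc 0"
  by (auto simp: fvar_def)

definition factF :: "fact \<Rightarrow> nat \<Rightarrow> fm" where
  "factF f p = memF (fvar f) p"

definition iteF :: "fm \<Rightarrow> fm \<Rightarrow> fm \<Rightarrow> fm" where
  "iteF a b c = Conj (Impl a b) (Impl (Neg a) c)"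

definition succF :: "nat \<Rightarrow> nat \<Rightarrow> fm" where
  "succF p q = Conj (ltF p q) (allP 16 (Neg (Conj (ltF p 16) (ltF 16 q))))"

text \<open>The words \<open>u\<close> and \<open>v\<close> have varying lengths, so each needs two
  sets: its bits and the cells it occupies. Gaps are harmless, because the machine stops at the
  first blank.\<close>

definition cellF :: "nat \<Rightarrow> nat \<Rightarrow> nat \<Rightarrow> fm" where
  "cellF j c p =
     (if j = 0 then iteF (bitF c) (factF (FC 0 2) p) (factF (FC 0 1) p)
      else if j = 1 then iteF (memF 1 c) (iteF (memF 0 c) (factF (FC 1 2) p) (factF (FC 1 1) p)) (factF (FC 1 0) p)
      else if j = 2 then iteF (factF FVP c) (iteF (factF FVB c) (factF (FC 2 2) p) (factF (FC 2 1) p)) (factF (FC 2 0) p)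
      else factF (FC j 0) p)"

text \<open>Variable 6 holds \<open>a\<close> and variable 7 the width \<open>W\<close>. Cell
  \<open>c\<close> of a row stands for tape cell \<open>c - a\<close>, so heads start at
  \<open>a\<close> and the cells below it are blank. On tape 0, cell \<open>c\<close> receives the
  letter at position \<open>c\<close> of the stored word, so the machine sees that word from
  position \<open>a\<close> on.\<close>

definition initF :: "otm \<Rightarrow> fm" where
  "initF M = andF [factF FM 7, factF (FQ (q_start M)) 7,
     allP 11 (Impl (plusF 7 6 11) (andF (map (\<lambda>j. factF (FH j) 11) [0..<n_tapes M]))),
     allP 10 (Impl (ltF 10 7) (allP 11 (Impl (plusF 7 10 11)
       (andF (map (\<lambda>j. iteF (ltF 10 6) (factF (FC j 0) 11) (cellF j 10 11)) [0..<n_tapes M])))))]"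

definition readF :: "otm \<Rightarrow> fm" where
  "readF M = allP 10 (Impl (ltF 10 7) (allP 11 (Impl (plusF 8 10 11)
     (andF (map (\<lambda>(j, x). Impl (Conj (factF (FH j) 11) (factF (FC j x) 11)) (factF (FR j x) 8))
       (List.product [0..<n_tapes M] [0..<n_syms M]))))))"

definition transF :: "otm \<Rightarrow> fm" where
  "transF M = andF (map (\<lambda>(q, ss). Impl
       (Conj (factF (FQ q) 8) (andF (map (\<lambda>j. factF (FR j (ss ! j)) 8) [0..<n_tapes M])))
       (Conj (factF (FQ (fst (tr M q ss))) 9)
          (andF (map (\<lambda>j. factF (FA j (fst (snd (tr M q ss) ! j)) (snd (snd (tr M q ss) ! j))) 8)
             [0..<n_tapes M]))))
     (List.product [0..<n_states M] (List.n_lists (n_tapes M) [0..<n_syms M])))"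

fun moveF :: "nat \<Rightarrow> move \<Rightarrow> fm" where
  "moveF j Stay = factF (FH j) 12"
| "moveF j GoRight = allP 15 (Impl (succF 12 15) (factF (FH j) 15))"
| "moveF j GoLeft = allP 15 (Impl (succF 15 12) (factF (FH j) 15))"

text \<open>A symbol is copied if the head is known to be at some other cell. Saying that the head
  is not at this cell would negate a fact, and the clause would no longer be Horn.\<close>

definition writeF :: "otm \<Rightarrow> fm" where
  "writeF M = allP 10 (Impl (ltF 10 7) (allP 11 (Impl (plusF 8 10 11) (allP 12 (Impl (plusF 9 10 12)
     (andF (map (\<lambda>j. Conj
        (andF (map (\<lambda>(x, d). Impl (Conj (factF (FA j x d) 8) (factF (FH j) 11))
             (Conj (factF (FC j x) 12) (moveF j d))) (List.product [0..<n_syms M] [GoLeft, Stay, GoRight])))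
        (allP 13 (Impl (Conj (ltF 13 7) (Neg (eqF 13 10))) (allP 14 (Impl (plusF 8 13 14)
             (andF (map (\<lambda>x. Impl (Conj (factF (FH j) 14) (factF (FC j x) 11)) (factF (FC j x) 12)) [0..<n_syms M])))))))
        [0..<n_tapes M])))))))"

text \<open>Row starts are derived facts themselves, passed on from \<open>t\<close> to
  \<open>t + W\<close>; multiples of \<open>W\<close> thus need addition only.\<close>

definition stepF :: "otm \<Rightarrow> fm" where
  "stepF M = allP 8 (Impl (factF FM 8) (allP 9 (Impl (plusF 8 7 9)
     (andF [factF FM 9, readF M, transF M, writeF M]))))"

text \<open>The first 1 of the stored word supplies \<open>a\<close>. In this way a fixed formula
  learns the time bound, which varies with the input.\<close>

definition closeF :: "otm \<Rightarrow> fm" where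
  "closeF M = allP 6 (Impl (Conj (bitF 6) (allP 11 (Impl (bitF 11) (Neg (ltF 11 6)))))
     (allP 7 (Impl (plusF 6 6 7) (Conj (initF M) (stepF M)))))"

definition acceptF :: "otm \<Rightarrow> nat \<Rightarrow> fm" where
  "acceptF M r = exP 8 (Conj (factF (FQ (q_halt M)) 8) (factF (FR r 2) 8))"

text \<open>The two trivial equalities guarantee that 0 and 1 are free variables whatever
  \<open>M\<close> is.\<close>

definition bodyF :: "otm \<Rightarrow> nat \<Rightarrow> fm" where
  "bodyF M r = Conj (Conj (Equal 0 0) (Equal 1 1)) (Impl (closeF M) (acceptF M r))"

definition tabF :: "otm \<Rightarrow> nat \<Rightarrow> fm" where
  "tabF M r = foldr All (sorted_list_of_set (fv (bodyF M r) - {0, 1})) (bodyF M r)"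

lemma dt_factF: "dt_foil (factF f p)"
  by (simp add: factF_def dt_memF)

lemma dt_iteF: "dt_foil a \<Longrightarrow> dt_foil b \<Longrightarrow> dt_foil c \<Longrightarrow> dt_foil (iteF a b c)"
  unfolding iteF_def by (intro dt_intros)

lemma dt_succF: "dt_foil (succF p q)"
  unfolding succF_def by (intro dt_intros)

lemma dt_cellF: "dt_foil (cellF j c p)"
  unfolding cellF_def by (auto intro!: dt_iteF dt_factF dt_intros)

lemma dt_moveF: "dt_foil (moveF j d)"
  by (cases d) (auto intro!: dt_factF dt_intros dt_succF)

lemma dt_andF_map: "(\<And>x. x \<in> set xs \<Longrightarrow> dt_foil (f x)) \<Longrightarrow> dt_foil (andF (map f xs))"
  by (rule dt_andF) auto

lemma dt_andF_Cons: "dt_foil f \<Longrightarrow> dt_foil (andF fs) \<Longrightarrow> dt_foil (andF (f # fs))"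
  by (simp add: andF_def dt_foil.conj)

lemma dt_andF_Nil: "dt_foil (andF [])"
  by (simp add: andF_def dt_foil.base)

lemma dt_case_prod: "(\<And>a b. dt_foil (f a b)) \<Longrightarrow> dt_foil (case x of (a, b) \<Rightarrow> f a b)"
  by (cases x) simp

lemmas dt_more = dt_andF_map dt_andF_Cons dt_andF_Nil dt_case_prod dt_factF dt_iteF dt_cellF dt_moveF
  dt_memF dt_exP dt_allP dt_ltF dt_eqF dt_plusF dt_bitF dt_foil.neg dt_foil.conj dt_foil.impl

lemma dt_bodyF: "dt_foil (bodyF M r)"
proof -
  have "dt_foil (initF M)" unfolding initF_def by (intro dt_more)
  moreover have "dt_foil (readF M)" unfolding readF_def by (intro dt_more)
  moreover have "dt_foil (transF M)" unfolding transF_def by (intro dt_more)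
  moreover have "dt_foil (writeF M)" unfolding writeF_def by (intro dt_more)
  ultimately have "dt_foil (closeF M)" unfolding closeF_def stepF_def
    by (intro dt_more)
  moreover have "dt_foil (acceptF M r)" unfolding acceptF_def by (intro dt_more)
  moreover have "dt_foil (Equal x x)" for x by (rule dt_foil.base) simp
  ultimately show ?thesis unfolding bodyF_def by (intro dt_more)
qed

lemma q_dt_foil_tabF: "q_dt_foil (tabF M r)"
  unfolding tabF_def by (rule q_dt_foil.all_block[OF dt_bodyF])

lemma fv_tabF: "fv (tabF M r) = {..<2}"
proof -
  have "fv (tabF M r) = fv (bodyF M r) - (fv (bodyF M r) - {0, 1})"
    unfolding tabF_def fv_All_block using finite_fv by simp
  moreover have "{0, 1} \<subseteq> fv (bodyF M r)" by (simp add: bodyF_def)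
  moreover have "{..<2} = {0, 1 :: nat}" by auto
  then have "A - (A - {0, 1}) = {..<2}" if "{0, 1} \<subseteq> A" for A :: "nat set"
    using that by blast
  ultimately show ?thesis by simp
qed

section \<open>The tableau formula as a statement about sets of positions\<close>

definition is_pos :: "nat \<Rightarrow> pinst \<Rightarrow> bool" where
  "is_pos n e \<longleftrightarrow> (\<exists>i. 0 < i \<and> i < n \<and> e = pos i)"

definition idx :: "pinst \<Rightarrow> nat" where
  "idx e = card (dom e)"

lemma idx_pos [simp]: "0 < i \<Longrightarrow> idx (pos i) = i"
  by (simp add: idx_def)

lemma is_pos_pos [simp]: "0 < i \<Longrightarrow> i < n \<Longrightarrow> is_pos n (pos i)"
  by (auto simp: is_pos_def)

lemma s_memF: "is_pos n (v p) \<Longrightarrow> p \<noteq> 2 \<Longrightarrow> y \<noteq> 2 \<Longrightarrow> sat n T v (memF y p) \<longleftrightarrow> idx (v p) \<in> coded n (v y)"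
  by (auto simp: is_pos_def sat_memF)

lemma s_ltF: "is_pos n (v p) \<Longrightarrow> is_pos n (v q) \<Longrightarrow> sat n T v (ltF p q) \<longleftrightarrow> idx (v p) < idx (v q)"
  by (auto simp: is_pos_def sat_ltF)

lemma s_eqF: "is_pos n (v p) \<Longrightarrow> is_pos n (v q) \<Longrightarrow> sat n T v (eqF p q) \<longleftrightarrow> idx (v p) = idx (v q)"
  using s_ltF[of n v p q T] s_ltF[of n v q p T] by (auto simp: eqF_def ltF_def)

lemma s_bitF: "is_pos n (v p) \<Longrightarrow> p \<noteq> 2 \<Longrightarrow> length bs = n \<Longrightarrow>
   sat n (wtree bs) v (bitF p) \<longleftrightarrow> bs ! (idx (v p) - 1)"
  by (auto simp: is_pos_def sat_bitF)

lemma s_plusF: "is_pos n (v a) \<Longrightarrow> is_pos n (v b) \<Longrightarrow> is_pos n (v c) \<Longrightarrow> 5 < a \<Longrightarrow> 5 < b \<Longrightarrow> 5 < c \<Longrightarrow>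
   sat n T v (plusF a b c) \<longleftrightarrow> idx (v a) + idx (v b) = idx (v c)"
  by (auto simp: is_pos_def sat_plusF)

lemma s_succF: "is_pos n (v p) \<Longrightarrow> is_pos n (v q) \<Longrightarrow> p \<noteq> 16 \<Longrightarrow> q \<noteq> 16 \<Longrightarrow> length bs = n \<Longrightarrow>
   sat n (wtree bs) v (succF p q) \<longleftrightarrow> idx (v q) = Suc (idx (v p))"
proof -
  assume a: "is_pos n (v p)" "is_pos n (v q)" "p \<noteq> 16" "q \<noteq> 16" "length bs = n"
  then obtain i j where ij: "0 < i" "i < n" "v p = pos i" "0 < j" "j < n" "v q = pos j"
    by (auto simp: is_pos_def)
  have "sat n (wtree bs) v (succF p q) \<longleftrightarrow> i < j \<and> (\<forall>m. 0 < m \<and> m < n \<longrightarrow> \<not> (i < m \<and> m < j))"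
    unfolding succF_def using a ij by (simp add: sat_allP s_ltF)
  also have "\<dots> \<longleftrightarrow> j = Suc i"
  proof
    assume l: "i < j \<and> (\<forall>m. 0 < m \<and> m < n \<longrightarrow> \<not> (i < m \<and> m < j))"
    then have "\<not> Suc i < j" using ij by (auto dest: spec[of _ "Suc i"])
    then show "j = Suc i" using l by simp
  qed auto
  finally show ?thesis using ij by simp
qed

definition inp :: "bool list \<Rightarrow> nat set \<Rightarrow> nat set \<Rightarrow> nat set \<Rightarrow> nat set \<Rightarrow> nat \<Rightarrow> nat \<Rightarrow> nat" where
  "inp bs XB XP VB VP j c =
     (if j = 0 then (if bs ! (c - 1) then 2 else 1)
      else if j = 1 then (if c \<in> XP then if c \<in> XB then 2 else 1 else 0)
      else if j = 2 then (if c \<in> VP then if c \<in> VB then 2 else 1 else 0)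
      else 0)"

text \<open>The predicates starting with \<open>tab_\<close> keep the nesting of the quantifiers in
  the formulas, including the equations that introduce sums, so that the simplifier alone proves the
  equivalences.\<close>

definition tab_init :: "otm \<Rightarrow> nat \<Rightarrow> (nat \<Rightarrow> nat \<Rightarrow> nat) \<Rightarrow> nat \<Rightarrow> nat \<Rightarrow> (fact \<Rightarrow> nat set) \<Rightarrow> bool" where
  "tab_init M n I a W D \<longleftrightarrow> W \<in> D FM \<and> W \<in> D (FQ (q_start M)) \<and>
     (\<forall>p. 0 < p \<and> p < n \<longrightarrow> W + a = p \<longrightarrow> (\<forall>j\<in>{0..<n_tapes M}. p \<in> D (FH j))) \<and>
     (\<forall>c. 0 < c \<and> c < n \<longrightarrow> c < W \<longrightarrow> (\<forall>p. 0 < p \<and> p < n \<longrightarrow> W + c = p \<longrightarrow>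
       (\<forall>j\<in>{0..<n_tapes M}. p \<in> D (FC j (if c < a then 0 else I j c)))))"

definition tab_read :: "otm \<Rightarrow> nat \<Rightarrow> nat \<Rightarrow> (fact \<Rightarrow> nat set) \<Rightarrow> nat \<Rightarrow> bool" where
  "tab_read M n W D t \<longleftrightarrow> (\<forall>c. 0 < c \<and> c < n \<longrightarrow> c < W \<longrightarrow> (\<forall>p. 0 < p \<and> p < n \<longrightarrow> t + c = p \<longrightarrow>
     (\<forall>j\<in>{0..<n_tapes M}. \<forall>x\<in>{0..<n_syms M}. p \<in> D (FH j) \<and> p \<in> D (FC j x) \<longrightarrow> t \<in> D (FR j x))))"

definition tab_trans :: "otm \<Rightarrow> (fact \<Rightarrow> nat set) \<Rightarrow> nat \<Rightarrow> nat \<Rightarrow> bool" where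
  "tab_trans M D t t' \<longleftrightarrow> (\<forall>q\<in>{0..<n_states M}. \<forall>ss. length ss = n_tapes M \<and> set ss \<subseteq> {0..<n_syms M} \<longrightarrow>
     t \<in> D (FQ q) \<and> (\<forall>j\<in>{0..<n_tapes M}. t \<in> D (FR j (ss ! j))) \<longrightarrow>
     t' \<in> D (FQ (fst (tr M q ss))) \<and>
     (\<forall>j\<in>{0..<n_tapes M}. t \<in> D (FA j (fst (snd (tr M q ss) ! j)) (snd (snd (tr M q ss) ! j)))))"

definition tab_move :: "nat \<Rightarrow> (fact \<Rightarrow> nat set) \<Rightarrow> nat \<Rightarrow> nat \<Rightarrow> move \<Rightarrow> bool" where
  "tab_move n D p' j d \<longleftrightarrow> (case d of Stay \<Rightarrow> p' \<in> D (FH j)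
     | GoRight \<Rightarrow> (\<forall>p. 0 < p \<and> p < n \<longrightarrow> p = Suc p' \<longrightarrow> p \<in> D (FH j))
     | GoLeft \<Rightarrow> (\<forall>p. 0 < p \<and> p < n \<longrightarrow> p' = Suc p \<longrightarrow> p \<in> D (FH j)))"

definition tab_write :: "otm \<Rightarrow> nat \<Rightarrow> nat \<Rightarrow> (fact \<Rightarrow> nat set) \<Rightarrow> nat \<Rightarrow> nat \<Rightarrow> bool" where
  "tab_write M n W D t t' \<longleftrightarrow> (\<forall>c. 0 < c \<and> c < n \<longrightarrow> c < W \<longrightarrow> (\<forall>p. 0 < p \<and> p < n \<longrightarrow> t + c = p \<longrightarrow>
     (\<forall>p'. 0 < p' \<and> p' < n \<longrightarrow> t' + c = p' \<longrightarrow> (\<forall>j\<in>{0..<n_tapes M}.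
       (\<forall>x\<in>{0..<n_syms M}. \<forall>d. t \<in> D (FA j x d) \<and> p \<in> D (FH j) \<longrightarrow> p' \<in> D (FC j x) \<and> tab_move n D p' j d) \<and>
       (\<forall>c2. 0 < c2 \<and> c2 < n \<longrightarrow> c2 < W \<and> c2 \<noteq> c \<longrightarrow> (\<forall>p2. 0 < p2 \<and> p2 < n \<longrightarrow> t + c2 = p2 \<longrightarrow>
          (\<forall>x\<in>{0..<n_syms M}. p2 \<in> D (FH j) \<and> p \<in> D (FC j x) \<longrightarrow> p' \<in> D (FC j x))))))))"

definition tab_closed :: "otm \<Rightarrow> nat \<Rightarrow> (nat \<Rightarrow> nat \<Rightarrow> nat) \<Rightarrow> nat \<Rightarrow> nat \<Rightarrow> (fact \<Rightarrow> nat set) \<Rightarrow> bool" where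
  "tab_closed M n I a W D \<longleftrightarrow> tab_init M n I a W D \<and>
     (\<forall>t. 0 < t \<and> t < n \<longrightarrow> t \<in> D FM \<longrightarrow> (\<forall>t'. 0 < t' \<and> t' < n \<longrightarrow> t + W = t' \<longrightarrow>
        t' \<in> D FM \<and> tab_read M n W D t \<and> tab_trans M D t t' \<and> tab_write M n W D t t'))"

definition first_bit :: "bool list \<Rightarrow> nat \<Rightarrow> bool" where
  "first_bit bs a \<longleftrightarrow> bs ! (a - 1) \<and> (\<forall>p. 0 < p \<and> p < length bs \<longrightarrow> bs ! (p - 1) \<longrightarrow> \<not> p < a)"

definition facts_of :: "nat \<Rightarrow> (nat \<Rightarrow> pinst) \<Rightarrow> fact \<Rightarrow> nat set" where
  "facts_of n v f = coded n (v (fvar f))"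

lemma s_factF: "is_pos n (v p) \<Longrightarrow> p \<noteq> 2 \<Longrightarrow> sat n T v (factF f p) \<longleftrightarrow> idx (v p) \<in> facts_of n v f"
  unfolding factF_def facts_of_def by (rule s_memF) auto

lemma facts_of_upd: "x < 20 \<Longrightarrow> facts_of n (v(x := e)) = facts_of n v"
  by (auto simp: facts_of_def fvar_def fun_eq_iff)

lemma s_moveF: "is_pos n (v 12) \<Longrightarrow> length bs = n \<Longrightarrow>
   sat n (wtree bs) v (moveF j d) \<longleftrightarrow> tab_move n (facts_of n v) (idx (v 12)) j d"
  by (cases d) (simp_all add: tab_move_def s_factF sat_allP s_succF facts_of_upd)

lemmas s_rules = sat_allP s_memF s_ltF s_eqF s_bitF s_plusF s_succF s_factF facts_of_upd

lemma s_initF: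
  assumes "length bs = n" "v 6 = pos a" "v 7 = pos W" "0 < a" "a < n" "0 < W" "W < n"
  shows "sat n (wtree bs) v (initF M) \<longleftrightarrow> tab_init M n
     (inp bs (coded n (v 0)) (coded n (v 1)) (facts_of n v FVB) (facts_of n v FVP)) a W (facts_of n v)"
proof -
  have cell: "sat n (wtree bs) u (cellF j 10 11) \<longleftrightarrow> p \<in> facts_of n v (FC j
      (inp bs (coded n (v 0)) (coded n (v 1)) (facts_of n v FVB) (facts_of n v FVP) j c))"
    if "u 10 = pos c" "u 11 = pos p" "0 < c" "c < n" "0 < p" "p < n" "facts_of n u = facts_of n v"
      "u 0 = v 0" "u (Suc 0) = v (Suc 0)" for u j c p
    using that assms by (simp add: cellF_def iteF_def inp_def s_rules)
  show ?thesis unfolding initF_def tab_init_def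
    using assms by (simp add: s_rules cell iteF_def)
qed

lemma s_readF:
  assumes "length bs = n" "v 7 = pos W" "v 8 = pos t" "0 < W" "W < n" "0 < t" "t < n"
  shows "sat n (wtree bs) v (readF M) \<longleftrightarrow> tab_read M n W (facts_of n v) t"
  unfolding readF_def tab_read_def using assms by (simp add: s_rules)

lemma s_transF:
  assumes "length bs = n" "v 9 = pos t'" "v 8 = pos t" "0 < t" "t < n" "0 < t'" "t' < n"
  shows "sat n (wtree bs) v (transF M) \<longleftrightarrow> tab_trans M (facts_of n v) t t'"
  unfolding transF_def tab_trans_def using assms by (simp add: s_rules set_n_lists)

lemma s_writeF:
  assumes "length bs = n" "v 7 = pos W" "v 8 = pos t" "v 9 = pos t'" "0 < W" "W < n" "0 < t" "t < n"
    "0 < t'" "t' < n"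
  shows "sat n (wtree bs) v (writeF M) \<longleftrightarrow> tab_write M n W (facts_of n v) t t'"
proof -
  have all_d: "P GoLeft \<and> P Stay \<and> P GoRight \<longleftrightarrow> (\<forall>d. P d)" for P by (metis move.exhaust)
  show ?thesis unfolding writeF_def tab_write_def all_d[symmetric] using assms
    by (simp add: s_rules s_moveF)
qed

lemma s_closeF:
  assumes "length bs = n"
  shows "sat n (wtree bs) v (closeF M) \<longleftrightarrow> (\<forall>a. 0 < a \<and> a < n \<longrightarrow> first_bit bs a \<longrightarrow>
     (\<forall>W. 0 < W \<and> W < n \<longrightarrow> a + a = W \<longrightarrow> tab_closed M n
     (inp bs (coded n (v 0)) (coded n (v 1)) (facts_of n v FVB) (facts_of n v FVP)) a W (facts_of n v)))"
  unfolding closeF_def stepF_def tab_closed_def first_bit_def using assms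
  by (simp add: s_rules s_initF s_readF s_transF s_writeF)

lemma s_acceptF:
  assumes "length bs = n"
  shows "sat n (wtree bs) v (acceptF M r) \<longleftrightarrow>
    (\<exists>t. (0 < t \<and> t < n) \<and> t \<in> facts_of n v (FQ (q_halt M)) \<and> t \<in> facts_of n v (FR r 2))"
  unfolding acceptF_def using assms by (simp add: sat_exP s_rules cong: conj_cong)

text \<open>Every valuation of the fact variables codes a family of sets, and every family of
  subsets of \<open>{1..<n}\<close> is coded by some valuation, so quantifying over instances
  amounts to quantifying over families. Since the first 1 is unique, closure is required for a
  single \<open>a\<close>.\<close>

lemma sat_tabF:
  assumes "length bs = n" "v 0 \<in> pinsts n" "v 1 \<in> pinsts n"
    "0 < a" "first_bit bs a" "a + a < n"
  shows "sat n (wtree bs) v (tabF M r) \<longleftrightarrow>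
    (\<forall>D. (\<forall>f. D f \<subseteq> {1..<n}) \<longrightarrow>
       tab_closed M n (inp bs (coded n (v 0)) (coded n (v 1)) (D FVB) (D FVP)) a (a + a) D \<longrightarrow>
       (\<exists>t. t \<in> D (FQ (q_halt M)) \<and> t \<in> D (FR r 2)))" (is "?L \<longleftrightarrow> ?R")
proof -
  have uniq: "b = a" if "0 < b" "b < n" "first_bit bs b" for b
  proof (rule linorder_cases)
    assume "b < a"
    then show ?thesis using that assms(1,5) unfolding first_bit_def by blast
  next
    assume "a < b"
    moreover have "a < n" using assms(6) by simp
    ultimately show ?thesis using that assms(1,4,5) unfolding first_bit_def by blast
  qed
  have only: "(\<forall>b. 0 < b \<and> b < n \<longrightarrow> first_bit bs b \<longrightarrow>
     (\<forall>W. 0 < W \<and> W < n \<longrightarrow> b + b = W \<longrightarrow> P b W)) \<longleftrightarrow> P a (a + a)" for P :: "nat \<Rightarrow> nat \<Rightarrow> bool"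
  proof
    assume "\<forall>b. 0 < b \<and> b < n \<longrightarrow> first_bit bs b \<longrightarrow> (\<forall>W. 0 < W \<and> W < n \<longrightarrow> b + b = W \<longrightarrow> P b W)"
    then show "P a (a + a)" using assms(4-6) by simp
  qed (use uniq in blast)
  have body: "sat n (wtree bs) u (bodyF M r) \<longleftrightarrow>
     (tab_closed M n (inp bs (coded n (u 0)) (coded n (u 1)) (facts_of n u FVB) (facts_of n u FVP)) a (a + a) (facts_of n u) \<longrightarrow>
     (\<exists>t. (0 < t \<and> t < n) \<and> t \<in> facts_of n u (FQ (q_halt M)) \<and> t \<in> facts_of n u (FR r 2)))" for u
  proof -
    have "sat n (wtree bs) u (closeF M) \<longleftrightarrow>
      tab_closed M n (inp bs (coded n (u 0)) (coded n (u 1)) (facts_of n u FVB) (facts_of n u FVP)) a (a + a) (facts_of n u)"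
      unfolding s_closeF[OF assms(1)] by (rule only)
    then show ?thesis unfolding bodyF_def sat.simps s_acceptF[OF assms(1)] by blast
  qed
  have sub: "facts_of n u f \<subseteq> {1..<n}" for u f by (auto simp: facts_of_def coded_def)
  let ?ys = "sorted_list_of_set (fv (bodyF M r) - {0, 1})"
  have ys: "set ?ys = fv (bodyF M r) - {0, 1}" using finite_fv by simp
  show ?thesis
  proof
    assume L: ?L
    show ?R
    proof (intro allI impI)
      fix D :: "fact \<Rightarrow> nat set"
      assume D: "\<forall>f. D f \<subseteq> {1..<n}"
        and c: "tab_closed M n (inp bs (coded n (v 0)) (coded n (v 1)) (D FVB) (D FVP)) a (a + a) D"
      define u where "u = (\<lambda>x. if x \<in> range fvar then code (D (inv fvar x)) else v x)"
      have injf: "inj fvar" by (rule injI) (simp add: fvar_inj)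
      have uf: "facts_of n u = D"
        using D by (simp add: fun_eq_iff facts_of_def u_def injf coded_code)
      have nr: "0 \<notin> range fvar" "1 \<notin> range fvar" by (auto simp: fvar_def)
      have u01: "u 0 = v 0" "u 1 = v 1" using nr by (auto simp: u_def)
      \<comment> \<open>The block binds only the variables that occur, so \<open>u\<close> itself is
        not an instance of it. The valuation \<open>w\<close> is, and it agrees on the free
        variables of the body with one that codes all of \<open>D\<close>.\<close>
      define w where "w = (\<lambda>x. if x \<in> set ?ys then (if x \<in> range fvar then u x else Map.empty) else v x)"
      have "\<forall>x\<in>set ?ys. w x \<in> pinsts n"
        using D code_pinst by (auto simp: w_def u_def injf pinsts_def code_def split: if_splits)
      moreover have "\<forall>x. x \<notin> set ?ys \<longrightarrow> w x = v x" by (simp add: w_def)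
      ultimately have "sat n (wtree bs) w (bodyF M r)"
        using L unfolding tabF_def sat_All_block by blast
      moreover have "sat n (wtree bs) w (bodyF M r) = sat n (wtree bs) (\<lambda>x. if x \<in> range fvar \<or> x = 0 \<or> x = 1 then u x else Map.empty) (bodyF M r)"
        by (rule sat_cong) (use ys u01 in \<open>auto simp: w_def\<close>)
      moreover have "facts_of n (\<lambda>x. if x \<in> range fvar \<or> x = 0 \<or> x = 1 then u x else Map.empty) = facts_of n u"
        by (auto simp: facts_of_def)
      ultimately show "\<exists>t. t \<in> D (FQ (q_halt M)) \<and> t \<in> D (FR r 2)"
        using c unfolding body by (auto simp: uf u01[simplified])
    qed
  next
    assume R: ?R
    show ?L unfolding tabF_def sat_All_block
    proof (intro allI impI)
      fix u assume u: "(\<forall>x\<in>set ?ys. u x \<in> pinsts n) \<and> (\<forall>x. x \<notin> set ?ys \<longrightarrow> u x = v x)"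
      then have u01: "u 0 = v 0" "u 1 = v 1" using ys by auto
      show "sat n (wtree bs) u (bodyF M r)"
        unfolding body using R[rule_format, of "facts_of n u"] sub by (auto simp: u01[simplified] facts_of_def coded_def)
    qed
  qed
qed

section \<open>The tableau of a run, seen through closed families\<close>

definition conf :: "otm \<Rightarrow> tape list \<Rightarrow> nat \<Rightarrow> config" where
  "conf M ts t = (step M {} ^^ t) (q_start M, ts)"

definition row_syms :: "otm \<Rightarrow> tape list \<Rightarrow> nat \<Rightarrow> nat list" where
  "row_syms M ts t = map read_sym (snd (conf M ts t))"

definition row_acts :: "otm \<Rightarrow> tape list \<Rightarrow> nat \<Rightarrow> (nat \<times> move) list" where
  "row_acts M ts t = snd (tr M (fst (conf M ts t)) (row_syms M ts t))"

text \<open>The start is not an \<open>init_config\<close>, because tapes 1 and 2 hold the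
  existential and the universal word. By \<open>cells0\<close>, the function \<open>I\<close>
  describes what row 0 shows of the tapes: the cells strictly between \<open>-a\<close> and
  \<open>a\<close>.\<close>

locale tableau_run =
  fixes M :: otm and ts0 :: "tape list" and a :: nat and I :: "nat \<Rightarrow> nat \<Rightarrow> nat"
  assumes wf: "wf_otm M" and wf0: "wf_conf M (q_start M, ts0)"
    and heads0: "\<And>j. j < n_tapes M \<Longrightarrow> fst (ts0 ! j) = 0"
    and a_pos: "0 < a"
    and cells0: "\<And>j c. j < n_tapes M \<Longrightarrow> 0 < c \<Longrightarrow> c < a + a \<Longrightarrow>
      snd (ts0 ! j) (int c - int a) = (if c < a then 0 else I j c)"
begin

abbreviation "W \<equiv> a + a"
abbreviation "Q t \<equiv> fst (conf M ts0 t)"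
abbreviation "X t j \<equiv> snd (conf M ts0 t) ! j"
abbreviation "rsyms t \<equiv> row_syms M ts0 t"
abbreviation "racts t \<equiv> row_acts M ts0 t"

lemma wf_row: "wf_conf M (conf M ts0 t)"
  unfolding conf_def using wf wf0 by (rule wf_conf_steps)

lemma Q_bound: "Q t < n_states M"
  using wf_row[of t] by (simp add: wf_conf_def)

lemma length_row: "length (snd (conf M ts0 t)) = n_tapes M"
  using wf_row[of t] by (simp add: wf_conf_def)

lemma sym_bound: "j < n_tapes M \<Longrightarrow> snd (X t j) i < n_syms M"
  using wf_row[of t] length_row[of t] by (simp add: wf_conf_def)

lemma rsyms: "length (rsyms t) = n_tapes M" "set (rsyms t) \<subseteq> {0..<n_syms M}"
    "j < n_tapes M \<Longrightarrow> rsyms t ! j = snd (X t j) (fst (X t j))"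
proof -
  show "length (rsyms t) = n_tapes M" using length_row[of t] by (simp add: row_syms_def)
  show e: "j < n_tapes M \<Longrightarrow> rsyms t ! j = snd (X t j) (fst (X t j))" for j
    using length_row[of t] by (simp add: row_syms_def read_pair)
  show "set (rsyms t) \<subseteq> {0..<n_syms M}"
  proof
    fix x assume "x \<in> set (rsyms t)"
    then obtain j where "j < n_tapes M" "x = rsyms t ! j"
      using length_row[of t] by (auto simp: in_set_conv_nth row_syms_def)
    then show "x \<in> {0..<n_syms M}" using e sym_bound by simp
  qed
qed

lemma length_racts: "length (racts t) = n_tapes M"
proof -
  have "set (rsyms t) \<subseteq> {..<n_syms M}" using rsyms(2)[of t] by auto
  then show ?thesis using tr_wf(2)[OF wf Q_bound rsyms(1)] by (simp add: row_acts_def)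
qed

lemma conf_0: "conf M ts0 0 = (q_start M, ts0)"
  by (simp add: conf_def)

lemma row_Suc: "Q (Suc t) = fst (tr M (Q t) (rsyms t))"
    "j < n_tapes M \<Longrightarrow> X (Suc t) j = act (racts t ! j) (X t j)"
proof -
  have "conf M ts0 (Suc t) = step M {} (Q t, snd (conf M ts0 t))" by (simp add: conf_def)
  then have *: "conf M ts0 (Suc t) =
      (fst (tr M (Q t) (rsyms t)), map2 act (racts t) (snd (conf M ts0 t)))"
    unfolding step_tr by (simp add: row_syms_def row_acts_def)
  show "Q (Suc t) = fst (tr M (Q t) (rsyms t))" unfolding * by simp
  show "j < n_tapes M \<Longrightarrow> X (Suc t) j = act (racts t ! j) (X t j)"
    unfolding * using length_row[of t] length_racts[of t] by simp
qed

lemma head_bound: "j < n_tapes M \<Longrightarrow> \<bar>fst (X t j)\<bar> \<le> int t"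
proof (induction t)
  case 0
  then show ?case by (simp add: conf_0 heads0)
next
  case (Suc t)
  have "\<bar>offset (snd (racts t ! j))\<bar> \<le> 1" by (cases "snd (racts t ! j)") auto
  then show ?case using Suc unfolding row_Suc(2)[OF Suc.prems] act_fst by simp
qed

lemma racts_sym: "j < n_tapes M \<Longrightarrow> fst (racts t ! j) < n_syms M"
proof -
  assume j: "j < n_tapes M"
  have "set (rsyms t) \<subseteq> {..<n_syms M}" using rsyms(2)[of t] by auto
  then have "fst ` set (racts t) \<subseteq> {..<n_syms M}"
    using tr_wf(3)[OF wf Q_bound rsyms(1)] by (simp add: row_acts_def)
  then show ?thesis using j length_racts[of t] by (auto simp: image_subset_iff)
qed

text \<open>The invariant that closure carries from row to row. Symbols read and actions are left
  out, being derived anew from it within each step.\<close>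

definition row_facts :: "(fact \<Rightarrow> nat set) \<Rightarrow> nat \<Rightarrow> bool" where
  "row_facts D t \<longleftrightarrow> Suc t * W \<in> D FM \<and> Suc t * W \<in> D (FQ (Q t)) \<and>
     (\<forall>j<n_tapes M. Suc t * W + nat (int a + fst (X t j)) \<in> D (FH j)) \<and>
     (\<forall>j<n_tapes M. \<forall>c. 0 < c \<and> c < W \<longrightarrow> Suc t * W + c \<in> D (FC j (snd (X t j) (int c - int a))))"

text \<open>From \<open>t < a\<close> the heads lie strictly inside the row. The clauses of a row
  fire only if the next row also starts at a position, so one more row must fit below
  \<open>n\<close>; this accounts for the third \<open>Suc\<close>.\<close>

lemma row_read:
  assumes D: "tab_closed M n I a W D" and R: "row_facts D t" and t: "t < a" "Suc (Suc (Suc t)) * W \<le> n"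
    and j: "j < n_tapes M"
  shows "Suc t * W \<in> D (FR j (rsyms t ! j))"
proof -
  define h where "h = nat (int a + fst (X t j))"
  have h: "int h = int a + fst (X t j)" "0 < h" "h < W"
    using head_bound[OF j, of t] t(1) by (auto simp: h_def)
  have n: "Suc t * W + h < n" "Suc t * W < n" "Suc t * W + W < n" "0 < W" using t(2) h a_pos by auto
  have "Suc t * W \<in> D FM" using R by (simp add: row_facts_def)
  then have rd: "tab_read M n W D (Suc t * W)"
    using D n unfolding tab_closed_def by auto
  have "Suc t * W + h \<in> D (FH j)" using R j by (simp add: row_facts_def h_def)
  moreover have "Suc t * W + h \<in> D (FC j (rsyms t ! j))"
  proof -
    have "int h - int a = fst (X t j)" using h by simp
    then show ?thesis using R j h unfolding row_facts_def rsyms(3)[OF j] by metis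
  qed
  moreover have "rsyms t ! j < n_syms M" using rsyms(3)[OF j] sym_bound[OF j] by simp
  ultimately show ?thesis
    using rd[unfolded tab_read_def, rule_format, of h "Suc t * W + h" j "rsyms t ! j"] h n j by simp
qed

lemma row_step:
  assumes D: "tab_closed M n I a W D" and R: "row_facts D t" and t: "Suc t < a" "Suc (Suc (Suc t)) * W \<le> n"
  shows "row_facts D (Suc t)"
proof -
  define \<tau> where "\<tau> = Suc t * W"
  have \<tau>': "Suc (Suc t) * W = \<tau> + W" by (simp add: \<tau>_def)
  have n: "\<tau> + W + W \<le> n" "0 < W" using t(2) a_pos by (auto simp: \<tau>_def)
  have \<tau>0: "0 < \<tau>" using n(2) by (simp add: \<tau>_def)
  have FM: "\<tau> \<in> D FM" using R by (simp add: row_facts_def \<tau>_def)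
  have all: "\<tau> + W \<in> D FM \<and> tab_read M n W D \<tau> \<and> tab_trans M D \<tau> (\<tau> + W) \<and> tab_write M n W D \<tau> (\<tau> + W)"
    using D FM n \<tau>0 unfolding tab_closed_def by auto
  have rd: "\<tau> \<in> D (FR j (rsyms t ! j))" if "j < n_tapes M" for j
    unfolding \<tau>_def by (rule row_read[OF D R _ t(2) that]) (use t in simp)
  have q: "\<tau> \<in> D (FQ (Q t))" using R by (simp add: row_facts_def \<tau>_def)
  have tr: "\<tau> + W \<in> D (FQ (Q (Suc t)))"
     "\<And>j. j < n_tapes M \<Longrightarrow> \<tau> \<in> D (FA j (fst (racts t ! j)) (snd (racts t ! j)))"
    using all q rd Q_bound[of t] rsyms(1,2)[of t] unfolding tab_trans_def row_Suc(1) row_acts_def by auto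
  have hd: "\<exists>h. int h = int a + fst (X t j) \<and> 0 < h \<and> h < W \<and> \<tau> + h \<in> D (FH j)" if "j < n_tapes M" for j
    using R head_bound[OF that, of t] t(1) that
    by (intro exI[of _ "nat (int a + fst (X t j))"]) (auto simp: row_facts_def \<tau>_def)
  have ct: "\<tau> + c \<in> D (FC j (snd (X t j) (int c - int a)))" if "j < n_tapes M" "0 < c" "c < W" for j c
    using R that by (simp add: row_facts_def \<tau>_def)
  have wr: "(\<tau> + W) + h \<in> D (FC j (fst (racts t ! j)))" "tab_move n D ((\<tau> + W) + h) j (snd (racts t ! j))"
    if "j < n_tapes M" "0 < h" "h < W" "\<tau> + h \<in> D (FH j)" for j h
    using all tr(2)[OF that(1)] that n \<tau>0 racts_sym[OF that(1), of t] unfolding tab_write_def by auto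
  have cp: "(\<tau> + W) + c \<in> D (FC j x)"
    if "j < n_tapes M" "0 < h" "h < W" "\<tau> + h \<in> D (FH j)" "0 < c" "c < W" "h \<noteq> c" "\<tau> + c \<in> D (FC j x)" "x < n_syms M" for j h c x
  proof -
    have "tab_write M n W D \<tau> (\<tau> + W)" using all by blast
    from this[unfolded tab_write_def, rule_format, of c "\<tau> + c" "\<tau> + W + c" j, THEN conjunct2,
        rule_format, of h "\<tau> + h" x]
    show ?thesis using that n \<tau>0 by simp
  qed
  show ?thesis unfolding row_facts_def \<tau>'
  proof (intro conjI allI impI)
    show "\<tau> + W \<in> D FM" using all by blast
    show "\<tau> + W \<in> D (FQ (Q (Suc t)))" by (rule tr(1))
  next
    fix j assume j: "j < n_tapes M"
    then obtain h where h: "int h = int a + fst (X t j)" "0 < h" "h < W" "\<tau> + h \<in> D (FH j)" using hd by blast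
    have hb: "\<bar>fst (X (Suc t) j)\<bar> < int a" using head_bound[OF j, of "Suc t"] t(1) by simp
    have e: "fst (X (Suc t) j) = fst (X t j) + offset (snd (racts t ! j))"
      unfolding row_Suc(2)[OF j] act_fst ..
    have g: "int a + fst (X (Suc t) j) = int h + offset (snd (racts t ! j))" using e h(1) by simp
    note m = wr(2)[OF j h(2-4)]
    show "\<tau> + W + nat (int a + fst (X (Suc t) j)) \<in> D (FH j)"
    proof (cases "snd (racts t ! j)")
      case GoLeft
      obtain l where l: "h = Suc l" using h(2) by (cases h) auto
      have "nat (int h - 1) = l" using l by simp
      then show ?thesis using m n l h(3) \<tau>0 unfolding g GoLeft by (simp add: tab_move_def)
    next
      case Stay
      then show ?thesis using m unfolding g by (simp add: tab_move_def)
    next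
      case GoRight
      have "nat (int h + 1) = Suc h" by simp
      moreover have "Suc (\<tau> + W + h) < n" using n h(3) g hb GoRight by auto
      ultimately show ?thesis using m unfolding g GoRight by (simp add: tab_move_def)
    qed
  next
    fix j c assume j: "j < n_tapes M" and c: "0 < c \<and> c < W"
    from j obtain h where h: "int h = int a + fst (X t j)" "0 < h" "h < W" "\<tau> + h \<in> D (FH j)" using hd by blast
    show "\<tau> + W + c \<in> D (FC j (snd (X (Suc t) j) (int c - int a)))"
    proof (cases "h = c")
      case True
      then have "snd (X (Suc t) j) (int c - int a) = fst (racts t ! j)"
        unfolding row_Suc(2)[OF j] act_snd using h(1) by simp
      then show ?thesis using wr(1)[OF j h(2-4)] True by simp
    next
      case False
      then have "int c - int a \<noteq> fst (X t j)" using h(1) by simp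
      then have "snd (X (Suc t) j) (int c - int a) = snd (X t j) (int c - int a)"
        unfolding row_Suc(2)[OF j] act_snd by simp
      then show ?thesis using cp[OF j h(2-4) _ _ False ct[OF j]] c sym_bound[OF j] by simp
    qed
  qed
qed

lemma row_0:
  assumes D: "tab_closed M n I a W D" and n: "W + W \<le> n"
  shows "row_facts D 0"
proof -
  have i: "tab_init M n I a W D" using D by (simp add: tab_closed_def)
  show ?thesis unfolding row_facts_def conf_0
  proof (intro conjI allI impI)
    fix j assume j: "j < n_tapes M"
    show "Suc 0 * W + nat (int a + fst (snd (q_start M, ts0) ! j)) \<in> D (FH j)"
      using i j n heads0[OF j] a_pos unfolding tab_init_def by simp
    fix c assume c: "0 < c \<and> c < W"
    have "W + c \<in> D (FC j (if c < a then 0 else I j c))"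
      using i j n c unfolding tab_init_def by auto
    then show "Suc 0 * W + c \<in> D (FC j (snd (snd (q_start M, ts0) ! j) (int c - int a)))"
      using cells0[OF j, of c] c by simp
  qed (use i in \<open>auto simp: tab_init_def\<close>)
qed

lemma rows:
  assumes D: "tab_closed M n I a W D" and "t < a" "Suc (Suc t) * W \<le> n"
  shows "row_facts D t"
  using assms(2,3)
proof (induction t)
  case 0
  then show ?case using row_0[OF D] by simp
next
  case (Suc t)
  then show ?case by (intro row_step[OF D]) auto
qed

theorem accepting_derived:
  assumes D: "tab_closed M n I a W D" and t: "t < a" "Suc (Suc (Suc t)) * W \<le> n"
    and acc: "Q t = q_halt M" "r < n_tapes M" "read_sym (X t r) = 2"
  shows "\<exists>\<tau>. \<tau> \<in> D (FQ (q_halt M)) \<and> \<tau> \<in> D (FR r 2)"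
proof -
  have R: "row_facts D t" by (rule rows[OF D t(1)]) (use t in simp)
  have "Suc t * W \<in> D (FQ (q_halt M))" using R acc by (simp add: row_facts_def)
  moreover have "Suc t * W \<in> D (FR r 2)"
    using row_read[OF D R t acc(2)] rsyms(3)[OF acc(2)] acc(3) by (simp add: read_pair)
  ultimately show ?thesis by blast
qed

text \<open>A position splits into a row \<open>p div W - 1\<close> and a cell
  \<open>p mod W\<close>; the shift by one reflects that row 0 starts at \<open>W\<close> and not at
  the excluded position 0.\<close>

definition true_fact :: "(nat set) \<Rightarrow> (nat set) \<Rightarrow> fact \<Rightarrow> nat \<Rightarrow> bool" where
  "true_fact VB VP f p = (let t = p div W - 1; c = p mod W in
     case f of FVB \<Rightarrow> p \<in> VB | FVP \<Rightarrow> p \<in> VP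
     | FM \<Rightarrow> c = 0
     | FQ q \<Rightarrow> c = 0 \<and> q = Q t
     | FR j x \<Rightarrow> c = 0 \<and> x = rsyms t ! j
     | FA j x d \<Rightarrow> c = 0 \<and> (x, d) = racts t ! j
     | FH j \<Rightarrow> int c = int a + fst (X t j)
     | FC j x \<Rightarrow> x = snd (X t j) (int c - int a))"

definition true_facts :: "nat \<Rightarrow> nat set \<Rightarrow> nat set \<Rightarrow> fact \<Rightarrow> nat set" where
  "true_facts n VB VP f = {p. 0 < p \<and> p < n \<and> W \<le> p \<and> true_fact VB VP f p}"

text \<open>The heads must stay strictly inside the window at all times, also after halting: then
  neither a head nor its successor cell after a move spills over into a neighbouring row. The sets
  \<open>FVB\<close> and \<open>FVP\<close> enter only through \<open>I\<close>, so \<open>D\<close>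
  is free there.\<close>

lemma true_closed:
  assumes hb: "\<And>t j. j < n_tapes M \<Longrightarrow> \<bar>fst (X t j)\<bar> < int a" and n: "W < n"
    and D: "\<And>f. f \<noteq> FVB \<Longrightarrow> f \<noteq> FVP \<Longrightarrow> D f = true_facts n {} {} f"
  shows "tab_closed M n I a W D"
proof -
  have W: "0 < W" using a_pos by simp
  have dm: "(Suc t * W + c) div W - 1 = t" "(Suc t * W + c) mod W = c" "(Suc t * W) div W - 1 = t"
    "(Suc t * W) mod W = 0" if "c < W" for t c
  proof -
    show "(Suc t * W + c) div W - 1 = t" using that W by (metis diff_Suc_1 div_less div_mult_self3 add.commute add.right_neutral less_not_refl2)
    show "(Suc t * W + c) mod W = c" using that by (metis mod_less mod_mult_self3)
    show "(Suc t * W) div W - 1 = t" using W by (metis diff_Suc_1 nonzero_mult_div_cancel_right less_not_refl2)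
    show "(Suc t * W) mod W = 0" by (rule mod_mult_self2_is_0)
  qed
  have ge: "W \<le> Suc t * W + c" for t c by simp
  have mFM: "\<tau> \<in> D FM \<longleftrightarrow> 0 < \<tau> \<and> \<tau> < n \<and> W \<le> \<tau> \<and> \<tau> mod W = 0" for \<tau>
    by (simp add: D true_facts_def true_fact_def)
  have mQ: "Suc t * W \<in> D (FQ q) \<longleftrightarrow> Suc t * W < n \<and> q = Q t" for t q
    using dm[of 0 t] W ge[of t 0] by (simp add: D true_facts_def true_fact_def Let_def del: mult_Suc)
  have mR: "Suc t * W \<in> D (FR j x) \<longleftrightarrow> Suc t * W < n \<and> x = rsyms t ! j" for t j x
    using dm[of 0 t] W ge[of t 0] by (simp add: D true_facts_def true_fact_def Let_def del: mult_Suc)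
  have mA: "Suc t * W \<in> D (FA j x d) \<longleftrightarrow> Suc t * W < n \<and> (x, d) = racts t ! j" for t j x d
    using dm[of 0 t] W ge[of t 0] by (simp add: D true_facts_def true_fact_def Let_def del: mult_Suc)
  have mH: "Suc t * W + c \<in> D (FH j) \<longleftrightarrow> Suc t * W + c < n \<and> int c = int a + fst (X t j)" if "c < W" for t c j
    using dm[OF that, of t] W ge[of t c] by (simp add: D true_facts_def true_fact_def Let_def del: mult_Suc)
  have mC: "Suc t * W + c \<in> D (FC j x) \<longleftrightarrow> Suc t * W + c < n \<and> x = snd (X t j) (int c - int a)"
    if "c < W" for t c j x
    using dm[OF that, of t] W ge[of t c] by (simp add: D true_facts_def true_fact_def Let_def del: mult_Suc)
  have "tab_init M n I a W D" unfolding tab_init_def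
  proof (intro conjI allI impI ballI)
    show "W \<in> D FM" using n W by (simp add: mFM)
    show "W \<in> D (FQ (q_start M))" using mQ[of 0] n by (simp add: conf_0)
    fix p j assume p: "0 < p \<and> p < n" "W + a = p" "j \<in> {0..<n_tapes M}"
    show "p \<in> D (FH j)" using mH[of a 0 j] p heads0 a_pos by (auto simp: conf_0)
  next
    fix c p j assume p: "0 < c \<and> c < n" "c < W" "0 < p \<and> p < n" "W + c = p" "j \<in> {0..<n_tapes M}"
    show "p \<in> D (FC j (if c < a then 0 else I j c))"
      using mC[of c 0 j] p cells0[of j c] by (auto simp: conf_0)
  qed
  moreover have "\<tau>' \<in> D FM \<and> tab_read M n W D \<tau> \<and> tab_trans M D \<tau> \<tau>' \<and> tab_write M n W D \<tau> \<tau>'"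
    if \<tau>: "0 < \<tau> \<and> \<tau> < n" "\<tau> \<in> D FM" "0 < \<tau>' \<and> \<tau>' < n" "\<tau> + W = \<tau>'" for \<tau> \<tau>'
  proof -
    have "\<tau> mod W = 0" "W \<le> \<tau>" using \<tau>(2) by (auto simp: mFM)
    then obtain t where t: "\<tau> = Suc t * W"
      by (metis W add_leE dvd_def mod_0_imp_dvd mult.commute mult_0 not0_implies_Suc not_less)
    have t': "\<tau>' = Suc (Suc t) * W" using \<tau>(4) t by simp
    have n1: "Suc t * W < n" using \<tau>(1) unfolding t by blast
    have n2: "Suc (Suc t) * W < n" using \<tau>(3) unfolding t' by blast
    show ?thesis
    proof (intro conjI)
      show "\<tau>' \<in> D FM" using \<tau> W mod_mult_self2_is_0[of "Suc (Suc t)" W] unfolding mFM t' by auto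
      show "tab_read M n W D \<tau>" unfolding tab_read_def t
      proof (intro allI impI ballI)
        fix c p j x assume c: "0 < c \<and> c < n" "c < W" "0 < p \<and> p < n" "Suc t * W + c = p"
          "j \<in> {0..<n_tapes M}" "x \<in> {0..<n_syms M}" "p \<in> D (FH j) \<and> p \<in> D (FC j x)"
        then have "int c = int a + fst (X t j)" "x = snd (X t j) (int c - int a)"
          using mH[OF c(2), of t j] mC[OF c(2), of t j x] by auto
        then have "x = rsyms t ! j" using rsyms(3)[of j t] c by simp
        then show "Suc t * W \<in> D (FR j x)" using \<tau> t mR by auto
      qed
      show "tab_trans M D \<tau> \<tau>'" unfolding tab_trans_def t t'
      proof (intro allI impI ballI)
        fix q ss assume q: "q \<in> {0..<n_states M}" "length ss = n_tapes M \<and> set ss \<subseteq> {0..<n_syms M}"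
          "Suc t * W \<in> D (FQ q) \<and> (\<forall>j\<in>{0..<n_tapes M}. Suc t * W \<in> D (FR j (ss ! j)))"
        then have "ss = rsyms t" using rsyms(1)[of t] mR by (auto simp: list_eq_iff_nth_eq)
        have "q = Q t" using q mQ by blast
        show "Suc (Suc t) * W \<in> D (FQ (fst (tr M q ss))) \<and>
           (\<forall>j\<in>{0..<n_tapes M}. Suc t * W \<in> D (FA j (fst (snd (tr M q ss) ! j)) (snd (snd (tr M q ss) ! j))))"
          unfolding \<open>ss = rsyms t\<close> \<open>q = Q t\<close> row_Suc(1)[symmetric] row_acts_def[symmetric] mQ mA
          using n1 n2 by simp
      qed
      show "tab_write M n W D \<tau> \<tau>'" unfolding tab_write_def t t'
      proof (intro allI impI ballI conjI)
        fix c p p' j x d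
        assume c: "0 < c \<and> c < n" "c < W" "0 < p \<and> p < n" "Suc t * W + c = p" "0 < p' \<and> p' < n"
          "Suc (Suc t) * W + c = p'" "j \<in> {0..<n_tapes M}" "x \<in> {0..<n_syms M}"
          "Suc t * W \<in> D (FA j x d) \<and> p \<in> D (FH j)"
        have j: "j < n_tapes M" using c by simp
        have h: "int c = int a + fst (X t j)" using c mH[OF c(2), of t j] by auto
        have ra: "racts t ! j = (x, d)" using c mA by auto
        have Xs: "X (Suc t) j = act (x, d) (X t j)" using row_Suc(2)[OF j] ra by simp
        show "p' \<in> D (FC j x)"
          using mC[OF c(2), of "Suc t" j x] c h by (simp add: Xs act_snd)
        have h2: "int c + offset d = int a + fst (X (Suc t) j)" using h by (simp add: Xs act_fst)
        \<comment> \<open>The cell after the move is again between 0 and \<open>W\<close>, so it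
          belongs to the same row.\<close>
        then have b: "0 < int c + offset d" "int c + offset d < int W" using hb[OF j, of "Suc t"] by auto
        show "tab_move n D p' j d"
        proof (cases d)
          case Stay
          then show ?thesis using mH[OF c(2), of "Suc t" j] c h2 by (simp add: tab_move_def)
        next
          case GoRight
          then show ?thesis using mH[of "Suc c" "Suc t" j] c(5,6) h2 b by (auto simp: tab_move_def)
        next
          case GoLeft
          then obtain c' where c': "c = Suc c'" using b by (cases c) auto
          have "c' < W" using c(2) c' by simp
          then show ?thesis using mH[of c' "Suc t" j] c(5,6) h2 b GoLeft c' by (auto simp: tab_move_def)
        qed
      next
        fix c p p' j c2 p2 x
        assume c: "0 < c \<and> c < n" "c < W" "0 < p \<and> p < n" "Suc t * W + c = p" "0 < p' \<and> p' < n"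
          "Suc (Suc t) * W + c = p'" "j \<in> {0..<n_tapes M}" and c2: "0 < c2 \<and> c2 < n" "c2 < W \<and> c2 \<noteq> c"
          "0 < p2 \<and> p2 < n" "Suc t * W + c2 = p2" "x \<in> {0..<n_syms M}" "p2 \<in> D (FH j) \<and> p \<in> D (FC j x)"
        have j: "j < n_tapes M" using c by simp
        have "int c2 = int a + fst (X t j)" using c2 mH[of c2 t j] by auto
        then have "int c - int a \<noteq> fst (X t j)" using c2(2) by auto
        moreover have "x = snd (X t j) (int c - int a)" using c2(6) c(4) mC[OF c(2), of t j x] by auto
        ultimately have "x = snd (X (Suc t) j) (int c - int a)" unfolding row_Suc(2)[OF j] act_snd by simp
        then show "p' \<in> D (FC j x)" using mC[OF c(2), of "Suc t" j x] c by auto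
      qed
    qed
  qed
  ultimately show ?thesis unfolding tab_closed_def by blast
qed

theorem rejecting_not_derived:
  assumes "\<And>t. Q t = q_halt M \<Longrightarrow> read_sym (X t r) \<noteq> 2" "r < n_tapes M"
  shows "\<not> (\<exists>\<tau>. \<tau> \<in> true_facts n VB VP (FQ (q_halt M)) \<and> \<tau> \<in> true_facts n VB VP (FR r 2))"
  using assms rsyms(3)[OF assms(2)] by (auto simp: true_facts_def true_fact_def Let_def read_pair)

end

section \<open>Polynomial-time programs\<close>

definition init_store :: "bool list \<Rightarrow> store" where
  "init_store x = (\<lambda>i. if i = 0 then wt 0 (map bit_sym x) else blank)"

lemma class_P_I:
  assumes "wf_cmd K g c" "3 \<le> K" "3 \<le> g" "polyfun F"
    and r: "\<And>x. \<exists>s. run c (init_store x) (F (length x)) s \<and> s 1 = cell_tape (bit_sym (x \<in> L))"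
  shows "L \<in> class_P"
proof -
  obtain M where M: "wf_otm M" "n_tapes M = K"
    "\<And>s t s' A. run c s t s' \<Longrightarrow> (step M A ^^ t) (q_start M, map s [0..<K]) = (q_halt M, map s' [0..<K])"
    using compile[OF assms(1-3)] by blast
  obtain p where p: "F = poly p" using assms(4) by (auto simp: polyfun_def)
  have "computes_in_time M {} (\<lambda>x. [x \<in> L]) (poly p)"
    unfolding computes_in_time_def
  proof
    fix x
    obtain s where s: "run c (init_store x) (F (length x)) s" "s 1 = cell_tape (bit_sym (x \<in> L))"
      using r by blast
    have "map (init_store x) [0..<K] = tape_of x # replicate (K - 1) (tape_of [])"
      using assms(2) by (intro nth_equalityI) (auto simp: init_store_def nth_Cons' tape_of_wt[of x] tape_of_Nil)
    then have "(step M {} ^^ poly p (length x)) (init_config M x) = (q_halt M, map s [0..<K])"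
      using M(3)[OF s(1)] M(2) p by (simp add: init_config_def)
    moreover have "carries (map s [0..<K] ! 1) [x \<in> L]"
      using assms(2) s(2) by (simp add: carries_def cell_tape_def)
    ultimately show "\<exists>ts. (step M {} ^^ poly p (length x)) (init_config M x) = (q_halt M, ts) \<and>
        carries (ts ! 1) [x \<in> L]" by blast
  qed
  then show ?thesis using M(1) unfolding class_P_def FP_oracle_def by blast
qed

lemma class_P_D: "L \<in> class_P \<Longrightarrow> \<exists>M p. wf_otm M \<and> computes_in_time M {} (\<lambda>x. [x \<in> L]) (poly p)"
  by (auto simp: class_P_def FP_oracle_def)

lemma loc_eq: "a < K \<Longrightarrow> loc K (\<lambda>r. r a = v)"
  by (simp add: loc_def)

lemma loc_pos: "a < K \<Longrightarrow> loc K (\<lambda>r. 0 < r a)"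
  by (simp add: loc_def)

definition verdict :: "bool \<Rightarrow> cmd" where
  "verdict b = wr 1 (bit_sym b) Stay"

lemma run_verdict: "s 1 = blank \<Longrightarrow> s' = s(1 := cell_tape (bit_sym b)) \<Longrightarrow> run (verdict b) s 1 s'"
  unfolding verdict_def by (rule run_wr) (simp add: cell_tape_def)

lemma wf_verdict: "1 < K \<Longrightarrow> 2 < g \<Longrightarrow> wf_cmd K g (verdict b)"
  unfolding verdict_def by (rule wf_wr) (auto simp: bit_sym_def)

lemma inj_bit_sym: "inj bit_sym"
  by (auto simp: inj_def bit_sym_def split: if_splits)

lemma dec_bits: "dec (map bit_sym z) = (map bit_sym (fst (dec z)), map bit_sym (snd (dec z)))"
  by (rule dec_map[OF inj_bit_sym])

text \<open>\<open>Sigma_p 1\<close> is built from complements of \<open>class_P\<close>, so the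
  machine decides the pairs whose first component lies outside \<open>L\<close>. The bound 0 leaves
  only the empty word to be quantified.\<close>

lemma Sigma_0_1: "class_P \<subseteq> Sigma_p 1"
proof
  fix L assume "L \<in> class_P"
  then obtain M p where M: "wf_otm M" "computes_in_time M {} (\<lambda>x. [x \<in> L]) (poly p)"
    using class_P_D by blast
  define R where "R = {z. fst (dec z) \<notin> L}"
  define c where "c = decc 0 15 3 ;; rewind 15 ;; decide M p 10 ;;
    Cond (\<lambda>r. r 16 = 2) (verdict False) (verdict True)"
  obtain F where F: "polyfun F" "\<And>B s x n. s (B + 5) = wt 0 (map bit_sym x) \<Longrightarrow> length x \<le> n \<Longrightarrow>
     \<forall>i\<in>block M B. i \<noteq> B + 5 \<longrightarrow> s i = blank \<Longrightarrow>
     \<exists>s'. run (decide M p B) s (F n) s' \<and> read_sym (s' (B + 6)) = (if x \<in> L then 2 else 1) \<and>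
        (\<forall>i. i \<notin> block M B \<longrightarrow> s' i = s i)"
    by (rule run_decide[OF M]) (rule that)
  have k3: "3 \<le> n_tapes M" "3 \<le> n_syms M" using M(1) by (auto simp: wf_otm_def)
  have "R \<in> class_P"
  proof (rule class_P_I)
    show "wf_cmd (15 + n_tapes M) (n_syms M + n_states M) c"
      using k3 M(1) by (simp add: c_def wf_decc wf_rewind wf_decide wf_verdict loc_eq)
    show "polyfun (\<lambda>n. (10 * n + 17) + ((3 * n + 6) + (F n + (1 + 1) + 1) + 1) + 1)"
      by (intro polyfun_intros F)
    fix z :: "bool list"
    let ?n = "length z"
    let ?w = "map bit_sym (fst (dec z))"
    define i where "i = length z - length (map bit_sym (snd (dec z)))"
    have len: "length (fst (dec z)) \<le> ?n" using dec_length[of z] by simp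
    let ?s1 = "(init_store z)(0 := wt i (map bit_sym z), 15 := fin ?w)"
    have 1: "run (decc 0 15 3) (init_store z) (10 * ?n + 17) ?s1"
      by (rule run_decc[where w = "map bit_sym z" and i = 0 and v = "[]" and u = ?w and r = "map bit_sym (snd (dec z))"])
        (use bit_sym_pos len in \<open>auto simp: init_store_def blank_wt dec_bits i_def\<close>)
    let ?s2 = "?s1(15 := wt 0 ?w)"
    have 2: "run (rewind 15) ?s1 (3 * ?n + 6) ?s2"
      by (rule run_rewind) (use bit_sym_pos len in auto)
    have "\<exists>s'. run (decide M p 10) ?s2 (F ?n) s' \<and> read_sym (s' (10 + 6)) = (if fst (dec z) \<in> L then 2 else 1) \<and>
        (\<forall>i. i \<notin> block M 10 \<longrightarrow> s' i = ?s2 i)"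
      by (rule F(2)) (use len in \<open>auto simp: init_store_def block_def\<close>)
    then obtain s3 where s3: "run (decide M p 10) ?s2 (F ?n) s3"
      "read_sym (s3 16) = (if fst (dec z) \<in> L then 2 else 1)" "\<And>i. i \<notin> block M 10 \<Longrightarrow> s3 i = ?s2 i" by auto
    have b: "s3 1 = blank" using s3(3)[of 1] by (simp add: block_def init_store_def)
    let ?s4 = "s3(1 := cell_tape (bit_sym (z \<in> R)))"
    have 4: "run (Cond (\<lambda>r. r 16 = 2) (verdict False) (verdict True)) s3 (1 + 1) ?s4"
      by (rule run_Cond) (use s3(2) b in \<open>auto simp: reads_def R_def split: if_splits intro!: run_verdict[simplified]\<close>)
    have "run c (init_store z) ((10 * ?n + 17) + ((3 * ?n + 6) + (F ?n + (1 + 1) + 1) + 1) + 1) ?s4"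
      unfolding c_def by (rule run_Seq[OF 1 run_Seq[OF 2 run_Seq[OF s3(1) 4]]])
    then show "\<exists>s. run c (init_store z) ((10 * ?n + 17) + ((3 * ?n + 6) + (F ?n + (1 + 1) + 1) + 1) + 1) s \<and>
       s 1 = cell_tape (bit_sym (z \<in> R))" by (intro exI[of _ ?s4]) simp
  qed (use k3 in auto)
  then have "- R \<in> uminus ` class_P" by blast
  moreover have "x \<in> L \<longleftrightarrow> (\<exists>u. length u \<le> poly 0 (length x) \<and> pair_word x u \<in> - R)" for x
    by (auto simp: R_def dec_pair)
  ultimately have "L \<in> poly_ex (uminus ` class_P)"
    unfolding poly_ex_def by (intro CollectI bexI[of _ "- R"] exI[of _ 0] allI)
  then show "L \<in> Sigma_p 1" by simp
qed

lemma poly_ex_mono: "C \<subseteq> C' \<Longrightarrow> poly_ex C \<subseteq> poly_ex C'"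
  unfolding poly_ex_def by blast

lemma Sigma_mono: "Sigma_p k \<subseteq> Sigma_p (Suc k)"
proof (induction k)
  case 0
  then show ?case using Sigma_0_1 by simp
next
  case (Suc k)
  then have "uminus ` Sigma_p k \<subseteq> uminus ` Sigma_p (Suc k)" by blast
  then show ?case using poly_ex_mono by simp
qed

text \<open>Both complementation and \<open>poly_ex\<close> respect inclusion, so an inclusion of
  one level in \<open>Sigma_p 2\<close> lifts the next level into \<open>Sigma_p 3\<close> and hence
  back into \<open>Sigma_p 2\<close>.\<close>

lemma PH_collapse:
  assumes "Sigma_p 3 \<subseteq> Sigma_p 2"
  shows "PH = Sigma_p 2"
proof -
  have ge: "Sigma_p (k + 2) \<subseteq> Sigma_p 2" for k
  proof (induction k)
    case 0
    show ?case by (simp only: add_0 order_refl)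
  next
    case (Suc k)
    then have "uminus ` Sigma_p (k + 2) \<subseteq> uminus ` Sigma_p 2" by blast
    moreover have "(3 :: nat) = Suc 2" by simp
    ultimately have "Sigma_p (Suc (k + 2)) \<subseteq> Sigma_p 3" by (simp only: Sigma_p.simps poly_ex_mono)
    then show ?case using assms by (simp only: add_Suc)
  qed
  have "Sigma_p k \<subseteq> Sigma_p (k + 2)" for k using Sigma_mono[of k] Sigma_mono[of "Suc k"] by simp
  with ge have "Sigma_p k \<subseteq> Sigma_p 2" for k by blast
  then show ?thesis unfolding PH_def by blast
qed

subsection \<open>The matrix of a two-quantifier language\<close>

lemma map_pair_word: "map bit_sym (pair_word x u) = dbl (map bit_sym x) @ [1, 2] @ map bit_sym u"
  by (simp add: pair_word_dbl map_dbl bit_sym_def)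

lemma length_pair_word: "length (pair_word x u) = 2 * length x + 2 + length u"
  by (simp add: pair_word_dbl)

lemma run_emit: "s b = fin w \<Longrightarrow> s' = s(b := fin (w @ [v])) \<Longrightarrow> run (wr b v GoRight) s 1 s'"
  by (rule run_wr) simp

text \<open>Tape \<open>b\<close> receives the pair of the word on tape \<open>a\<close> and the word that starts at the head of
  tape \<open>c\<close>, cut off by the clock \<open>k\<close>.\<close>

definition pairc :: "nat \<Rightarrow> nat \<Rightarrow> nat \<Rightarrow> nat \<Rightarrow> cmd" where
  "pairc a c k b = dblcopy a b ;; wr b 1 GoRight ;; wr b 2 GoRight ;; takecopy c b k ;; rewind b"

lemma wf_pairc: "a < K \<Longrightarrow> b < K \<Longrightarrow> c < K \<Longrightarrow> k < K \<Longrightarrow> 2 < g \<Longrightarrow> wf_cmd K g (pairc a c k b)"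
  by (auto simp: pairc_def intro!: wf_dblcopy wf_wr wf_takecopy wf_rewind)

lemma run_pairc:
  assumes "s a = wt 0 (map bit_sym x)" "s b = blank" "s k = ctr m m" "distinct [a, b, c, k]"
    "prefix_word (s c) m = map bit_sym u" "length x \<le> n" "m \<le> n"
  shows "\<exists>s'. run (pairc a c k b) s (21 * n + 20) s' \<and> s' b = wt 0 (map bit_sym (pair_word x u)) \<and>
    (\<forall>i. i \<notin> {a, b, c, k} \<longrightarrow> s' i = s i)"
proof -
  let ?x = "map bit_sym x" and ?u = "map bit_sym u"
  have u: "length u \<le> m" using prefix_word_length[of "s c" m] assms(5) by simp
  let ?s1 = "s(a := fin ?x, b := fin ([] @ dbl ?x))"
  have 1: "run (dblcopy a b) s (7 * n + 1) ?s1"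
    by (rule run_dblcopy[where s = s and a = a and b = b and w = ?x and v = "[]" and n = n])
      (use assms bit_sym_pos in \<open>auto simp: blank_wt\<close>)
  let ?s2 = "?s1(b := fin (dbl ?x @ [1]))"
  have 2: "run (wr b 1 GoRight) ?s1 1 ?s2" by (rule run_emit[where w = "dbl ?x"]) auto
  let ?s3 = "?s2(b := fin ((dbl ?x @ [1]) @ [2]))"
  have 3: "run (wr b 2 GoRight) ?s2 1 ?s3" by (rule run_emit[where w = "dbl ?x @ [1]"]) auto
  let ?s4 = "?s3(c := (fst (s c) + int (length ?u), snd (s c)), b := fin (((dbl ?x @ [1]) @ [2]) @ ?u),
      k := ctr (m - length ?u) m)"
  have 4: "run (takecopy c b k) ?s3 (5 * n + 1) ?s4"
    by (rule run_takecopy[where m = m and T = m and v = "(dbl ?x @ [1]) @ [2]" and u = ?u])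
      (use assms in \<open>auto\<close>)
  let ?s5 = "?s4(b := wt 0 (((dbl ?x @ [1]) @ [2]) @ ?u))"
  have z: "0 \<notin> set (((dbl ?x @ [1]) @ [2]) @ ?u)" using bit_sym_pos[of x] bit_sym_pos[of u] by auto
  have 5: "run (rewind b) ?s4 (3 * (3 * n + 2) + 6) ?s5"
    by (rule run_rewind[where i = "length (((dbl ?x @ [1]) @ [2]) @ ?u)", OF _ order_refl z _ refl])
      (use assms u in auto)
  have "run (pairc a c k b) s (21 * n + 20) ?s5"
    unfolding pairc_def
    by (rule run_mono[OF run_Seq[OF 1 run_Seq[OF 2 run_Seq[OF 3 run_Seq[OF 4 5]]]]]) simp
  moreover have "?s5 b = wt 0 (map bit_sym (pair_word x u))" by (simp add: map_pair_word)
  moreover have "\<forall>i. i \<notin> {a, b, c, k} \<longrightarrow> ?s5 i = s i" by simp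
  ultimately show ?thesis by blast
qed

text \<open>The machine of the tableau. Its clocks cut \<open>u\<close> and \<open>v\<close> out of
  arbitrary tapes, so every choice of sets is meaningful and the formula need not express length
  bounds. The time depends on \<open>w\<close> alone, so the padding can be chosen afterwards, large
  enough for the tableau. The leading \<open>True\<close> is the marker of the time bound in the
  stored word.\<close>

lemma matrix_machine:
  assumes "R \<in> class_P"
  shows "\<exists>M T. wf_otm M \<and> 16 < n_tapes M \<and> polyfun T \<and>
    (\<forall>w pad Y1 Y2 u v. prefix_word Y1 (poly p1 (length w)) = map bit_sym u \<longrightarrow>
       prefix_word Y2 (poly p2 (length (pair_word w u))) = map bit_sym v \<longrightarrow>
       (\<exists>ts. (step M {} ^^ T (length w))
          (q_start M, wt 0 (map bit_sym (True # pair_word w pad)) # Y1 # Y2 # replicate (n_tapes M - 3) blank) =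
          (q_halt M, ts) \<and> read_sym (ts ! 16) = (if pair_word (pair_word w u) v \<in> R then 2 else 1)))"
proof -
  obtain MR pR where MR: "wf_otm MR" "computes_in_time MR {} (\<lambda>x. [x \<in> R]) (poly pR)"
    using class_P_D[OF assms] by blast
  define c where "c = mv 0 GoRight ;; decc 0 3 4 ;; rewind 3 ;; polyc p1 3 5 6 ;; pairc 3 1 5 7 ;;
    polyc p2 7 8 9 ;; pairc 7 2 8 15 ;; decide MR pR 10"
  have k3: "3 \<le> n_tapes MR" "3 \<le> n_syms MR" using MR(1) by (auto simp: wf_otm_def)
  have "wf_cmd (15 + n_tapes MR) (n_syms MR + n_states MR) c"
    using k3 MR(1) by (simp add: c_def wf_mv wf_decc wf_rewind wf_polyc wf_pairc wf_decide)
  from compile[OF this] obtain M where M: "wf_otm M" "n_tapes M = 15 + n_tapes MR"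
    "\<And>s t s' A. run c s t s' \<Longrightarrow>
      (step M A ^^ t) (q_start M, map s [0..<15 + n_tapes MR]) = (q_halt M, map s' [0..<15 + n_tapes MR])"
    using k3 by auto
  obtain F where F: "polyfun F" "\<And>B s x n. s (B + 5) = wt 0 (map bit_sym x) \<Longrightarrow> length x \<le> n \<Longrightarrow>
     \<forall>i\<in>block MR B. i \<noteq> B + 5 \<longrightarrow> s i = blank \<Longrightarrow>
     \<exists>s'. run (decide MR pR B) s (F n) s' \<and> read_sym (s' (B + 6)) = (if x \<in> R then 2 else 1) \<and>
        (\<forall>i. i \<notin> block MR B \<longrightarrow> s' i = s i)"
    by (rule run_decide[OF MR]) (rule that)
  obtain F1 where F1: "polyfun F1" "\<And>s a c d w n. s a = wt 0 w \<Longrightarrow> 0 \<notin> set w \<Longrightarrow> length w \<le> n \<Longrightarrow>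
     s c = blank \<Longrightarrow> s d = blank \<Longrightarrow> distinct [a, c, d] \<Longrightarrow>
     run (polyc p1 a c d) s (F1 n) (s(c := ctr (poly p1 (length w)) (poly p1 (length w))))"
    by (rule run_polyc[where p = p1]) (rule that)
  obtain F2 where F2: "polyfun F2" "\<And>s a c d w n. s a = wt 0 w \<Longrightarrow> 0 \<notin> set w \<Longrightarrow> length w \<le> n \<Longrightarrow>
     s c = blank \<Longrightarrow> s d = blank \<Longrightarrow> distinct [a, c, d] \<Longrightarrow>
     run (polyc p2 a c d) s (F2 n) (s(c := ctr (poly p2 (length w)) (poly p2 (length w))))"
    by (rule run_polyc[where p = p2]) (rule that)
  \<comment> \<open>\<open>Y\<close> and \<open>Z\<close> bound the lengths of
    \<open>pair_word w u\<close> and of \<open>pair_word (pair_word w u) v\<close> in terms of the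
    length of \<open>w\<close>.\<close>
  define Y where "Y = (\<lambda>n. 2 * n + 2 + poly p1 n)"
  define Z where "Z = (\<lambda>n. 2 * Y n + 2 + poly p2 (Y n))"
  define T where "T = (\<lambda>n. 1 + ((10 * n + 17) + ((3 * n + 6) + (F1 n + ((21 * Y n + 20) +
      (F2 (Y n) + ((21 * Z n + 20) + F (Z n) + 1) + 1) + 1) + 1) + 1) + 1) + 1)"
  have pY: "polyfun Y" unfolding Y_def by (intro polyfun_intros polyfun_poly)
  have pZ: "polyfun Z" unfolding Z_def by (intro polyfun_intros pY polyfun_compose[OF polyfun_poly pY])
  have pT: "polyfun T" unfolding T_def
    by (intro polyfun_intros F1(1) pY pZ polyfun_compose[OF F2(1) pY] polyfun_compose[OF F(1) pZ])
  have "\<exists>ts. (step M {} ^^ T (length w))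
          (q_start M, wt 0 (map bit_sym (True # pair_word w pad)) # Y1 # Y2 # replicate (n_tapes M - 3) blank) =
          (q_halt M, ts) \<and> read_sym (ts ! 16) = (if pair_word (pair_word w u) v \<in> R then 2 else 1)"
    if Y1: "prefix_word Y1 (poly p1 (length w)) = map bit_sym u"
      and Y2: "prefix_word Y2 (poly p2 (length (pair_word w u))) = map bit_sym v" for w pad Y1 Y2 u v
  proof -
    let ?n = "length w" and ?w = "map bit_sym w" and ?y = "pair_word w u"
    define s0 :: store where "s0 = (\<lambda>i. if i = 0 then wt 0 (map bit_sym (True # pair_word w pad))
       else if i = 1 then Y1 else if i = 2 then Y2 else blank)"
    define b where "b = map bit_sym (True # pair_word w pad)"
    have u: "length u \<le> poly p1 ?n" using Y1 prefix_word_length[of Y1 "poly p1 ?n"] by simp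
    then have y: "length ?y \<le> Y ?n" by (simp add: length_pair_word Y_def)
    have p2: "poly p2 (length ?y) \<le> poly p2 (Y ?n)" by (rule poly_nat_mono[OF y])
    have v: "length v \<le> poly p2 (Y ?n)"
      using Y2 prefix_word_length[of Y2 "poly p2 (length ?y)"] p2 by simp
    have z: "length (pair_word ?y v) \<le> Z ?n" using y v by (simp add: length_pair_word[of ?y] Z_def)
    let ?s1 = "s0(0 := wt 1 b)"
    have 1: "run (mv 0 GoRight) s0 1 ?s1" by (rule run_mv) (simp add: s0_def b_def)
    have d: "dec (drop 1 b) = (?w, map bit_sym pad)" by (simp add: b_def dec_bits dec_pair)
    let ?s2 = "?s1(0 := wt (length b - length (map bit_sym pad)) b, 3 := fin ([] @ ?w))"
    have 2: "run (decc 0 3 4) ?s1 (10 * ?n + 17) ?s2"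
      by (rule run_decc[where i = 1 and r = "map bit_sym pad" and u = ?w and v = "[]"])
        (use bit_sym_pos d in \<open>auto simp: s0_def b_def blank_wt bit_sym_def\<close>)
    let ?s3 = "?s2(3 := wt 0 ?w)"
    have 3: "run (rewind 3) ?s2 (3 * ?n + 6) ?s3"
      by (rule run_rewind) (use bit_sym_pos in auto)
    let ?s4 = "?s3(5 := ctr (poly p1 (length ?w)) (poly p1 (length ?w)))"
    have 4: "run (polyc p1 3 5 6) ?s3 (F1 ?n) ?s4"
      by (rule F1(2)) (use bit_sym_pos in \<open>auto simp: s0_def\<close>)
    have "\<exists>s'. run (pairc 3 1 5 7) ?s4 (21 * Y ?n + 20) s' \<and> s' 7 = wt 0 (map bit_sym ?y) \<and>
      (\<forall>i. i \<notin> {3, 7, 1, 5} \<longrightarrow> s' i = ?s4 i)"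
      by (rule run_pairc) (use Y1 in \<open>auto simp: s0_def Y_def\<close>)
    then obtain s5 where 5: "run (pairc 3 1 5 7) ?s4 (21 * Y ?n + 20) s5" "s5 7 = wt 0 (map bit_sym ?y)"
      "\<And>i. i \<notin> {3, 7, 1, 5} \<Longrightarrow> s5 i = ?s4 i" by blast
    let ?s6 = "s5(8 := ctr (poly p2 (length (map bit_sym ?y))) (poly p2 (length (map bit_sym ?y))))"
    have 6: "run (polyc p2 7 8 9) s5 (F2 (Y ?n)) ?s6"
      by (rule F2(2)) (use bit_sym_pos[of ?y] y 5(2,3) in \<open>auto simp: s0_def\<close>)
    have "\<exists>s'. run (pairc 7 2 8 15) ?s6 (21 * Z ?n + 20) s' \<and> s' 15 = wt 0 (map bit_sym (pair_word ?y v)) \<and>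
      (\<forall>i. i \<notin> {7, 15, 2, 8} \<longrightarrow> s' i = ?s6 i)"
      by (rule run_pairc[where m = "poly p2 (length ?y)"])
        (use Y2 5(2,3) y p2 in \<open>auto simp: s0_def Z_def\<close>)
    then obtain s7 where 7: "run (pairc 7 2 8 15) ?s6 (21 * Z ?n + 20) s7"
      "s7 15 = wt 0 (map bit_sym (pair_word ?y v))" "\<And>i. i \<notin> {7, 15, 2, 8} \<Longrightarrow> s7 i = ?s6 i" by blast
    have "\<exists>s'. run (decide MR pR 10) s7 (F (Z ?n)) s' \<and>
       read_sym (s' (10 + 6)) = (if pair_word ?y v \<in> R then 2 else 1) \<and> (\<forall>i. i \<notin> block MR 10 \<longrightarrow> s' i = s7 i)"
      by (rule F(2)) (use 7(2,3) 5(3) z in \<open>auto simp: s0_def block_def\<close>)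
    then obtain s8 where 8: "run (decide MR pR 10) s7 (F (Z ?n)) s8"
      "read_sym (s8 16) = (if pair_word ?y v \<in> R then 2 else 1)" by auto
    have "run c s0 (T ?n) s8" unfolding c_def T_def
      by (rule run_Seq[OF 1 run_Seq[OF 2 run_Seq[OF 3 run_Seq[OF 4 run_Seq[OF 5(1) run_Seq[OF 6 run_Seq[OF 7(1) 8(1)]]]]]]])
    from M(3)[OF this] have "(step M {} ^^ T ?n) (q_start M, map s0 [0..<15 + n_tapes MR]) =
       (q_halt M, map s8 [0..<15 + n_tapes MR])" .
    moreover have "map s0 [0..<15 + n_tapes MR] =
       wt 0 (map bit_sym (True # pair_word w pad)) # Y1 # Y2 # replicate (n_tapes M - 3) blank"
      using M(2) by (intro nth_equalityI) (auto simp: s0_def nth_Cons' numeral_2_eq_2)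
    moreover have "read_sym (map s8 [0..<15 + n_tapes MR] ! 16) = (if pair_word ?y v \<in> R then 2 else 1)"
      using 8(2) k3 by simp
    ultimately show ?thesis by metis
  qed
  then show ?thesis using M(1,2) pT k3 by (intro exI[of _ M] exI[of _ T]) auto
qed

section \<open>Generating the decision tree\<close>

lemma enc_comb: "enc_tree (comb i bs) =
   concat (map (\<lambda>k. True # replicate (i + k) True @ [False, False, bs ! k]) [0..<length bs]) @ [False, False]"
proof (induction i bs rule: comb.induct)
  case (2 i b bs)
  have "[0..<length (b # bs)] = 0 # map Suc [0..<length bs]"
    by (simp add: map_Suc_upt upt_conv_Cons del: upt_Suc)
  then show ?case using 2 by (simp add: comp_def)
qed simp

text \<open>The loop invariant of the generator: the output after \<open>m\<close> branches. Only
  the closing negative leaf is missing at the end.\<close>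

definition tree_prefix :: "bool list \<Rightarrow> nat \<Rightarrow> bool list" where
  "tree_prefix bs m = replicate (length bs) True @ False #
     concat (map (\<lambda>k. True # replicate (Suc k) True @ [False, False, bs ! k]) [0..<m])"

lemma enc_wtree: "enc_input (length bs) (wtree bs) = tree_prefix bs (length bs) @ [False, False]"
  by (simp add: enc_input_def wtree_def enc_comb tree_prefix_def)

lemma tree_prefix_Suc: "tree_prefix bs (Suc m) =
    tree_prefix bs m @ True # replicate (Suc m) True @ [False, False, bs ! m]"
  by (simp add: tree_prefix_def)

lemma length_tree_prefix: "m \<le> length bs \<Longrightarrow> length (tree_prefix bs m) \<le> length bs + 1 + m * (length bs + 4)"
proof (induction m)
  case (Suc m)
  then show ?case by (simp add: tree_prefix_Suc)
qed (simp add: tree_prefix_def)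

lemma length_enc_wtree: "length (enc_input (length bs) (wtree bs)) \<le> length bs + 3 + length bs * (length bs + 4)"
  using length_tree_prefix[of "length bs" bs] by (simp add: enc_wtree)

text \<open>Tape \<open>c\<close> gains one mark per round and so holds the unary feature of the
  current branch. The two symbols 1 after it end the feature and announce a leaf.\<close>

definition genstep :: "nat \<Rightarrow> nat \<Rightarrow> nat \<Rightarrow> cmd" where
  "genstep b c o' = wr c 2 GoRight ;; wr o' 2 GoRight ;; rewind c ;; copy c o' ;; wr o' 1 GoRight ;;
     wr o' 1 GoRight ;; emit_from b o' ;; mv b GoRight"

definition gentree :: "nat \<Rightarrow> nat \<Rightarrow> nat \<Rightarrow> cmd" where
  "gentree b c o' = While (\<lambda>r. r b \<noteq> 0) (wr o' 2 GoRight ;; mv b GoRight) ;; rewind b ;; wr o' 1 GoRight ;;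
     While (\<lambda>r. r b \<noteq> 0) (genstep b c o') ;; wr o' 1 GoRight ;; wr o' 1 GoRight ;; rewind o'"

lemma wf_gentree: "b < K \<Longrightarrow> c < K \<Longrightarrow> o' < K \<Longrightarrow> 2 < g \<Longrightarrow> wf_cmd K g (gentree b c o')"
  by (simp add: gentree_def genstep_def wf_wr wf_mv wf_rewind wf_copy wf_emit_from loc_pos)

lemma bit_sym_simps [simp]: "bit_sym True = 2" "bit_sym False = 1" "bit_sym b \<noteq> 0" "0 < bit_sym b"
  by (auto simp: bit_sym_def)

lemma run_genstep:
  assumes "s b = wt k (map bit_sym bs)" "k < length bs" "s c = fin (replicate k 2)" "s o' = fin v"
    "distinct [b, c, o']"
    "s' = s(b := wt (Suc k) (map bit_sym bs), c := fin (replicate (Suc k) 2),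
       o' := fin (v @ map bit_sym (True # replicate (Suc k) True @ [False, False, bs ! k])))"
  shows "run (genstep b c o') s (8 * length bs + 20) s'"
proof -
  let ?c = "replicate (Suc k) (2 :: nat)"
  have c0: "0 \<notin> set ?c" by auto
  let ?s1 = "s(c := fin ?c)"
  have 1: "run (wr c 2 GoRight) s 1 ?s1"
    by (rule run_emit[where w = "replicate k 2"]) (use assms in \<open>auto simp: replicate_append_same\<close>)
  let ?s2 = "?s1(o' := fin (v @ [2]))"
  have 2: "run (wr o' 2 GoRight) ?s1 1 ?s2"
    by (rule run_emit[where w = v]) (use assms in auto)
  let ?s3 = "?s2(c := wt 0 ?c)"
  have 3: "run (rewind c) ?s2 (3 * length bs + 6) ?s3"
    by (rule run_rewind[where i = "Suc k" and w = ?c]) (use assms c0 in auto)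
  let ?s4 = "?s3(c := fin ?c, o' := fin ((v @ [2]) @ drop 0 ?c))"
  have 4: "run (copy c o') ?s3 (5 * length bs + 1) ?s4"
    by (rule run_copy[where i = 0 and w = ?c and v = "v @ [2]"]) (use assms c0 in auto)
  let ?w5 = "((v @ [2]) @ drop 0 ?c) @ [1]"
  let ?s5 = "?s4(o' := fin ?w5)"
  have 5: "run (wr o' 1 GoRight) ?s4 1 ?s5" by (rule run_emit[where w = "(v @ [2]) @ drop 0 ?c"]) auto
  let ?s6 = "?s5(o' := fin (?w5 @ [1]))"
  have 6: "run (wr o' 1 GoRight) ?s5 1 ?s6" by (rule run_emit[where w = ?w5]) auto
  let ?s7 = "?s6(o' := fin ((?w5 @ [1]) @ [bit_sym (bs ! k)]))"
  have 7: "run (emit_from b o') ?s6 1 ?s7"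
    by (rule run_emit_from) (use assms in auto)
  have 8: "run (mv b GoRight) ?s7 1 s'"
    by (rule run_mv) (use assms in \<open>auto simp: fun_eq_iff\<close>)
  show ?thesis unfolding genstep_def
    by (rule run_mono[OF run_Seq[OF 1 run_Seq[OF 2 run_Seq[OF 3 run_Seq[OF 4 run_Seq[OF 5
              run_Seq[OF 6 run_Seq[OF 7 8]]]]]]]]) simp
qed

lemma run_gentree:
  assumes "s b = wt 0 (map bit_sym bs)" "s c = blank" "s o' = blank" "distinct [b, c, o']" "length bs \<le> n"
  shows "\<exists>s'. run (gentree b c o') s (20 * (n + 4) * (n + 4)) s' \<and>
    s' o' = wt 0 (map bit_sym (enc_input (length bs) (wtree bs))) \<and> (\<forall>i. i \<notin> {b, c, o'} \<longrightarrow> s' i = s i)"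
proof -
  let ?w = "map bit_sym bs" and ?N = "length bs"
  define S where "S = (\<lambda>k. s(b := wt k ?w, o' := fin (replicate k 2)))"
  have 1: "run (While (\<lambda>r. r b \<noteq> 0) (wr o' 2 GoRight ;; mv b GoRight)) s (?N * (3 + 2) + 1) (S ?N)"
  proof (rule run_While_iter[where S = S])
    fix k assume k: "k < ?N"
    have "run (wr o' 2 GoRight ;; mv b GoRight) (S k) (1 + 1 + 1) (S (Suc k))"
      by (rule run_Seq[OF run_emit[where w = "replicate k 2", OF _ refl] run_mv])
        (use assms in \<open>auto simp: S_def fun_eq_iff replicate_append_same\<close>)
    moreover have "reads (S k) b \<noteq> 0" using k assms by (simp add: S_def reads_def)
    ultimately show "reads (S k) b \<noteq> 0 \<and> run (wr o' 2 GoRight ;; mv b GoRight) (S k) 3 (S (Suc k))"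
      by (simp add: numeral_3_eq_3)
  qed (use assms in \<open>auto simp: S_def reads_def fun_eq_iff blank_wt\<close>)
  let ?s2 = "s(o' := fin (replicate ?N 2))"
  have 2: "run (rewind b) (S ?N) (3 * n + 6) ?s2"
    by (rule run_rewind[where i = ?N and w = ?w]) (use assms bit_sym_pos[of bs] in \<open>auto simp: S_def fun_eq_iff\<close>)
  define S' where "S' = (\<lambda>k. s(b := wt k ?w, c := fin (replicate k 2), o' := fin (map bit_sym (tree_prefix bs k))))"
  have 3: "run (wr o' 1 GoRight) ?s2 1 (S' 0)"
    by (rule run_emit[where w = "replicate ?N 2"]) (use assms in \<open>auto simp: S'_def fun_eq_iff tree_prefix_def blank_wt\<close>)
  have 4: "run (While (\<lambda>r. r b \<noteq> 0) (genstep b c o')) (S' 0) (?N * ((8 * ?N + 20) + 2) + 1) (S' ?N)"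
  proof (rule run_While_iter[where S = S'])
    fix k assume k: "k < ?N"
    have "run (genstep b c o') (S' k) (8 * ?N + 20) (S' (Suc k))"
      by (rule run_genstep[where k = k and v = "map bit_sym (tree_prefix bs k)"])
        (use k assms in \<open>auto simp: S'_def fun_eq_iff tree_prefix_Suc\<close>)
    moreover have "reads (S' k) b \<noteq> 0" using k assms by (simp add: S'_def reads_def)
    ultimately show "reads (S' k) b \<noteq> 0 \<and> run (genstep b c o') (S' k) (8 * ?N + 20) (S' (Suc k))" by simp
  qed (use assms in \<open>auto simp: S'_def reads_def\<close>)
  let ?w5 = "map bit_sym (tree_prefix bs ?N) @ [1]"
  let ?s5 = "(S' ?N)(o' := fin ?w5)"
  have 5: "run (wr o' 1 GoRight) (S' ?N) 1 ?s5"
    by (rule run_emit[where w = "map bit_sym (tree_prefix bs ?N)"]) (auto simp: S'_def)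
  let ?s6 = "?s5(o' := fin (?w5 @ [1]))"
  have 6: "run (wr o' 1 GoRight) ?s5 1 ?s6" by (rule run_emit[where w = ?w5]) auto
  let ?e = "map bit_sym (enc_input ?N (wtree bs))"
  have e: "?e = ?w5 @ [1]" by (simp add: enc_wtree)
  have len: "length ?e \<le> ?N + 3 + ?N * (?N + 4)" using length_enc_wtree[of bs] by simp
  let ?s7 = "?s6(o' := wt 0 ?e)"
  have 7: "run (rewind o') ?s6 (3 * (?N + 3 + ?N * (?N + 4)) + 6) ?s7"
    by (rule run_rewind[where i = "length ?e" and w = ?e, OF _ order_refl bit_sym_pos len]) (simp_all add: e)
  have "?N * (?N + 4) \<le> n * (n + 4)" "?N * (8 * ?N + 22) \<le> n * (8 * n + 22)"
    using assms(5) by (intro mult_mono; simp)+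
  then have t: "(?N * (3 + 2) + 1) + ((3 * n + 6) + (1 + ((?N * ((8 * ?N + 20) + 2) + 1) + (1 + (1 +
      (3 * (?N + 3 + ?N * (?N + 4)) + 6) + 1) + 1) + 1) + 1) + 1) + 1 \<le> 20 * (n + 4) * (n + 4)"
    using assms(5) by (simp add: algebra_simps)
  have "run (gentree b c o') s (20 * (n + 4) * (n + 4)) ?s7" unfolding gentree_def
    by (rule run_mono[OF run_Seq[OF 1 run_Seq[OF 2 run_Seq[OF 3 run_Seq[OF 4 run_Seq[OF 5 run_Seq[OF 6 7]]]]]] t])
  moreover have "\<forall>i. i \<notin> {b, c, o'} \<longrightarrow> ?s7 i = s i" by (simp add: S'_def)
  moreover have "?s7 o' = wt 0 ?e" by simp
  ultimately show ?thesis by blast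
qed

definition fill :: "nat \<Rightarrow> nat \<Rightarrow> cmd" where
  "fill c o' = While (\<lambda>r. r c \<noteq> 0) (pop c ;; wr o' 1 GoRight)"

lemma wf_fill: "c < K \<Longrightarrow> o' < K \<Longrightarrow> 2 < g \<Longrightarrow> wf_cmd K g (fill c o')"
  by (simp add: fill_def wf_wr wf_pop loc_pos)

lemma run_fill:
  assumes "s c = ctr m m" "s o' = fin v" "c \<noteq> o'" "m \<le> n" "s' = s(c := ctr 0 0, o' := fin (v @ replicate m 1))"
  shows "run (fill c o') s (5 * n + 1) s'"
proof -
  define S where "S = (\<lambda>k. s(c := ctr (m - k) (m - k), o' := fin (v @ replicate k 1)))"
  have "run (fill c o') s (m * (3 + 2) + 1) s'"
    unfolding fill_def
  proof (rule run_While_iter[where S = S])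
    fix k assume k: "k < m"
    then obtain l where l: "m - k = Suc l" "m - Suc k = l" by (metis Suc_diff_Suc)
    have "run (pop c ;; wr o' 1 GoRight) (S k) (1 + 1 + 1) (S (Suc k))"
      by (rule run_Seq[OF run_pop[where m = l, OF _ refl] run_emit[where w = "v @ replicate k 1"]])
        (use assms l in \<open>auto simp: S_def fun_eq_iff replicate_append_same\<close>)
    moreover have "reads (S k) c \<noteq> 0" using k assms by (simp add: S_def reads_def)
    ultimately show "reads (S k) c \<noteq> 0 \<and> run (pop c ;; wr o' 1 GoRight) (S k) 3 (S (Suc k))"
      by (simp add: numeral_3_eq_3)
  qed (use assms in \<open>auto simp: S_def reads_def\<close>)
  then show ?thesis by (rule run_mono) (use assms in simp)
qed

text \<open>The number of leading zeros is the time bound of the matrix machine, to be found by the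
  formula as the place of the first 1; the zeros at the end only create enough positions for the
  rows.\<close>

definition tree_word :: "nat poly \<Rightarrow> nat poly \<Rightarrow> bool list \<Rightarrow> bool list" where
  "tree_word pa pp w = replicate (poly pa (length w)) False @ True #
     pair_word w (replicate (poly pp (length w)) False)"

lemma length_tree_word: "length (tree_word pa pp w) =
    poly pa (length w) + 1 + (2 * length w + 2 + poly pp (length w))"
  by (simp add: tree_word_def length_pair_word)

definition wordc :: "nat poly \<Rightarrow> nat poly \<Rightarrow> nat \<Rightarrow> nat \<Rightarrow> nat \<Rightarrow> nat \<Rightarrow> nat \<Rightarrow> cmd" where
  "wordc pa pp a c d t b = polyc pa a c t ;; polyc pp a d t ;; fill c b ;; wr b 2 GoRight ;; dblcopy a b ;;
     wr b 1 GoRight ;; wr b 2 GoRight ;; fill d b ;; rewind b"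

lemma wf_wordc: "a < K \<Longrightarrow> b < K \<Longrightarrow> c < K \<Longrightarrow> d < K \<Longrightarrow> t < K \<Longrightarrow> 2 < g \<Longrightarrow> wf_cmd K g (wordc pa pp a c d t b)"
  by (simp add: wordc_def wf_polyc wf_fill wf_wr wf_dblcopy wf_rewind)

lemma run_wordc:
  obtains F where "polyfun F" "\<And>s a c d t b w n. s a = wt 0 (map bit_sym w) \<Longrightarrow> s c = blank \<Longrightarrow> s d = blank \<Longrightarrow>
    s t = blank \<Longrightarrow> s b = blank \<Longrightarrow> distinct [a, b, c, d, t] \<Longrightarrow> length w \<le> n \<Longrightarrow>
    \<exists>s'. run (wordc pa pp a c d t b) s (F n) s' \<and> s' b = wt 0 (map bit_sym (tree_word pa pp w)) \<and>
      (\<forall>i. i \<notin> {a, b, c, d} \<longrightarrow> s' i = s i)"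
proof -
  obtain F1 where F1: "polyfun F1" "\<And>s a c d w n. s a = wt 0 w \<Longrightarrow> 0 \<notin> set w \<Longrightarrow> length w \<le> n \<Longrightarrow>
     s c = blank \<Longrightarrow> s d = blank \<Longrightarrow> distinct [a, c, d] \<Longrightarrow>
     run (polyc pa a c d) s (F1 n) (s(c := ctr (poly pa (length w)) (poly pa (length w))))"
    by (rule run_polyc[where p = pa]) (rule that)
  obtain F2 where F2: "polyfun F2" "\<And>s a c d w n. s a = wt 0 w \<Longrightarrow> 0 \<notin> set w \<Longrightarrow> length w \<le> n \<Longrightarrow>
     s c = blank \<Longrightarrow> s d = blank \<Longrightarrow> distinct [a, c, d] \<Longrightarrow>
     run (polyc pp a c d) s (F2 n) (s(c := ctr (poly pp (length w)) (poly pp (length w))))"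
    by (rule run_polyc[where p = pp]) (rule that)
  define N where "N = (\<lambda>n. poly pa n + 1 + (2 * n + 2 + poly pp n))"
  define G where "G = (\<lambda>n. F1 n + (F2 n + ((5 * poly pa n + 1) + (1 + ((7 * n + 1) + (1 + (1 +
     ((5 * poly pp n + 1) + (3 * N n + 6) + 1) + 1) + 1) + 1) + 1) + 1) + 1) + 1)"
  have G: "polyfun G" unfolding G_def N_def by (intro polyfun_intros polyfun_poly F1(1) F2(1))
  have "\<exists>s'. run (wordc pa pp a c d t b) s (G n) s' \<and> s' b = wt 0 (map bit_sym (tree_word pa pp w)) \<and>
      (\<forall>i. i \<notin> {a, b, c, d} \<longrightarrow> s' i = s i)"
    if h: "s a = wt 0 (map bit_sym w)" "s c = blank" "s d = blank" "s t = blank" "s b = blank"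
      "distinct [a, b, c, d, t]" "length w \<le> n" for s a c d t b w n
  proof -
    let ?w = "map bit_sym w"
    define A where "A = poly pa (length w)"
    define P where "P = poly pp (length w)"
    have AP: "A \<le> poly pa n" "P \<le> poly pp n" unfolding A_def P_def by (rule poly_nat_mono[OF h(7)])+
    let ?s1 = "s(c := ctr A A)"
    have 1: "run (polyc pa a c t) s (F1 n) ?s1"
      using F1(2)[of s a ?w n c t] h bit_sym_pos[of w] by (simp add: A_def)
    let ?s2 = "?s1(d := ctr P P)"
    have 2: "run (polyc pp a d t) ?s1 (F2 n) ?s2"
    proof -
      have "run (polyc pp a d t) ?s1 (F2 n) (?s1(d := ctr (poly pp (length ?w)) (poly pp (length ?w))))"
        by (rule F2(2)) (use h bit_sym_pos[of w] in auto)
      then show ?thesis by (simp add: P_def)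
    qed
    let ?v3 = "[] @ replicate A 1"
    let ?s3 = "?s2(c := ctr 0 0, b := fin ?v3)"
    have 3: "run (fill c b) ?s2 (5 * poly pa n + 1) ?s3"
      by (rule run_fill[where m = A and v = "[]"]) (use h AP in \<open>auto simp: blank_wt\<close>)
    let ?s4 = "?s3(b := fin (?v3 @ [2]))"
    have 4: "run (wr b 2 GoRight) ?s3 1 ?s4" by (rule run_emit[where w = ?v3]) auto
    let ?v5 = "(?v3 @ [2]) @ dbl ?w"
    let ?s5 = "?s4(a := fin ?w, b := fin ?v5)"
    have 5: "run (dblcopy a b) ?s4 (7 * n + 1) ?s5"
      by (rule run_dblcopy[where w = ?w and v = "?v3 @ [2]"]) (use h bit_sym_pos[of w] in auto)
    let ?s6 = "?s5(b := fin (?v5 @ [1]))"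
    have 6: "run (wr b 1 GoRight) ?s5 1 ?s6" by (rule run_emit[where w = ?v5]) auto
    let ?s7 = "?s6(b := fin ((?v5 @ [1]) @ [2]))"
    have 7: "run (wr b 2 GoRight) ?s6 1 ?s7" by (rule run_emit[where w = "?v5 @ [1]"]) auto
    let ?v8 = "((?v5 @ [1]) @ [2]) @ replicate P 1"
    let ?s8 = "?s7(d := ctr 0 0, b := fin ?v8)"
    have 8: "run (fill d b) ?s7 (5 * poly pp n + 1) ?s8"
      by (rule run_fill[where m = P and v = "(?v5 @ [1]) @ [2]"]) (use h AP in auto)
    let ?e = "map bit_sym (tree_word pa pp w)"
    have e: "?e = ?v8" by (simp add: tree_word_def map_pair_word A_def P_def)
    let ?s9 = "?s8(b := wt 0 ?e)"
    have len: "length ?e \<le> N n" using AP h(7) by (simp add: length_tree_word N_def A_def P_def)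
    have 9: "run (rewind b) ?s8 (3 * N n + 6) ?s9"
      by (rule run_rewind[where i = "length ?e" and w = ?e, OF _ order_refl bit_sym_pos len])
        (simp_all add: e)
    have "run (wordc pa pp a c d t b) s (G n) ?s9" unfolding wordc_def G_def
      by (rule run_Seq[OF 1 run_Seq[OF 2 run_Seq[OF 3 run_Seq[OF 4 run_Seq[OF 5 run_Seq[OF 6
            run_Seq[OF 7 run_Seq[OF 8 9]]]]]]]])
    moreover have "\<forall>i. i \<notin> {a, b, c, d} \<longrightarrow> ?s9 i = s i" by simp
    moreover have "?s9 b = wt 0 ?e" by simp
    ultimately show ?thesis by blast
  qed
  then show thesis by (rule that[OF G])
qed

section \<open>Simulation with guessed oracle answers\<close>

text \<open>The second component is the remaining list of guessed answers: \<open>False\<close> for a negative answer,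
  \<open>True\<close> followed by the doubled certificate and a separator for a positive one.\<close>

fun qstep :: "otm \<Rightarrow> config \<times> bool list \<Rightarrow> config \<times> bool list" where
  "qstep M ((q, ts), A) =
     (if q = q_query M \<and> q \<noteq> q_halt M
      then if A \<noteq> [] \<and> hd A then ((q_yes M, ts), snd (dec (tl A))) else ((q_no M, ts), tl A)
      else (step M {} (q, ts), A))"

definition qrun :: "otm \<Rightarrow> config \<Rightarrow> bool list \<Rightarrow> nat \<Rightarrow> config \<times> bool list" where
  "qrun M c A t = (qstep M ^^ t) (c, A)"

lemma qrun_Suc: "qrun M c A (Suc t) = qstep M (qrun M c A t)"
  by (simp add: qrun_def)

lemma wf_conf_qstep: "wf_otm M \<Longrightarrow> wf_conf M (fst cA) \<Longrightarrow> wf_conf M (fst (qstep M cA))"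
proof -
  assume a: "wf_otm M" "wf_conf M (fst cA)"
  obtain q ts A where cA: "cA = ((q, ts), A)" by (metis prod.collapse)
  have "q_yes M < n_states M" "q_no M < n_states M" using a(1) by (auto simp: wf_otm_def)
  then show ?thesis using a wf_conf_step[OF a(1), of "(q, ts)" "{}"] unfolding cA
    by (simp add: wf_conf_def del: step.simps)
qed

lemma wf_conf_qrun: "wf_otm M \<Longrightarrow> wf_conf M c \<Longrightarrow> wf_conf M (fst (qrun M c A t))"
  by (induction t) (simp_all add: qrun_def wf_conf_qstep del: qstep.simps)

lemma reach_tape_qrun:
  assumes "wf_otm M" "0 < j" "j < n_tapes M"
  shows "reach_tape t (snd (fst (qrun M (init_config M x) A t)) ! j)"
proof (induction t)
  case 0
  show ?case using reach_tape_init[OF assms, of 0 "{}" x] by (simp add: qrun_def)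
next
  case (Suc t)
  obtain q ts A' where cA: "qrun M (init_config M x) A t = ((q, ts), A')" by (metis prod.collapse)
  have w: "wf_conf M (q, ts)" using wf_conf_qrun[OF assms(1) wf_conf_init[OF assms(1)], of x A t] cA by simp
  show ?case unfolding qrun_Suc cA
    using reach_tape_step[OF assms(1) w assms(3), of t "{}"] Suc cA reach_tape_mono[of t "ts ! j" "Suc t"]
    by (simp del: step.simps)
qed

text \<open>Tape 0 carries the universally chosen word, whose first 1 selects the step to be checked;
  tape 3 carries the answers.\<close>

definition query_step :: "otm \<Rightarrow> cmd" where
  "query_step M = Cond (\<lambda>r. r 20 = q_query M \<and> r 20 \<noteq> q_halt M)
     (Cond (\<lambda>r. r 3 = 2) (mv 3 GoRight ;; decc 3 14 2 ;; wr 20 (q_yes M) Stay)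
        (Cond (\<lambda>r. r 3 = 0) Skip (mv 3 GoRight) ;; wr 20 (q_no M) Stay))
     (sim M 20)"

text \<open>The loop leaves the head of tape 0 on the selecting 1, right before the challenge.
  Letters beyond the end of the universal word count as 0, so a short word lets the run
  finish.\<close>

definition query_loop :: "otm \<Rightarrow> cmd" where
  "query_loop M = While (\<lambda>r. r 23 \<noteq> 0 \<and> r 0 \<noteq> 2)
     (Cond (\<lambda>r. r 0 = 0) Skip (mv 0 GoRight) ;; query_step M ;; mv 23 GoLeft)"

lemma loc_conj: "loc K P \<Longrightarrow> loc K Q \<Longrightarrow> loc K (\<lambda>r. P r \<and> Q r)"
  by (rule loc_comp2)

lemma loc_neq: "a < K \<Longrightarrow> loc K (\<lambda>r. r a \<noteq> v)"
  by (simp add: loc_def)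

lemma wf_query_loop: "wf_otm M \<Longrightarrow> 25 + n_tapes M \<le> K \<Longrightarrow> n_syms M + n_states M \<le> g \<Longrightarrow> 2 < g \<Longrightarrow>
   wf_cmd K g (query_loop M)"
proof -
  assume a: "wf_otm M" "25 + n_tapes M \<le> K" "n_syms M + n_states M \<le> g" "2 < g"
  have q: "q_yes M < n_states M" "q_no M < n_states M" using a(1) by (auto simp: wf_otm_def)
  have l: "loc K (\<lambda>r. r 20 = q_query M \<and> r 20 \<noteq> q_halt M)" "loc K (\<lambda>r. r 23 \<noteq> 0 \<and> r 0 \<noteq> 2)"
    using a(2) by (intro loc_conj loc_eq loc_neq; simp)+
  have s: "wf_cmd K g (sim M 20)" by (rule wf_sim) (use a in auto)
  show ?thesis unfolding query_loop_def query_step_def wf_cmd.simps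
    using l s a q by (auto intro!: wf_mv wf_decc wf_wr loc_eq)
qed

definition stop :: "nat \<Rightarrow> bool list \<Rightarrow> nat" where
  "stop T V = (if True \<in> set V then min T (length (takeWhile Not V)) else T)"

lemma stop_le: "stop T V \<le> T"
  by (simp add: stop_def)

lemma stop_before: "i < stop T V \<Longrightarrow> i < length V \<Longrightarrow> \<not> V ! i"
proof -
  assume i: "i < stop T V" "i < length V"
  show ?thesis
  proof (cases "True \<in> set V")
    case True
    then have l: "i < length (takeWhile Not V)" using i by (simp add: stop_def)
    then have "takeWhile Not V ! i \<in> set (takeWhile Not V)" by (rule nth_mem)
    then show ?thesis using takeWhile_nth[OF l] set_takeWhileD by metis
  next
    case False
    then show ?thesis using i(2) nth_mem by metis
  qed
qed

lemma stop_at: "stop T V < T \<Longrightarrow> stop T V < length V \<and> V ! stop T V"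
proof -
  assume s: "stop T V < T"
  then have t: "True \<in> set V" by (auto simp: stop_def split: if_splits)
  then have e: "stop T V = length (takeWhile Not V)" using s by (simp add: stop_def min_def split: if_splits)
  have "takeWhile Not V \<noteq> V" using t by (metis set_takeWhileD)
  then have "length (takeWhile Not V) < length V"
    by (metis le_neq_implies_less length_takeWhile_le takeWhile_eq_take take_all_iff order_refl)
  then show ?thesis unfolding e using nth_length_takeWhile[of Not V] by simp
qed

text \<open>The remaining answers are given as a suffix of tape 3. Tape 14 collects certificates
  that are merely skipped, so all that matters is that it can be extended.\<close>

definition qinv :: "otm \<Rightarrow> store \<Rightarrow> bool list \<Rightarrow> nat \<Rightarrow> bool list \<Rightarrow> nat \<Rightarrow> config \<times> bool list \<Rightarrow> nat \<Rightarrow> store \<Rightarrow> bool" where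
  "qinv M s0 wV iV wA T cA t s \<longleftrightarrow> emb M 20 (fst cA) s \<and>
     s 0 = wt (iV + min t (length wV - iV)) (map bit_sym wV) \<and>
     (\<exists>i\<le>length wA. s 3 = wt i (map bit_sym wA) \<and> drop i wA = snd cA) \<and>
     (\<exists>v. s 14 = fin v) \<and> s 2 = blank \<and> s 23 = ctr (T - t) T \<and>
     (\<forall>i. i \<notin> {0, 3, 14} \<union> block M 20 \<longrightarrow> s i = s0 i)"

lemma emb_cong:
  assumes "emb M B (q, ts) s" "q' < n_states M" "s' B = cell_tape q'"
    "\<And>i. i \<in> block M B \<Longrightarrow> i \<noteq> B \<Longrightarrow> i \<noteq> B + 3 \<Longrightarrow> s' i = s i" "3 \<le> n_tapes M"
  shows "emb M B (q', ts) s'"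
proof -
  have "s' (B + 5 + j) = s (B + 5 + j)" if "j < n_tapes M" for j
    by (rule assms(4)) (use that in \<open>auto simp: block_def\<close>)
  moreover have "s' (B + 1) = s (B + 1)" "s' (B + 2) = s (B + 2)"
    by (rule assms(4); use assms(5) in \<open>simp add: block_def\<close>)+
  ultimately show ?thesis using assms(1-3) by (auto simp: emb_def wf_conf_def)
qed

lemma act_cell_tape: "act (v, Stay) (cell_tape q) = cell_tape v"
  by (simp add: cell_tape_def)

lemma drop_dec:
  assumes "i \<le> length w" "u = snd (dec (drop i w))"
  shows "length w - length u \<le> length w \<and> drop (length w - length u) w = u"
proof -
  have l: "length u \<le> length (drop i w)" using dec_length[of "drop i w"] assms(2) by simp
  have "u = drop (length (drop i w) - length u) (drop i w)" using dec_drop[of "drop i w"] assms(2) by simp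
  also have "\<dots> = drop (length w - length u) w" using l assms(1) by simp
  finally show ?thesis by simp
qed

lemma run_query_step:
  assumes wf: "wf_otm M" and inv: "emb M 20 (fst cA) s" "i \<le> length wA" "s 3 = wt i (map bit_sym wA)"
    "drop i wA = snd cA" "s 14 = fin v" "s 2 = blank"
  shows "\<exists>s'. run (query_step M) s (10 * length wA + 30) s' \<and> emb M 20 (fst (qstep M cA)) s' \<and>
     (\<exists>i\<le>length wA. s' 3 = wt i (map bit_sym wA) \<and> drop i wA = snd (qstep M cA)) \<and>
     (\<exists>v. s' 14 = fin v) \<and> (\<forall>i. i \<notin> {3, 14} \<union> block M 20 \<or> i = 23 \<longrightarrow> s' i = s i)"
proof -
  obtain q ts A where cA: "cA = ((q, ts), A)" by (metis prod.collapse)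
  have k3: "3 \<le> n_tapes M" and qb: "q_yes M < n_states M" "q_no M < n_states M"
    using wf by (auto simp: wf_otm_def)
  have e: "emb M 20 (q, ts) s" using inv(1) cA by simp
  then have s20: "s 20 = cell_tape q" "reads s 20 = q" by (auto simp: emb_def reads_def cell_tape_def)
  have A: "A = drop i wA" using inv(4) cA by simp
  show ?thesis
  proof (cases "q = q_query M \<and> q \<noteq> q_halt M")
    case False
    have qs: "qstep M cA = (step M {} (q, ts), A)" unfolding cA qstep.simps by (rule if_not_P[OF False])
    have "q \<noteq> q_query M \<or> q = q_halt M" using False by blast
    then obtain s' where s': "run (sim M 20) s 1 s'" "emb M 20 (step M {} (q, ts)) s'"
      "\<forall>i. i \<notin> block M 20 \<or> i = 20 + 3 \<or> i = 20 + 4 \<longrightarrow> s' i = s i"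
      using run_sim[OF wf e, of "{}"] by auto
    have "run (query_step M) s (1 + 1) s'" unfolding query_step_def
      by (rule run_Cond) (use False s20 s'(1) in auto)
    then have "run (query_step M) s (10 * length wA + 30) s'" by (rule run_mono) simp
    moreover have "s' 3 = s 3" "s' 14 = s 14" using s'(3) by (auto simp: block_def)
    ultimately show ?thesis using s'(2,3) inv A unfolding qs by (intro exI[of _ s']) auto
  next
    case True
    show ?thesis
    proof (cases "A \<noteq> [] \<and> hd A")
      case hd: True
      then have il: "i < length wA" "wA ! i" using A hd_drop_conv_nth[of i wA] by auto
      then have tl: "tl A = drop (Suc i) wA" unfolding A by (simp add: drop_Suc tl_drop)
      define u where "u = snd (dec (tl A))"
      define x where "x = fst (dec (tl A))"
      have qs: "qstep M cA = ((q_yes M, ts), u)" unfolding cA u_def using True hd by simp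
      let ?s1 = "s(3 := wt (Suc i) (map bit_sym wA))"
      have 1: "run (mv 3 GoRight) s 1 ?s1" by (rule run_mv) (use inv in auto)
      have dm: "dec (drop (Suc i) (map bit_sym wA)) = (map bit_sym x, map bit_sym u)"
        unfolding drop_map dec_bits u_def x_def tl by simp
      have xl: "length x \<le> length wA"
        using dec_length[of "tl A"] tl unfolding x_def by simp
      let ?s2 = "?s1(3 := wt (length (map bit_sym wA) - length (map bit_sym u)) (map bit_sym wA), 14 := fin (v @ map bit_sym x))"
      have 2: "run (decc 3 14 2) ?s1 (10 * length wA + 17) ?s2"
        by (rule run_decc[where i = "Suc i" and u = "map bit_sym x" and r = "map bit_sym u"])
          (use inv il dm bit_sym_pos[of wA] xl in auto)
      let ?s3 = "?s2(20 := cell_tape (q_yes M))"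
      have 3: "run (wr 20 (q_yes M) Stay) ?s2 1 ?s3"
        by (rule run_wr) (simp add: s20 act_cell_tape)
      have "run (query_step M) s ((1 + ((10 * length wA + 17) + 1 + 1) + 1) + 1 + 1) ?s3"
        unfolding query_step_def
        by (rule run_Cond, rule run_Cond, rule run_Seq[OF 1 run_Seq[OF 2 3]])
          (use True s20 inv il in \<open>auto simp: reads_def\<close>)
      then have r: "run (query_step M) s (10 * length wA + 30) ?s3" by (rule run_mono) simp
      have "emb M 20 (q_yes M, ts) ?s3"
        by (rule emb_cong[OF e qb(1)]) (use k3 in \<open>auto simp: block_def\<close>)
      moreover have "length wA - length u \<le> length wA \<and> drop (length wA - length u) wA = u"
        by (rule drop_dec[of "Suc i"]) (use il in \<open>auto simp: u_def tl\<close>)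
      then have "\<exists>i\<le>length wA. ?s3 3 = wt i (map bit_sym wA) \<and> drop i wA = u"
        by (intro exI[of _ "length wA - length u"]) simp
      moreover have "?s3 14 = fin (v @ map bit_sym x)" by simp
      moreover have "\<forall>i. i \<notin> {3, 14} \<union> block M 20 \<or> i = 23 \<longrightarrow> ?s3 i = s i" by (auto simp: block_def)
      ultimately show ?thesis using r unfolding qs fst_conv snd_conv by blast
    next
      case hd: False
      have qs: "qstep M cA = ((q_no M, ts), tl A)"
        unfolding cA qstep.simps if_P[OF True] by (rule if_not_P[OF hd])
      let ?j = "min (Suc i) (length wA)"
      let ?s1 = "s(3 := wt ?j (map bit_sym wA))"
      have 1: "run (Cond (\<lambda>r. r 3 = 0) Skip (mv 3 GoRight)) s (1 + 1) ?s1"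
      proof (rule run_Cond)
        assume "reads s 3 = 0"
        then have "i = length wA" using inv by (auto simp: reads_def split: if_splits)
        then have "?s1 = s" using inv(3) by (simp add: fun_upd_idem)
        then show "run Skip s 1 ?s1" by (simp add: run_Skip)
      next
        assume "reads s 3 \<noteq> 0"
        then have "i < length wA" using inv by (auto simp: reads_def split: if_splits)
        then show "run (mv 3 GoRight) s 1 ?s1" by (intro run_mv) (use inv in \<open>auto simp: min_def\<close>)
      qed
      let ?s2 = "?s1(20 := cell_tape (q_no M))"
      have 2: "run (wr 20 (q_no M) Stay) ?s1 1 ?s2"
        by (rule run_wr) (simp add: s20 act_cell_tape)
      have n2: "reads s 3 \<noteq> 2"
        using hd A inv(3) hd_drop_conv_nth[of i wA] by (auto simp: reads_def bit_sym_def)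
      have "run (query_step M) s (((1 + 1) + 1 + 1) + 1 + 1) ?s2"
        unfolding query_step_def
        by (rule run_Cond, rule run_Cond) (use True s20 n2 run_Seq[OF 1 2] in auto)
      then have r: "run (query_step M) s (10 * length wA + 30) ?s2" by (rule run_mono) simp
      have "emb M 20 (q_no M, ts) ?s2"
        by (rule emb_cong[OF e qb(2)]) (use k3 in \<open>auto simp: block_def\<close>)
      moreover have "tl A = drop ?j wA" unfolding A by (auto simp: min_def drop_Suc tl_drop)
      then have "\<exists>i\<le>length wA. ?s2 3 = wt i (map bit_sym wA) \<and> drop i wA = tl A"
        by (intro exI[of _ ?j]) simp
      moreover have "?s2 14 = fin v" using inv by simp
      moreover have "\<forall>i. i \<notin> {3, 14} \<union> block M 20 \<or> i = 23 \<longrightarrow> ?s2 i = s i" by (auto simp: block_def)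
      ultimately show ?thesis using r unfolding qs fst_conv snd_conv by blast
    qed
  qed
qed

lemma run_query_loop:
  assumes wf: "wf_otm M" and inv: "qinv M s0 wV iV wA T (c, A) 0 s" and iV: "iV \<le> length wV"
    and V: "V = drop iV wV" and n: "T \<le> n" "length wA \<le> m"
  shows "\<exists>s'. run (query_loop M) s (n * (10 * m + 40) + 1) s' \<and>
     qinv M s0 wV iV wA T (qrun M c A (stop T V)) (stop T V) s'"
proof -
  let ?I = "\<lambda>t. qinv M s0 wV iV wA T (qrun M c A t) t"
  have k3: "3 \<le> n_tapes M" using wf by (simp add: wf_otm_def)
  have rd: "reads s 0 = (if t < length V then bit_sym (V ! t) else 0)" "reads s 23 = (if t < T then 1 else 0)"
    if "?I t s" "t \<le> T" for t s
  proof -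
    have "s 0 = wt (iV + min t (length wV - iV)) (map bit_sym wV)" "s 23 = ctr (T - t) T"
      using that by (auto simp: qinv_def)
    then show "reads s 0 = (if t < length V then bit_sym (V ! t) else 0)" "reads s 23 = (if t < T then 1 else 0)"
      using V iV that(2) by (auto simp: reads_def min_def)
  qed
  have "\<exists>s'. run (query_loop M) s (stop T V * ((10 * m + 38) + 2) + 1) s' \<and> ?I (stop T V) s'"
    unfolding query_loop_def
  proof (rule run_While_inv[where I = ?I])
    fix t s assume t: "t < stop T V" and I: "?I t s"
    have tT: "t < T" using t stop_le[of T V] by simp
    note r = rd[OF I less_imp_le[OF tT]]
    have cond: "reads s 23 \<noteq> 0 \<and> reads s 0 \<noteq> 2"
      using r tT stop_before[OF t] by auto
    let ?s1 = "s(0 := wt (iV + min (Suc t) (length wV - iV)) (map bit_sym wV))"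
    have s0: "s 0 = wt (iV + min t (length wV - iV)) (map bit_sym wV)" using I by (simp add: qinv_def)
    have 1: "run (Cond (\<lambda>r. r 0 = 0) Skip (mv 0 GoRight)) s (1 + 1) ?s1"
    proof (rule run_Cond)
      assume "reads s 0 = 0"
      then have "length wV - iV \<le> t" using r(1) V by (auto split: if_splits)
      then have "?s1 = s" using s0 by (simp add: fun_upd_idem min_def)
      then show "run Skip s 1 ?s1" by (simp add: run_Skip)
    next
      assume "reads s 0 \<noteq> 0"
      then have "t < length wV - iV" using r(1) V by (auto split: if_splits)
      then show "run (mv 0 GoRight) s 1 ?s1" by (intro run_mv) (use s0 in \<open>auto simp: min_def\<close>)
    qed
    obtain i v where iv: "i \<le> length wA" "s 3 = wt i (map bit_sym wA)" "drop i wA = snd (qrun M c A t)"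
      "s 14 = fin v" using I by (auto simp: qinv_def)
    have e: "emb M 20 (fst (qrun M c A t)) ?s1"
    proof -
      obtain q ts where qt: "fst (qrun M c A t) = (q, ts)" by (cases "fst (qrun M c A t)")
      have e0: "emb M 20 (q, ts) s" using I qt by (simp add: qinv_def)
      then have b: "q < n_states M" "s 20 = cell_tape q" by (simp_all add: emb_def wf_conf_def)
      have "emb M 20 (q, ts) ?s1"
        by (rule emb_cong[OF e0 b(1)]) (use k3 in \<open>auto simp: b block_def\<close>)
      then show ?thesis using qt by simp
    qed
    obtain s2 where s2: "run (query_step M) ?s1 (10 * length wA + 30) s2"
      "emb M 20 (fst (qstep M (qrun M c A t))) s2"
      "\<exists>i\<le>length wA. s2 3 = wt i (map bit_sym wA) \<and> drop i wA = snd (qstep M (qrun M c A t))"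
      "\<exists>v. s2 14 = fin v" and s2f: "\<forall>i. i \<notin> {3, 14} \<union> block M 20 \<or> i = 23 \<longrightarrow> s2 i = ?s1 i"
    proof -
      have "?s1 3 = wt i (map bit_sym wA)" "?s1 14 = fin v" "?s1 2 = blank"
        using iv I by (simp_all add: qinv_def)
      from run_query_step[OF wf e iv(1) this(1) iv(3) this(2,3)] show thesis
        by - (erule exE, (erule conjE)+, rule that)
    qed
    obtain l where l: "T - t = Suc l" "T - Suc t = l" using tT by (metis Suc_diff_Suc)
    let ?s3 = "s2(23 := ctr (T - Suc t) T)"
    have 3: "run (mv 23 GoLeft) s2 1 ?s3"
      by (rule run_mv) (use s2f[rule_format, of 23] I l in \<open>auto simp: qinv_def\<close>)
    have "run (Cond (\<lambda>r. r 0 = 0) Skip (mv 0 GoRight) ;; query_step M ;; mv 23 GoLeft) s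
      ((1 + 1) + ((10 * length wA + 30) + 1 + 1) + 1) ?s3"
      by (rule run_Seq[OF 1 run_Seq[OF s2(1) 3]])
    then have 4: "run (Cond (\<lambda>r. r 0 = 0) Skip (mv 0 GoRight) ;; query_step M ;; mv 23 GoLeft) s (10 * m + 38) ?s3"
      by (rule run_mono) (use n in simp)
    have "?I (Suc t) ?s3"
      unfolding qinv_def qrun_Suc
    proof (intro conjI)
      show "emb M 20 (fst (qstep M (qrun M c A t))) ?s3"
      proof -
        obtain q ts where qt: "fst (qstep M (qrun M c A t)) = (q, ts)" by (cases "fst (qstep M (qrun M c A t))")
        have e2: "emb M 20 (q, ts) s2" using s2(2) qt by simp
        then have b: "q < n_states M" "s2 20 = cell_tape q" by (simp_all add: emb_def wf_conf_def)
        have "emb M 20 (q, ts) ?s3"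
          by (rule emb_cong[OF e2 b(1)]) (simp_all add: b k3)
        then show ?thesis using qt by simp
      qed
      show "?s3 0 = wt (iV + min (Suc t) (length wV - iV)) (map bit_sym wV)"
        using s2f[rule_format, of 0] by (simp add: block_def)
      show "\<exists>i\<le>length wA. ?s3 3 = wt i (map bit_sym wA) \<and> drop i wA = snd (qstep M (qrun M c A t))"
        using s2(3) by simp
      show "\<exists>v. ?s3 14 = fin v" using s2(4) by simp
      show "?s3 2 = blank" using s2f[rule_format, of 2] I by (simp add: block_def qinv_def)
      show "?s3 23 = ctr (T - Suc t) T" by simp
      show "\<forall>i. i \<notin> {0, 3, 14} \<union> block M 20 \<longrightarrow> ?s3 i = s0 i"
      proof (intro allI impI)
        fix i assume i: "i \<notin> {0, 3, 14} \<union> block M 20"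
        then have "i \<noteq> 23" using k3 by (auto simp: block_def)
        then have "?s3 i = ?s1 i" using s2f[rule_format, of i] i by auto
        also have "\<dots> = s i" using i by simp
        also have "\<dots> = s0 i" using I i unfolding qinv_def by blast
        finally show "?s3 i = s0 i" .
      qed
    qed
    with cond 4 show "(reads s 23 \<noteq> 0 \<and> reads s 0 \<noteq> 2) \<and>
      (\<exists>s'. run (Cond (\<lambda>r. r 0 = 0) Skip (mv 0 GoRight) ;; query_step M ;; mv 23 GoLeft) s (10 * m + 38) s' \<and>
         ?I (Suc t) s')" by blast
  next
    fix s assume I: "?I (stop T V) s"
    note r = rd[OF I stop_le]
    show "\<not> (reads s 23 \<noteq> 0 \<and> reads s 0 \<noteq> 2)"
    proof (cases "stop T V < T")
      case True
      then show ?thesis using r(1) stop_at[OF True] by simp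
    qed (use r(2) in simp)
  next
    show "?I 0 s" using inv by (simp add: qrun_def)
  qed
  moreover have "stop T V * ((10 * m + 38) + 2) + 1 \<le> n * (10 * m + 40) + 1"
    using mult_le_mono1[of "stop T V" n "10 * m + 40"] stop_le[of T V] n(1) by (simp add: add.commute)
  ultimately show ?thesis using run_mono by blast
qed

section \<open>The verifier\<close>

text \<open>The simulated machine may write further symbols. If the leading bits of the query tape
  are ended by one of these and not by a blank, the tape carries no word and the query has to be
  answered negatively.\<close>

lemma query_prefix:
  assumes "reach_tape T x"
  obtains w where "length w \<le> T" "\<And>i. i < length w \<Longrightarrow> snd x (int i) = bit_sym (w ! i)"
    "snd x (int (length w)) \<notin> {1, 2}"
proof -
  define P where "P = (\<lambda>i. snd x (int i) \<notin> {1, 2})"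
  have "snd x (int T) = 0" using assms unfolding reach_tape_def by (metis abs_of_nat less_irrefl)
  then have PT: "P T" by (simp add: P_def)
  define l where "l = (LEAST i. P i)"
  have l: "P l" "l \<le> T" unfolding l_def using PT by (auto intro: LeastI Least_le)
  have less: "\<not> P i" if "i < l" for i using that not_less_Least unfolding l_def by blast
  define w where "w = map (\<lambda>i. snd x (int i) = 2) [0..<l]"
  have "snd x (int i) = bit_sym (w ! i)" if "i < length w" for i
    using less[of i] that by (auto simp: w_def P_def bit_sym_def)
  moreover have "length w = l" by (simp add: w_def)
  ultimately show thesis using l that[of w] by (auto simp: P_def)
qed

lemma carries_iff:
  assumes "\<And>i. i < length w \<Longrightarrow> snd x (int i) = bit_sym (w ! i)" "snd x (int (length w)) \<notin> {1, 2}"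
  shows "carries x v \<longleftrightarrow> v = w \<and> snd x (int (length w)) = 0"
proof
  assume c: "carries x v"
  then have v: "\<And>i. i < length v \<Longrightarrow> snd x (int i) = bit_sym (v ! i)" "snd x (int (length v)) = 0"
    by (auto simp: carries_def)
  have "\<not> length v < length w" using assms(1)[of "length v"] v(2) by auto
  moreover have "\<not> length w < length v" using assms(2) v(1)[of "length w"] by (cases "v ! length w") auto
  ultimately have l: "length v = length w" by simp
  have "v ! i = w ! i" if "i < length v" for i
    using assms(1)[of i] v(1)[of i] that l inj_bit_sym by (metis injD)
  then have "v = w" using l by (intro nth_equalityI) auto
  then show "v = w \<and> snd x (int (length w)) = 0" using v(2) by simp
qed (use assms in \<open>auto simp: carries_def\<close>)

lemma carries_unique: "carries x v \<Longrightarrow> carries x w \<Longrightarrow> v = w"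
  using carries_iff[of w x v] by (auto simp: carries_def)

definition answer :: "bool list \<Rightarrow> bool" where
  "answer A \<longleftrightarrow> A \<noteq> [] \<and> hd A"

text \<open>The word \<open>y\<close> is the certificate offered against a negative answer.\<close>

definition chk :: "otm \<Rightarrow> bool list set \<Rightarrow> nat poly \<Rightarrow> config \<times> bool list \<Rightarrow> bool list \<Rightarrow> bool" where
  "chk M R p cA y \<longleftrightarrow> (fst (fst cA) = q_query M \<and> fst (fst cA) \<noteq> q_halt M \<longrightarrow>
     answer (snd cA) = (\<exists>w. carries (snd (fst cA) ! 2) w \<and>
       pair_word w (take (poly p (length w)) (if answer (snd cA) then fst (dec (tl (snd cA))) else y)) \<in> R))"

locale verifier =
  fixes M MA :: otm and tf tA p0 pa pp pA :: "nat poly" and R :: "bool list set"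
  assumes wf: "wf_otm M" and wfA: "wf_otm MA"
    and RA: "computes_in_time MA {} (\<lambda>x. [x \<in> R]) (poly tA)"
begin

abbreviation "BA \<equiv> 25 + n_tapes M"

text \<open>Tape 0 holds the input and, at its end, the universal word; tape 3 the guessed answers; the tapes
  from 20 on the simulation of \<open>M\<close> with its clock on tape 23; the tapes from \<open>BA\<close> on that of \<open>MA\<close>. A query is
  checked with its word on tape 16, the certificate on tape 15 and a claimed positive answer marked
  on tape 13.\<close>

definition "prep = decc 0 3 2 ;; rewind 3 ;; decc 3 4 2 ;; rewind 4 ;; decc 3 5 2 ;; rewind 5 ;;
   polyc p0 4 6 7 ;; pairc 4 5 6 8 ;; wordc pa pp 8 9 10 7 11 ;; gentree 11 12 25 ;; polyc tf 25 23 24 ;; boot M 20"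

text \<open>A positive answer must be confirmed by its certificate and a negative one must survive
  the challenge: in both cases claim and outcome have to coincide.\<close>

definition "judge = Cond (\<lambda>r. r (BA + 6) = 2)
   (Cond (\<lambda>r. r 13 = 0) (verdict False) (verdict True))
   (Cond (\<lambda>r. r 13 = 0) (verdict True) (verdict False))"

definition "getcert = Cond (\<lambda>r. r 3 = 2) (mv 3 GoRight ;; decc 3 15 2 ;; wr 13 1 Stay) (mv 0 GoRight ;; copy 0 15)"

definition "getquery = While (\<lambda>r. r 27 = 1 \<or> r 27 = 2) (emit_from 27 16 ;; mv 27 GoRight)"

text \<open>The simulation was interrupted with time left on the clock, whereas \<open>home\<close>
  expects the clock at its bottom.\<close>

definition "rewclock = While (\<lambda>r. r 23 \<noteq> 0) (mv 23 GoLeft)"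

definition "qchk = getcert ;; rewind 15 ;; rewclock ;; home 20 2 ;; getquery ;;
   Cond (\<lambda>r. r 27 = 0)
     (rewind 16 ;; polyc pA 16 17 7 ;; pairc 16 15 17 (BA + 5) ;; decide MA tA BA ;; judge)
     (Cond (\<lambda>r. r 13 = 0) (verdict True) (verdict False))"

text \<open>The output must be \<open>[False]\<close>, the encoding of the answer no: a symbol 1
  followed by a blank.\<close>

definition "outchk = home 20 1 ;; Cond (\<lambda>r. r 26 = 1)
   (mv 26 GoRight ;; Cond (\<lambda>r. r 26 = 0) (verdict True) (verdict False)) (verdict False)"

definition "verify = prep ;; query_loop M ;; Cond (\<lambda>r. r 23 = 0) outchk
   (Cond (\<lambda>r. r 20 = q_query M \<and> r 20 \<noteq> q_halt M) qchk (verdict True))"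

text \<open>The components of \<open>z = pair_word (pair_word X U) V\<close>, where \<open>U\<close>
  pairs the guessed word with the guessed answers. They are total, and \<open>vw\<close> cuts the
  guessed word to its admissible length, so every \<open>z\<close> describes some computation to be
  checked.\<close>

definition "xu z = fst (dec z)"
definition "vX z = fst (dec (xu z))"
definition "vu z = fst (dec (snd (dec (xu z))))"
definition "vA z = snd (dec (snd (dec (xu z))))"
definition "vV z = snd (dec z)"
definition "vw z = pair_word (vX z) (take (poly p0 (length (vX z))) (vu z))"
definition "vz z = (let b = tree_word pa pp (vw z) in enc_input (length b) (wtree b))"
definition "vT z = poly tf (length (vz z))"

lemma k3: "3 \<le> n_tapes M" "3 \<le> n_tapes MA" "3 \<le> n_syms M" "3 \<le> n_syms MA"
  using wf wfA by (auto simp: wf_otm_def)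

lemma wf_verify: "wf_cmd (30 + n_tapes M + n_tapes MA) (n_syms M + n_states M + n_syms MA + n_states MA) verify"
proof -
  have d: "wf_cmd (30 + n_tapes M + n_tapes MA) (n_syms M + n_states M + n_syms MA + n_states MA) (decide MA tA BA)"
    by (rule wf_decide[OF wfA]) auto
  have q: "wf_cmd (30 + n_tapes M + n_tapes MA) (n_syms M + n_states M + n_syms MA + n_states MA) (query_loop M)"
    by (rule wf_query_loop[OF wf]) (use k3 in auto)
  have b: "wf_cmd (30 + n_tapes M + n_tapes MA) (n_syms M + n_states M + n_syms MA + n_states MA) (boot M 20)"
    by (rule wf_boot[OF wf]) (use k3 in auto)
  have l: "loc (30 + n_tapes M + n_tapes MA) (\<lambda>r. r 20 = q_query M \<and> r 20 \<noteq> q_halt M)"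
    "loc (30 + n_tapes M + n_tapes MA) (\<lambda>r. r 27 = 1 \<or> r 27 = 2)"
    using k3 by (auto simp: loc_def)
  have p: "loc (30 + n_tapes M + n_tapes MA) (\<lambda>r. r i \<noteq> v)" if "i < 30" for i v
    by (rule loc_neq) (use that in simp)
  show ?thesis
    unfolding verify_def prep_def qchk_def outchk_def getcert_def getquery_def rewclock_def judge_def
      wf_cmd.simps
    using d q b l p k3
    by (simp only: simp_thms) (simp add: wf_decc wf_rewind wf_polyc wf_pairc wf_wordc wf_gentree wf_home
        wf_mv wf_wr wf_copy wf_emit_from wf_verdict loc_eq loc_pos)
qed

lemma sizes: "length (xu z) \<le> length z" "length (vX z) \<le> length z" "length (vu z) \<le> length z"
    "length (vV z) \<le> length z" "length (vw z) \<le> 3 * length z + 2"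
proof -
  show 1: "length (xu z) \<le> length z" using dec_length[of z] by (simp add: xu_def)
  show 2: "length (vX z) \<le> length z" using dec_length[of "xu z"] 1 by (simp add: vX_def)
  show 3: "length (vu z) \<le> length z"
    using dec_length[of "snd (dec (xu z))"] dec_length[of "xu z"] 1 by (simp add: vu_def)
  show "length (vV z) \<le> length z" using dec_length[of z] by (simp add: vV_def)
  show "length (vw z) \<le> 3 * length z + 2" using 2 3 by (simp add: vw_def length_pair_word)
qed

text \<open>Bounds on the stored word and on the encoded tree in terms of the input length
  \<open>n\<close>; \<open>3 * n + 2\<close> bounds a pair of two words of length at most
  \<open>n\<close>.\<close>

definition "wlen n = poly pa (3 * n + 2) + 1 + (2 * (3 * n + 2) + 2 + poly pp (3 * n + 2))"
definition "zlen n = wlen n + 3 + wlen n * (wlen n + 4)"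

lemma polyfun_3: "polyfun (\<lambda>n. 3 * n + 2)"
  by (intro polyfun_intros)

lemma polyfun_wlen: "polyfun wlen"
  unfolding wlen_def[abs_def] by (intro polyfun_intros polyfun_compose[OF polyfun_poly polyfun_3])

lemma polyfun_zlen: "polyfun zlen"
  unfolding zlen_def[abs_def] by (intro polyfun_intros polyfun_wlen)

lemma length_vword: "length z \<le> n \<Longrightarrow> length (tree_word pa pp (vw z)) \<le> wlen n"
proof -
  assume "length z \<le> n"
  then have "length (vw z) \<le> 3 * n + 2" using sizes(5)[of z] by simp
  with poly_nat_mono[OF this] show ?thesis unfolding length_tree_word wlen_def
    by (intro add_mono mult_mono) auto
qed

lemma length_vz: "length z \<le> n \<Longrightarrow> length (vz z) \<le> zlen n"
proof -
  assume "length z \<le> n"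
  from length_vword[OF this] show ?thesis unfolding vz_def Let_def zlen_def
    using length_enc_wtree[of "tree_word pa pp (vw z)"]
    by (meson add_mono le_trans mult_mono order_refl le0)
qed

lemma run_prep:
  obtains F where "polyfun F" "\<And>z n. length z \<le> n \<Longrightarrow> \<exists>s. run prep (init_store z) (F n) s \<and>
    emb M 20 (init_config M (vz z)) s \<and> s 0 = wt (length z - length (vV z)) (map bit_sym z) \<and>
    (\<exists>i\<le>length (xu z). s 3 = wt i (map bit_sym (xu z)) \<and> drop i (xu z) = vA z) \<and>
    s 23 = ctr (vT z) (vT z) \<and> s 2 = blank \<and> s 14 = blank \<and>
    (\<forall>i. i \<in> {1, 7, 13, 15, 16, 17} \<or> BA \<le> i \<longrightarrow> s i = blank)"
proof -
  obtain F0 where F0: "polyfun F0" "\<And>s a c d w n. s a = wt 0 w \<Longrightarrow> 0 \<notin> set w \<Longrightarrow> length w \<le> n \<Longrightarrow>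
     s c = blank \<Longrightarrow> s d = blank \<Longrightarrow> distinct [a, c, d] \<Longrightarrow>
     run (polyc p0 a c d) s (F0 n) (s(c := ctr (poly p0 (length w)) (poly p0 (length w))))"
    by (rule run_polyc[where p = p0]) (rule that)
  obtain Ft where Ft: "polyfun Ft" "\<And>s a c d w n. s a = wt 0 w \<Longrightarrow> 0 \<notin> set w \<Longrightarrow> length w \<le> n \<Longrightarrow>
     s c = blank \<Longrightarrow> s d = blank \<Longrightarrow> distinct [a, c, d] \<Longrightarrow>
     run (polyc tf a c d) s (Ft n) (s(c := ctr (poly tf (length w)) (poly tf (length w))))"
    by (rule run_polyc[where p = tf]) (rule that)
  obtain Fw where Fw: "polyfun Fw" "\<And>s a c d t b w n. s a = wt 0 (map bit_sym w) \<Longrightarrow> s c = blank \<Longrightarrow> s d = blank \<Longrightarrow>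
    s t = blank \<Longrightarrow> s b = blank \<Longrightarrow> distinct [a, b, c, d, t] \<Longrightarrow> length w \<le> n \<Longrightarrow>
    \<exists>s'. run (wordc pa pp a c d t b) s (Fw n) s' \<and> s' b = wt 0 (map bit_sym (tree_word pa pp w)) \<and>
      (\<forall>i. i \<notin> {a, b, c, d} \<longrightarrow> s' i = s i)"
    by (rule run_wordc[where pa = pa and pp = pp]) (rule that)
  define G where "G = (\<lambda>n. (10 * n + 17) + ((3 * n + 6) + ((10 * n + 17) + ((3 * n + 6) + ((10 * n + 17) +
     ((3 * n + 6) + (F0 n + ((21 * (n + poly p0 n) + 20) + (Fw (3 * n + 2) + (20 * (wlen n + 4) * (wlen n + 4) +
     (Ft (zlen n) + 5 + 1) + 1) + 1) + 1) + 1) + 1) + 1) + 1) + 1) + 1) + 1)"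
  have G: "polyfun G" unfolding G_def
    by (intro polyfun_intros polyfun_poly F0(1) polyfun_compose[OF Fw(1) polyfun_3] polyfun_wlen
        polyfun_compose[OF Ft(1) polyfun_zlen])
  have "\<exists>s. run prep (init_store z) (G n) s \<and>
    emb M 20 (init_config M (vz z)) s \<and> s 0 = wt (length z - length (vV z)) (map bit_sym z) \<and>
    (\<exists>i\<le>length (xu z). s 3 = wt i (map bit_sym (xu z)) \<and> drop i (xu z) = vA z) \<and>
    s 23 = ctr (vT z) (vT z) \<and> s 2 = blank \<and> s 14 = blank \<and>
    (\<forall>i. i \<in> {1, 7, 13, 15, 16, 17} \<or> BA \<le> i \<longrightarrow> s i = blank)" if n: "length z \<le> n" for z n
  proof -
    let ?xu = "map bit_sym (xu z)" and ?X = "map bit_sym (vX z)" and ?u = "map bit_sym (vu z)"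
    define U where "U = snd (dec (xu z))"
    note sz = sizes[of z] n
    let ?s0 = "init_store z"
    let ?s1 = "?s0(0 := wt (length (map bit_sym z) - length (map bit_sym (vV z))) (map bit_sym z), 3 := fin ([] @ ?xu))"
    have 1: "run (decc 0 3 2) ?s0 (10 * n + 17) ?s1"
      by (rule run_decc[where i = 0 and u = ?xu and r = "map bit_sym (vV z)" and w = "map bit_sym z" and v = "[]"])
        (use sz bit_sym_pos[of z] in \<open>auto simp: init_store_def blank_wt dec_bits xu_def vV_def\<close>)
    let ?s2 = "?s1(3 := wt 0 ?xu)"
    have 2: "run (rewind 3) ?s1 (3 * n + 6) ?s2"
      by (rule run_rewind[where i = "length ?xu" and w = ?xu]) (use sz bit_sym_pos[of "xu z"] in auto)
    have d3: "dec (drop 0 ?xu) = (?X, map bit_sym U)" by (simp add: dec_bits U_def vX_def)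
    let ?i3 = "length ?xu - length (map bit_sym U)"
    let ?s3 = "?s2(3 := wt ?i3 ?xu, 4 := fin ([] @ ?X))"
    have 3: "run (decc 3 4 2) ?s2 (10 * n + 17) ?s3"
      by (rule run_decc[where i = 0 and u = ?X and r = "map bit_sym U" and w = ?xu and v = "[]"])
        (use sz bit_sym_pos[of "xu z"] d3 in \<open>auto simp: init_store_def blank_wt\<close>)
    let ?s4 = "?s3(4 := wt 0 ?X)"
    have 4: "run (rewind 4) ?s3 (3 * n + 6) ?s4"
      by (rule run_rewind[where i = "length ?X" and w = ?X]) (use sz bit_sym_pos[of "vX z"] in auto)
    have U: "?i3 \<le> length ?xu" "drop ?i3 (xu z) = U"
      using drop_dec[of 0 "xu z" U] by (simp_all add: U_def)
    have d5: "dec (drop ?i3 ?xu) = (?u, map bit_sym (vA z))"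
      unfolding drop_map U(2) dec_bits by (simp add: U_def vu_def vA_def)
    let ?i5 = "length ?xu - length (map bit_sym (vA z))"
    let ?s5 = "?s4(3 := wt ?i5 ?xu, 5 := fin ([] @ ?u))"
    have 5: "run (decc 3 5 2) ?s4 (10 * n + 17) ?s5"
      by (rule run_decc[where i = ?i3 and u = ?u and r = "map bit_sym (vA z)" and w = ?xu and v = "[]"])
        (use sz bit_sym_pos[of "xu z"] d5 U(1) in \<open>auto simp: init_store_def blank_wt\<close>)
    have A: "length (xu z) - length (vA z) \<le> length (xu z) \<and> drop (length (xu z) - length (vA z)) (xu z) = vA z"
      by (rule drop_dec[of ?i3]) (use U in \<open>simp_all add: vA_def U_def\<close>)
    let ?s6 = "?s5(5 := wt 0 ?u)"
    have 6: "run (rewind 5) ?s5 (3 * n + 6) ?s6"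
      by (rule run_rewind[where i = "length ?u" and w = ?u]) (use sz bit_sym_pos[of "vu z"] in auto)
    let ?P = "poly p0 (length ?X)"
    have P: "?P \<le> poly p0 n" by (rule poly_nat_mono) (use sz in simp)
    let ?s7 = "?s6(6 := ctr ?P ?P)"
    have 7: "run (polyc p0 4 6 7) ?s6 (F0 n) ?s7"
      by (rule F0(2)) (use sz bit_sym_pos[of "vX z"] in \<open>auto simp: init_store_def\<close>)
    have "\<exists>s'. run (pairc 4 5 6 8) ?s7 (21 * (n + poly p0 n) + 20) s' \<and> s' 8 = wt 0 (map bit_sym (vw z)) \<and>
      (\<forall>i. i \<notin> {4, 8, 5, 6} \<longrightarrow> s' i = ?s7 i)"
      unfolding vw_def
      by (rule run_pairc[where m = ?P])
        (use sz P bit_sym_pos[of "vu z"] prefix_word_wt[of ?u 0 ?P] in \<open>auto simp: init_store_def take_map\<close>)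
    then obtain s8 where 8: "run (pairc 4 5 6 8) ?s7 (21 * (n + poly p0 n) + 20) s8"
      "s8 8 = wt 0 (map bit_sym (vw z))" "\<forall>i. i \<notin> {4, 8, 5, 6} \<longrightarrow> s8 i = ?s7 i" by blast
    have s8b: "s8 9 = blank" "s8 10 = blank" "s8 7 = blank" "s8 11 = blank" "s8 12 = blank"
      using 8(3) by (simp_all add: init_store_def)
    have w3: "length (vw z) \<le> 3 * n + 2" using sz by linarith
    have "\<exists>s'. run (wordc pa pp 8 9 10 7 11) s8 (Fw (3 * n + 2)) s' \<and>
      s' 11 = wt 0 (map bit_sym (tree_word pa pp (vw z))) \<and> (\<forall>i. i \<notin> {8, 11, 9, 10} \<longrightarrow> s' i = s8 i)"
      by (rule Fw(2)) (use 8(2) s8b w3 in auto)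
    then obtain s9 where 9: "run (wordc pa pp 8 9 10 7 11) s8 (Fw (3 * n + 2)) s9"
      "s9 11 = wt 0 (map bit_sym (tree_word pa pp (vw z)))" "\<forall>i. i \<notin> {8, 11, 9, 10} \<longrightarrow> s9 i = s8 i" by blast
    have s9b: "s9 12 = blank" "s9 25 = blank" using 9(3) 8(3) by (simp_all add: init_store_def)
    have "\<exists>s'. run (gentree 11 12 25) s9 (20 * (wlen n + 4) * (wlen n + 4)) s' \<and>
      s' 25 = wt 0 (map bit_sym (enc_input (length (tree_word pa pp (vw z))) (wtree (tree_word pa pp (vw z))))) \<and>
      (\<forall>i. i \<notin> {11, 12, 25} \<longrightarrow> s' i = s9 i)"
      by (rule run_gentree) (use 9(2) s9b length_vword[OF n] in auto)
    then obtain s10 where 10: "run (gentree 11 12 25) s9 (20 * (wlen n + 4) * (wlen n + 4)) s10"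
      "s10 25 = wt 0 (map bit_sym (vz z))" "\<forall>i. i \<notin> {11, 12, 25} \<longrightarrow> s10 i = s9 i"
      unfolding vz_def Let_def by blast
    have fr: "s10 i = ?s7 i" if "i \<notin> {4, 5, 6, 8, 9, 10, 11, 12, 25}" for i
      using 8(3) 9(3) 10(3) that by simp
    let ?s11 = "s10(23 := ctr (poly tf (length (map bit_sym (vz z)))) (poly tf (length (map bit_sym (vz z)))))"
    have 11: "run (polyc tf 25 23 24) s10 (Ft (zlen n)) ?s11"
      by (rule Ft(2)) (use 10(2) bit_sym_pos[of "vz z"] length_vz[OF n] fr[of 23] fr[of 24] in \<open>auto simp: init_store_def\<close>)
    have bl: "s10 i = blank" if "i \<in> {1, 2, 7, 13, 14, 15, 16, 17} \<or> (20 \<le> i \<and> i \<noteq> 25)" for i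
      using fr[of i] that by (auto simp: init_store_def)
    have "\<exists>s'. run (boot M 20) ?s11 5 s' \<and> emb M 20 (init_config M (vz z)) s' \<and>
      (\<forall>i. i \<notin> {20, 20 + 1, 20 + 2} \<longrightarrow> s' i = ?s11 i)"
    proof (rule run_boot[OF wf])
      show "?s11 (20 + 5) = tape_of (vz z)" using 10(2) by (simp add: tape_of_wt)
      fix i assume i: "i \<in> block M 20" "i \<noteq> 20 + 3" "i \<noteq> 20 + 5"
      then show "?s11 i = blank" using bl[of i] by (auto simp: block_def)
    qed
    then obtain s12 where 12: "run (boot M 20) ?s11 5 s12" "emb M 20 (init_config M (vz z)) s12"
      "\<forall>i. i \<notin> {20, 20 + 1, 20 + 2} \<longrightarrow> s12 i = ?s11 i" by blast
    have fr2: "s12 i = s10 i" if "i \<notin> {20, 21, 22, 23}" for i using 12(3) that by simp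
    have "run prep (init_store z) (G n) s12" unfolding prep_def G_def
      by (rule run_Seq[OF 1 run_Seq[OF 2 run_Seq[OF 3 run_Seq[OF 4 run_Seq[OF 5 run_Seq[OF 6 run_Seq[OF 7
            run_Seq[OF 8(1) run_Seq[OF 9(1) run_Seq[OF 10(1) run_Seq[OF 11 12(1)]]]]]]]]]]])
    moreover have "s12 0 = wt (length z - length (vV z)) (map bit_sym z)" using fr2[of 0] fr[of 0] by simp
    moreover have "s12 3 = wt (length (xu z) - length (vA z)) ?xu" using fr2[of 3] fr[of 3] by simp
    moreover have "s12 23 = ctr (vT z) (vT z)" using 12(3) by (simp add: vT_def)
    moreover have "s12 2 = blank" "s12 14 = blank" using fr2[of 2] fr2[of 14] bl[of 2] bl[of 14] by simp_all
    moreover have "\<forall>i. i \<in> {1, 7, 13, 15, 16, 17} \<or> BA \<le> i \<longrightarrow> s12 i = blank"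
    proof (intro allI impI)
      fix i assume "i \<in> {1, 7, 13, 15, 16, 17} \<or> BA \<le> i"
      moreover have "3 \<le> n_tapes M" by (rule k3)
      ultimately have "i \<notin> {20, 21, 22, 23}" "i \<in> {1, 2, 7, 13, 14, 15, 16, 17} \<or> (20 \<le> i \<and> i \<noteq> 25)" by auto
      then show "s12 i = blank" using fr2[of i] bl[of i] by simp
    qed
    ultimately show ?thesis using 12(2) A by blast
  qed
  then show thesis by (rule that[OF G])
qed

lemma run_rewclock:
  assumes "s 23 = ctr m T" "m \<le> T" "T \<le> n" "s' = s(23 := ctr 0 T)"
  shows "run rewclock s (3 * n + 1) s'"
proof -
  define S where "S = (\<lambda>k. s(23 := ctr (m - k) T))"
  have "run rewclock s (m * (1 + 2) + 1) s'" unfolding rewclock_def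
  proof (rule run_While_iter[where S = S])
    fix k assume k: "k < m"
    then obtain l where l: "m - k = Suc l" "m - Suc k = l" by (metis Suc_diff_Suc)
    have "run (mv 23 GoLeft) (S k) 1 (S (Suc k))" by (rule run_mv) (use l in \<open>simp add: S_def\<close>)
    moreover have "1 \<le> m - k \<and> m - k \<le> T" using k assms(2) by auto
    then have "reads (S k) 23 \<noteq> 0" by (simp add: S_def reads_def)
    ultimately show "reads (S k) 23 \<noteq> 0 \<and> run (mv 23 GoLeft) (S k) 1 (S (Suc k))" by simp
  qed (use assms in \<open>auto simp: S_def reads_def\<close>)
  then show ?thesis by (rule run_mono) (use assms in simp)
qed

lemma run_getquery:
  assumes "s 27 = (0, c)" "s 16 = blank" "\<And>i. i < length w \<Longrightarrow> c (int i) = bit_sym (w ! i)"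
    "c (int (length w)) \<notin> {1, 2}" "length w \<le> n" "s' = s(27 := (int (length w), c), 16 := fin (map bit_sym w))"
  shows "run getquery s (5 * n + 1) s'"
proof -
  define S where "S = (\<lambda>k. s(27 := (int k, c), 16 := fin (map bit_sym (take k w))))"
  have "run getquery s (length w * (3 + 2) + 1) s'" unfolding getquery_def
  proof (rule run_While_iter[where S = S])
    fix k assume k: "k < length w"
    have "run (emit_from 27 16 ;; mv 27 GoRight) (S k) (1 + 1 + 1) (S (Suc k))"
      by (rule run_Seq[OF run_emit_from[OF refl] run_mv])
        (use k assms(3)[OF k] in \<open>auto simp: S_def fun_eq_iff shift_pair take_Suc_conv_app_nth\<close>)
    moreover have "reads (S k) 27 = 1 \<or> reads (S k) 27 = 2"
      using assms(3)[OF k] by (simp add: S_def reads_def bit_sym_def)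
    ultimately show "(reads (S k) 27 = 1 \<or> reads (S k) 27 = 2) \<and>
       run (emit_from 27 16 ;; mv 27 GoRight) (S k) 3 (S (Suc k))" by (simp add: numeral_3_eq_3)
  qed (use assms in \<open>auto simp: S_def reads_def blank_wt fun_eq_iff\<close>)
  then show ?thesis by (rule run_mono) (use assms in simp)
qed

lemma run_getcert:
  assumes "s 0 = wt j (map bit_sym wV)" "j < length wV" "s 3 = wt i (map bit_sym wA)" "i \<le> length wA"
    "s 2 = blank" "s 13 = blank" "s 15 = blank" "length wA \<le> n" "length wV \<le> n"
    "A = drop i wA" "y = (if answer A then fst (dec (tl A)) else drop (Suc j) wV)"
  shows "\<exists>s'. run getcert s (10 * n + 25) s' \<and> s' 15 = fin (map bit_sym y) \<and>
     s' 13 = (if answer A then raised else blank) \<and> (\<forall>i. i \<notin> {0, 3, 13, 15} \<longrightarrow> s' i = s i)"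
proof (cases "answer A")
  case True
  then have il: "i < length wA" "wA ! i" using hd_drop_conv_nth[of i wA] by (auto simp: answer_def assms(10))
  then have tl: "tl A = drop (Suc i) wA" unfolding assms(10) by (simp add: drop_Suc tl_drop)
  define r where "r = map bit_sym (snd (dec (tl A)))"
  have y: "y = fst (dec (tl A))" using True assms(11) by simp
  have yl: "length y \<le> n" using dec_length[of "tl A"] tl assms(8) by (simp add: y)
  have d: "dec (drop (Suc i) (map bit_sym wA)) = (map bit_sym y, r)"
    unfolding drop_map dec_bits y r_def tl by simp
  let ?s1 = "s(3 := wt (Suc i) (map bit_sym wA))"
  have 1: "run (mv 3 GoRight) s 1 ?s1" by (rule run_mv) (use assms in auto)
  let ?s2 = "?s1(3 := wt (length (map bit_sym wA) - length r) (map bit_sym wA), 15 := fin ([] @ map bit_sym y))"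
  have 2: "run (decc 3 15 2) ?s1 (10 * n + 17) ?s2"
    by (rule run_decc[where i = "Suc i" and u = "map bit_sym y" and r = r and v = "[]"])
      (use assms(5,7) il d yl bit_sym_pos[of wA] in \<open>auto simp: blank_wt\<close>)
  let ?s3 = "?s2(13 := raised)"
  have 3: "run (wr 13 1 Stay) ?s2 1 ?s3" by (rule run_wr) (use assms(6) in simp)
  have "run getcert s ((1 + ((10 * n + 17) + 1 + 1) + 1) + 1) ?s3" unfolding getcert_def
    by (rule run_Cond, rule run_Seq[OF 1 run_Seq[OF 2 3]]) (use assms(3) il in \<open>auto simp: reads_def\<close>)
  then have "run getcert s (10 * n + 25) ?s3" by (rule run_mono) simp
  then show ?thesis using True by (intro exI[of _ ?s3]) auto
next
  case False
  have y: "y = drop (Suc j) wV" using False assms(11) by simp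
  have n2: "reads s 3 \<noteq> 2"
    using False assms(3,4,10) hd_drop_conv_nth[of i wA]
    by (cases "i < length wA") (auto simp: reads_def bit_sym_def answer_def)
  let ?s1 = "s(0 := wt (Suc j) (map bit_sym wV))"
  have 1: "run (mv 0 GoRight) s 1 ?s1" by (rule run_mv) (use assms in auto)
  let ?s2 = "?s1(0 := fin (map bit_sym wV), 15 := fin ([] @ drop (Suc j) (map bit_sym wV)))"
  have 2: "run (copy 0 15) ?s1 (5 * n + 1) ?s2"
    by (rule run_copy[where i = "Suc j" and w = "map bit_sym wV" and v = "[]"])
      (use assms(2,7,9) bit_sym_pos[of wV] in \<open>auto simp: blank_wt\<close>)
  have "run getcert s ((1 + (5 * n + 1) + 1) + 1) ?s2" unfolding getcert_def
    by (rule run_Cond) (use n2 run_Seq[OF 1 2] in auto)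
  then have "run getcert s (10 * n + 25) ?s2" by (rule run_mono) simp
  then show ?thesis using False assms(6) by (intro exI[of _ ?s2]) (auto simp: y drop_map)
qed

lemma run_judge:
  assumes "s 1 = blank" "read_sym (s 13) = (if b then 1 else 0)" "read_sym (s (BA + 6)) = (if c then 2 else 1)"
  shows "run judge s 3 (s(1 := cell_tape (bit_sym (b = c))))"
proof -
  have r: "reads s 13 = (if b then 1 else 0)" "reads s (BA + 6) = (if c then 2 else 1)"
    using assms by (simp_all add: reads_def)
  have "run judge s ((1 + 1) + 1) (s(1 := cell_tape (bit_sym (b = c))))"
    unfolding judge_def
    by (rule run_Cond; rule run_Cond; rule run_verdict) (use assms(1) r in \<open>auto split: if_splits\<close>)
  then show ?thesis by (rule run_mono) simp
qed

lemma run_qchk: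
  obtains F where "polyfun F" "\<And>s cA wA wV i j T m n. emb M 20 (fst cA) s \<Longrightarrow>
    fst (fst cA) = q_query M \<and> fst (fst cA) \<noteq> q_halt M \<Longrightarrow>
    s 0 = wt j (map bit_sym wV) \<Longrightarrow> j < length wV \<Longrightarrow> s 3 = wt i (map bit_sym wA) \<Longrightarrow> i \<le> length wA \<Longrightarrow>
    drop i wA = snd cA \<Longrightarrow> s 2 = blank \<Longrightarrow> s 23 = ctr m T \<Longrightarrow> m \<le> T \<Longrightarrow>
    \<forall>i. i \<in> {1, 7, 13, 15, 16, 17} \<or> BA \<le> i \<longrightarrow> s i = blank \<Longrightarrow>
    reach_tape T (snd (fst cA) ! 2) \<Longrightarrow> length wA \<le> n \<Longrightarrow> length wV \<le> n \<Longrightarrow> T \<le> n \<Longrightarrow>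
    \<exists>s'. run qchk s (F n) s' \<and> s' 1 = cell_tape (bit_sym (chk M R pA cA (drop (Suc j) wV)))"
proof -
  obtain Fp where Fp: "polyfun Fp" "\<And>s a c d w n. s a = wt 0 w \<Longrightarrow> 0 \<notin> set w \<Longrightarrow> length w \<le> n \<Longrightarrow>
     s c = blank \<Longrightarrow> s d = blank \<Longrightarrow> distinct [a, c, d] \<Longrightarrow>
     run (polyc pA a c d) s (Fp n) (s(c := ctr (poly pA (length w)) (poly pA (length w))))"
    by (rule run_polyc[where p = pA]) (rule that)
  obtain FA where FA: "polyfun FA" "\<And>B s x n. s (B + 5) = wt 0 (map bit_sym x) \<Longrightarrow> length x \<le> n \<Longrightarrow>
     \<forall>i\<in>block MA B. i \<noteq> B + 5 \<longrightarrow> s i = blank \<Longrightarrow>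
     \<exists>s'. run (decide MA tA B) s (FA n) s' \<and> read_sym (s' (B + 6)) = (if x \<in> R then 2 else 1) \<and>
        (\<forall>i. i \<notin> block MA B \<longrightarrow> s' i = s i)"
    by (rule run_decide[OF wfA RA]) (rule that)
  define Z where "Z = (\<lambda>n :: nat. 3 * n + 2)"
  define G where "G = (\<lambda>n. (10 * n + 25) + ((3 * n + 6) + ((3 * n + 1) + ((11 * n + 6) + ((5 * n + 1) +
    (((3 * n + 6) + (Fp n + ((21 * (n + poly pA n) + 20) + (FA (Z n) + 3 + 1) + 1) + 1) + 1) + 1) + 1) + 1) + 1) + 1) + 1)"
  have G: "polyfun G" unfolding G_def Z_def
    by (intro polyfun_intros polyfun_poly Fp(1) polyfun_compose[OF FA(1) polyfun_3])
  have "\<exists>s'. run qchk s (G n) s' \<and> s' 1 = cell_tape (bit_sym (chk M R pA cA (drop (Suc j) wV)))"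
    if h: "emb M 20 (fst cA) s" "fst (fst cA) = q_query M \<and> fst (fst cA) \<noteq> q_halt M"
    "s 0 = wt j (map bit_sym wV)" "j < length wV" "s 3 = wt i (map bit_sym wA)" "i \<le> length wA"
    "drop i wA = snd cA" "s 2 = blank" "s 23 = ctr m T" "m \<le> T"
    "\<forall>i. i \<in> {1, 7, 13, 15, 16, 17} \<or> BA \<le> i \<longrightarrow> s i = blank"
    "reach_tape T (snd (fst cA) ! 2)" "length wA \<le> n" "length wV \<le> n" "T \<le> n"
    for s cA wA wV i j T m n
  proof -
    define x where "x = snd (fst cA) ! 2"
    define A where "A = snd cA"
    define y where "y = (if answer A then fst (dec (tl A)) else drop (Suc j) wV)"
    have yl: "length y \<le> n"
    proof (cases "answer A")
      case True
      have "length A \<le> n" using h(7,13) A_def length_drop[of i wA] by simp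
      then show ?thesis using True dec_length[of "tl A"] by (simp add: y_def)
    qed (use h(14) in \<open>simp add: y_def\<close>)
    have bl: "s i = blank" if "i \<in> {1, 7, 13, 15, 16, 17} \<or> BA \<le> i" for i using h(11) that by blast
    obtain s1 where 1: "run getcert s (10 * n + 25) s1" "s1 15 = fin (map bit_sym y)"
      "s1 13 = (if answer A then raised else blank)" "\<forall>i. i \<notin> {0, 3, 13, 15} \<longrightarrow> s1 i = s i"
      using run_getcert[OF h(3-6,8) bl[of 13] bl[of 15] h(13,14) _ y_def] h(7) by (auto simp: A_def)
    let ?s2 = "s1(15 := wt 0 (map bit_sym y))"
    have 2: "run (rewind 15) s1 (3 * n + 6) ?s2"
      by (rule run_rewind[where i = "length (map bit_sym y)" and w = "map bit_sym y"])
        (use 1(2) yl bit_sym_pos[of y] in simp_all)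
    let ?s3 = "?s2(23 := ctr 0 T)"
    have 3: "run rewclock ?s2 (3 * n + 1) ?s3"
      by (rule run_rewclock[where m = m]) (use 1(4) h(9,10,15) in auto)
    have x27: "s 27 = x" "s 22 = shadow (fst x)"
    proof -
      have "\<forall>j<n_tapes M. s (20 + 5 + j) = snd (fst cA) ! j" using h(1) unfolding emb_def by blast
      from this[rule_format, of 2] show "s 27 = x" using k3 by (simp add: x_def)
      show "s 22 = shadow (fst x)" using h(1) by (simp add: emb_def x_def)
    qed
    let ?s4 = "?s3(20 + 3 := ctr (Suc T) T, 20 + 2 := shadow 0, 20 + 5 + 2 := (0, snd x))"
    have 4: "run (home 20 2) ?s3 (11 * n + 6) ?s4"
      by (rule run_home[where h = "fst x"]) (use 1(4) x27 h(12,15) in \<open>auto simp: reach_tape_def x_def\<close>)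
    obtain w where w: "length w \<le> T" "\<And>i. i < length w \<Longrightarrow> snd x (int i) = bit_sym (w ! i)"
      "snd x (int (length w)) \<notin> {1, 2}" by (rule query_prefix[OF h(12)[folded x_def]]) (rule that)
    have cw: "carries x v \<longleftrightarrow> v = w \<and> snd x (int (length w)) = 0" for v by (rule carries_iff[OF w(2,3)])
    let ?s5 = "?s4(27 := (int (length w), snd x), 16 := fin (map bit_sym w))"
    have 5: "run getquery ?s4 (5 * n + 1) ?s5"
      by (rule run_getquery[where w = w, OF _ _ w(2,3)]) (use 1(4) bl[of 16] w(1) h(15) in auto)
    have wn: "length w \<le> n" using w(1) h(15) by simp
    let ?b = "chk M R pA cA (drop (Suc j) wV)"
    have fr5: "?s5 i = s i" if "i \<in> {1, 7, 17} \<or> BA \<le> i" for i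
    proof -
      have "i \<notin> {0, 3, 13, 15, 22, 23, 27, 16}" using that k3 by auto
      then show ?thesis using 1(4) by simp
    qed
    have s13: "?s5 13 = (if answer A then raised else blank)" using 1(3) by simp
    have 6: "\<exists>s'. run (Cond (\<lambda>r. r 27 = 0)
       (rewind 16 ;; polyc pA 16 17 7 ;; pairc 16 15 17 (BA + 5) ;; decide MA tA BA ;; judge)
       (Cond (\<lambda>r. r 13 = 0) (verdict True) (verdict False))) ?s5
       (((3 * n + 6) + (Fp n + ((21 * (n + poly pA n) + 20) + (FA (Z n) + 3 + 1) + 1) + 1) + 1) + 1) s' \<and>
       s' 1 = cell_tape (bit_sym ?b)"
    proof (cases "snd x (int (length w)) = 0")
      case True
      let ?s6 = "?s5(16 := wt 0 (map bit_sym w))"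
      have 6: "run (rewind 16) ?s5 (3 * n + 6) ?s6"
        by (rule run_rewind[where i = "length (map bit_sym w)" and w = "map bit_sym w"])
            (use wn bit_sym_pos[of w] in simp_all)
      let ?P = "poly pA (length (map bit_sym w))"
      have P: "?P \<le> poly pA n" by (rule poly_nat_mono) (use wn in simp)
      let ?s7 = "?s6(17 := ctr ?P ?P)"
      have 7: "run (polyc pA 16 17 7) ?s6 (Fp n) ?s7"
        by (rule Fp(2)) (use wn bit_sym_pos[of w] fr5[of 17] fr5[of 7] bl[of 17] bl[of 7] in auto)
      define v where "v = pair_word w (take ?P y)"
      have s7I: "?s7 (BA + 5) = blank" using fr5[of "BA + 5"] bl[of "BA + 5"] by simp
      have s715: "?s7 15 = wt 0 (map bit_sym y)" by simp
      have "\<exists>s'. run (pairc 16 15 17 (BA + 5)) ?s7 (21 * (n + poly pA n) + 20) s' \<and>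
        s' (BA + 5) = wt 0 (map bit_sym v) \<and> (\<forall>i. i \<notin> {16, BA + 5, 15, 17} \<longrightarrow> s' i = ?s7 i)"
        unfolding v_def
      proof (rule run_pairc[where m = ?P])
        show "prefix_word (?s7 15) ?P = map bit_sym (take ?P y)"
          unfolding s715 using prefix_word_wt[OF bit_sym_pos[of y], of 0 ?P] by (simp add: take_map)
      qed (use s7I wn P in auto)
      then obtain s8 where 8: "run (pairc 16 15 17 (BA + 5)) ?s7 (21 * (n + poly pA n) + 20) s8"
        "s8 (BA + 5) = wt 0 (map bit_sym v)" "\<forall>i. i \<notin> {16, BA + 5, 15, 17} \<longrightarrow> s8 i = ?s7 i" by blast
      have fr8: "s8 i = ?s5 i" if "i \<notin> {16, BA + 5, 15, 17}" for i using 8(3) that by simp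
      have vl: "length v \<le> Z n" using wn yl by (simp add: v_def Z_def length_pair_word)
      have "\<exists>s'. run (decide MA tA BA) s8 (FA (Z n)) s' \<and> read_sym (s' (BA + 6)) = (if v \<in> R then 2 else 1) \<and>
        (\<forall>i. i \<notin> block MA BA \<longrightarrow> s' i = s8 i)"
      proof (rule FA(2))
        show "s8 (BA + 5) = wt 0 (map bit_sym v)" by (rule 8(2))
        show "length v \<le> Z n" by (rule vl)
        show "\<forall>i\<in>block MA BA. i \<noteq> BA + 5 \<longrightarrow> s8 i = blank"
        proof (intro ballI impI)
          fix i assume i: "i \<in> block MA BA" "i \<noteq> BA + 5"
          then have "BA \<le> i" by (simp add: block_def)
          then show "s8 i = blank" using fr8[of i] fr5[of i] bl[of i] i(2) by simp
        qed
      qed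
      then obtain s9 where 9: "run (decide MA tA BA) s8 (FA (Z n)) s9"
        "read_sym (s9 (BA + 6)) = (if v \<in> R then 2 else 1)" "\<forall>i. i \<notin> block MA BA \<longrightarrow> s9 i = s8 i" by blast
      have s9: "s9 1 = blank" "s9 13 = (if answer A then raised else blank)"
        using 9(3) fr8[of 1] fr8[of 13] fr5[of 1] bl[of 1] s13 by (simp_all add: block_def)
      have 10: "run judge s9 3 (s9(1 := cell_tape (bit_sym (answer A = (v \<in> R)))))"
        by (rule run_judge) (use s9 9(2) in auto)
      have b: "?b = (answer A = (v \<in> R))"
        using h(2) cw True by (simp add: chk_def x_def[symmetric] A_def[symmetric] v_def y_def)
      have "run (Cond (\<lambda>r. r 27 = 0)
         (rewind 16 ;; polyc pA 16 17 7 ;; pairc 16 15 17 (BA + 5) ;; decide MA tA BA ;; judge)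
         (Cond (\<lambda>r. r 13 = 0) (verdict True) (verdict False))) ?s5
         (((3 * n + 6) + (Fp n + ((21 * (n + poly pA n) + 20) + (FA (Z n) + 3 + 1) + 1) + 1) + 1) + 1)
         (s9(1 := cell_tape (bit_sym ?b)))"
        unfolding b
        by (rule run_Cond, rule run_Seq[OF 6 run_Seq[OF 7 run_Seq[OF 8(1) run_Seq[OF 9(1) 10]]]])
          (use True in \<open>simp add: reads_def\<close>)
      then show ?thesis by (intro exI[of _ "s9(1 := cell_tape (bit_sym ?b))"]) simp
    next
      case False
      \<comment> \<open>The query tape carries no word, so no certificate can exist and only a
        negative answer passes.\<close>
      have b: "?b = (\<not> answer A)"
        using h(2) cw False by (simp add: chk_def x_def[symmetric] A_def[symmetric])
      have s1b: "?s5 1 = blank" using fr5[of 1] bl[of 1] by simp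
      have "run (Cond (\<lambda>r. r 13 = 0) (verdict True) (verdict False)) ?s5 (1 + 1) (?s5(1 := cell_tape (bit_sym ?b)))"
        unfolding b
        by (rule run_Cond; rule run_verdict) (use s1b s13 in \<open>auto simp: reads_at split: if_splits\<close>)
      then have le: "run (Cond (\<lambda>r. r 13 = 0) (verdict True) (verdict False)) ?s5
         ((3 * n + 6) + (Fp n + ((21 * (n + poly pA n) + 20) + (FA (Z n) + 3 + 1) + 1) + 1) + 1) (?s5(1 := cell_tape (bit_sym ?b)))"
        by (rule run_mono) simp
      have "run (Cond (\<lambda>r. r 27 = 0)
         (rewind 16 ;; polyc pA 16 17 7 ;; pairc 16 15 17 (BA + 5) ;; decide MA tA BA ;; judge)
         (Cond (\<lambda>r. r 13 = 0) (verdict True) (verdict False))) ?s5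
         (((3 * n + 6) + (Fp n + ((21 * (n + poly pA n) + 20) + (FA (Z n) + 3 + 1) + 1) + 1) + 1) + 1)
         (?s5(1 := cell_tape (bit_sym ?b)))"
        by (rule run_Cond, use False in \<open>simp add: reads_def\<close>) (rule le)
      then show ?thesis by (intro exI[of _ "?s5(1 := cell_tape (bit_sym ?b))"]) simp
    qed
    then obtain s6 where s6: "run (Cond (\<lambda>r. r 27 = 0)
       (rewind 16 ;; polyc pA 16 17 7 ;; pairc 16 15 17 (BA + 5) ;; decide MA tA BA ;; judge)
       (Cond (\<lambda>r. r 13 = 0) (verdict True) (verdict False))) ?s5
       (((3 * n + 6) + (Fp n + ((21 * (n + poly pA n) + 20) + (FA (Z n) + 3 + 1) + 1) + 1) + 1) + 1) s6"
       "s6 1 = cell_tape (bit_sym ?b)" by blast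
    have "run qchk s (G n) s6" unfolding qchk_def G_def
      by (rule run_Seq[OF 1(1) run_Seq[OF 2 run_Seq[OF 3 run_Seq[OF 4 run_Seq[OF 5 s6(1)]]]]])
    then show ?thesis using s6(2) by blast
  qed
  then show thesis by (rule that[OF G])
qed

lemma run_outchk:
  assumes "emb M 20 c s" "s 23 = ctr 0 T" "T \<le> n" "s 1 = blank" "reach_tape T (snd c ! 1)"
  shows "\<exists>s'. run outchk s (11 * n + 20) s' \<and> s' 1 = cell_tape (bit_sym (carries (snd c ! 1) [False]))"
proof -
  define x where "x = snd c ! 1"
  have x26: "s 26 = x" "s 21 = shadow (fst x)"
  proof -
    have "\<forall>j<n_tapes M. s (20 + 5 + j) = snd c ! j" using assms(1) unfolding emb_def by blast
    from this[rule_format, of 1] show "s 26 = x" using k3 by (simp add: x_def)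
    show "s 21 = shadow (fst x)" using assms(1) by (simp add: emb_def x_def)
  qed
  let ?s1 = "s(20 + 3 := ctr (Suc T) T, 20 + 1 := shadow 0, 20 + 5 + 1 := (0, snd x))"
  have 1: "run (home 20 1) s (11 * n + 6) ?s1"
    by (rule run_home[where h = "fst x"]) (use x26 assms in \<open>auto simp: reach_tape_def x_def\<close>)
  define b where "b = carries x [False]"
  have b: "b \<longleftrightarrow> snd x 0 = 1 \<and> snd x 1 = 0" by (simp add: b_def carries_def)
  have s1: "?s1 26 = (0, snd x)" "?s1 1 = blank" using assms(4) by simp_all
  let ?s2 = "?s1(26 := (1, snd x))"
  have 2: "run (mv 26 GoRight) ?s1 1 ?s2" by (rule run_mv) (simp add: shift_pair)
  define e where "e = Cond (\<lambda>r. r 26 = 0) (verdict True) (verdict False)"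
  have 3: "run e ?s2 (1 + 1) (?s2(1 := cell_tape (bit_sym (snd x 1 = 0))))"
    unfolding e_def by (rule run_Cond; rule run_verdict) (use assms(4) in \<open>auto simp: reads_at\<close>)
  have "\<exists>s'. run (Cond (\<lambda>r. r 26 = 1) (mv 26 GoRight ;; e) (verdict False)) ?s1 ((1 + (1 + 1) + 1) + 1) s' \<and>
      s' 1 = cell_tape (bit_sym b)"
  proof (cases "snd x 0 = 1")
    case True
    have "run (Cond (\<lambda>r. r 26 = 1) (mv 26 GoRight ;; e) (verdict False)) ?s1 ((1 + (1 + 1) + 1) + 1)
      (?s2(1 := cell_tape (bit_sym (snd x 1 = 0))))"
      by (rule run_Cond, rule run_Seq[OF 2 3]) (use True in \<open>simp add: reads_at\<close>)
    then show ?thesis using True b by auto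
  next
    case False
    have "run (verdict False) ?s1 1 (?s1(1 := cell_tape (bit_sym b)))"
      by (rule run_verdict) (use False b assms(4) in auto)
    then have v: "run (verdict False) ?s1 (1 + (1 + 1) + 1) (?s1(1 := cell_tape (bit_sym b)))"
      by (rule run_mono) simp
    have "run (Cond (\<lambda>r. r 26 = 1) (mv 26 GoRight ;; e) (verdict False)) ?s1 ((1 + (1 + 1) + 1) + 1)
      (?s1(1 := cell_tape (bit_sym b)))"
      by (rule run_Cond) (use v False in \<open>simp_all add: reads_at\<close>)
    then show ?thesis by (intro exI[of _ "?s1(1 := cell_tape (bit_sym b))"]) simp
  qed
  then obtain s' where s': "run (Cond (\<lambda>r. r 26 = 1) (mv 26 GoRight ;; e) (verdict False)) ?s1 ((1 + (1 + 1) + 1) + 1) s'"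
      "s' 1 = cell_tape (bit_sym b)" by blast
  have "run outchk s (11 * n + 20) s'" unfolding outchk_def e_def[symmetric]
    by (rule run_mono[OF run_Seq[OF 1 s'(1)]]) simp
  then show ?thesis using s'(2) by (auto simp: b_def x_def)
qed

section \<open>The language decided by the verifier\<close>

definition "vrun z t = qrun M (init_config M (vz z)) (vA z) t"

definition "accepted z \<longleftrightarrow> (let t = stop (vT z) (vV z) in
   if t < vT z then chk M R pA (vrun z t) (drop (Suc t) (vV z))
   else carries (snd (fst (vrun z t)) ! 1) [False])"

theorem verify_P: "{z. accepted z} \<in> class_P"
proof -
  obtain F1 where F1: "polyfun F1" "\<And>z n. length z \<le> n \<Longrightarrow> \<exists>s. run prep (init_store z) (F1 n) s \<and>
    emb M 20 (init_config M (vz z)) s \<and> s 0 = wt (length z - length (vV z)) (map bit_sym z) \<and>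
    (\<exists>i\<le>length (xu z). s 3 = wt i (map bit_sym (xu z)) \<and> drop i (xu z) = vA z) \<and>
    s 23 = ctr (vT z) (vT z) \<and> s 2 = blank \<and> s 14 = blank \<and>
    (\<forall>i. i \<in> {1, 7, 13, 15, 16, 17} \<or> BA \<le> i \<longrightarrow> s i = blank)"
    by (rule run_prep) (rule that)
  obtain F2 where F2: "polyfun F2" "\<And>s cA wA wV i j T m n. emb M 20 (fst cA) s \<Longrightarrow>
    fst (fst cA) = q_query M \<and> fst (fst cA) \<noteq> q_halt M \<Longrightarrow>
    s 0 = wt j (map bit_sym wV) \<Longrightarrow> j < length wV \<Longrightarrow> s 3 = wt i (map bit_sym wA) \<Longrightarrow> i \<le> length wA \<Longrightarrow>
    drop i wA = snd cA \<Longrightarrow> s 2 = blank \<Longrightarrow> s 23 = ctr m T \<Longrightarrow> m \<le> T \<Longrightarrow>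
    \<forall>i. i \<in> {1, 7, 13, 15, 16, 17} \<or> BA \<le> i \<longrightarrow> s i = blank \<Longrightarrow>
    reach_tape T (snd (fst cA) ! 2) \<Longrightarrow> length wA \<le> n \<Longrightarrow> length wV \<le> n \<Longrightarrow> T \<le> n \<Longrightarrow>
    \<exists>s'. run qchk s (F2 n) s' \<and> s' 1 = cell_tape (bit_sym (chk M R pA cA (drop (Suc j) wV)))"
    by (rule run_qchk) (rule that)
  \<comment> \<open>\<open>N\<close> bounds both the length of the input and the clock of the
    simulated machine.\<close>
  define N where "N = (\<lambda>n. n + poly tf (zlen n))"
  have N: "polyfun N" unfolding N_def by (intro polyfun_intros polyfun_compose[OF polyfun_poly polyfun_zlen])
  define G where "G = (\<lambda>n. F1 n + ((N n * (10 * n + 40) + 1) + ((11 * N n + 20) + (F2 (N n) + 1) + 1) + 1) + 1)"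
  have G: "polyfun G" unfolding G_def by (intro polyfun_intros F1(1) N polyfun_compose[OF F2(1) N])
  show ?thesis
  proof (rule class_P_I[OF wf_verify])
    show "polyfun G" by (rule G)
    fix z :: "bool list"
    let ?n = "length z"
    define c0 where "c0 = init_config M (vz z)"
    define t where "t = stop (vT z) (vV z)"
    have tT: "t \<le> vT z" unfolding t_def by (rule stop_le)
    have Tn: "vT z \<le> N ?n"
      using poly_nat_mono[OF length_vz[OF order_refl]] by (simp add: N_def vT_def trans_le_add2)
    obtain s1 where s1: "run prep (init_store z) (F1 ?n) s1" "emb M 20 c0 s1"
      "s1 0 = wt (?n - length (vV z)) (map bit_sym z)"
      "\<exists>i\<le>length (xu z). s1 3 = wt i (map bit_sym (xu z)) \<and> drop i (xu z) = vA z"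
      "s1 23 = ctr (vT z) (vT z)" "s1 2 = blank" "s1 14 = blank"
      "\<forall>i. i \<in> {1, 7, 13, 15, 16, 17} \<or> BA \<le> i \<longrightarrow> s1 i = blank"
      using F1(2)[OF order_refl[of ?n]] unfolding c0_def by blast
    have V: "vV z = drop (?n - length (vV z)) z" using drop_dec[of 0 z "vV z"] by (simp add: vV_def)
    have inv0: "qinv M s1 z (?n - length (vV z)) (xu z) (vT z) (c0, vA z) 0 s1"
    proof -
      have "\<exists>v. s1 14 = fin v" using s1(7) blank_wt by (intro exI[of _ "[]"]) simp
      then show ?thesis unfolding qinv_def using s1(2-6) by simp
    qed
    have "\<exists>s'. run (query_loop M) s1 (N ?n * (10 * ?n + 40) + 1) s' \<and>
       qinv M s1 z (?n - length (vV z)) (xu z) (vT z) (qrun M c0 (vA z) t) t s'"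
      unfolding t_def by (rule run_query_loop[OF wf inv0 _ V Tn sizes(1)]) simp
    then obtain s2 where s2: "run (query_loop M) s1 (N ?n * (10 * ?n + 40) + 1) s2"
      "qinv M s1 z (?n - length (vV z)) (xu z) (vT z) (vrun z t) t s2" unfolding vrun_def c0_def by blast
    have e2: "emb M 20 (fst (vrun z t)) s2" "s2 23 = ctr (vT z - t) (vT z)" "s2 2 = blank"
      "s2 0 = wt (?n - length (vV z) + min t (length (vV z))) (map bit_sym z)"
      "\<exists>i\<le>length (xu z). s2 3 = wt i (map bit_sym (xu z)) \<and> drop i (xu z) = snd (vrun z t)"
      using s2(2) sizes(4)[of z] unfolding qinv_def by auto
    have bl2: "\<forall>i. i \<in> {1, 7, 13, 15, 16, 17} \<or> BA \<le> i \<longrightarrow> s2 i = blank"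
    proof (intro allI impI)
      fix i assume i: "i \<in> {1, 7, 13, 15, 16, 17} \<or> BA \<le> i"
      then have "i \<notin> {0, 3, 14} \<union> block M 20" by (auto simp: block_def)
      then have "s2 i = s1 i" using s2(2) unfolding qinv_def by blast
      then show "s2 i = blank" using s1(8)[rule_format, OF i] by simp
    qed
    have reach: "reach_tape (vT z) (snd (fst (vrun z t)) ! j)" if "j = 1 \<or> j = 2" for j
      using reach_tape_mono[OF reach_tape_qrun[OF wf, of j t "vz z" "vA z"] tT] that k3 by (auto simp: vrun_def)
    have r23: "reads s2 23 = (if t < vT z then 1 else 0)" using e2(2) tT by (auto simp: reads_def)
    have "\<exists>s'. run (Cond (\<lambda>r. r 23 = 0) outchk
       (Cond (\<lambda>r. r 20 = q_query M \<and> r 20 \<noteq> q_halt M) qchk (verdict True))) s2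
       ((11 * N ?n + 20) + (F2 (N ?n) + 1) + 1) s' \<and> s' 1 = cell_tape (bit_sym (accepted z))"
    proof (cases "t < vT z")
      case True
      have tV: "t < length (vV z)" using stop_at[of "vT z" "vV z"] True by (simp add: t_def)
      have acc: "accepted z = chk M R pA (vrun z t) (drop (Suc t) (vV z))"
        using True by (simp add: accepted_def t_def[symmetric])
      have r20: "reads s2 20 = fst (fst (vrun z t))" using e2(1) by (simp add: emb_def reads_def cell_tape_def)
      define j where "j = ?n - length (vV z) + t"
      have j: "s2 0 = wt j (map bit_sym z)" "j < length z" "drop (Suc j) z = drop (Suc t) (vV z)"
      proof -
        show "s2 0 = wt j (map bit_sym z)" using e2(4) tV by (simp add: j_def)
        show "j < length z" using tV sizes(4)[of z] by (simp add: j_def)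
        have "drop (Suc t) (vV z) = drop (Suc t) (drop (?n - length (vV z)) z)" using V by simp
        then show "drop (Suc j) z = drop (Suc t) (vV z)" by (simp add: j_def add.commute)
      qed
      obtain i where i: "i \<le> length (xu z)" "s2 3 = wt i (map bit_sym (xu z))" "drop i (xu z) = snd (vrun z t)"
        using e2(5) by blast
      have "\<exists>s'. run (Cond (\<lambda>r. r 20 = q_query M \<and> r 20 \<noteq> q_halt M) qchk (verdict True)) s2 (F2 (N ?n) + 2) s' \<and>
         s' 1 = cell_tape (bit_sym (accepted z))"
      proof (cases "fst (fst (vrun z t)) = q_query M \<and> fst (fst (vrun z t)) \<noteq> q_halt M")
        case q: True
        have nN: "length (xu z) \<le> N ?n" "length z \<le> N ?n" using sizes(1)[of z] by (auto simp: N_def)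
        obtain s3 where s3: "run qchk s2 (F2 (N ?n)) s3" "s3 1 = cell_tape (bit_sym (accepted z))"
          using F2(2)[OF e2(1) q j(1,2) i(2,1,3) e2(3,2) _ bl2 reach nN Tn] unfolding acc j(3) by auto
        have "run (Cond (\<lambda>r. r 20 = q_query M \<and> r 20 \<noteq> q_halt M) qchk (verdict True)) s2 (F2 (N ?n) + 1) s3"
          by (rule run_Cond) (use q r20 s3(1) in auto)
        then have "run (Cond (\<lambda>r. r 20 = q_query M \<and> r 20 \<noteq> q_halt M) qchk (verdict True)) s2 (F2 (N ?n) + 2) s3"
          by (rule run_mono) simp
        then show ?thesis using s3(2) by blast
      next
        case q: False
        have "accepted z" unfolding acc chk_def using q by blast
        then have "run (verdict True) s2 1 (s2(1 := cell_tape (bit_sym (accepted z))))"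
          by (intro run_verdict) (use bl2 in auto)
        then have "run (Cond (\<lambda>r. r 20 = q_query M \<and> r 20 \<noteq> q_halt M) qchk (verdict True)) s2 (1 + 1)
          (s2(1 := cell_tape (bit_sym (accepted z))))"
          by (intro run_Cond) (use q r20 in auto)
        then show ?thesis
          by (intro exI[of _ "s2(1 := cell_tape (bit_sym (accepted z)))"]) (auto intro: run_mono)
      qed
      then obtain s3 where s3: "run (Cond (\<lambda>r. r 20 = q_query M \<and> r 20 \<noteq> q_halt M) qchk (verdict True)) s2 (F2 (N ?n) + 2) s3"
        "s3 1 = cell_tape (bit_sym (accepted z))" by blast
      have "run (Cond (\<lambda>r. r 23 = 0) outchk
       (Cond (\<lambda>r. r 20 = q_query M \<and> r 20 \<noteq> q_halt M) qchk (verdict True))) s2 ((F2 (N ?n) + 2) + 1) s3"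
        by (rule run_Cond) (use r23 True s3(1) in auto)
      then have "run (Cond (\<lambda>r. r 23 = 0) outchk
       (Cond (\<lambda>r. r 20 = q_query M \<and> r 20 \<noteq> q_halt M) qchk (verdict True))) s2
       ((11 * N ?n + 20) + (F2 (N ?n) + 1) + 1) s3" by (rule run_mono) simp
      then show ?thesis using s3(2) by blast
    next
      case False
      then have tT: "t = vT z" using tT by simp
      have acc: "accepted z = carries (snd (fst (vrun z t)) ! 1) [False]"
        using False by (simp add: accepted_def t_def[symmetric])
      obtain s3 where s3: "run outchk s2 (11 * N ?n + 20) s3" "s3 1 = cell_tape (bit_sym (accepted z))"
        using run_outchk[OF e2(1) _ Tn _ reach, of] e2(2) bl2 unfolding acc tT by auto
      have "run (Cond (\<lambda>r. r 23 = 0) outchk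
       (Cond (\<lambda>r. r 20 = q_query M \<and> r 20 \<noteq> q_halt M) qchk (verdict True))) s2 ((11 * N ?n + 20) + 1) s3"
        by (rule run_Cond) (use r23 False s3(1) in auto)
      then have "run (Cond (\<lambda>r. r 23 = 0) outchk
       (Cond (\<lambda>r. r 20 = q_query M \<and> r 20 \<noteq> q_halt M) qchk (verdict True))) s2
       ((11 * N ?n + 20) + (F2 (N ?n) + 1) + 1) s3" by (rule run_mono) simp
      then show ?thesis using s3(2) by blast
    qed
    then obtain s3 where s3: "run (Cond (\<lambda>r. r 23 = 0) outchk
       (Cond (\<lambda>r. r 20 = q_query M \<and> r 20 \<noteq> q_halt M) qchk (verdict True))) s2
       ((11 * N ?n + 20) + (F2 (N ?n) + 1) + 1) s3" "s3 1 = cell_tape (bit_sym (accepted z))" by blast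
    have "run verify (init_store z) (G ?n) s3" unfolding verify_def G_def
      by (rule run_Seq[OF s1(1) run_Seq[OF s2(1) s3(1)]])
    then show "\<exists>s. run verify (init_store z) (G ?n) s \<and> s 1 = cell_tape (bit_sym (z \<in> {z. accepted z}))"
      using s3(2) by auto
  qed (use k3 in auto)
qed

end

section \<open>Correctness of the tableau formula\<close>

text \<open>The tape that two sets of positions describe, with position \<open>a\<close> as cell 0;
  \<open>P\<close> need not be an interval.\<close>

definition set_tape :: "nat \<Rightarrow> nat set \<Rightarrow> nat set \<Rightarrow> tape" where
  "set_tape a B P = (0, \<lambda>i. if 0 \<le> i \<and> a + nat i \<in> P then if a + nat i \<in> B then 2 else 1 else 0)"

lemma set_tape_word:
  "set_tape a {a + i | i. i < length u \<and> u ! i} {a..<a + length u} = wt 0 (map bit_sym u)"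
  by (auto simp: set_tape_def wt_def cells_def fun_eq_iff bit_sym_def)

text \<open>Every pair of sets stands for some word of admissible length, so arbitrary values of the
  set variables may be read as quantified words.\<close>

lemma prefix_word_bits:
  assumes "\<And>i. snd x i \<le> 2"
  obtains u where "prefix_word x m = map bit_sym u" "length u \<le> m"
proof -
  let ?u = "map (\<lambda>s. s = 2) (prefix_word x m)"
  have "s = 1 \<or> s = 2" if s: "s \<in> set (prefix_word x m)" for s
  proof -
    from s obtain k where "k < length (prefix_word x m)" "s = prefix_word x m ! k"
      by (auto simp: in_set_conv_nth)
    then have "s \<noteq> 0" "s \<le> 2" using prefix_word_cell[of k x m] assms by auto
    then show ?thesis by auto
  qed
  then have "map (bit_sym \<circ> (\<lambda>s. s = 2)) (prefix_word x m) = prefix_word x m"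
    by (intro map_idI) (auto simp: bit_sym_def)
  then have "prefix_word x m = map bit_sym ?u" by simp
  then show thesis using that[of ?u] prefix_word_length[of x m] by simp
qed

lemma prefix_word_set_tape:
  assumes "length u \<le> m"
  shows "prefix_word (set_tape a {a + i | i. i < length u \<and> u ! i} {a..<a + length u}) m = map bit_sym u"
  unfolding set_tape_word using prefix_word_wt[OF bit_sym_pos[of u], of 0 m] assms by simp

lemma tree_word_nth: "i < poly pa (length w) \<Longrightarrow> \<not> tree_word pa pp w ! i"
    "tree_word pa pp w ! poly pa (length w)"
  by (simp_all add: tree_word_def nth_append)

lemma first_bit_tree_word: "first_bit (tree_word pa pp w) (poly pa (length w) + 1)"
proof -
  have "\<not> p < poly pa (length w) + 1" if "0 < p" "tree_word pa pp w ! (p - 1)" for p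
    using tree_word_nth(1)[of "p - 1" pa w pp] that by fastforce
  then show ?thesis using tree_word_nth(2) by (simp add: first_bit_def)
qed

lemma halted_mono:
  assumes "(step M A ^^ t) c = (q_halt M, ts)" "t \<le> t'"
  shows "(step M A ^^ t') c = (q_halt M, ts)"
  using assms(2)
proof (induction t' rule: dec_induct)
  case (step k)
  then show ?case by simp
qed (use assms(1) in simp)

text \<open>Given \<open>u\<close>, take its sets as the answer: a closed family fixes some
  \<open>v\<close> through \<open>FVB\<close> and \<open>FVP\<close>, and it contains the accepting
  row of the run on \<open>v\<close>. Conversely, an answer yields a \<open>u\<close>; for each
  \<open>v\<close> the true facts of the run form a closed family, so the formula finds an accepting
  row among them.\<close>

theorem tableau_formula:
  assumes "R \<in> class_P"
  obtains M pa pp where "wf_otm M" "\<And>w. answers (tabF M 16) 2 (length (tree_word pa pp w)) (wtree (tree_word pa pp w)) \<noteq> {} \<longleftrightarrow>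
    (\<exists>u. length u \<le> poly p1 (length w) \<and>
      (\<forall>v. length v \<le> poly p2 (length (pair_word w u)) \<longrightarrow> pair_word (pair_word w u) v \<in> R))"
proof -
  obtain M T where M: "wf_otm M" "16 < n_tapes M" "polyfun T"
    and run: "\<And>w pad Y1 Y2 u v. prefix_word Y1 (poly p1 (length w)) = map bit_sym u \<Longrightarrow>
       prefix_word Y2 (poly p2 (length (pair_word w u))) = map bit_sym v \<Longrightarrow>
       \<exists>ts. (step M {} ^^ T (length w))
          (q_start M, wt 0 (map bit_sym (True # pair_word w pad)) # Y1 # Y2 # replicate (n_tapes M - 3) blank) =
          (q_halt M, ts) \<and> read_sym (ts ! 16) = (if pair_word (pair_word w u) v \<in> R then 2 else 1)"
    using matrix_machine[OF assms, of p1 p2] by blast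
  obtain pa where pa: "T = poly pa" using M(3) by (auto simp: polyfun_def)
  \<comment> \<open>A bound on the length of \<open>v\<close> in terms of \<open>w\<close> alone, as
    \<open>u\<close> is at most \<open>poly p1\<close> long.\<close>
  define P2 where "P2 = (\<lambda>n. poly p2 (2 * n + 2 + poly p1 n))"
  have P2: "polyfun P2" unfolding P2_def
    by (rule polyfun_compose[OF polyfun_poly]) (intro polyfun_intros polyfun_poly)
  \<comment> \<open>With \<open>a = T n + 1\<close> the width is \<open>2 * T n + 2\<close>. The
    factor \<open>T n + 3\<close> leaves room for the rows up to time \<open>T n\<close> and the
    margin before and after them; the other summands make room for \<open>u\<close> and
    \<open>v\<close>, which are placed from position \<open>a\<close> on.\<close>
  have "polyfun (\<lambda>n. (T n + 3) * (2 * T n + 2) + poly p1 n + P2 n)"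
    by (intro polyfun_intros polyfun_poly P2 M(3))
  then obtain pp where pp: "(\<lambda>n. (T n + 3) * (2 * T n + 2) + poly p1 n + P2 n) = poly pp"
    by (auto simp: polyfun_def)
  have syms: "3 \<le> n_syms M" using M(1) by (simp add: wf_otm_def)
  have "answers (tabF M 16) 2 (length (tree_word pa pp w)) (wtree (tree_word pa pp w)) \<noteq> {} \<longleftrightarrow>
    (\<exists>u. length u \<le> poly p1 (length w) \<and>
      (\<forall>v. length v \<le> poly p2 (length (pair_word w u)) \<longrightarrow> pair_word (pair_word w u) v \<in> R))"
    (is "?L \<longleftrightarrow> ?R") for w
  proof -
    define bs where "bs = tree_word pa pp w"
    define N where "N = length bs"
    define t where "t = T (length w)"
    define a where "a = t + 1"
    define pad where "pad = replicate (poly pp (length w)) False"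
    have bs_eq: "bs = replicate t False @ True # pair_word w pad"
      by (simp add: bs_def tree_word_def t_def pa pad_def)
    have N: "N = a + (2 * length w + 2 + ((t + 3) * (2 * a) + poly p1 (length w) + P2 (length w)))"
      unfolding N_def bs_def length_tree_word pp[symmetric] pa[symmetric] by (simp add: a_def t_def)
    have "3 * (2 * a) \<le> (t + 3) * (2 * a)" by (rule mult_le_mono1) simp
    moreover have "Suc (Suc (Suc t)) * (a + a) = (t + 3) * (2 * a)" by (simp add: algebra_simps)
    moreover have "0 < a" "t < a" by (simp_all add: a_def)
    ultimately have N1: "a + a < N" "Suc (Suc (Suc t)) * (a + a) \<le> N" "0 < a" "t < a"
      using N by linarith+
    have fb: "first_bit bs a" using first_bit_tree_word[of pa pp w] by (simp add: bs_def a_def t_def pa)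
    define Y0 where "Y0 = wt 0 (map bit_sym (True # pair_word w pad))"
    define ts0 where "ts0 = (\<lambda>XB XP VB VP. Y0 # set_tape a XB XP # set_tape a VB VP # replicate (n_tapes M - 3) blank)"
    have small: "snd (set_tape a B P) i \<le> 2" for B P i by (simp add: set_tape_def)
    have run_t: "\<exists>ts. conf M (ts0 XB XP VB VP) t = (q_halt M, ts) \<and>
        read_sym (ts ! 16) = (if pair_word (pair_word w u) v \<in> R then 2 else 1)"
      if "prefix_word (set_tape a XB XP) (poly p1 (length w)) = map bit_sym u"
        "prefix_word (set_tape a VB VP) (poly p2 (length (pair_word w u))) = map bit_sym v" for XB XP VB VP u v
      using run[OF that] unfolding conf_def ts0_def Y0_def t_def by blast
    have tabl: "tableau_run M (ts0 XB XP VB VP) a (inp bs XB XP VB VP)" for XB XP VB VP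
    proof
      show "wf_otm M" by (rule M(1))
      have "snd Y0 i < n_syms M" for i
        using syms by (auto simp: Y0_def wt_def cells_def bit_sym_def nth_Cons' simp del: list.map)
      then show "wf_conf M (q_start M, ts0 XB XP VB VP)"
        using M(1,2) syms by (auto simp: wf_conf_def wf_otm_def ts0_def ctr_def set_tape_def)
      show "fst (ts0 XB XP VB VP ! j) = 0" if "j < n_tapes M" for j
        using that M(2) by (auto simp: ts0_def Y0_def wt_def set_tape_def ctr_def nth_Cons')
      show "0 < a" by (rule N1)
      fix j c assume j: "j < n_tapes M" and c: "0 < c" "c < a + a"
      show "snd (ts0 XB XP VB VP ! j) (int c - int a) = (if c < a then 0 else inp bs XB XP VB VP j c)"
      proof (cases "c < a")
        case True
        then show ?thesis using j M(2) by (auto simp: ts0_def Y0_def wt_def cells_def set_tape_def ctr_def nth_Cons')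
      next
        case False
        then obtain d where d: "c = a + d" by (metis le_iff_add not_less)
        \<comment> \<open>Since \<open>a = t + 1\<close>, the index \<open>c - 1\<close> equals
          \<open>t + d\<close>, which points to letter \<open>d\<close> after the \<open>t\<close>
          zeros.\<close>
        have "bs ! (c - 1) = (True # pair_word w pad) ! d" using d by (simp add: bs_eq a_def nth_append)
        moreover have "d < length (True # pair_word w pad)"
          using N1(1) c(2) d unfolding N_def bs_eq by (simp add: a_def)
        moreover have "snd Y0 (int d) = bit_sym ((True # pair_word w pad) ! d)"
          if "d < length (True # pair_word w pad)"
          using that unfolding Y0_def wt_def cells_def by (simp del: list.map)
        ultimately have "snd Y0 (int d) = (if bs ! (c - 1) then 2 else 1)" by (simp add: bit_sym_def)
        then show ?thesis using j M(2) d
          by (auto simp: ts0_def set_tape_def ctr_def nth_Cons' inp_def)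
      qed
    qed
    show ?thesis unfolding bs_def[symmetric]
    proof
      assume ?R
      then obtain u where u: "length u \<le> poly p1 (length w)"
        "\<And>v. length v \<le> poly p2 (length (pair_word w u)) \<Longrightarrow> pair_word (pair_word w u) v \<in> R" by blast
      define XB where "XB = {a + i | i. i < length u \<and> u ! i}"
      define XP where "XP = {a..<a + length u}"
      have X: "XB \<subseteq> {1..<N}" "XP \<subseteq> {1..<N}" using N u(1) N1(3) by (auto simp: XB_def XP_def)
      let ?es = "[code XB, code XP]"
      have "sat N (wtree bs) ((!) ?es) (tabF M 16)"
      proof (subst sat_tabF[where a = a], goal_cases)
        case 7
        show ?case
        proof (intro allI impI)
          fix D assume D: "\<forall>f. D f \<subseteq> {1..<N}"
            "tab_closed M N (inp bs (coded N (?es ! 0)) (coded N (?es ! 1)) (D FVB) (D FVP)) a (a + a) D"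
          have D2: "tab_closed M N (inp bs XB XP (D FVB) (D FVP)) a (a + a) D"
            using D(2) by (simp add: coded_code[OF X(1)] coded_code[OF X(2)])
          interpret tableau_run M "ts0 XB XP (D FVB) (D FVP)" a "inp bs XB XP (D FVB) (D FVP)" by (rule tabl)
          obtain v where v: "prefix_word (set_tape a (D FVB) (D FVP)) (poly p2 (length (pair_word w u))) = map bit_sym v"
            "length v \<le> poly p2 (length (pair_word w u))" by (rule prefix_word_bits[OF small]) (rule that)
          have "prefix_word (set_tape a XB XP) (poly p1 (length w)) = map bit_sym u"
            unfolding XB_def XP_def by (rule prefix_word_set_tape[OF u(1)])
          then obtain ts where "conf M (ts0 XB XP (D FVB) (D FVP)) t = (q_halt M, ts)" "read_sym (ts ! 16) = 2"
            using run_t[OF _ v(1)] u(2)[OF v(2)] by auto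
          then show "\<exists>\<tau>. \<tau> \<in> D (FQ (q_halt M)) \<and> \<tau> \<in> D (FR 16 2)"
            by (intro accepting_derived[OF D2 N1(4,2) _ M(2)]) simp_all
        qed
      qed (use N1 fb code_pinst X in \<open>simp_all add: N_def\<close>)
      then have "?es \<in> answers (tabF M 16) 2 N (wtree bs)"
        using code_pinst[OF X(1)] code_pinst[OF X(2)] by (simp add: answers_def)
      then show "answers (tabF M 16) 2 (length bs) (wtree bs) \<noteq> {}" unfolding N_def by blast
    next
      assume "answers (tabF M 16) 2 (length bs) (wtree bs) \<noteq> {}"
      then obtain es where es: "length es = 2" "set es \<subseteq> pinsts N" "sat N (wtree bs) ((!) es) (tabF M 16)"
        by (auto simp: answers_def N_def)
      then have e01: "es ! 0 \<in> pinsts N" "es ! 1 \<in> pinsts N" by auto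
      define XB where "XB = coded N (es ! 0)"
      define XP where "XP = coded N (es ! 1)"
      have der: "\<exists>\<tau>. \<tau> \<in> D (FQ (q_halt M)) \<and> \<tau> \<in> D (FR 16 2)"
        if "\<And>f. D f \<subseteq> {1..<N}" "tab_closed M N (inp bs XB XP (D FVB) (D FVP)) a (a + a) D" for D
        using es(3) that unfolding sat_tabF[OF N_def[symmetric] e01 N1(3) fb N1(1)] XB_def XP_def by blast
      obtain u where u: "prefix_word (set_tape a XB XP) (poly p1 (length w)) = map bit_sym u"
        "length u \<le> poly p1 (length w)" by (rule prefix_word_bits[OF small]) (rule that)
      have "pair_word (pair_word w u) v \<in> R" if v: "length v \<le> poly p2 (length (pair_word w u))" for v
      proof -
        define VB where "VB = {a + i | i. i < length v \<and> v ! i}"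
        define VP where "VP = {a..<a + length v}"
        have "length v \<le> P2 (length w)"
          using v poly_nat_mono[of "length (pair_word w u)" "2 * length w + 2 + poly p1 (length w)" p2] u(2)
          by (simp add: P2_def length_pair_word)
        then have V: "VB \<subseteq> {1..<N}" "VP \<subseteq> {1..<N}" using N N1(3) by (auto simp: VB_def VP_def)
        interpret tableau_run M "ts0 XB XP VB VP" a "inp bs XB XP VB VP" by (rule tabl)
        have "prefix_word (set_tape a VB VP) (poly p2 (length (pair_word w u))) = map bit_sym v"
          unfolding VB_def VP_def by (rule prefix_word_set_tape[OF v])
        then obtain ts where ts: "conf M (ts0 XB XP VB VP) t = (q_halt M, ts)"
          "read_sym (ts ! 16) = (if pair_word (pair_word w u) v \<in> R then 2 else 1)"
          using run_t[OF u(1)] by blast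
        have late: "conf M (ts0 XB XP VB VP) t' = (q_halt M, ts)" if "t \<le> t'" for t'
          using halted_mono[OF ts(1)[unfolded conf_def] that] by (simp add: conf_def)
        \<comment> \<open>A run has only one halting configuration, so whichever halting row the
          formula finds, it shows the outcome at time \<open>t\<close>.\<close>
        have early: "conf M (ts0 XB XP VB VP) t' = (q_halt M, ts)" if q: "Q t' = q_halt M" for t'
        proof (cases "t \<le> t'")
          case False
          obtain ts' where ts': "conf M (ts0 XB XP VB VP) t' = (q_halt M, ts')" using q by (metis prod.collapse)
          then show ?thesis using halted_mono[OF ts'[unfolded conf_def], of t] False ts(1) by (simp add: conf_def)
        qed (rule late)
        \<comment> \<open>The family to which the formula is applied: the true facts, with the sets
          of this particular \<open>v\<close> as universal word.\<close>
        define D where "D = (\<lambda>f. if f = FVB then VB else if f = FVP then VP else true_facts N {} {} f)"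
        have tf: "true_facts N {} {} f \<subseteq> {1..<N}" for f by (auto simp: true_facts_def)
        have "tab_closed M N (inp bs XB XP VB VP) a (a + a) D"
        proof (rule true_closed)
          fix t' j assume j: "j < n_tapes M"
          show "\<bar>fst (X t' j)\<bar> < int a"
          proof (cases "t \<le> t'")
            case True
            then show ?thesis using late[OF True] head_bound[OF j, of t] ts(1) N1(4) by simp
          next
            case False
            then show ?thesis using head_bound[OF j, of t'] N1(4) by simp
          qed
        qed (use N1 in \<open>simp_all add: D_def\<close>)
        then have "\<exists>\<tau>. \<tau> \<in> D (FQ (q_halt M)) \<and> \<tau> \<in> D (FR 16 2)"
          by (intro der) (use V tf in \<open>simp_all add: D_def\<close>)
        then have "\<exists>\<tau>. \<tau> \<in> true_facts N {} {} (FQ (q_halt M)) \<and> \<tau> \<in> true_facts N {} {} (FR 16 2)"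
          by (simp add: D_def)
        then obtain t' where t': "Q t' = q_halt M" "read_sym (X t' 16) = 2"
          using rejecting_not_derived[OF _ M(2), of N "{}" "{}"] by blast
        have "read_sym (ts ! 16) = 2" using t'(2) unfolding early[OF t'(1)] by simp
        then show ?thesis using ts(2) by (simp split: if_splits)
      qed
      then show ?R using u(2) by blast
    qed
  qed
  then show thesis by (rule that[OF M(1)])
qed

section \<open>Guessing the oracle answers\<close>

lemma reach_tape_carries: "reach_tape T x \<Longrightarrow> carries x w \<Longrightarrow> length w \<le> T"
proof (rule ccontr)
  assume r: "reach_tape T x" and c: "carries x w" and "\<not> length w \<le> T"
  then have "snd x (int T) \<noteq> 0" by (auto simp: carries_def)
  then show False using r unfolding reach_tape_def by (metis abs_of_nat less_irrefl)
qed

lemma stop_replicate: "t < T \<Longrightarrow> stop T (replicate t False @ True # y) = t"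
proof -
  assume t: "t < T"
  have "takeWhile Not (replicate t False @ True # y) = replicate t False" by (induction t) auto
  then show ?thesis using t by (simp add: stop_def)
qed

lemma stop_Nil: "stop T [] = T"
  by (simp add: stop_def)

definition querying :: "otm \<Rightarrow> config \<Rightarrow> bool" where
  "querying M c \<longleftrightarrow> fst c = q_query M \<and> fst c \<noteq> q_halt M"

lemma step_querying: "querying M c \<Longrightarrow>
    step M A c = (if \<exists>w\<in>A. carries (snd c ! 2) w then q_yes M else q_no M, snd c)"
  by (cases c) (simp add: querying_def)

lemma step_not_querying: "\<not> querying M c \<Longrightarrow> step M A c = step M {} c"
  by (cases c) (simp add: querying_def)

lemma qstep_eq: "qstep M (c, A) = (if querying M c
    then if answer A then ((q_yes M, snd c), snd (dec (tl A))) else ((q_no M, snd c), tl A)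
    else (step M {} c, A))"
  by (cases c) (simp add: querying_def answer_def)

lemma chk_querying: "chk M R p (c, A) y \<longleftrightarrow> (querying M c \<longrightarrow>
     answer A = (\<exists>w. carries (snd c ! 2) w \<and>
       pair_word w (take (poly p (length w)) (if answer A then fst (dec (tl A)) else y)) \<in> R))"
  by (simp add: chk_def querying_def)

text \<open>The list of answers that makes \<open>qrun\<close> follow the run with oracle
  \<open>A\<close> for \<open>k\<close> steps, with \<open>g\<close> supplying the
  certificates.\<close>

fun honest :: "otm \<Rightarrow> bool list set \<Rightarrow> (config \<Rightarrow> bool list) \<Rightarrow> config \<Rightarrow> nat \<Rightarrow> bool list" where
  "honest M A g c 0 = []"
| "honest M A g c (Suc k) = (if querying M c
     then if \<exists>w\<in>A. carries (snd c ! 2) w then True # pair_word (g c) (honest M A g (step M A c) k)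
       else False # honest M A g (step M A c) k
     else honest M A g (step M A c) k)"

lemma answer_honest: "querying M c \<Longrightarrow> answer (honest M A g c (Suc k)) \<longleftrightarrow> (\<exists>w\<in>A. carries (snd c ! 2) w)"
  by (simp add: answer_def)

lemma qstep_honest: "qstep M (c, honest M A g c (Suc k)) = (step M A c, honest M A g (step M A c) k)"
proof (cases "querying M c")
  case True
  show ?thesis
  proof (cases "\<exists>w\<in>A. carries (snd c ! 2) w")
    case yes: True
    have h: "honest M A g c (Suc k) = True # pair_word (g c) (honest M A g (step M A c) k)"
      by (simp only: honest.simps True yes if_True)
    have s: "step M A c = (q_yes M, snd c)" by (simp only: step_querying[OF True] yes if_True)
    show ?thesis unfolding h qstep_eq by (simp add: True answer_def dec_pair s)
  next
    case no: False
    have h: "honest M A g c (Suc k) = False # honest M A g (step M A c) k"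
      by (simp only: honest.simps True no if_True if_False)
    have s: "step M A c = (q_no M, snd c)" by (simp only: step_querying[OF True] no if_False)
    show ?thesis unfolding h qstep_eq by (simp add: True answer_def s)
  qed
next
  case False
  have h: "honest M A g c (Suc k) = honest M A g (step M A c) k" by (simp only: honest.simps False if_False)
  show ?thesis unfolding h qstep_eq by (simp only: False if_False step_not_querying[OF False, of A])
qed

lemma qrun_honest: "t \<le> k \<Longrightarrow>
   qrun M c (honest M A g c k) t = ((step M A ^^ t) c, honest M A g ((step M A ^^ t) c) (k - t))"
proof (induction t)
  case (Suc t)
  then obtain l where l: "k - t = Suc l" "k - Suc t = l" by (metis Suc_diff_Suc Suc_le_lessD)
  show ?case using Suc unfolding qrun_Suc l(2) by (simp only: l(1) qstep_honest funpow.simps o_apply)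
qed (simp add: qrun_def)

text \<open>A positive answer costs its leading letter, the doubled certificate and a separator of
  two letters, together at most \<open>2 * B + 3\<close>.\<close>

lemma length_honest:
  assumes "\<And>i w. i < k \<Longrightarrow> querying M ((step M A ^^ i) c) \<Longrightarrow> w \<in> A \<Longrightarrow>
    carries (snd ((step M A ^^ i) c) ! 2) w \<Longrightarrow> length (g ((step M A ^^ i) c)) \<le> B"
  shows "length (honest M A g c k) \<le> k * (2 * B + 3)"
  using assms
proof (induction k arbitrary: c)
  case (Suc k)
  have IH: "length (honest M A g (step M A c) k) \<le> k * (2 * B + 3)"
  proof (rule Suc.IH)
    fix i w assume i: "i < k" "querying M ((step M A ^^ i) (step M A c))" "w \<in> A"
      "carries (snd ((step M A ^^ i) (step M A c)) ! 2) w"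
    have e: "(step M A ^^ i) (step M A c) = (step M A ^^ Suc i) c" by (simp only: funpow_Suc_right o_apply)
    show "length (g ((step M A ^^ i) (step M A c))) \<le> B"
      unfolding e by (rule Suc.prems[of "Suc i" w]) (use i in \<open>simp_all only: e Suc_less_eq\<close>)
  qed
  show ?case
  proof (cases "querying M c \<and> (\<exists>w\<in>A. carries (snd c ! 2) w)")
    case True
    then have "length (g c) \<le> B" using Suc.prems[of 0] by auto
    then show ?thesis using IH True by (simp add: length_pair_word)
  next
    case False
    then have "length (honest M A g c (Suc k)) \<le> Suc (length (honest M A g (step M A c) k))" by simp
    then show ?thesis using IH by simp
  qed
qed simp

lemma Sigma_Suc_I:
  assumes "R \<in> Sigma_p k" "\<And>x. x \<in> L \<longleftrightarrow> (\<exists>u. length u \<le> poly p (length x) \<and> pair_word x u \<notin> R)"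
  shows "L \<in> Sigma_p (Suc k)"
proof -
  have "\<exists>p. \<forall>x. x \<in> L \<longleftrightarrow> (\<exists>u. length u \<le> poly p (length x) \<and> pair_word x u \<in> - R)" using assms(2) by auto
  then show ?thesis using assms(1) unfolding Sigma_p.simps poly_ex_def by blast
qed

lemma Sigma_Suc_E:
  assumes "L \<in> Sigma_p (Suc k)"
  obtains R p where "R \<in> Sigma_p k" "\<And>x. x \<in> L \<longleftrightarrow> (\<exists>u. length u \<le> poly p (length x) \<and> pair_word x u \<notin> R)"
proof -
  obtain R p where "R \<in> Sigma_p k" "\<forall>x. x \<in> L \<longleftrightarrow> (\<exists>u. length u \<le> poly p (length x) \<and> pair_word x u \<in> - R)"
    using assms unfolding Sigma_p.simps poly_ex_def by blast
  then show thesis by (intro that[of R p]) auto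
qed

section \<open>Soundness and completeness of the verifier\<close>

context verifier
begin

definition "inst w = (let b = tree_word pa pp w in enc_input (length b) (wtree b))"

lemma inst_pair:
  "vz (pair_word (pair_word X U) V) = inst (pair_word X (take (poly p0 (length X)) (fst (dec U))))"
  by (simp add: vz_def inst_def vw_def vX_def vu_def xu_def dec_pair)

definition "start X U = init_config M (inst (pair_word X (take (poly p0 (length X)) (fst (dec U)))))"
definition "clock X U = poly tf (length (inst (pair_word X (take (poly p0 (length X)) (fst (dec U))))))"

lemma clock_le: "2 * length (pair_word X U) + 2 \<le> n \<Longrightarrow> clock X U \<le> poly tf (zlen n)"
proof -
  assume "2 * length (pair_word X U) + 2 \<le> n"
  then have "length (pair_word (pair_word X U) []) \<le> n" by (simp add: length_pair_word)
  from length_vz[OF this] show ?thesis unfolding inst_pair clock_def by (rule poly_nat_mono)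
qed

lemma accepted_pair: "accepted (pair_word (pair_word X U) V) \<longleftrightarrow>
   (let t = stop (clock X U) V in
    if t < clock X U then chk M R pA (qrun M (start X U) (snd (dec U)) t) (drop (Suc t) V)
    else carries (snd (fst (qrun M (start X U) (snd (dec U)) t)) ! 1) [False])"
  unfolding accepted_def vrun_def vT_def inst_pair start_def[symmetric] clock_def[symmetric]
  by (simp add: vV_def vA_def xu_def dec_pair)

text \<open>Step by step the guessed answers turn out to be those of the oracle: a positive one
  comes with a certificate, and a wrong negative one would be refuted by a universal word that
  presents a true certificate. The guessed run is then the real one, and the empty universal word
  checks its output.\<close>

lemma accepted_sound:
  assumes A: "\<And>q. q \<in> A \<longleftrightarrow> (\<exists>c. length c \<le> poly pA (length q) \<and> pair_word q c \<in> R)"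
    and acc: "\<And>V. length V \<le> clock X U + poly pA (clock X U) \<Longrightarrow> accepted (pair_word (pair_word X U) V)"
  shows "carries (snd ((step M A ^^ clock X U) (start X U)) ! 1) [False]"
proof -
  let ?T = "clock X U" and ?A = "snd (dec U)" and ?c = "start X U"
  \<comment> \<open>This word selects step \<open>t\<close> and offers \<open>y\<close> as the
    challenge. Because of \<open>t < ?T\<close> it is within the length bound.\<close>
  have chk: "chk M R pA (qrun M ?c ?A t) y" if "t < ?T" "length y \<le> poly pA ?T" for t y
    using acc[of "replicate t False @ True # y"] that by (simp add: accepted_pair stop_replicate Let_def)
  have run: "t \<le> ?T \<Longrightarrow> fst (qrun M ?c ?A t) = (step M A ^^ t) ?c" for t
  proof (induction t)
    case (Suc t)
    obtain d B where dB: "qrun M ?c ?A t = (d, B)" by (cases "qrun M ?c ?A t") auto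
    have d: "(step M A ^^ t) ?c = d" using Suc dB by simp
    have "fst (qstep M (d, B)) = step M A d"
    proof (cases "querying M d")
      case True
      have x: "reach_tape ?T (snd d ! 2)"
        using reach_tape_mono[OF reach_tape_qrun[OF wf, of 2 t]] k3 dB Suc.prems unfolding start_def
        by (metis fst_conv Suc_leD less_le_trans numeral_3_eq_3 lessI numeral_2_eq_2 zero_less_Suc)
      have c: "answer B = (\<exists>w. carries (snd d ! 2) w \<and>
          pair_word w (take (poly pA (length w)) (if answer B then fst (dec (tl B)) else y)) \<in> R)"
        if "length y \<le> poly pA ?T" for y
        using chk[OF _ that, of t] Suc.prems True unfolding dB chk_querying by simp
      have "answer B \<longleftrightarrow> (\<exists>w\<in>A. carries (snd d ! 2) w)"
      proof
        assume "answer B"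
        then obtain w where w: "carries (snd d ! 2) w" "pair_word w (take (poly pA (length w)) (fst (dec (tl B)))) \<in> R"
          using c[of "[]"] by auto
        \<comment> \<open>\<open>chk\<close> cuts the guessed certificate to the admissible length,
          so it is a legal witness however long the guess was.\<close>
        then have "w \<in> A" unfolding A by (intro exI[of _ "take (poly pA (length w)) (fst (dec (tl B)))"]) simp
        then show "\<exists>w\<in>A. carries (snd d ! 2) w" using w(1) by blast
      next
        assume "\<exists>w\<in>A. carries (snd d ! 2) w"
        then obtain w where w0: "carries (snd d ! 2) w" "w \<in> A" by blast
        then obtain y where w: "carries (snd d ! 2) w" "length y \<le> poly pA (length w)" "pair_word w y \<in> R"
          unfolding A by blast
        \<comment> \<open>A word written within \<open>?T\<close> steps has length at most
          \<open>?T\<close>, so its certificate is short enough to serve as a challenge.\<close>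
        have "poly pA (length w) \<le> poly pA ?T" by (rule poly_nat_mono[OF reach_tape_carries[OF x w(1)]])
        then have "length y \<le> poly pA ?T" using w(2) by simp
        moreover have "take (poly pA (length w)) y = y" using w(2) by simp
        ultimately show "answer B" using c[of y] w(1,3) by (cases "answer B") auto
      qed
      then show ?thesis using True by (simp add: qstep_eq step_querying)
    next
      case False
      then show ?thesis by (simp add: qstep_eq step_not_querying[OF False, of A])
    qed
    then show ?case unfolding qrun_Suc dB using d by simp
  qed (simp add: qrun_def)
  have "carries (snd (fst (qrun M ?c ?A ?T)) ! 1) [False]"
    using acc[of "[]"] by (simp add: accepted_pair stop_Nil Let_def)
  then show ?thesis unfolding run[OF order_refl] .
qed

definition "cert c = (SOME y. \<exists>w. carries (snd c ! 2) w \<and> length y \<le> poly pA (length w) \<and> pair_word w y \<in> R)"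

text \<open>With honest answers no universal word can do harm: \<open>cert\<close> confirms the
  positive answers, and a challenge against a negative one is cut to admissible length, so its
  success would put the query into \<open>A\<close>.\<close>

lemma accepted_complete:
  assumes A: "\<And>q. q \<in> A \<longleftrightarrow> (\<exists>c. length c \<le> poly pA (length q) \<and> pair_word q c \<in> R)"
    and out: "carries (snd ((step M A ^^ clock X U) (start X U)) ! 1) [False]"
    and U: "snd (dec U) = honest M A cert (start X U) (clock X U)"
  shows "accepted (pair_word (pair_word X U) V)"
proof -
  let ?T = "clock X U" and ?c = "start X U"
  define t where "t = stop ?T V"
  have t: "t \<le> ?T" unfolding t_def by (rule stop_le)
  define d where "d = (step M A ^^ t) ?c"
  have q: "qrun M ?c (snd (dec U)) t = (d, honest M A cert d (?T - t))"
    unfolding U d_def by (rule qrun_honest[OF t])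
  show ?thesis
  proof (cases "t < ?T")
    case True
    then obtain k where k: "?T - t = Suc k" by (metis Suc_diff_Suc)
    define B where "B = honest M A cert d (Suc k)"
    have "chk M R pA (d, B) (drop (Suc t) V)"
      unfolding chk_querying
    proof
      assume d: "querying M d"
      let ?y = "drop (Suc t) V"
      have ans: "answer B \<longleftrightarrow> (\<exists>w\<in>A. carries (snd d ! 2) w)" unfolding B_def by (rule answer_honest[OF d])
      show "answer B = (\<exists>w. carries (snd d ! 2) w \<and>
         pair_word w (take (poly pA (length w)) (if answer B then fst (dec (tl B)) else ?y)) \<in> R)"
      proof (cases "answer B")
        case True
        then obtain v where "carries (snd d ! 2) v" "v \<in> A" using ans by blast
        then have "\<exists>y w. carries (snd d ! 2) w \<and> length y \<le> poly pA (length w) \<and> pair_word w y \<in> R"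
          unfolding A by blast
        then obtain w where w: "carries (snd d ! 2) w" "length (cert d) \<le> poly pA (length w)" "pair_word w (cert d) \<in> R"
          unfolding cert_def by (drule_tac someI_ex) blast
        have "fst (dec (tl B)) = cert d" using d True ans by (simp add: B_def dec_pair)
        then show ?thesis using True w by (auto intro!: exI[of _ w])
      next
        case False
        have "w \<in> A" if "pair_word w (take (poly pA (length w)) ?y) \<in> R" for w
          unfolding A using that by (intro exI[of _ "take (poly pA (length w)) ?y"]) simp
        then show ?thesis using False ans by auto
      qed
    qed
    then show ?thesis using True by (simp add: accepted_pair Let_def t_def[symmetric] q k B_def)
  next
    case False
    then have tT: "t = ?T" using t by simp
    have "carries (snd (fst (qrun M ?c (snd (dec U)) t)) ! 1) [False]"
      unfolding q fst_conv using out by (simp only: d_def tT)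
    then show ?thesis unfolding accepted_pair Let_def t_def[symmetric] using False by simp
  qed
qed

lemma length_cert:
  assumes "\<And>q. q \<in> A \<longleftrightarrow> (\<exists>c. length c \<le> poly pA (length q) \<and> pair_word q c \<in> R)"
    and "i \<le> T" "w \<in> A" "carries (snd ((step M A ^^ i) (init_config M x)) ! 2) w"
  shows "length (cert ((step M A ^^ i) (init_config M x))) \<le> poly pA T"
proof -
  let ?d = "(step M A ^^ i) (init_config M x)"
  have r: "reach_tape T (snd ?d ! 2)"
    by (rule reach_tape_mono[OF reach_tape_init[OF wf]]) (use k3 assms(2) in auto)
  have "\<exists>y w. carries (snd ?d ! 2) w \<and> length y \<le> poly pA (length w) \<and> pair_word w y \<in> R"
    using assms(1,3,4) by blast
  then obtain w' where w': "carries (snd ?d ! 2) w'" "length (cert ?d) \<le> poly pA (length w')"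
    unfolding cert_def by (drule_tac someI_ex) blast
  have "poly pA (length w') \<le> poly pA T" by (rule poly_nat_mono[OF reach_tape_carries[OF r w'(1)]])
  then show ?thesis using w'(2) by simp
qed

end
theorem guessing_Sigma_2:
  assumes f: "f \<in> FP_NP" and K: "\<And>w. f (enc_input (length (tree_word pa pp w)) (wtree (tree_word pa pp w))) = [False] \<longleftrightarrow> w \<notin> K"
    and L: "\<And>x. x \<in> L \<longleftrightarrow> (\<exists>u. length u \<le> poly p0 (length x) \<and> pair_word x u \<notin> K)"
  shows "L \<in> Sigma_p 2"
proof -
  obtain A where A: "A \<in> class_NP" "f \<in> FP_oracle A" using f by (auto simp: FP_NP_def)
  obtain M tf where M: "wf_otm M" "computes_in_time M A f (poly tf)" using A(2) by (auto simp: FP_oracle_def)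
  obtain R pA where R: "R \<in> class_P"
    "\<And>q. q \<in> A \<longleftrightarrow> (\<exists>c. length c \<le> poly pA (length q) \<and> pair_word q c \<in> R)"
    using A(1) unfolding class_NP_def poly_ex_def by blast
  obtain MA tA where MA: "wf_otm MA" "computes_in_time MA {} (\<lambda>x. [x \<in> R]) (poly tA)"
    using class_P_D[OF R(1)] by blast
  interpret verifier M MA tf tA p0 pa pp pA R by standard (rule M(1) MA)+
  have out: "carries (snd ((step M A ^^ clock X U) (start X U)) ! 1) [False] \<longleftrightarrow>
     pair_word X (take (poly p0 (length X)) (fst (dec U))) \<notin> K" for X U
  proof -
    let ?w = "pair_word X (take (poly p0 (length X)) (fst (dec U)))"
    have "carries (snd ((step M A ^^ clock X U) (start X U)) ! 1) (f (inst ?w))"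
      using M(2)[unfolded computes_in_time_def, rule_format, of "inst ?w"]
      unfolding clock_def start_def by (metis snd_conv)
    then have "carries (snd ((step M A ^^ clock X U) (start X U)) ! 1) [False] \<longleftrightarrow> f (inst ?w) = [False]"
      using carries_unique by metis
    then show ?thesis using K[of ?w] by (simp add: inst_def Let_def)
  qed
  \<comment> \<open>\<open>2 * n + 2\<close> is the length of \<open>pair_word z []\<close> for a
    word \<open>z\<close> of length \<open>n\<close>; with \<open>z\<close> the pair of input and
    guess, this is the size that \<open>clock_le\<close> asks for.\<close>
  define m where "m = (\<lambda>n. poly tf (zlen (2 * n + 2)))"
  have m: "polyfun m" unfolding m_def
    by (rule polyfun_compose[OF polyfun_poly]) (rule polyfun_compose[OF polyfun_zlen], intro polyfun_intros)
  have "polyfun (\<lambda>n. m n + poly pA (m n))"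
    by (intro polyfun_intros m polyfun_compose[OF polyfun_poly m])
  then obtain qV where qV: "(\<lambda>n. m n + poly pA (m n)) = poly qV" by (auto simp: polyfun_def)
  \<comment> \<open>The argument of \<open>m\<close> bounds the length of
    \<open>pair_word x (pair_word u [])\<close>, so \<open>m2\<close> bounds the clock in terms of
    the input alone.\<close>
  define m2 where "m2 = (\<lambda>n. m (2 * n + 2 + (2 * poly p0 n + 2)))"
  have m2: "polyfun m2" unfolding m2_def
    by (rule polyfun_compose[OF m]) (intro polyfun_intros polyfun_poly)
  have "polyfun (\<lambda>n. 2 * poly p0 n + 2 + m2 n * (2 * poly pA (m2 n) + 3))"
    by (intro polyfun_intros polyfun_poly m2 polyfun_compose[OF polyfun_poly m2])
  then obtain qU where qU: "(\<lambda>n. 2 * poly p0 n + 2 + m2 n * (2 * poly pA (m2 n) + 3)) = poly qU"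
    by (auto simp: polyfun_def)
  define S where "S = {z. \<exists>V. length V \<le> poly qV (length z) \<and> pair_word z V \<in> - {z. accepted z}}"
  have "S \<in> Sigma_p 1"
    unfolding One_nat_def by (rule Sigma_Suc_I[where p = qV and R = "{z. accepted z}"]) (use verify_P in \<open>simp_all add: S_def\<close>)
  moreover have "x \<in> L \<longleftrightarrow> (\<exists>U. length U \<le> poly qU (length x) \<and> pair_word x U \<in> - S)" for x
  proof
    assume "x \<in> L"
    then obtain u where u: "length u \<le> poly p0 (length x)" "pair_word x u \<notin> K" unfolding L by blast
    \<comment> \<open>Clock and start depend on the guess only through its first component. They can
      be fixed with an empty list of answers, before the honest list, which depends on them, is
      formed.\<close>
    let ?T = "clock x (pair_word u [])" and ?c = "start x (pair_word u [])"
    define B where "B = honest M A cert ?c ?T"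
    define U where "U = pair_word u B"
    have e: "clock x U = ?T" "start x U = ?c" "fst (dec U) = u" "snd (dec U) = B"
      by (simp_all add: clock_def start_def U_def dec_pair)
    have T: "?T \<le> m2 (length x)" unfolding m2_def m_def
      by (rule clock_le) (use u(1) in \<open>simp add: length_pair_word\<close>)
    have "length B \<le> ?T * (2 * poly pA ?T + 3)" unfolding B_def
    proof (rule length_honest)
      fix i w assume i: "i < ?T" "w \<in> A" "carries (snd ((step M A ^^ i) ?c) ! 2) w"
      then show "length (cert ((step M A ^^ i) ?c)) \<le> poly pA ?T"
        unfolding start_def by (intro length_cert[OF R(2)]) auto
    qed
    also have "\<dots> \<le> m2 (length x) * (2 * poly pA (m2 (length x)) + 3)"
      using poly_nat_mono[OF T, of pA] by (intro mult_le_mono[OF T]) simp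
    finally have "length U \<le> poly qU (length x)"
      unfolding qU[symmetric] U_def length_pair_word using u(1) by simp
    moreover have "accepted (pair_word (pair_word x U) V)" for V
      by (rule accepted_complete[OF R(2)]) (use out[of x U] u in \<open>simp_all add: e B_def\<close>)
    ultimately show "\<exists>U. length U \<le> poly qU (length x) \<and> pair_word x U \<in> - S" unfolding S_def by blast
  next
    assume "\<exists>U. length U \<le> poly qU (length x) \<and> pair_word x U \<in> - S"
    then obtain U where U: "\<And>V. length V \<le> poly qV (length (pair_word x U)) \<Longrightarrow> accepted (pair_word (pair_word x U) V)"
      unfolding S_def by blast
    have T: "clock x U \<le> m (length (pair_word x U))" unfolding m_def by (rule clock_le) simp
    have "carries (snd ((step M A ^^ clock x U) (start x U)) ! 1) [False]"
    proof (rule accepted_sound[OF R(2)])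
      fix V :: "bool list" assume "length V \<le> clock x U + poly pA (clock x U)"
      then have "length V \<le> poly qV (length (pair_word x U))"
        unfolding qV[symmetric] using T poly_nat_mono[OF T, of pA] by simp
      then show "accepted (pair_word (pair_word x U) V)" by (rule U)
    qed
    then show "x \<in> L" unfolding L out by (intro exI[of _ "take (poly p0 (length x)) (fst (dec U))"]) simp
  qed
  ultimately show ?thesis unfolding Suc_1[symmetric] by (intro Sigma_Suc_I[where R = S and p = qU]) simp_all
qed

theorem theorem7:
  "\<exists>\<phi> m. q_dt_foil \<phi> \<and> fv \<phi> = {..<m} \<and>
     ((\<exists>f \<in> FP_NP. solves_Comp \<phi> m f) \<longrightarrow> PH = Sigma_p 2)"
proof (cases "PH = Sigma_p 2")
  case True
  \<comment> \<open>The conclusion of the implication holds here, so any formula with an initial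
    segment of variables as free variables will do.\<close>
  have "q_dt_foil (Equal 0 0)" by (rule q_dt_foil.dt, rule dt_foil.base) simp
  moreover have "fv (Equal 0 0) = {..<1}" by auto
  ultimately show ?thesis using True by blast
next
  case False
  then obtain L where L: "L \<in> Sigma_p 3" "L \<notin> Sigma_p 2" using PH_collapse by blast
  have n3: "(3 :: nat) = Suc 2" by simp
  obtain K p0 where K: "K \<in> Sigma_p 2"
    "\<And>x. x \<in> L \<longleftrightarrow> (\<exists>u. length u \<le> poly p0 (length x) \<and> pair_word x u \<notin> K)"
    using L(1) unfolding n3 by (rule Sigma_Suc_E) (rule that)
  obtain S p1 where S: "S \<in> Sigma_p 1"
    "\<And>w. w \<in> K \<longleftrightarrow> (\<exists>u. length u \<le> poly p1 (length w) \<and> pair_word w u \<notin> S)"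
    using K(1) unfolding Suc_1[symmetric] by (rule Sigma_Suc_E) (rule that)
  obtain R p2 where R: "R \<in> Sigma_p 0"
    "\<And>z. z \<in> S \<longleftrightarrow> (\<exists>v. length v \<le> poly p2 (length z) \<and> pair_word z v \<notin> R)"
    using S(1) unfolding One_nat_def by (rule Sigma_Suc_E) (rule that)
  obtain M pa pp where M: "\<And>w. answers (tabF M 16) 2 (length (tree_word pa pp w)) (wtree (tree_word pa pp w)) \<noteq> {} \<longleftrightarrow>
    (\<exists>u. length u \<le> poly p1 (length w) \<and>
      (\<forall>v. length v \<le> poly p2 (length (pair_word w u)) \<longrightarrow> pair_word (pair_word w u) v \<in> R))"
    by (rule tableau_formula[OF R(1)[unfolded Sigma_p.simps], of p1 p2]) (rule that)
  have "\<not> solves_Comp (tabF M 16) 2 f" if f: "f \<in> FP_NP" for f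
  proof
    assume s: "solves_Comp (tabF M 16) 2 f"
    \<comment> \<open>The encoding of a tuple starts with \<open>True\<close>, so
      \<open>[False]\<close> can only be the answer no. Nothing else about the output is
      used.\<close>
    have "f (enc_input (length b) (wtree b)) = [False] \<longleftrightarrow> answers (tabF M 16) 2 (length b) (wtree b) = {}" for b
      using s[unfolded solves_Comp_def, rule_format, OF decision_tree_wtree[of b]] by (auto split: if_splits)
    then have "f (enc_input (length (tree_word pa pp w)) (wtree (tree_word pa pp w))) = [False] \<longleftrightarrow> w \<notin> K" for w
      using M[of w] unfolding S(2) R(2) by blast
    then show False using guessing_Sigma_2[OF f _ K(2)] L(2) by blast
  qed
  then show ?thesis using q_dt_foil_tabF fv_tabF by blast
qed

end
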